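(* Let $S$ and $T$ be inverse hulls of Markov shifts. Then the following are equivalent: (1) $S$ is Morita equivalent to $T$. (2) There exists a $\mathcal{D}$-class preserving isomorphism $\pi: CD(S^{\preceq})\to CD(T^{\preceq})$. (3) The labelled graphs associated with $S$ and $T$ are isomorphic via an isomorphism whose map on vertices is an order isomorphism (with respect to the orders $\preceq$ on nonzero $\mathcal{D}$-classes).
   Context: Basics. For an inverse semigroup $S$: $E(S)$ is the set of idempotents, $s^*$ the inverse, $\leq$ the natural partial order, $[s]$ the $\mathcal{D}$-class of $s$, $e^{\downarrow}=\{g\in E(S):g\le e\}$ for $e\in E(S)$, and $0\in S/\mathcal{D}$ also denotes the class of $0$. For idempotents, $e\ll f$ means $e<f$ and no idempotent lies strictly between. Morita equivalence. $C(S)$ is the category with objects $E(S)$, morphisms $(e,s,f)$ with $s\in eSf$, and composition $(e,s,f)(f,t,g)=(e,st,g)$. $S$ and $T$ are Morita equivalent if $C(S)$ and $C(T)$ are equivalent categories. Markov shifts. A Markov transition matrix over a finite alphabet $A$ is a $0$-$1$ matrix $M=(M_{a,b})_{a,b\in A}$ with a nonzero entry in every row. $L_M$ is the set of nonempty finite words $a_1\cdots a_n$ with $M_{a_i,a_{i+1}}=1$ for all $i<n$. For $a\in A$, $\theta_a$ is the partial bijection of $L_M$ with domain $\{w\in L_M:aw\in L_M\}$ and $\theta_a(w)=aw$. The inverse hull $S=H(M)$ is the inverse semigroup of partial bijections generated by $\{\theta_a:a\in A\}\cup\{0\}$ ($0$ the empty map). Inverse semigroups of this form are the inverse hulls of Markov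 shifts. Put $\mathcal{O}=\{\theta_a\theta_a^{-1}:a\in A\}$ and let $\mathcal{O}^{\uparrow}$ be the set of idempotents lying above some element of $\mathcal{O}$. Each nonzero $\mathcal{D}$-class of $S$ contains exactly one element of $\mathcal{O}^{\uparrow}-\mathcal{O}$; for nonzero $a\in S/\mathcal{D}$ let $e_a$ be that element, and $e_0=0$. The order $\preceq$ on $S/\mathcal{D}$. For $e\in E(S)$, the core $C_e$ is the intersection of all subsets $C\subseteq e^{\downarrow}$ such that: (i) $e\in C$; (ii) $f,g\in C$, $fg\neq0$ imply $fg\in C$; (iii) if $h_1,h_2\in C$, $f\ll h_1$, $g\ll h_2$, $f,g$ are incomparable and $fg\neq0$, then $f,g\in C$; (iv) if $e_1,e_2\in C$ and $e_1<g<e_2$ then $g\in C$. Write $a\preceq' b$ if there are $e\in E(S)$ and $f,g\in C_e$ with $[f]=a$, $[g]=b$, $f\leq g$. Then $\preceq$ is the transitive closure of $\preceq'$ together with the relations $0\preceq a$ for all $a\in S/\mathcal{D}$. It is a partial order making $S/\mathcal{D}$ a meet semilattice, with meet $\wedge$. The semigroup $S^{\preceq}$. For $u,v\in S/\mathcal{D}$ put $p_{u,v}=e_{u\wedge v}$. $S^{\preceq}$ is the set of equivalence classes $[u,s,v]$ of triples with $u,v\in S/\mathcal{D}$, $s\in S$, $ss^*\leq p_{u,u}$, $s^*s\leq p_{v,v}$, where $(u,s,v)\sim(w,t,z)$ iff $s=p_{u,w}tp_{z,v}$ and $t=p_{w,u}sp_{v,z}$; the product is $[u,s,v][w,t,z]=[u,sp_{v,w}t,z]$.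 It is an inverse semigroup with zero. Combinatorial data. $\mathcal{C}=\{[a,e_a,a]:e_a\in\mathcal{O}^{\uparrow}-\mathcal{O}\}\cup\{0\}$, $\mathcal{C}^{\ll}=\{[b,f,b]: 0\neq f\ll e_b,\ f \text{ idempotent, and either } f\neq e_{[f]} \text{ or } [f]\not\preceq b\}$, and $CD(S^{\preceq})=\mathcal{C}\cup\mathcal{C}^{\ll}$ (also written $CD(S)$), a subsemigroup of $S^{\preceq}$. An isomorphism $\pi:CD(S^{\preceq})\to CD(T^{\preceq})$ is $\mathcal{D}$-class preserving if $x,y\in CD(S^{\preceq})$ are $\mathcal{D}$-related in $S^{\preceq}$ iff $\pi(x),\pi(y)$ are $\mathcal{D}$-related in $T^{\preceq}$. The labelled graph associated with $S$. Vertex set $\mathcal{E}^0=(S/\mathcal{D})-\{0\}$. For $a\in\mathcal{E}^0$, each nonzero idempotent $f\ll e_a$ such that $f\neq e_{[f]}$ or $[f]\not\preceq a$, and each $b\in\mathcal{E}^0$ with $b\preceq[f]$, there is one edge $x_{a,f,b}$ with range $r(x_{a,f,b})=a$, source $s(x_{a,f,b})=b$ and label $\mathcal{L}(x_{a,f,b})=(a,f)$; these are all the edges. The alphabet $\mathcal{A}$ is the set of labels occurring. An isomorphism of labelled graphs $(\mathcal{E}_1,\mathcal{L}_1)\to(\mathcal{E}_2,\mathcal{L}_2)$ is a triple of bijections $\pi_0:\mathcal{E}_1^0\to\mathcal{E}_2^0$, $\pi_1:\mathcal{E}_1^1\to\mathcal{E}_2^1$, $\pi_2:\mathcal{A}_1\to\mathcal{A}_2$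 with $s(\pi_1(x))=\pi_0(s(x))$, $r(\pi_1(x))=\pi_0(r(x))$, $\mathcal{L}_2(\pi_1(x))=\pi_2(\mathcal{L}_1(x))$ for every edge $x$. *)

theory Defs
  imports "HOL-Algebra.Congruence"
begin

section \<open>Semigroups, inverse semigroups and Green's relations\<close>

text \<open>Not the record \<open>monoid\<close> of HOL-Algebra: the semigroups below need not have an identity.\<close>

record 'x sgrp = "'x partial_object" +
  mult :: "'x \<Rightarrow> 'x \<Rightarrow> 'x"  (infixl \<open>\<odot>\<index>\<close> 70)

definition is_zero :: "('x, 'm) sgrp_scheme \<Rightarrow> 'x \<Rightarrow> bool" where
  "is_zero S z \<longleftrightarrow> z \<in> carrier S \<and> (\<forall>s\<in>carrier S. z \<odot>\<^bsub>S\<^esub> s = z \<and> s \<odot>\<^bsub>S\<^esub> z = z)"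

definition zero_el :: "('x, 'm) sgrp_scheme \<Rightarrow> 'x" where
  "zero_el S = (THE z. is_zero S z)"

definition idems :: "('x, 'm) sgrp_scheme \<Rightarrow> 'x set" where
  "idems S = {e \<in> carrier S. e \<odot>\<^bsub>S\<^esub> e = e}"

definition star :: "('x, 'm) sgrp_scheme \<Rightarrow> 'x \<Rightarrow> 'x" where
  "star S s = (THE t. t \<in> carrier S \<and> s \<odot>\<^bsub>S\<^esub> t \<odot>\<^bsub>S\<^esub> s = s \<and> t \<odot>\<^bsub>S\<^esub> s \<odot>\<^bsub>S\<^esub> t = t)"

definition nat_le :: "('x, 'm) sgrp_scheme \<Rightarrow> 'x \<Rightarrow> 'x \<Rightarrow> bool" where
  "nat_le S s t \<longleftrightarrow> s \<in> carrier S \<and> t \<in> carrier S \<and> (\<exists>e\<in>idems S. s = e \<odot>\<^bsub>S\<^esub> t)"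

definition nat_less :: "('x, 'm) sgrp_scheme \<Rightarrow> 'x \<Rightarrow> 'x \<Rightarrow> bool" where
  "nat_less S s t \<longleftrightarrow> nat_le S s t \<and> s \<noteq> t"

definition covered_by :: "('x, 'm) sgrp_scheme \<Rightarrow> 'x \<Rightarrow> 'x \<Rightarrow> bool" where
  "covered_by S e f \<longleftrightarrow> e \<in> idems S \<and> f \<in> idems S \<and> nat_less S e f \<and>
     \<not> (\<exists>g\<in>idems S. nat_less S e g \<and> nat_less S g f)"

definition down :: "('x, 'm) sgrp_scheme \<Rightarrow> 'x \<Rightarrow> 'x set" where
  "down S e = {g \<in> idems S. nat_le S g e}"

definition left_ideal :: "('x, 'm) sgrp_scheme \<Rightarrow> 'x \<Rightarrow> 'x set" where
  "left_ideal S s = insert s {x \<odot>\<^bsub>S\<^esub> s |x. x \<in> carrier S}"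

definition right_ideal :: "('x, 'm) sgrp_scheme \<Rightarrow> 'x \<Rightarrow> 'x set" where
  "right_ideal S s = insert s {s \<odot>\<^bsub>S\<^esub> x |x. x \<in> carrier S}"

definition green_D :: "('x, 'm) sgrp_scheme \<Rightarrow> 'x \<Rightarrow> 'x \<Rightarrow> bool" where
  "green_D S s t \<longleftrightarrow> s \<in> carrier S \<and> t \<in> carrier S \<and>
     (\<exists>x\<in>carrier S. left_ideal S s = left_ideal S x \<and> right_ideal S x = right_ideal S t)"

definition D_class :: "('x, 'm) sgrp_scheme \<Rightarrow> 'x \<Rightarrow> 'x set" where
  "D_class S s = {t. green_D S s t}"

definition D_classes :: "('x, 'm) sgrp_scheme \<Rightarrow> 'x set set" where
  "D_classes S = D_class S ` carrier S"

definition zero_class :: "('x, 'm) sgrp_scheme \<Rightarrow> 'x set" where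
  "zero_class S = D_class S (zero_el S)"

definition sgrp_iso :: "('x, 'm) sgrp_scheme \<Rightarrow> ('y, 'n) sgrp_scheme \<Rightarrow> ('x \<Rightarrow> 'y) \<Rightarrow> bool" where
  "sgrp_iso S T \<pi> \<longleftrightarrow> bij_betw \<pi> (carrier S) (carrier T) \<and>
     (\<forall>x\<in>carrier S. \<forall>y\<in>carrier S. \<pi> (x \<odot>\<^bsub>S\<^esub> y) = \<pi> x \<odot>\<^bsub>T\<^esub> \<pi> y)"


section \<open>Equivalence of categories and Morita equivalence\<close>

text \<open>\<open>Comp C g f\<close> is the composite \<open>g \<circ> f\<close>, meaningful when \<open>Cod C f = Dom C g\<close>.\<close>

record ('o, 'a) category =
  Obj :: "'o set"
  Arr :: "'a set"
  Dom :: "'a \<Rightarrow> 'o"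
  Cod :: "'a \<Rightarrow> 'o"
  Ident :: "'o \<Rightarrow> 'a"
  Comp :: "'a \<Rightarrow> 'a \<Rightarrow> 'a"

definition is_functor ::
  "('o, 'a) category \<Rightarrow> ('p, 'b) category \<Rightarrow> ('o \<Rightarrow> 'p) \<Rightarrow> ('a \<Rightarrow> 'b) \<Rightarrow> bool" where
  "is_functor C D F\<^sub>0 F\<^sub>1 \<longleftrightarrow>
     (\<forall>x\<in>Obj C. F\<^sub>0 x \<in> Obj D) \<and>
     (\<forall>f\<in>Arr C. F\<^sub>1 f \<in> Arr D \<and> Dom D (F\<^sub>1 f) = F\<^sub>0 (Dom C f) \<and> Cod D (F\<^sub>1 f) = F\<^sub>0 (Cod C f)) \<and>
     (\<forall>x\<in>Obj C. F\<^sub>1 (Ident C x) = Ident D (F\<^sub>0 x)) \<and>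
     (\<forall>f\<in>Arr C. \<forall>g\<in>Arr C. Cod C f = Dom C g \<longrightarrow> F\<^sub>1 (Comp C g f) = Comp D (F\<^sub>1 g) (F\<^sub>1 f))"

definition is_isomorphism :: "('o, 'a) category \<Rightarrow> 'a \<Rightarrow> bool" where
  "is_isomorphism C f \<longleftrightarrow> f \<in> Arr C \<and>
     (\<exists>g\<in>Arr C. Dom C g = Cod C f \<and> Cod C g = Dom C f \<and>
        Comp C g f = Ident C (Dom C f) \<and> Comp C f g = Ident C (Cod C f))"

definition is_natural_iso ::
  "('o, 'a) category \<Rightarrow> ('p, 'b) category \<Rightarrow> ('o \<Rightarrow> 'p) \<Rightarrow> ('a \<Rightarrow> 'b) \<Rightarrow> ('o \<Rightarrow> 'p) \<Rightarrow> ('a \<Rightarrow> 'b) \<Rightarrow>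
    ('o \<Rightarrow> 'b) \<Rightarrow> bool" where
  "is_natural_iso C D F\<^sub>0 F\<^sub>1 G\<^sub>0 G\<^sub>1 \<eta> \<longleftrightarrow>
     (\<forall>x\<in>Obj C. is_isomorphism D (\<eta> x) \<and> Dom D (\<eta> x) = F\<^sub>0 x \<and> Cod D (\<eta> x) = G\<^sub>0 x) \<and>
     (\<forall>f\<in>Arr C. Comp D (\<eta> (Cod C f)) (F\<^sub>1 f) = Comp D (G\<^sub>1 f) (\<eta> (Dom C f)))"

definition equivalent_categories :: "('o, 'a) category \<Rightarrow> ('p, 'b) category \<Rightarrow> bool" where
  "equivalent_categories C D \<longleftrightarrow>
     (\<exists>F\<^sub>0 F\<^sub>1 G\<^sub>0 G\<^sub>1 \<eta> \<epsilon>. is_functor C D F\<^sub>0 F\<^sub>1 \<and> is_functor D C G\<^sub>0 G\<^sub>1 \<and>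
        is_natural_iso C C id id (G\<^sub>0 \<circ> F\<^sub>0) (G\<^sub>1 \<circ> F\<^sub>1) \<eta> \<and>
        is_natural_iso D D (F\<^sub>0 \<circ> G\<^sub>0) (F\<^sub>1 \<circ> G\<^sub>1) id id \<epsilon>)"

text \<open>The category \<open>C(S)\<close>.  Since \<open>(e,s,f)(f,t,g) = (e,st,g)\<close> is written as a composite, \<open>(e,s,f)\<close>
  is taken as an arrow from \<open>f\<close> to \<open>e\<close>.  The opposite convention gives the opposite category, so
  Morita equivalence does not depend on this choice.\<close>

definition morita_category :: "('x, 'm) sgrp_scheme \<Rightarrow> ('x, 'x \<times> 'x \<times> 'x) category" where
  "morita_category S =
     \<lparr>Obj = idems S,
      Arr = {(e, s, f). e \<in> idems S \<and> f \<in> idems S \<and> (\<exists>t\<in>carrier S. s = e \<odot>\<^bsub>S\<^esub> t \<odot>\<^bsub>S\<^esub> f)},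
      Dom = (\<lambda>(e, s, f). f),
      Cod = (\<lambda>(e, s, f). e),
      Ident = (\<lambda>e. (e, e, e)),
      Comp = (\<lambda>(e, s, f) (f', t, g). (e, s \<odot>\<^bsub>S\<^esub> t, g))\<rparr>"

definition morita_equivalent :: "('x, 'm) sgrp_scheme \<Rightarrow> ('y, 'n) sgrp_scheme \<Rightarrow> bool" where
  "morita_equivalent S T \<longleftrightarrow> equivalent_categories (morita_category S) (morita_category T)"


section \<open>The order on \<open>\<D>\<close>-classes\<close>

definition core_closed :: "('x, 'm) sgrp_scheme \<Rightarrow> 'x \<Rightarrow> 'x set \<Rightarrow> bool" where
  "core_closed S e C \<longleftrightarrow> C \<subseteq> down S e \<and> e \<in> C \<and>
     (\<forall>f\<in>C. \<forall>g\<in>C. f \<odot>\<^bsub>S\<^esub> g \<noteq> zero_el S \<longrightarrow> f \<odot>\<^bsub>S\<^esub> g \<in> C) \<and>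
     (\<forall>h\<^sub>1\<in>C. \<forall>h\<^sub>2\<in>C. \<forall>f g. covered_by S f h\<^sub>1 \<and> covered_by S g h\<^sub>2 \<and>
        \<not> nat_le S f g \<and> \<not> nat_le S g f \<and> f \<odot>\<^bsub>S\<^esub> g \<noteq> zero_el S \<longrightarrow> f \<in> C \<and> g \<in> C) \<and>
     (\<forall>e\<^sub>1\<in>C. \<forall>e\<^sub>2\<in>C. \<forall>g\<in>idems S. nat_less S e\<^sub>1 g \<and> nat_less S g e\<^sub>2 \<longrightarrow> g \<in> C)"

definition core :: "('x, 'm) sgrp_scheme \<Rightarrow> 'x \<Rightarrow> 'x set" where
  "core S e = \<Inter> {C. core_closed S e C}"

definition preceq1 :: "('x, 'm) sgrp_scheme \<Rightarrow> 'x set \<Rightarrow> 'x set \<Rightarrow> bool" where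
  "preceq1 S a b \<longleftrightarrow>
     (\<exists>e\<in>idems S. \<exists>f\<in>core S e. \<exists>g\<in>core S e. D_class S f = a \<and> D_class S g = b \<and> nat_le S f g)"

definition preceq :: "('x, 'm) sgrp_scheme \<Rightarrow> 'x set \<Rightarrow> 'x set \<Rightarrow> bool" where
  "preceq S = (\<lambda>a b. preceq1 S a b \<or> (a = zero_class S \<and> b \<in> D_classes S))\<^sup>+\<^sup>+"

definition meet :: "('x, 'm) sgrp_scheme \<Rightarrow> 'x set \<Rightarrow> 'x set \<Rightarrow> 'x set" where
  "meet S u v = (THE m. m \<in> D_classes S \<and> preceq S m u \<and> preceq S m v \<and>
     (\<forall>x\<in>D_classes S. preceq S x u \<and> preceq S x v \<longrightarrow> preceq S x m))"


section \<open>Inverse hulls of Markov shifts\<close>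

text \<open>The alphabet is the finite set \<open>A\<close>; entries of \<open>M\<close> outside \<open>A \<times> A\<close> are never used.\<close>

definition markov_matrix :: "'a set \<Rightarrow> ('a \<Rightarrow> 'a \<Rightarrow> nat) \<Rightarrow> bool" where
  "markov_matrix A M \<longleftrightarrow> finite A \<and> (\<forall>a\<in>A. \<forall>b\<in>A. M a b \<in> {0, 1}) \<and> (\<forall>a\<in>A. \<exists>b\<in>A. M a b \<noteq> 0)"

definition markov_words :: "'a set \<Rightarrow> ('a \<Rightarrow> 'a \<Rightarrow> nat) \<Rightarrow> 'a list set" where
  "markov_words A M =
     {w. w \<noteq> [] \<and> set w \<subseteq> A \<and> (\<forall>i. Suc i < length w \<longrightarrow> M (w ! i) (w ! Suc i) = 1)}"

text \<open>Partial maps are of type \<open>'a list \<rightharpoonup> 'a list\<close>, composed from right to left by \<open>\<circ>\<^sub>m\<close>.\<close>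

definition theta :: "'a set \<Rightarrow> ('a \<Rightarrow> 'a \<Rightarrow> nat) \<Rightarrow> 'a \<Rightarrow> 'a list \<rightharpoonup> 'a list" where
  "theta A M a = (\<lambda>w. if w \<in> markov_words A M \<and> a # w \<in> markov_words A M then Some (a # w) else None)"

definition pinverse :: "('w \<rightharpoonup> 'w) \<Rightarrow> 'w \<rightharpoonup> 'w" where
  "pinverse f = (\<lambda>y. if y \<in> ran f then Some (THE x. f x = Some y) else None)"

inductive_set hull_carrier :: "'a set \<Rightarrow> ('a \<Rightarrow> 'a \<Rightarrow> nat) \<Rightarrow> ('a list \<rightharpoonup> 'a list) set"
  for A :: "'a set" and M :: "'a \<Rightarrow> 'a \<Rightarrow> nat" where
  zero: "Map.empty \<in> hull_carrier A M"
| gen: "a \<in> A \<Longrightarrow> theta A M a \<in> hull_carrier A M"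
| comp: "f \<in> hull_carrier A M \<Longrightarrow> g \<in> hull_carrier A M \<Longrightarrow> f \<circ>\<^sub>m g \<in> hull_carrier A M"
| inv: "f \<in> hull_carrier A M \<Longrightarrow> pinverse f \<in> hull_carrier A M"

definition inverse_hull :: "'a set \<Rightarrow> ('a \<Rightarrow> 'a \<Rightarrow> nat) \<Rightarrow> ('a list \<rightharpoonup> 'a list) sgrp" where
  "inverse_hull A M = \<lparr>carrier = hull_carrier A M, mult = (\<circ>\<^sub>m)\<rparr>"

definition gen_idems :: "'a set \<Rightarrow> ('a \<Rightarrow> 'a \<Rightarrow> nat) \<Rightarrow> ('a list \<rightharpoonup> 'a list) set" where
  "gen_idems A M = {theta A M a \<circ>\<^sub>m pinverse (theta A M a) |a. a \<in> A}"

definition gen_idems_up :: "'a set \<Rightarrow> ('a \<Rightarrow> 'a \<Rightarrow> nat) \<Rightarrow> ('a list \<rightharpoonup> 'a list) set" where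
  "gen_idems_up A M =
     {e \<in> idems (inverse_hull A M). \<exists>d\<in>gen_idems A M. nat_le (inverse_hull A M) d e}"

type_synonym 'a hull_class = "('a list \<rightharpoonup> 'a list) set"

text \<open>\<open>class_rep\<close> is \<open>a \<mapsto> e\<^sub>a\<close>.  It, and everything below, depends on the presentation \<open>(A, M)\<close> and
  not only on the abstract semigroup.\<close>

definition class_rep :: "'a set \<Rightarrow> ('a \<Rightarrow> 'a \<Rightarrow> nat) \<Rightarrow> 'a hull_class \<Rightarrow> 'a list \<rightharpoonup> 'a list" where
  "class_rep A M a =
     (if a = zero_class (inverse_hull A M) then zero_el (inverse_hull A M)
      else (THE e. e \<in> a \<and> e \<in> gen_idems_up A M - gen_idems A M))"


section \<open>The semigroup \<open>S\<^sup>\<preceq>\<close>\<close>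

type_synonym 'a hull_triple = "'a hull_class \<times> ('a list \<rightharpoonup> 'a list) \<times> 'a hull_class"

definition p_idem :: "'a set \<Rightarrow> ('a \<Rightarrow> 'a \<Rightarrow> nat) \<Rightarrow> 'a hull_class \<Rightarrow> 'a hull_class \<Rightarrow> 'a list \<rightharpoonup> 'a list" where
  "p_idem A M u v = class_rep A M (meet (inverse_hull A M) u v)"

definition triples :: "'a set \<Rightarrow> ('a \<Rightarrow> 'a \<Rightarrow> nat) \<Rightarrow> 'a hull_triple set" where
  "triples A M = (let S = inverse_hull A M in
     {(u, s, v). u \<in> D_classes S \<and> v \<in> D_classes S \<and> s \<in> carrier S \<and>
        nat_le S (s \<odot>\<^bsub>S\<^esub> star S s) (p_idem A M u u) \<and>
        nat_le S (star S s \<odot>\<^bsub>S\<^esub> s) (p_idem A M v v)})"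

definition triple_rel :: "'a set \<Rightarrow> ('a \<Rightarrow> 'a \<Rightarrow> nat) \<Rightarrow> ('a hull_triple \<times> 'a hull_triple) set" where
  "triple_rel A M = (let S = inverse_hull A M in
     {((u, s, v), (w, t, z)). (u, s, v) \<in> triples A M \<and> (w, t, z) \<in> triples A M \<and>
        s = p_idem A M u w \<odot>\<^bsub>S\<^esub> t \<odot>\<^bsub>S\<^esub> p_idem A M z v \<and>
        t = p_idem A M w u \<odot>\<^bsub>S\<^esub> s \<odot>\<^bsub>S\<^esub> p_idem A M v z})"

definition triple_class :: "'a set \<Rightarrow> ('a \<Rightarrow> 'a \<Rightarrow> nat) \<Rightarrow> 'a hull_triple \<Rightarrow> 'a hull_triple set" where
  "triple_class A M x = triple_rel A M `` {x}"

definition triple_mult ::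
  "'a set \<Rightarrow> ('a \<Rightarrow> 'a \<Rightarrow> nat) \<Rightarrow> 'a hull_triple \<Rightarrow> 'a hull_triple \<Rightarrow> 'a hull_triple" where
  "triple_mult A M = (let S = inverse_hull A M in
     (\<lambda>(u, s, v) (w, t, z). (u, s \<odot>\<^bsub>S\<^esub> p_idem A M v w \<odot>\<^bsub>S\<^esub> t, z)))"

text \<open>The product of two classes is given on representatives; the union is the usual idiom of
  \<open>HOL.Equiv_Relations\<close> for a congruent operation, all the sets in it being equal.\<close>

definition S_preceq :: "'a set \<Rightarrow> ('a \<Rightarrow> 'a \<Rightarrow> nat) \<Rightarrow> 'a hull_triple set sgrp" where
  "S_preceq A M =
     \<lparr>carrier = triples A M // triple_rel A M,
      mult = (\<lambda>X Y. \<Union>x\<in>X. \<Union>y\<in>Y. triple_class A M (triple_mult A M x y))\<rparr>"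


section \<open>Combinatorial data and the labelled graph\<close>

text \<open>The condition on \<open>f\<close> shared by the definitions of \<open>\<C>\<^sup>\<lless>\<close> and of the labelled graph.\<close>

definition exit_idem ::
  "'a set \<Rightarrow> ('a \<Rightarrow> 'a \<Rightarrow> nat) \<Rightarrow> 'a hull_class \<Rightarrow> ('a list \<rightharpoonup> 'a list) \<Rightarrow> bool" where
  "exit_idem A M b f \<longleftrightarrow> (let S = inverse_hull A M in
     f \<in> idems S \<and> f \<noteq> zero_el S \<and> covered_by S f (class_rep A M b) \<and>
     (f \<noteq> class_rep A M (D_class S f) \<or> \<not> preceq S (D_class S f) b))"

definition CD_carrier :: "'a set \<Rightarrow> ('a \<Rightarrow> 'a \<Rightarrow> nat) \<Rightarrow> 'a hull_triple set set" where
  "CD_carrier A M = (let S = inverse_hull A M in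
     {triple_class A M (a, class_rep A M a, a) |a.
        a \<in> D_classes S \<and> class_rep A M a \<in> gen_idems_up A M - gen_idems A M}
     \<union> {zero_el (S_preceq A M)}
     \<union> {triple_class A M (b, f, b) |b f. b \<in> D_classes S \<and> exit_idem A M b f})"

definition CD :: "'a set \<Rightarrow> ('a \<Rightarrow> 'a \<Rightarrow> nat) \<Rightarrow> 'a hull_triple set sgrp" where
  "CD A M = \<lparr>carrier = CD_carrier A M, mult = mult (S_preceq A M)\<rparr>"

definition D_preserving_CD_iso ::
  "'a set \<Rightarrow> ('a \<Rightarrow> 'a \<Rightarrow> nat) \<Rightarrow> 'b set \<Rightarrow> ('b \<Rightarrow> 'b \<Rightarrow> nat) \<Rightarrow>
    ('a hull_triple set \<Rightarrow> 'b hull_triple set) \<Rightarrow> bool" where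
  "D_preserving_CD_iso A M B N \<pi> \<longleftrightarrow> sgrp_iso (CD A M) (CD B N) \<pi> \<and>
     (\<forall>x\<in>carrier (CD A M). \<forall>y\<in>carrier (CD A M).
        green_D (S_preceq A M) x y \<longleftrightarrow> green_D (S_preceq B N) (\<pi> x) (\<pi> y))"

record ('v, 'e, 'l) lgraph =
  verts :: "'v set"
  edges :: "'e set"
  src :: "'e \<Rightarrow> 'v"
  rng :: "'e \<Rightarrow> 'v"
  lab :: "'e \<Rightarrow> 'l"

definition alphabet :: "('v, 'e, 'l) lgraph \<Rightarrow> 'l set" where
  "alphabet G = lab G ` edges G"

definition lgraph_iso ::
  "('v, 'e, 'l) lgraph \<Rightarrow> ('w, 'f, 'k) lgraph \<Rightarrow> ('v \<Rightarrow> 'w) \<Rightarrow> ('e \<Rightarrow> 'f) \<Rightarrow> ('l \<Rightarrow> 'k) \<Rightarrow> bool" where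
  "lgraph_iso G H \<pi>\<^sub>0 \<pi>\<^sub>1 \<pi>\<^sub>2 \<longleftrightarrow>
     bij_betw \<pi>\<^sub>0 (verts G) (verts H) \<and> bij_betw \<pi>\<^sub>1 (edges G) (edges H) \<and>
     bij_betw \<pi>\<^sub>2 (alphabet G) (alphabet H) \<and>
     (\<forall>x\<in>edges G. src H (\<pi>\<^sub>1 x) = \<pi>\<^sub>0 (src G x) \<and> rng H (\<pi>\<^sub>1 x) = \<pi>\<^sub>0 (rng G x) \<and>
        lab H (\<pi>\<^sub>1 x) = \<pi>\<^sub>2 (lab G x))"

text \<open>The edge \<open>x\<^bsub>a,f,b\<^esub>\<close> is encoded as the triple \<open>(a, f, b)\<close>.\<close>

definition hull_graph ::
  "'a set \<Rightarrow> ('a \<Rightarrow> 'a \<Rightarrow> nat) \<Rightarrow>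
    ('a hull_class, 'a hull_class \<times> ('a list \<rightharpoonup> 'a list) \<times> 'a hull_class,
     'a hull_class \<times> ('a list \<rightharpoonup> 'a list)) lgraph" where
  "hull_graph A M = (let S = inverse_hull A M; V = D_classes S - {zero_class S} in
     \<lparr>verts = V,
      edges = {(a, f, b). a \<in> V \<and> b \<in> V \<and> exit_idem A M a f \<and> preceq S b (D_class S f)},
      src = (\<lambda>(a, f, b). b),
      rng = (\<lambda>(a, f, b). a),
      lab = (\<lambda>(a, f, b). (a, f))\<rparr>)"

definition order_iso_on ::
  "'v set \<Rightarrow> ('v \<Rightarrow> 'v \<Rightarrow> bool) \<Rightarrow> 'w set \<Rightarrow> ('w \<Rightarrow> 'w \<Rightarrow> bool) \<Rightarrow> ('v \<Rightarrow> 'w) \<Rightarrow> bool" where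
  "order_iso_on V le W le' \<phi> \<longleftrightarrow> bij_betw \<phi> V W \<and> (\<forall>a\<in>V. \<forall>b\<in>V. le a b \<longleftrightarrow> le' (\<phi> a) (\<phi> b))"

end

theory Submission
  imports Defs
begin

text \<open>
  Write \<open>F a\<close> for the set of letters that may follow \<open>a\<close>, and \<open>\<X>\<close> for the finite family of nonempty
  intersections of one or more sets \<open>F a\<close>.  Every nonzero element of the inverse hull is uniquely of
  the form \<open>\<theta>\<^sub>\<alpha> e\<^sub>X \<theta>\<^sub>\<beta>\<^sup>-\<^sup>1\<close>, where \<open>X \<in> \<X>\<close> and \<open>e\<^sub>X\<close> is the identity on the words that start in
  \<open>X\<close>.  Its class is determined by \<open>X\<close>, and \<open>e\<^sub>X\<close> is the distinguished idempotent of that class.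
  Thus the nonzero classes are the members of \<open>\<X>\<close>, and idempotents are cylinders, ordered by
  inclusion.

  Cores consist of idempotents with the same prefix, so \<open>\<preceq>\<close> is a suborder of the inclusion order on
  \<open>\<X>\<close>, generated by some of its covers, the good ones.  Three properties carry the whole argument: a
  cover of \<open>X\<close> that meets something properly below \<open>X\<close> for \<open>\<preceq>\<close> is good (\<open>gcov_spread\<close>); two sets
  below \<open>X\<close> that meet have their intersection below both (\<open>ple_Int\<close>); and \<open>\<preceq>\<close> is convex in the
  inclusion order (\<open>ple_convex\<close>).  They give the meets, and they make \<open>S\<^sup>\<preceq>\<close> well defined.

  The remaining covers of \<open>e\<^sub>X\<close>, called exits here, are the labels of the graph.  They are of the form
  \<open>e\<^sub>Y\<close> or \<open>\<theta>\<^sub>x \<theta>\<^sub>x\<^sup>-\<^sup>1\<close>, but this difference is invisible to each of the three conditions.  Each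
  condition is equivalent to a fourth one, \<open>comb_iso\<close>: there is an order isomorphism of the nonzero
  classes that preserves the number of exits from each class to each class.

  For \<open>CD\<close> this is read off its multiplication table: exits are atoms, an exit of \<open>X\<close> lies below the
  vertex \<open>Y\<close> iff \<open>X \<preceq> Y\<close>, and \<open>\<D>\<close> tells the class of an exit.  For the graph, the edges with a given
  label have as sources exactly the classes below the class of the label, so the order recovers this
  class.

  A Morita equivalence induces, for each \<open>X\<close>, an isomorphism of the semilattice below \<open>e\<^sub>X\<close> with the
  one below the image class, respecting classes (\<open>down_iso\<close>).  It preserves cores, hence \<open>\<preceq>\<close>, and the
  numbers of covers; and exits are the covers minus the covers of the order \<open>\<preceq>\<close>, by convexity.

  Conversely, the idempotents below the various \<open>e\<^sub>X\<close> are the arrows of a left cancellative category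
  with objects \<open>\<X>\<close>, composed by concatenation, and a nonzero element of \<open>e\<^sub>X S e\<^sub>Y\<close> is a pair of
  arrows to \<open>X\<close> and to \<open>Y\<close> with the same source.  The key is that this category is generated freely by the order \<open>\<preceq>\<close> and the
  exits: every arrow has a unique decomposition into exits joined by relations \<open>\<preceq>\<close> (\<open>lp_exists\<close> and
  \<open>lp_unique\<close>).  So \<open>comb_iso\<close> yields an isomorphism of these categories of arrows, even though it may
  exchange exits of the two forms, and the isomorphism carries products in the one hull to products
  in the other, up to the choice of objects in each class (\<open>lam_iso\<close>).
\<close>

section \<open>The order on a finite family of sets closed under nonempty intersections\<close>

locale intersection_family =
  fixes \<X> :: "'p set set"
  assumes finite_family: "finite \<X>"
    and finite_member: "X \<in> \<X> \<Longrightarrow> finite X"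
    and nonempty_member: "X \<in> \<X> \<Longrightarrow> X \<noteq> {}"
    and Int_member: "X \<in> \<X> \<Longrightarrow> Y \<in> \<X> \<Longrightarrow> X \<inter> Y \<noteq> {} \<Longrightarrow> X \<inter> Y \<in> \<X>"
begin

definition cov :: "'p set \<Rightarrow> 'p set \<Rightarrow> bool" where
  "cov Y X \<longleftrightarrow> Y \<in> \<X> \<and> X \<in> \<X> \<and> Y \<subset> X \<and> \<not> (\<exists>Z\<in>\<X>. Y \<subset> Z \<and> Z \<subset> X)"

text \<open>The core of an idempotent \<open>e\<^sub>W\<close> consists of idempotents \<open>e\<^sub>Y\<close>; the sets \<open>Y\<close> that occur are
  generated by the closure conditions of the core.  In the third rule the roles of \<open>Y\<close> and \<open>Z\<close>
  can be exchanged, so it suffices to conclude for \<open>Y\<close>.\<close>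

inductive_set set_core :: "'p set \<Rightarrow> 'p set set" for W where
  set_core_self: "W \<in> set_core W"
| set_core_Int: "Y \<in> set_core W \<Longrightarrow> Z \<in> set_core W \<Longrightarrow> Y \<inter> Z \<noteq> {} \<Longrightarrow> Y \<inter> Z \<in> set_core W"
| set_core_incomparable: "H \<in> set_core W \<Longrightarrow> K \<in> set_core W \<Longrightarrow> cov Y H \<Longrightarrow> cov Z K \<Longrightarrow>
    \<not> Y \<subseteq> Z \<Longrightarrow> \<not> Z \<subseteq> Y \<Longrightarrow> Y \<inter> Z \<noteq> {} \<Longrightarrow> Y \<in> set_core W"
| set_core_between: "Y \<in> set_core W \<Longrightarrow> Z \<in> set_core W \<Longrightarrow> G \<in> \<X> \<Longrightarrow> Y \<subset> G \<Longrightarrow> G \<subset> Z \<Longrightarrow> G \<in> set_core W"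

definition ple1 :: "'p set \<Rightarrow> 'p set \<Rightarrow> bool" where
  "ple1 Y X \<longleftrightarrow> (\<exists>W\<in>\<X>. Y \<in> set_core W \<and> X \<in> set_core W \<and> Y \<subseteq> X)"

text \<open>This is the relation \<open>\<preceq>\<close> on nonzero classes; the empty set will stand for the zero class.\<close>

definition ple :: "'p set \<Rightarrow> 'p set \<Rightarrow> bool" where
  "ple = ple1\<^sup>+\<^sup>+"

text \<open>These covers, called good below, generate \<open>\<preceq>\<close>.\<close>

definition gcov :: "'p set \<Rightarrow> 'p set \<Rightarrow> bool" where
  "gcov Y X \<longleftrightarrow> cov Y X \<and> ple1 Y X"

lemma covD: "cov Y X \<Longrightarrow> Y \<in> \<X>" "cov Y X \<Longrightarrow> X \<in> \<X>" "cov Y X \<Longrightarrow> Y \<subset> X"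
  by (auto simp: cov_def)

lemma cov_between: "cov Y X \<Longrightarrow> Z \<in> \<X> \<Longrightarrow> Y \<subseteq> Z \<Longrightarrow> Z \<subseteq> X \<Longrightarrow> Z = Y \<or> Z = X"
  unfolding cov_def by blast

lemma cov_incomparable: "cov Y X \<Longrightarrow> cov Z X \<Longrightarrow> Y \<noteq> Z \<Longrightarrow> \<not> Y \<subseteq> Z"
  unfolding cov_def by (metis psubsetI)

lemma cov_above:
  assumes "Y \<in> \<X>" "X \<in> \<X>" "Y \<subset> X"
  obtains Z where "cov Z X" "Y \<subseteq> Z"
proof -
  let ?P = "{Z \<in> \<X>. Y \<subseteq> Z \<and> Z \<subset> X}"
  have "finite ?P" using finite_family by simp
  moreover have "Y \<in> ?P" using assms by auto
  ultimately obtain Z where Z: "Z \<in> ?P" and mx: "\<forall>V\<in>?P. Z \<subseteq> V \<longrightarrow> V = Z"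
    using finite_has_maximal[of ?P] by (metis (no_types, lifting) empty_iff)
  have "V = Z" if "V \<in> \<X>" "Z \<subset> V" "V \<subset> X" for V
    using mx[rule_format, of V] Z that by auto
  then have "cov Z X" unfolding cov_def using Z assms by blast
  then show ?thesis using that Z by blast
qed

lemma set_coreD:
  assumes "W \<in> \<X>" "Y \<in> set_core W" shows "Y \<in> \<X> \<and> Y \<subseteq> W"
  using assms(2,1)
proof (induction rule: set_core.induct)
  case (set_core_incomparable H K Y Z)
  then show ?case using covD[of Y H] by blast
qed (use Int_member in auto)

lemma ple1D: "ple1 Y X \<Longrightarrow> Y \<in> \<X> \<and> X \<in> \<X> \<and> Y \<subseteq> X"
  unfolding ple1_def using set_coreD by blast

lemma gcovD: "gcov Y X \<Longrightarrow> Y \<in> \<X>" "gcov Y X \<Longrightarrow> X \<in> \<X>" "gcov Y X \<Longrightarrow> Y \<subset> X"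
  unfolding gcov_def using covD by blast+

lemma ple_refl: "X \<in> \<X> \<Longrightarrow> ple X X"
  unfolding ple_def ple1_def using set_core_self by blast

lemma ple_trans: "ple X Y \<Longrightarrow> ple Y Z \<Longrightarrow> ple X Z"
  unfolding ple_def by (rule tranclp_trans)

lemma ple_subset: "ple Y X \<Longrightarrow> Y \<in> \<X> \<and> X \<in> \<X> \<and> Y \<subseteq> X"
  unfolding ple_def by (induction rule: tranclp_induct) (use ple1D in blast)+

lemma ple_antisym: "ple X Y \<Longrightarrow> ple Y X \<Longrightarrow> X = Y"
  using ple_subset by blast

lemma gcov_ple: "gcov Y X \<Longrightarrow> ple Y X"
  unfolding gcov_def ple_def by blast

text \<open>A core contains everything between two of its members, so a step of \<open>\<preceq>'\<close> can be refined to
  a chain of covers inside the same core.\<close>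

lemma core_step:
  assumes W: "W \<in> \<X>" and "Y \<in> set_core W" "X \<in> set_core W" "Y \<subset> X"
  shows "\<exists>Z. gcov Z X \<and> ple Y Z"
proof -
  obtain Z where Z: "cov Z X" "Y \<subseteq> Z"
    using cov_above assms set_coreD[OF W] by blast
  then have "Z \<in> set_core W"
    using set_core_between[OF assms(2,3), of Z] covD assms by (metis psubsetI)
  then have "gcov Z X"
    unfolding gcov_def ple1_def using Z W assms covD by blast
  moreover have "ple Y Z" unfolding ple_def ple1_def using W assms(2) \<open>Z \<in> set_core W\<close> Z(2) by blast
  ultimately show ?thesis by blast
qed

text \<open>Induction along \<open>\<preceq>\<close> therefore only ever has to descend through good covers.\<close>

lemma ple_step:
  assumes "ple Z X" "Z \<noteq> X"
  obtains X1 where "gcov X1 X" "ple Z X1"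
proof -
  have "Z = X \<or> (\<exists>X1. gcov X1 X \<and> ple Z X1)"
    using assms(1)[unfolded ple_def]
  proof (induction rule: tranclp_induct)
    case (base y)
    then show ?case unfolding ple1_def using core_step by blast
  next
    case (step y z)
    then obtain W where W: "W \<in> \<X>" "y \<in> set_core W" "z \<in> set_core W" "y \<subseteq> z" unfolding ple1_def by blast
    have Zy: "ple Z y" using step unfolding ple_def by blast
    show ?case
    proof (cases "y = z")
      case True then show ?thesis using step by simp
    next
      case False
      then obtain X1 where "gcov X1 z" "ple y X1" using core_step W by blast
      then show ?thesis using Zy ple_trans by blast
    qed
  qed
  then show ?thesis using that assms(2) by blast
qed

text \<open>Goodness spreads: a cover of \<open>X\<close> that meets some \<open>V \<prec> X\<close> also meets the good cover of \<open>X\<close>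
  above \<open>V\<close>.  If the two differ they are incomparable, and then overlapping forces the first into
  the core that witnesses the goodness of the second.\<close>

lemma gcov_spread:
  assumes V: "ple V X" "V \<noteq> X" and Y: "cov Y X" and ne: "V \<inter> Y \<noteq> {}"
  shows "gcov Y X"
proof -
  obtain X1 where X1: "gcov X1 X" "ple V X1" using ple_step[OF V] by blast
  show ?thesis
  proof (cases "X1 = Y")
    case True then show ?thesis using X1 by simp
  next
    case False
    have c: "cov X1 X" using X1 gcov_def by blast
    obtain W where W: "W \<in> \<X>" "X1 \<in> set_core W" "X \<in> set_core W" using X1 unfolding gcov_def ple1_def by blast
    have "\<not> X1 \<subseteq> Y" "\<not> Y \<subseteq> X1"
      using cov_incomparable[OF c Y] cov_incomparable[OF Y c] False by simp_all
    moreover have "X1 \<inter> Y \<noteq> {}" using ne ple_subset[OF X1(2)] by blast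
    ultimately have "Y \<in> set_core W" using set_core_incomparable[OF W(3,3) Y c] by blast
    then show ?thesis unfolding gcov_def ple1_def using Y W covD by blast
  qed
qed

text \<open>Two good covers of the same set that meet have their intersection in a common core, hence
  below both.  From this local diamond the general one follows by the induction that proves
  Newman's lemma.\<close>

lemma ple_Int:
  assumes "ple Y X" "ple Z X" "Y \<inter> Z \<noteq> {}"
  shows "ple (Y \<inter> Z) Y \<and> ple (Y \<inter> Z) Z"
proof -
  have "finite X" using assms ple_subset finite_member by blast
  then show ?thesis using assms
  proof (induction X arbitrary: Y Z rule: finite_psubset_induct)
    case (psubset X)
    note YX = ple_subset[OF psubset.prems(1)] and ZX = ple_subset[OF psubset.prems(2)]
    show ?case
    proof (cases "Y = X \<or> Z = X")
      case True
      then have "Y \<inter> Z = Y \<or> Y \<inter> Z = Z" "Y = X \<and> Y \<inter> Z = Z \<or> Z = X \<and> Y \<inter> Z = Y" using YX ZX by blast+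
      then show ?thesis using psubset.prems YX ZX ple_refl by metis
    next
      case False
      obtain Y1 where Y1: "gcov Y1 X" "ple Y Y1" using ple_step psubset.prems(1) False by blast
      obtain Z1 where Z1: "gcov Z1 X" "ple Z Z1" using ple_step psubset.prems(2) False by blast
      have sub: "Y \<subseteq> Y1" "Z \<subseteq> Z1" "Y1 \<subset> X" "Z1 \<subset> X" using Y1 Z1 ple_subset gcovD by blast+
      show ?thesis
      proof (cases "Y1 = Z1")
        case True
        then show ?thesis using psubset.IH[OF sub(3)] Y1 Z1 psubset.prems(3) by blast
      next
        case ne: False
        let ?U = "Y1 \<inter> Z1"
        have Une: "?U \<noteq> {}" using sub psubset.prems(3) by blast
        have "ple1 Y1 X" using Y1 gcov_def by blast
        then obtain W where W: "W \<in> \<X>" "Y1 \<in> set_core W" "X \<in> set_core W" unfolding ple1_def by blast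
        have c: "cov Y1 X" "cov Z1 X" using Y1 Z1 gcov_def by blast+
        have inc: "\<not> Y1 \<subseteq> Z1" "\<not> Z1 \<subseteq> Y1"
          using cov_incomparable[OF c] cov_incomparable[OF c(2,1)] ne by simp_all
        have "Z1 \<in> set_core W" using set_core_incomparable[OF W(3,3) c(2,1) inc(2,1)] Une by blast
        then have "?U \<in> set_core W" using set_core_Int W Une by blast
        then have U: "ple ?U Y1" "ple ?U Z1"
          unfolding ple_def ple1_def using W \<open>Z1 \<in> set_core W\<close> by blast+
        have a: "ple (Y \<inter> ?U) Y \<and> ple (Y \<inter> ?U) ?U"
          using psubset.IH[OF sub(3) Y1(2) U(1)] psubset.prems(3) sub by blast
        have b: "ple (Z \<inter> ?U) Z \<and> ple (Z \<inter> ?U) ?U"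
          using psubset.IH[OF sub(4) Z1(2) U(2)] psubset.prems(3) sub by blast
        have eq: "(Y \<inter> ?U) \<inter> (Z \<inter> ?U) = Y \<inter> Z" using sub by blast
        have "?U \<subset> X" using sub by blast
        from psubset.IH[OF this, of "Y \<inter> ?U" "Z \<inter> ?U"] a b psubset.prems(3) eq
        have "ple (Y \<inter> Z) (Y \<inter> ?U) \<and> ple (Y \<inter> Z) (Z \<inter> ?U)" by metis
        then show ?thesis using a b ple_trans by blast
      qed
    qed
  qed
qed

text \<open>A set \<open>V\<close> between \<open>Z\<close> and \<open>X\<close> lies in a cover of \<open>X\<close>, which contains \<open>Z\<close> and is good because
  it meets \<open>Z\<close>; induction descends along it.\<close>

lemma ple_convex:
  assumes "ple Z X" "V \<in> \<X>" "Z \<subseteq> V" "V \<subseteq> X"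
  shows "ple Z V \<and> ple V X"
proof -
  have "finite X" using assms ple_subset finite_member by blast
  then show ?thesis using assms(1,4)
  proof (induction X rule: finite_psubset_induct)
    case (psubset X)
    show ?case
    proof (cases "V = X")
      case True then show ?thesis using psubset.prems assms ple_refl by blast
    next
      case False
      then have VX: "V \<subset> X" using psubset.prems by blast
      obtain V1 where V1: "cov V1 X" "V \<subseteq> V1" using cov_above assms(2) VX psubset.prems ple_subset by blast
      have Zne: "Z \<noteq> {}" using psubset.prems ple_subset nonempty_member by blast
      have "Z \<noteq> X" using VX assms by blast
      then have "gcov V1 X" using gcov_spread[OF psubset.prems(1) _ V1(1)] Zne V1 assms by blast
      then have V1X: "ple V1 X" by (rule gcov_ple)
      have "Z \<inter> V1 = Z" using V1 assms by blast
      then have "ple Z V1" using ple_Int[OF psubset.prems(1) V1X] Zne by simp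
      then show ?thesis using psubset.IH[of V1] V1 V1X covD ple_trans by blast
    qed
  qed
qed

text \<open>By convexity, the common lower bounds of \<open>X\<close> and \<open>Y\<close> are all below \<open>X \<inter> Y\<close>, and if there
  are any then \<open>X \<inter> Y\<close> is one of them.\<close>

definition mt :: "'p set \<Rightarrow> 'p set \<Rightarrow> 'p set" where
  "mt X Y = (if ple (X \<inter> Y) X \<and> ple (X \<inter> Y) Y then X \<inter> Y else {})"

definition ple0 :: "'p set \<Rightarrow> 'p set \<Rightarrow> bool" where
  "ple0 X Y \<longleftrightarrow> X = {} \<and> Y \<in> insert {} \<X> \<or> ple X Y"

lemma mt_greatest:
  assumes "ple Z X" "ple Z Y"
  shows "mt X Y = X \<inter> Y \<and> ple Z (X \<inter> Y)"
proof -
  have Z: "Z \<in> \<X>" "X \<in> \<X>" "Y \<in> \<X>" "Z \<subseteq> X \<inter> Y" "Z \<noteq> {}" using assms ple_subset nonempty_member by blast+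
  then have "X \<inter> Y \<in> \<X>" using Int_member by blast
  then show ?thesis unfolding mt_def using ple_convex assms Z by (metis Int_lower1 Int_lower2)
qed

lemma mt_lower: "X \<in> insert {} \<X> \<Longrightarrow> Y \<in> insert {} \<X> \<Longrightarrow> ple0 (mt X Y) X \<and> ple0 (mt X Y) Y"
  unfolding mt_def ple0_def by auto

lemma mt_member: "mt X Y \<in> insert {} \<X>"
  unfolding mt_def using ple_subset by auto

lemma mt_subset: "mt X Y \<subseteq> X" "mt X Y \<subseteq> Y"
  unfolding mt_def by auto

lemma mt_commute: "mt X Y = mt Y X"
  unfolding mt_def by (simp add: Int_commute)

lemma mt_self: "X \<in> insert {} \<X> \<Longrightarrow> mt X X = X"
  unfolding mt_def using ple_refl by auto

lemma mt_ple: "ple Y X \<Longrightarrow> mt Y X = Y"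
  unfolding mt_def using ple_subset ple_refl by (simp add: Int_absorb2)

lemma mt_eq_iff:
  assumes "Y \<in> \<X>" shows "mt Y X = Y \<longleftrightarrow> ple Y X"
proof
  assume eq: "mt Y X = Y"
  then have "ple (Y \<inter> X) X" "Y \<inter> X = Y"
    using nonempty_member[OF assms] unfolding mt_def by (metis)+
  then show "ple Y X" by simp
qed (rule mt_ple)

lemma ple0_member: "ple0 X Y \<Longrightarrow> X \<in> insert {} \<X> \<and> Y \<in> insert {} \<X>"
  unfolding ple0_def using ple_subset by blast

lemma ple0_subset: "ple0 X Y \<Longrightarrow> X \<subseteq> Y"
  unfolding ple0_def using ple_subset by blast

lemma ple0_trans: "ple0 X Y \<Longrightarrow> ple0 Y Z \<Longrightarrow> ple0 X Z"
  using ple_trans ple_subset nonempty_member unfolding ple0_def by blast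

lemma ple0_iff_ple: "X \<in> \<X> \<Longrightarrow> ple0 X Y \<longleftrightarrow> ple X Y"
  unfolding ple0_def using nonempty_member by blast

lemma mt_ple0_greatest:
  assumes "ple0 Z X" "ple0 Z Y" shows "ple0 Z (mt X Y)"
  using assms mt_greatest[of Z X Y] mt_member[of X Y] unfolding ple0_def by auto

text \<open>The inequality \<open>p\<^sub>u\<^sub>,\<^sub>v p\<^sub>v\<^sub>,\<^sub>w \<le> p\<^sub>u\<^sub>,\<^sub>w\<close>, which makes the multiplication of triples well defined.\<close>

lemma mt_triangle:
  assumes "z \<in> mt X Y" "z \<in> mt Y Z" shows "z \<in> mt X Z"
proof -
  have a: "ple (X \<inter> Y) X" "ple (X \<inter> Y) Y" "z \<in> X \<inter> Y" using assms(1) unfolding mt_def by (auto split: if_splits)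
  have b: "ple (Y \<inter> Z) Y" "ple (Y \<inter> Z) Z" "z \<in> Y \<inter> Z" using assms(2) unfolding mt_def by (auto split: if_splits)
  have "(X \<inter> Y) \<inter> (Y \<inter> Z) \<noteq> {}" using a b by blast
  from ple_Int[OF a(2) b(1) this] a b ple_trans
  have "ple (X \<inter> Y \<inter> (Y \<inter> Z)) X" "ple (X \<inter> Y \<inter> (Y \<inter> Z)) Z" by blast+
  from mt_greatest[OF this] show ?thesis using a b by blast
qed

text \<open>The core of \<open>X\<close> contains every cover of \<open>X\<close> that overlaps a different one.\<close>

lemma cov_eq_or_disjoint:
  assumes "cov Y X" "cov Z X" "\<not> ple Y X" "Y \<inter> Z \<noteq> {}" shows "Y = Z"
proof (rule ccontr)
  assume "Y \<noteq> Z"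
  then have "\<not> Y \<subseteq> Z" "\<not> Z \<subseteq> Y"
    using cov_incomparable[OF assms(1,2)] cov_incomparable[OF assms(2,1)] by simp_all
  from set_core_incomparable[OF set_core_self set_core_self assms(1,2) this assms(4)]
  have "ple1 Y X" unfolding ple1_def using set_core_self assms(1) covD by blast
  then show False using assms(3) unfolding ple_def by blast
qed

text \<open>By convexity, the pairs that are covers for inclusion and lie in \<open>\<preceq>\<close> are the covers of the
  order \<open>\<preceq>\<close>.  They are therefore known once this order is known, and need not be counted
  separately.\<close>

lemma cov_ple_iff:
  "cov Y X \<and> ple Y X \<longleftrightarrow> ple Y X \<and> Y \<noteq> X \<and> (\<forall>Z. ple Y Z \<and> ple Z X \<longrightarrow> Z = Y \<or> Z = X)"
proof
  assume L: "cov Y X \<and> ple Y X"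
  then have "Z = Y \<or> Z = X" if "ple Y Z" "ple Z X" for Z
    using cov_between[of Y X Z] ple_subset[OF that(1)] ple_subset[OF that(2)] by simp
  then show "ple Y X \<and> Y \<noteq> X \<and> (\<forall>Z. ple Y Z \<and> ple Z X \<longrightarrow> Z = Y \<or> Z = X)"
    using L covD(3)[of Y X] by auto
next
  assume R: "ple Y X \<and> Y \<noteq> X \<and> (\<forall>Z. ple Y Z \<and> ple Z X \<longrightarrow> Z = Y \<or> Z = X)"
  then have *: "Y \<in> \<X>" "X \<in> \<X>" "Y \<subset> X" using ple_subset[of Y X] by auto
  have "Z = Y \<or> Z = X" if "Z \<in> \<X>" "Y \<subset> Z" "Z \<subset> X" for Z
    using R ple_convex[of Y X Z] that by auto
  then have "\<not> (\<exists>Z\<in>\<X>. Y \<subset> Z \<and> Z \<subset> X)" by blast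
  then show "cov Y X \<and> ple Y X"
    unfolding cov_def using * R by simp
qed

end

section \<open>The inverse hull as a semigroup of prefix exchanges\<close>

text \<open>Partial identities; all idempotents of the inverse hull are of this form.\<close>

definition pid :: "'w set \<Rightarrow> 'w \<rightharpoonup> 'w" where
  "pid C = (\<lambda>w. if w \<in> C then Some w else None)"

definition pinj :: "('w \<rightharpoonup> 'w) \<Rightarrow> bool" where
  "pinj f \<longleftrightarrow> (\<forall>w w' v. f w = Some v \<and> f w' = Some v \<longrightarrow> w = w')"

lemma map_eqI: "(\<And>w v. f w = Some v \<longleftrightarrow> g w = Some v) \<Longrightarrow> f = g"
  by (rule ext) (metis not_Some_eq)

lemma pid_Some [simp]: "pid C w = Some v \<longleftrightarrow> w \<in> C \<and> v = w"
  by (auto simp: pid_def)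

lemma dom_pid [simp]: "dom (pid C) = C"
  by (auto simp: dom_def pid_def)

lemma ran_pid [simp]: "ran (pid C) = C"
  by (auto simp: ran_def pid_def)

lemma pid_eq_iff [simp]: "pid C = pid D \<longleftrightarrow> C = D"
  by (metis dom_pid)

lemma pid_empty: "pid {} = Map.empty"
  by (simp add: pid_def)

lemma pid_eq_empty [simp]: "pid C = Map.empty \<longleftrightarrow> C = {}"
  using pid_eq_iff[of C "{}"] by (simp only: pid_empty)

lemma empty_eq_pid [simp]: "Map.empty = pid C \<longleftrightarrow> C = {}"
  using pid_eq_empty[of C] by (metis)

lemma pid_comp: "pid C \<circ>\<^sub>m pid D = pid (C \<inter> D)"
  by (rule map_eqI) (auto simp: map_comp_Some_iff)

lemma pid_comp_eq: "ran f \<subseteq> C \<Longrightarrow> pid C \<circ>\<^sub>m f = f"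
  by (rule map_eqI) (auto simp: map_comp_Some_iff ran_def)

lemma comp_pid_eq: "dom f \<subseteq> C \<Longrightarrow> f \<circ>\<^sub>m pid C = f"
  by (rule map_eqI) (auto simp: map_comp_Some_iff dom_def)

lemma comp_empty [simp]: "f \<circ>\<^sub>m Map.empty = Map.empty" "Map.empty \<circ>\<^sub>m f = Map.empty"
  by (rule map_eqI; simp add: map_comp_Some_iff)+

lemma comp_assoc: "(f \<circ>\<^sub>m g) \<circ>\<^sub>m h = f \<circ>\<^sub>m (g \<circ>\<^sub>m h)"
  by (rule map_eqI) (auto simp: map_comp_Some_iff)

lemma pinj_inject: "pinj f \<Longrightarrow> f w = Some v \<Longrightarrow> f w' = Some v \<Longrightarrow> w = w'"
  by (auto simp: pinj_def)

lemma pinverse_Some: "pinj f \<Longrightarrow> pinverse f y = Some x \<longleftrightarrow> f x = Some y"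
proof
  assume inj: "pinj f" and "pinverse f y = Some x"
  then have "y \<in> ran f" "x = (THE x. f x = Some y)" by (auto simp: pinverse_def split: if_splits)
  moreover obtain x' where x': "f x' = Some y" using \<open>y \<in> ran f\<close> by (auto simp: ran_def)
  moreover have "(THE x. f x = Some y) = x'" by (rule the_equality, rule x', erule pinj_inject[OF inj _ x'])
  ultimately show "f x = Some y" by simp
next
  assume inj: "pinj f" and x: "f x = Some y"
  have "(THE x. f x = Some y) = x" by (rule the_equality, rule x, erule pinj_inject[OF inj _ x])
  then show "pinverse f y = Some x" using x by (auto simp: pinverse_def ran_def)
qed

lemma comp_pinverse: "pinj f \<Longrightarrow> f \<circ>\<^sub>m pinverse f = pid (ran f)"
  by (rule map_eqI) (auto simp: map_comp_Some_iff pinverse_Some ran_def)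

lemma pinverse_comp: "pinj f \<Longrightarrow> pinverse f \<circ>\<^sub>m f = pid (dom f)"
  by (rule map_eqI) (auto simp: map_comp_Some_iff pinverse_Some dom_def pinj_def)

locale markov_shift =
  fixes A :: "'a set" and M :: "'a \<Rightarrow> 'a \<Rightarrow> nat"
  assumes markov: "markov_matrix A M"
begin

definition F :: "'a \<Rightarrow> 'a set" where
  "F a = {b \<in> A. M a b = 1}"

definition \<X> :: "'a set set" where
  "\<X> = {X. X \<noteq> {} \<and> (\<exists>K\<subseteq>A. K \<noteq> {} \<and> X = \<Inter> (F ` K))}"

lemma finite_A: "finite A"
  using markov by (simp add: markov_matrix_def)

lemma F_subset: "F a \<subseteq> A"
  by (auto simp: F_def)

lemma \<X>_subset: "X \<in> \<X> \<Longrightarrow> X \<subseteq> A"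
  using F_subset by (fastforce simp: \<X>_def)

lemma F_nonempty: "a \<in> A \<Longrightarrow> F a \<noteq> {}"
  using markov unfolding markov_matrix_def F_def by fastforce

lemma F_in_\<X>: "a \<in> A \<Longrightarrow> F a \<in> \<X>"
  unfolding \<X>_def using F_nonempty by (auto intro!: exI[of _ "{a}"])

sublocale intersection_family \<X>
proof
  show "finite \<X>" using finite_subset[of \<X> "Pow A"] \<X>_subset finite_A by auto
  show "finite X" if "X \<in> \<X>" for X using finite_subset \<X>_subset[OF that] finite_A by blast
  show "X \<noteq> {}" if "X \<in> \<X>" for X using that by (simp add: \<X>_def)
  show "X \<inter> Y \<in> \<X>" if XY: "X \<in> \<X>" "Y \<in> \<X>" "X \<inter> Y \<noteq> {}" for X Y
  proof -
    obtain K L where "K \<subseteq> A" "K \<noteq> {}" "X = \<Inter> (F ` K)" "L \<subseteq> A" "L \<noteq> {}" "Y = \<Inter> (F ` L)"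
      using XY by (auto simp: \<X>_def)
    then have "X \<inter> Y = \<Inter> (F ` (K \<union> L))" "K \<union> L \<subseteq> A" "K \<union> L \<noteq> {}" by auto
    then show ?thesis using XY(3) unfolding \<X>_def by blast
  qed
qed

definition wd :: "'a list \<Rightarrow> bool" where
  "wd \<alpha> \<longleftrightarrow> set \<alpha> \<subseteq> A \<and> successively (\<lambda>a b. b \<in> F a) \<alpha>"

text \<open>The domain of the idempotent \<open>e\<^sub>X\<close>.\<close>

definition starts :: "'a set \<Rightarrow> 'a list set" where
  "starts X = {w. w \<noteq> [] \<and> wd w \<and> hd w \<in> X}"

text \<open>For \<open>X \<subseteq> F (last \<alpha>)\<close> this is the image of \<open>starts X\<close> under \<open>\<theta>\<^sub>\<alpha>\<close>.\<close>

definition cyl :: "'a list \<Rightarrow> 'a set \<Rightarrow> 'a list set" where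
  "cyl \<alpha> X = (@) \<alpha> ` starts X"

text \<open>The element \<open>\<theta>\<^sub>\<alpha> e\<^sub>X \<theta>\<^sub>\<beta>\<^sup>-\<^sup>1\<close>, which replaces the prefix \<open>\<beta>\<close> by \<open>\<alpha>\<close>.\<close>

definition rep :: "'a list \<Rightarrow> 'a set \<Rightarrow> 'a list \<Rightarrow> 'a list \<rightharpoonup> 'a list" where
  "rep \<alpha> X \<beta> = (\<lambda>w. if w \<in> cyl \<beta> X then Some (\<alpha> @ drop (length \<beta>) w) else None)"

text \<open>Words \<open>\<alpha>\<close>, possibly empty, and sets \<open>X\<close> such that every word starting in \<open>X\<close> can follow
  \<open>\<alpha>\<close>: the pairs that index the nonzero idempotents.\<close>

definition valid :: "'a list \<Rightarrow> 'a set \<Rightarrow> bool" where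
  "valid \<alpha> X \<longleftrightarrow> wd \<alpha> \<and> X \<in> \<X> \<and> (\<alpha> \<noteq> [] \<longrightarrow> X \<subseteq> F (last \<alpha>))"

lemma wd_Nil [simp]: "wd []"
  by (simp add: wd_def)

lemma wd_single: "wd [a] \<longleftrightarrow> a \<in> A"
  by (simp add: wd_def)

lemma wd_append: "wd (\<alpha> @ \<beta>) \<longleftrightarrow> wd \<alpha> \<and> wd \<beta> \<and> (\<alpha> \<noteq> [] \<and> \<beta> \<noteq> [] \<longrightarrow> hd \<beta> \<in> F (last \<alpha>))"
  by (auto simp: wd_def successively_append_iff)

lemma wd_Cons: "wd (a # \<beta>) \<longleftrightarrow> a \<in> A \<and> wd \<beta> \<and> (\<beta> \<noteq> [] \<longrightarrow> hd \<beta> \<in> F a)"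
  using wd_append[of "[a]" \<beta>] by (auto simp: wd_single)

lemma markov_words_eq: "markov_words A M = {w. w \<noteq> [] \<and> wd w}"
  unfolding markov_words_def wd_def successively_conv_nth F_def
  by (auto dest: nth_mem Suc_lessD)

lemma starts_empty [simp]: "starts {} = {}"
  by (simp add: starts_def)

lemma starts_Int: "starts X \<inter> starts Y = starts (X \<inter> Y)"
  by (auto simp: starts_def)

lemma single_starts: "x \<in> X \<Longrightarrow> X \<subseteq> A \<Longrightarrow> [x] \<in> starts X"
  by (auto simp: starts_def wd_single)

lemma starts_mono: "X \<subseteq> Y \<Longrightarrow> starts X \<subseteq> starts Y"
  by (auto simp: starts_def)

lemma starts_subset_iff: "X \<subseteq> A \<Longrightarrow> starts X \<subseteq> starts Y \<longleftrightarrow> X \<subseteq> Y"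
  using single_starts by (fastforce simp: starts_def)

lemma cyl_Nil: "cyl [] X = starts X"
  by (simp add: cyl_def image_def)

lemma cyl_iff: "w \<in> cyl \<alpha> X \<longleftrightarrow> (\<exists>r\<in>starts X. w = \<alpha> @ r)"
  by (auto simp: cyl_def)

lemma rep_Some: "rep \<alpha> X \<beta> w = Some v \<longleftrightarrow> (\<exists>r\<in>starts X. w = \<beta> @ r \<and> v = \<alpha> @ r)"
  by (auto simp: rep_def cyl_iff)

lemma dom_rep [simp]: "dom (rep \<alpha> X \<beta>) = cyl \<beta> X"
  by (auto simp: dom_def rep_Some cyl_iff)

lemma ran_rep [simp]: "ran (rep \<alpha> X \<beta>) = cyl \<alpha> X"
  by (auto simp: ran_def rep_Some cyl_iff)

lemma rep_self: "rep \<alpha> X \<alpha> = pid (cyl \<alpha> X)"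
  by (rule map_eqI) (auto simp: rep_Some cyl_iff)

lemma rep_empty: "rep \<alpha> {} \<beta> = Map.empty"
  by (rule map_eqI) (simp add: rep_Some)

lemma pinj_rep: "pinj (rep \<alpha> X \<beta>)"
  by (auto simp: pinj_def rep_Some)

lemma pinverse_rep: "pinverse (rep \<alpha> X \<beta>) = rep \<beta> X \<alpha>"
  by (rule map_eqI) (auto simp: pinverse_Some[OF pinj_rep] rep_Some)

lemma validD: "valid \<alpha> X \<Longrightarrow> X \<in> \<X>" "valid \<alpha> X \<Longrightarrow> wd \<alpha>" "valid \<alpha> X \<Longrightarrow> X \<subseteq> A" "valid \<alpha> X \<Longrightarrow> X \<noteq> {}"
  using \<X>_subset nonempty_member by (auto simp: valid_def)

lemma valid_Nil: "valid [] X \<longleftrightarrow> X \<in> \<X>"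
  by (simp add: valid_def)

lemma valid_wd_append: "valid \<alpha> X \<Longrightarrow> r \<in> starts X \<Longrightarrow> wd (\<alpha> @ r)"
  by (auto simp: valid_def starts_def wd_append)

lemma cyl_nonempty: "X \<subseteq> A \<Longrightarrow> X \<noteq> {} \<Longrightarrow> cyl \<alpha> X \<noteq> {}"
  using single_starts by (fastforce simp: cyl_def)

text \<open>The arrows of a left cancellative category with objects \<open>\<X>\<close>: \<open>\<alpha>\<close> is an arrow from \<open>Z\<close> to
  \<open>X\<close> if the idempotent indexed by \<open>(\<alpha>, Z)\<close> lies below \<open>e\<^sub>X\<close>.  Composition is concatenation.\<close>

definition lam :: "'a set \<Rightarrow> 'a list \<Rightarrow> 'a set \<Rightarrow> bool" where
  "lam X \<alpha> Z \<longleftrightarrow> X \<in> \<X> \<and> valid \<alpha> Z \<and> (if \<alpha> = [] then Z \<subseteq> X else hd \<alpha> \<in> X)"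

lemma lamD: "lam X \<alpha> Z \<Longrightarrow> X \<in> \<X>" "lam X \<alpha> Z \<Longrightarrow> Z \<in> \<X>" "lam X \<alpha> Z \<Longrightarrow> valid \<alpha> Z"
  using validD by (auto simp: lam_def)

lemma lam_Nil: "lam X [] Z \<longleftrightarrow> X \<in> \<X> \<and> Z \<in> \<X> \<and> Z \<subseteq> X"
  by (auto simp: lam_def valid_Nil)

lemma valid_append: "valid \<alpha> X \<Longrightarrow> lam X u Z \<Longrightarrow> valid (\<alpha> @ u) Z"
  by (auto simp: lam_def valid_def wd_append split: if_splits)

lemma lam_trans: "lam X u Z \<Longrightarrow> lam Z v W \<Longrightarrow> lam X (u @ v) W"
  using valid_append[of u Z v W] by (auto simp: lam_def split: if_splits)

lemma cyl_append: "w \<in> cyl (\<alpha> @ u) Z \<longleftrightarrow> (\<exists>r\<in>cyl u Z. w = \<alpha> @ r)"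
  by (auto simp: cyl_iff)

lemma lam_starts: "lam X u Z \<Longrightarrow> cyl u Z \<subseteq> starts X"
  using valid_wd_append by (auto simp: lam_def cyl_iff starts_def split: if_splits)

lemma cyl_mono: "lam X u Z \<Longrightarrow> cyl (\<alpha> @ u) Z \<subseteq> cyl \<alpha> X"
  using lam_starts[of X u Z] unfolding cyl_append cyl_iff[of _ \<alpha>] subset_iff by blast

text \<open>The shortest words of a cylinder, which are \<open>\<beta>\<close> followed by one letter of \<open>Z\<close>, determine \<open>\<beta>\<close>
  and \<open>Z\<close>; comparing them with words of \<open>cyl \<alpha> X\<close> exhibits \<open>\<alpha>\<close> as a prefix of \<open>\<beta>\<close>.\<close>

lemma cyl_subsetD:
  assumes "X \<in> \<X>" "valid \<beta> Z" "cyl \<beta> Z \<subseteq> cyl \<alpha> X"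
  shows "\<exists>u. \<beta> = \<alpha> @ u \<and> lam X u Z"
proof -
  have sp: "\<exists>r. \<beta> @ [z] = \<alpha> @ r \<and> r \<in> starts X" if "z \<in> Z" for z
  proof -
    have "\<beta> @ [z] \<in> cyl \<beta> Z" using single_starts[OF that] validD(3)[OF assms(2)] by (auto simp: cyl_iff)
    then have "\<beta> @ [z] \<in> cyl \<alpha> X" using assms(3) by blast
    then show ?thesis by (auto simp: cyl_iff)
  qed
  obtain z where z: "z \<in> Z" using validD(4)[OF assms(2)] by blast
  obtain r where r: "\<beta> @ [z] = \<alpha> @ r" "r \<in> starts X" using sp[OF z] by blast
  have rne: "r \<noteq> []" using r(2) by (simp add: starts_def)
  have "last (\<alpha> @ r) = z" using r(1) by (metis last_snoc)
  then have rz: "r = butlast r @ [z]" using rne by (metis append_butlast_last_id last_appendR)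
  have "butlast (\<beta> @ [z]) = butlast (\<alpha> @ r)" using r(1) by simp
  then have \<beta>: "\<beta> = \<alpha> @ butlast r" using rne by (simp add: butlast_append)
  define u where "u = butlast r"
  have ru: "r = u @ [z]" using rz u_def by simp
  have "valid u Z" using assms(2) unfolding valid_def \<beta> u_def[symmetric] wd_append by auto
  moreover have "Z \<subseteq> X" if "u = []"
  proof
    fix x assume "x \<in> Z"
    from sp[OF this] show "x \<in> X" using \<beta> \<open>u = []\<close> u_def by (auto simp: starts_def)
  qed
  moreover have "hd u \<in> X" if "u \<noteq> []" using r(2) ru that by (simp add: starts_def)
  ultimately have "lam X u Z" using assms(1) unfolding lam_def by auto
  then show ?thesis using \<beta> u_def by blast
qed

lemma cyl_subset_iff:
  assumes "X \<in> \<X>" "valid \<beta> Z"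
  shows "cyl \<beta> Z \<subseteq> cyl \<alpha> X \<longleftrightarrow> (\<exists>u. \<beta> = \<alpha> @ u \<and> lam X u Z)"
  using cyl_subsetD[OF assms] cyl_mono by blast

lemma cyl_subset_starts: "X \<in> \<X> \<Longrightarrow> valid \<beta> Z \<Longrightarrow> cyl \<beta> Z \<subseteq> starts X \<longleftrightarrow> lam X \<beta> Z"
  using cyl_subset_iff[of X \<beta> Z "[]"] by (simp add: cyl_Nil)

lemma cyl_inject:
  assumes "valid \<alpha> X" "valid \<beta> Y" "cyl \<alpha> X = cyl \<beta> Y" shows "\<alpha> = \<beta> \<and> X = Y"
proof -
  obtain u where u: "\<beta> = \<alpha> @ u" "lam X u Y" using cyl_subsetD[of X \<beta> Y \<alpha>] assms validD(1) by blast
  obtain v where v: "\<alpha> = \<beta> @ v" "lam Y v X" using cyl_subsetD[of Y \<alpha> X \<beta>] assms validD(1) by blast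
  have "u = []" "v = []" using u v by auto
  then show ?thesis using u v by (simp add: lam_Nil)
qed

text \<open>If two cylinders meet, then one prefix extends the other.  If they are equal the sets are
  intersected; otherwise the cylinder with the longer prefix is contained in the other one.\<close>

lemma cyl_Int:
  assumes "valid \<alpha> X" "valid \<beta> Y" "cyl \<alpha> X \<inter> cyl \<beta> Y \<noteq> {}"
  shows "\<exists>u v Z. \<alpha> @ u = \<beta> @ v \<and> lam X u Z \<and> lam Y v Z \<and> cyl \<alpha> X \<inter> cyl \<beta> Y = cyl (\<alpha> @ u) Z"
proof -
  have main: "\<exists>u v Z. \<alpha> @ u = \<beta> @ v \<and> lam X u Z \<and> lam Y v Z \<and> cyl \<alpha> X \<inter> cyl \<beta> Y = cyl (\<alpha> @ u) Z"
    if v: "valid \<alpha> X" "valid \<beta> Y" and r: "\<alpha> @ r = \<beta> @ r'" "r \<in> starts X" "r' \<in> starts Y" and \<beta>: "\<beta> = \<alpha> @ u"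
    for \<alpha> \<beta> X Y r r' u
  proof (cases "u = []")
    case True
    then have eq: "\<alpha> = \<beta>" "r = r'" using \<beta> r by auto
    then have "X \<inter> Y \<noteq> {}" using r by (auto simp: starts_def)
    then have Z: "X \<inter> Y \<in> \<X>" using Int_member v validD by blast
    have "cyl \<alpha> X \<inter> cyl \<beta> Y = cyl \<alpha> (X \<inter> Y)"
      unfolding eq(1) starts_Int[symmetric] cyl_def by auto
    then show ?thesis using Z eq v validD(1)
      by (intro exI[of _ "[]"] exI[of _ "X \<inter> Y"]) (auto simp: lam_Nil)
  next
    case False
    have "r = u @ r'" using \<beta> r by simp
    then have "hd u \<in> X" using False r(2) by (simp add: starts_def)
    moreover have "valid u Y" using v(2) False unfolding \<beta> valid_def wd_append by auto
    ultimately have l: "lam X u Y" using False v validD by (auto simp: lam_def)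
    then show ?thesis using cyl_mono[OF l, of \<alpha>] v(2) validD(1) \<beta>
      by (intro exI[of _ u] exI[of _ "[]"] exI[of _ Y]) (auto simp: lam_Nil)
  qed
  obtain r r' where r: "\<alpha> @ r = \<beta> @ r'" "r \<in> starts X" "r' \<in> starts Y"
    using assms(3) by (auto simp: cyl_iff)
  then obtain u where "\<beta> = \<alpha> @ u \<or> \<alpha> = \<beta> @ u" by (auto simp: append_eq_append_conv2)
  then show ?thesis
  proof
    assume "\<beta> = \<alpha> @ u" then show ?thesis using main assms r by blast
  next
    assume "\<alpha> = \<beta> @ u"
    then obtain u' v' Z where "\<beta> @ u' = \<alpha> @ v'" "lam Y u' Z" "lam X v' Z" "cyl \<beta> Y \<inter> cyl \<alpha> X = cyl (\<beta> @ u') Z"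
      using main[OF assms(2,1) r(1)[symmetric] r(3,2)] by blast
    then show ?thesis by (metis Int_commute)
  qed
qed

text \<open>All products reduce to this one rule, in which the intersection of the inner cylinders and
  the two ways of reaching it are data; it never asks which inner prefix is longer.\<close>

lemma rep_comp:
  assumes "\<beta> @ u = \<gamma> @ v" "cyl \<beta> X \<inter> cyl \<gamma> Y = cyl (\<beta> @ u) Z"
  shows "rep \<alpha> X \<beta> \<circ>\<^sub>m rep \<gamma> Y \<delta> = rep (\<alpha> @ u) Z (\<delta> @ v)"
proof (rule map_eqI)
  fix w x
  show "(rep \<alpha> X \<beta> \<circ>\<^sub>m rep \<gamma> Y \<delta>) w = Some x \<longleftrightarrow> rep (\<alpha> @ u) Z (\<delta> @ v) w = Some x"
  proof
    assume "(rep \<alpha> X \<beta> \<circ>\<^sub>m rep \<gamma> Y \<delta>) w = Some x"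
    then obtain r r' where r: "w = \<delta> @ r" "\<gamma> @ r = \<beta> @ r'" "x = \<alpha> @ r'" "r \<in> starts Y" "r' \<in> starts X"
      by (auto simp: map_comp_Some_iff rep_Some)
    then have "\<gamma> @ r \<in> cyl \<beta> X" "\<gamma> @ r \<in> cyl \<gamma> Y" unfolding cyl_iff by blast+
    then have "\<gamma> @ r \<in> cyl (\<beta> @ u) Z" using assms(2) by blast
    then obtain q where q: "q \<in> starts Z" "\<gamma> @ r = \<beta> @ u @ q" by (auto simp: cyl_iff)
    then have "r' = u @ q" using r(2) by simp
    moreover have "\<gamma> @ r = \<gamma> @ v @ q" using q(2) assms(1) append.assoc[of \<gamma> v q] append.assoc[of \<beta> u q] by simp
    then have "r = v @ q" by simp
    ultimately show "rep (\<alpha> @ u) Z (\<delta> @ v) w = Some x" using r q by (auto simp: rep_Some)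
  next
    assume "rep (\<alpha> @ u) Z (\<delta> @ v) w = Some x"
    then obtain q where q: "q \<in> starts Z" "w = \<delta> @ v @ q" "x = \<alpha> @ u @ q" by (auto simp: rep_Some)
    have "\<beta> @ u @ q \<in> cyl \<beta> X \<inter> cyl \<gamma> Y" using assms(2) q(1) by (auto simp: cyl_iff)
    then have "u @ q \<in> starts X" "\<beta> @ u @ q \<in> cyl \<gamma> Y" by (auto simp: cyl_iff)
    moreover have eq: "\<gamma> @ v @ q = \<beta> @ u @ q" using assms(1) append.assoc[of \<gamma> v q] append.assoc[of \<beta> u q] by simp
    ultimately have "\<gamma> @ v @ q \<in> cyl \<gamma> Y" by (simp only: eq)
    then have "v @ q \<in> starts Y" by (auto simp: cyl_iff)
    with \<open>u @ q \<in> starts X\<close> show "(rep \<alpha> X \<beta> \<circ>\<^sub>m rep \<gamma> Y \<delta>) w = Some x"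
      using q eq by (auto simp: map_comp_Some_iff rep_Some)
  qed
qed

lemma rep_comp_disjoint:
  assumes "cyl \<beta> X \<inter> cyl \<gamma> Y = {}" shows "rep \<alpha> X \<beta> \<circ>\<^sub>m rep \<gamma> Y \<delta> = Map.empty"
proof (rule map_eqI)
  have "\<gamma> @ r \<noteq> \<beta> @ r'" if "r \<in> starts Y" "r' \<in> starts X" for r r'
    using assms that unfolding cyl_iff disjoint_iff by metis
  then show "(rep \<alpha> X \<beta> \<circ>\<^sub>m rep \<gamma> Y \<delta>) w = Some v \<longleftrightarrow> Map.empty w = Some v" for w v
    by (auto simp: map_comp_Some_iff rep_Some) metis
qed

lemma rep_inject:
  assumes "valid \<alpha> X" "valid \<beta> X" "valid \<gamma> Y" "valid \<delta> Y" "rep \<alpha> X \<beta> = rep \<gamma> Y \<delta>"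
  shows "\<alpha> = \<gamma> \<and> X = Y \<and> \<beta> = \<delta>"
  using assms cyl_inject dom_rep ran_rep by metis

lemma rep_nonempty: "valid \<alpha> X \<Longrightarrow> rep \<alpha> X \<beta> \<noteq> Map.empty"
  by (metis cyl_nonempty dom_empty dom_rep validD(3,4))

abbreviation S :: "('a list \<rightharpoonup> 'a list) sgrp" where
  "S \<equiv> inverse_hull A M"

lemma carrier_S: "carrier S = hull_carrier A M"
  by (simp add: inverse_hull_def)

lemma mult_S [simp]: "mult S = (\<circ>\<^sub>m)"
  by (simp add: inverse_hull_def)

lemma theta_rep: "a \<in> A \<Longrightarrow> theta A M a = rep [a] (F a) []"
  by (rule map_eqI) (auto simp: theta_def rep_Some markov_words_eq starts_def wd_Cons)

lemma rep_in_hull: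
  assumes "valid \<alpha> X" "valid \<beta> X" shows "rep \<alpha> X \<beta> \<in> hull_carrier A M"
proof -
  have F: "pid (starts (F a)) \<in> hull_carrier A M" if "a \<in> A" for a
  proof -
    have "pinverse (theta A M a) \<circ>\<^sub>m theta A M a \<in> hull_carrier A M"
      using that by (intro hull_carrier.intros)
    then show ?thesis by (simp add: theta_rep[OF that] pinverse_comp pinj_rep cyl_Nil)
  qed
  have I: "pid (starts (\<Inter> (F ` K))) \<in> hull_carrier A M" if "finite K" "K \<noteq> {}" "K \<subseteq> A" for K
    using that
  proof (induction K rule: finite_ne_induct)
    case (singleton x) then show ?case using F by simp
  next
    case (insert x K)
    have "pid (starts (F x)) \<circ>\<^sub>m pid (starts (\<Inter> (F ` K))) \<in> hull_carrier A M"
      using insert F by (intro hull_carrier.comp) auto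
    then show ?case by (simp add: pid_comp starts_Int)
  qed
  have E: "rep [] X [] \<in> hull_carrier A M" if "X \<in> \<X>" for X
    using that I finite_subset[OF _ finite_A] unfolding \<X>_def rep_self cyl_Nil by blast
  have L: "rep \<alpha> X [] \<in> hull_carrier A M" if "valid \<alpha> X" for \<alpha> X
    using that
  proof (induction \<alpha>)
    case Nil then show ?case using E validD by simp
  next
    case (Cons a \<alpha>)
    have a: "a \<in> A" and v: "valid \<alpha> X" and st: "\<alpha> @ r \<in> starts (F a)" if "r \<in> starts X" for r
      using Cons.prems valid_wd_append[OF Cons.prems that] that
      by (auto simp: valid_def wd_Cons starts_def wd_append split: if_splits)
    obtain x where "x \<in> X" using validD(4) Cons.prems by blast
    then have r0: "[x] \<in> starts X" using single_starts validD(3) Cons.prems by blast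
    have "rep (a # \<alpha>) X [] = theta A M a \<circ>\<^sub>m rep \<alpha> X []"
      unfolding theta_rep[OF a[OF r0]]
      by (rule map_eqI) (auto simp: map_comp_Some_iff rep_Some st)
    then show ?case using Cons.IH[OF v[OF r0]] a[OF r0] by (simp add: hull_carrier.intros)
  qed
  have "rep \<alpha> X \<beta> = rep \<alpha> X [] \<circ>\<^sub>m pinverse (rep \<beta> X [])"
    unfolding pinverse_rep by (rule map_eqI) (auto simp: map_comp_Some_iff rep_Some)
  then show ?thesis using L assms by (simp add: hull_carrier.intros)
qed

lemma hull_cases:
  assumes "s \<in> hull_carrier A M"
  obtains "s = Map.empty" | \<alpha> X \<beta> where "s = rep \<alpha> X \<beta>" "valid \<alpha> X" "valid \<beta> X"
proof -
  have "s = Map.empty \<or> (\<exists>\<alpha> X \<beta>. s = rep \<alpha> X \<beta> \<and> valid \<alpha> X \<and> valid \<beta> X)"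
    using assms
  proof induction
    case zero then show ?case by simp
  next
    case (gen a)
    then have "valid [a] (F a)" "valid [] (F a)" using F_in_\<X> by (auto simp: valid_def wd_single)
    then show ?case using theta_rep gen by metis
  next
    case (comp f g)
    show ?case
    proof (cases "f = Map.empty \<or> g = Map.empty")
      case True then show ?thesis by auto
    next
      case False
      then obtain \<alpha> X \<beta> \<gamma> Y \<delta> where
        fg: "f = rep \<alpha> X \<beta>" "valid \<alpha> X" "valid \<beta> X" "g = rep \<gamma> Y \<delta>" "valid \<gamma> Y" "valid \<delta> Y"
        using comp.IH by blast
      show ?thesis
      proof (cases "cyl \<beta> X \<inter> cyl \<gamma> Y = {}")
        case True then show ?thesis using rep_comp_disjoint fg by simp
      next
        case False
        then obtain u v Z where "\<beta> @ u = \<gamma> @ v" "lam X u Z" "lam Y v Z" "cyl \<beta> X \<inter> cyl \<gamma> Y = cyl (\<beta> @ u) Z"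
          using cyl_Int fg by blast
        then have "f \<circ>\<^sub>m g = rep (\<alpha> @ u) Z (\<delta> @ v)" "valid (\<alpha> @ u) Z" "valid (\<delta> @ v) Z"
          using rep_comp[of \<beta> u \<gamma> v X Y Z \<alpha> \<delta>] valid_append[OF fg(2)] valid_append[OF fg(6)] fg(1,4) by simp_all
        then show ?thesis by blast
      qed
    qed
  next
    case (inv f)
    have "pinverse (Map.empty :: 'a list \<rightharpoonup> 'a list) = Map.empty" using pinverse_rep[of "[]" "{}" "[]"] by (simp add: rep_empty)
    then show ?case using inv.IH pinverse_rep by metis
  qed
  then show ?thesis using that by blast
qed

lemma hull_pinj: "s \<in> hull_carrier A M \<Longrightarrow> pinj s"
  by (erule hull_cases) (simp add: pinj_def, simp add: pinj_rep)

text \<open>The domains of the idempotents.\<close>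

definition cyls :: "'a list set set" where
  "cyls = insert {} {cyl \<alpha> X |\<alpha> X. valid \<alpha> X}"

lemma cylsE:
  assumes "C \<in> cyls" obtains "C = {}" | \<alpha> X where "C = cyl \<alpha> X" "valid \<alpha> X"
  using assms by (auto simp: cyls_def)

lemma cyl_in_cyls [simp]: "valid \<alpha> X \<Longrightarrow> cyl \<alpha> X \<in> cyls"
  by (auto simp: cyls_def)

lemma empty_in_cyls [simp]: "{} \<in> cyls"
  by (simp add: cyls_def)

lemma starts_in_cyls [simp]: "X \<in> insert {} \<X> \<Longrightarrow> starts X \<in> cyls"
  using cyl_in_cyls[of "[]" X] by (auto simp: cyl_Nil valid_Nil)

lemma Int_cyls: "C \<in> cyls \<Longrightarrow> D \<in> cyls \<Longrightarrow> C \<inter> D \<in> cyls"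
proof (elim cylsE)
  fix \<alpha> X \<beta> Y assume CD: "C = cyl \<alpha> X" "valid \<alpha> X" "D = cyl \<beta> Y" "valid \<beta> Y"
  show ?thesis
  proof (cases "C \<inter> D = {}")
    case False
    then obtain u Z where "lam X u Z" "C \<inter> D = cyl (\<alpha> @ u) Z" using cyl_Int[of \<alpha> X \<beta> Y] CD by blast
    then show ?thesis using valid_append[OF CD(2)] by simp
  qed simp
qed auto

lemma ran_in_cyls: "s \<in> hull_carrier A M \<Longrightarrow> ran s \<in> cyls"
  by (erule hull_cases) auto

lemma dom_in_cyls: "s \<in> hull_carrier A M \<Longrightarrow> dom s \<in> cyls"
  by (erule hull_cases) auto

lemma pid_in_hull: "pid C \<in> hull_carrier A M \<longleftrightarrow> C \<in> cyls"
proof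
  show "C \<in> cyls" if "pid C \<in> hull_carrier A M" using dom_in_cyls[OF that] by simp
  show "pid C \<in> hull_carrier A M" if "C \<in> cyls"
    using that
  proof (cases rule: cylsE)
    case 1 then show ?thesis using hull_carrier.zero by (simp add: pid_empty)
  next
    case (2 \<alpha> X) then show ?thesis using rep_in_hull[of \<alpha> X \<alpha>] by (simp add: rep_self)
  qed
qed

text \<open>An injective idempotent map is a partial identity, so the semilattice of idempotents is that
  of the cylinders under intersection.\<close>

lemma idems_S: "idems S = pid ` cyls"
proof
  show "pid ` cyls \<subseteq> idems S"
    by (auto simp: idems_def carrier_S pid_in_hull pid_comp)
  show "idems S \<subseteq> pid ` cyls"
  proof
    fix e assume "e \<in> idems S"
    then have e: "e \<in> hull_carrier A M" "e \<circ>\<^sub>m e = e" by (auto simp: idems_def carrier_S)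
    have "w = v" if "e w = Some v" for w v
    proof -
      have "(e \<circ>\<^sub>m e) w = Some v" using that e(2) by simp
      then have "e v = Some v" using that by (auto simp: map_comp_Some_iff)
      then show ?thesis using pinj_inject[OF hull_pinj[OF e(1)] that] by simp
    qed
    then have "e = pid (dom e)" by (intro map_eqI) auto
    then show "e \<in> pid ` cyls" using dom_in_cyls[OF e(1)] by blast
  qed
qed

lemma pid_in_idems [simp]: "pid C \<in> idems S \<longleftrightarrow> C \<in> cyls"
  by (auto simp: idems_S)

lemma nat_le_pid: "C \<in> cyls \<Longrightarrow> D \<in> cyls \<Longrightarrow> nat_le S (pid C) (pid D) \<longleftrightarrow> C \<subseteq> D"
proof
  assume "nat_le S (pid C) (pid D)"
  then show "C \<subseteq> D" by (auto simp: nat_le_def idems_S pid_comp)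
next
  assume "C \<in> cyls" "D \<in> cyls" "C \<subseteq> D"
  then show "nat_le S (pid C) (pid D)"
    unfolding nat_le_def carrier_S pid_in_hull by (auto simp: idems_S pid_comp intro!: bexI[of _ C])
qed

lemma nat_less_pid: "C \<in> cyls \<Longrightarrow> D \<in> cyls \<Longrightarrow> nat_less S (pid C) (pid D) \<longleftrightarrow> C \<subset> D"
  by (auto simp: nat_less_def nat_le_pid)

text \<open>The relation \<open>\<lless>\<close>, for the domains.\<close>

definition ccov :: "'a list set \<Rightarrow> 'a list set \<Rightarrow> bool" where
  "ccov C D \<longleftrightarrow> C \<in> cyls \<and> D \<in> cyls \<and> C \<subset> D \<and> \<not> (\<exists>G\<in>cyls. C \<subset> G \<and> G \<subset> D)"

lemma covered_by_pid: "covered_by S (pid C) (pid D) \<longleftrightarrow> ccov C D"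
  unfolding covered_by_def ccov_def by (auto simp: nat_less_pid idems_S)

lemma zero_el_S: "zero_el S = Map.empty"
proof -
  have z: "is_zero S Map.empty" by (simp add: is_zero_def carrier_S hull_carrier.zero)
  show ?thesis unfolding zero_el_def
  proof (rule the_equality)
    fix z assume "is_zero S z"
    then have "\<forall>s\<in>hull_carrier A M. z \<circ>\<^sub>m s = z" by (simp add: is_zero_def carrier_S)
    then have "z \<circ>\<^sub>m Map.empty = z" using hull_carrier.zero by blast
    then show "z = Map.empty" by (rule trans[OF sym comp_empty(1)])
  qed (fact z)
qed

lemma star_S:
  assumes s: "s \<in> hull_carrier A M" shows "star S s = pinverse s"
  unfolding star_def mult_S carrier_S
proof (rule the_equality)
  have j: "pinj s" using hull_pinj s by blast
  show "pinverse s \<in> hull_carrier A M \<and> s \<circ>\<^sub>m pinverse s \<circ>\<^sub>m s = s \<and> pinverse s \<circ>\<^sub>m s \<circ>\<^sub>m pinverse s = pinverse s"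
    using s by (auto simp: hull_carrier.intros comp_pinverse[OF j] pinverse_comp[OF j] intro!: pid_comp_eq)
      (auto simp: ran_def pinverse_Some[OF j])
  fix t assume t: "t \<in> hull_carrier A M \<and> s \<circ>\<^sub>m t \<circ>\<^sub>m s = s \<and> t \<circ>\<^sub>m s \<circ>\<^sub>m t = t"
  then have jt: "pinj t" using hull_pinj by blast
  show "t = pinverse s"
  proof (rule map_eqI)
    fix y x
    show "t y = Some x \<longleftrightarrow> pinverse s y = Some x"
    proof
      assume a: "t y = Some x"
      then have "(t \<circ>\<^sub>m s \<circ>\<^sub>m t) y = Some x" using t by simp
      then obtain y' where "s x = Some y'" "t y' = Some x" using a by (auto simp: map_comp_Some_iff)
      then show "pinverse s y = Some x" using a jt pinj_inject by (metis pinverse_Some[OF j])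
    next
      assume "pinverse s y = Some x"
      then have a: "s x = Some y" by (simp add: pinverse_Some[OF j])
      then have "(s \<circ>\<^sub>m t \<circ>\<^sub>m s) x = Some y" using t by simp
      then obtain x' where "t y = Some x'" "s x' = Some y" using a by (auto simp: map_comp_Some_iff)
      then show "t y = Some x" using a j pinj_inject by metis
    qed
  qed
qed

end

section \<open>Classes, cores and the order in the inverse hull\<close>

context markov_shift
begin

lemma valid_cyl_nonempty: "valid \<alpha> X \<Longrightarrow> cyl \<beta> X \<noteq> {}"
  by (rule cyl_nonempty[OF validD(3,4)])

lemma cyls_nonempty: "C \<in> cyls \<Longrightarrow> C \<noteq> {} \<Longrightarrow> \<exists>\<alpha> X. C = cyl \<alpha> X \<and> valid \<alpha> X"
  by (auto simp: cyls_def)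

lemma left_ideal_S:
  assumes "s \<in> hull_carrier A M"
  shows "left_ideal S s = {y \<in> hull_carrier A M. dom y \<subseteq> dom s}"
proof (intro Set.set_eqI iffI)
  fix y assume "y \<in> left_ideal S s"
  then show "y \<in> {y \<in> hull_carrier A M. dom y \<subseteq> dom s}"
    using assms by (auto simp: left_ideal_def carrier_S hull_carrier.comp map_comp_Some_iff)
next
  fix y assume y: "y \<in> {y \<in> hull_carrier A M. dom y \<subseteq> dom s}"
  then have "y = (y \<circ>\<^sub>m pinverse s) \<circ>\<^sub>m s"
    by (simp add: comp_assoc pinverse_comp[OF hull_pinj[OF assms]] comp_pid_eq)
  moreover have "y \<circ>\<^sub>m pinverse s \<in> hull_carrier A M" using y assms by (simp add: hull_carrier.intros)
  ultimately show "y \<in> left_ideal S s" unfolding left_ideal_def mult_S carrier_S by blast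
qed

lemma right_ideal_S:
  assumes "s \<in> hull_carrier A M"
  shows "right_ideal S s = {y \<in> hull_carrier A M. ran y \<subseteq> ran s}"
proof (intro Set.set_eqI iffI)
  fix y assume "y \<in> right_ideal S s"
  then show "y \<in> {y \<in> hull_carrier A M. ran y \<subseteq> ran s}"
    using assms by (auto simp: right_ideal_def carrier_S hull_carrier.comp map_comp_Some_iff ran_def)
next
  fix y assume y: "y \<in> {y \<in> hull_carrier A M. ran y \<subseteq> ran s}"
  then have "y = s \<circ>\<^sub>m (pinverse s \<circ>\<^sub>m y)"
    by (simp add: comp_assoc[symmetric] comp_pinverse[OF hull_pinj[OF assms]] pid_comp_eq)
  moreover have "pinverse s \<circ>\<^sub>m y \<in> hull_carrier A M" using y assms by (simp add: hull_carrier.intros)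
  ultimately show "y \<in> right_ideal S s" unfolding right_ideal_def mult_S carrier_S by blast
qed

text \<open>Principal left and right ideals are given by domains and ranges.\<close>

lemma green_D_S:
  "green_D S s t \<longleftrightarrow> s \<in> hull_carrier A M \<and> t \<in> hull_carrier A M \<and>
    (\<exists>x\<in>hull_carrier A M. dom x = dom s \<and> ran x = ran t)"
proof -
  have L: "left_ideal S s = left_ideal S x \<longleftrightarrow> dom x = dom s"
    if "s \<in> hull_carrier A M" "x \<in> hull_carrier A M" for s x
  proof
    assume "left_ideal S s = left_ideal S x"
    then have "s \<in> left_ideal S x" "x \<in> left_ideal S s" by (auto simp: left_ideal_def)
    then show "dom x = dom s" using that by (simp add: left_ideal_S subset_antisym)
  qed (use that in \<open>simp add: left_ideal_S\<close>)
  have R: "right_ideal S s = right_ideal S x \<longleftrightarrow> ran s = ran x"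
    if "s \<in> hull_carrier A M" "x \<in> hull_carrier A M" for s x
  proof
    assume "right_ideal S s = right_ideal S x"
    then have "s \<in> right_ideal S x" "x \<in> right_ideal S s" by (auto simp: right_ideal_def)
    then show "ran s = ran x" using that by (simp add: right_ideal_S subset_antisym)
  qed (use that in \<open>simp add: right_ideal_S\<close>)
  then show ?thesis unfolding green_D_def carrier_S using L R by metis
qed

text \<open>The class with index \<open>X\<close>; the empty set indexes the class of zero.\<close>

definition cls :: "'a set \<Rightarrow> ('a list \<rightharpoonup> 'a list) set" where
  "cls X = (if X = {} then {Map.empty} else {rep \<alpha> X \<beta> |\<alpha> \<beta>. valid \<alpha> X \<and> valid \<beta> X})"

lemma rep_in_cls: "valid \<alpha> X \<Longrightarrow> valid \<beta> X \<Longrightarrow> rep \<alpha> X \<beta> \<in> cls X"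
  using validD(4) by (auto simp: cls_def)

lemma D_class_rep:
  assumes "valid \<alpha> X" "valid \<beta> X" shows "D_class S (rep \<alpha> X \<beta>) = cls X"
proof (intro Set.set_eqI iffI)
  fix t assume "t \<in> D_class S (rep \<alpha> X \<beta>)"
  then obtain x where t: "t \<in> hull_carrier A M" and x: "x \<in> hull_carrier A M" "dom x = cyl \<beta> X" "ran x = ran t"
    by (auto simp: D_class_def green_D_S)
  have "x \<noteq> Map.empty" using x(2) valid_cyl_nonempty[OF assms(2), of \<beta>] by auto
  then obtain \<gamma> Y \<delta> where Y: "x = rep \<gamma> Y \<delta>" "valid \<gamma> Y" "valid \<delta> Y" using hull_cases x(1) by blast
  then have "Y = X" using x(2) cyl_inject assms(2) dom_rep by metis
  have "t \<noteq> Map.empty" using x(3) Y valid_cyl_nonempty[OF Y(2), of \<gamma>] by auto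
  then obtain \<gamma>' Y' \<delta>' where Y': "t = rep \<gamma>' Y' \<delta>'" "valid \<gamma>' Y'" "valid \<delta>' Y'" using hull_cases t by blast
  then have "Y' = X" using x(3) Y \<open>Y = X\<close> cyl_inject ran_rep by metis
  then show "t \<in> cls X" using Y' rep_in_cls by simp
next
  fix t assume "t \<in> cls X"
  then obtain \<gamma> \<delta> where t: "t = rep \<gamma> X \<delta>" "valid \<gamma> X" "valid \<delta> X"
    using validD(4)[OF assms(1)] by (auto simp: cls_def)
  then show "t \<in> D_class S (rep \<alpha> X \<beta>)"
    unfolding D_class_def green_D_S mem_Collect_eq
    using rep_in_hull assms by (intro conjI bexI[of _ "rep \<gamma> X \<beta>"]) simp_all
qed

lemma D_class_cyl: "valid \<alpha> X \<Longrightarrow> D_class S (pid (cyl \<alpha> X)) = cls X"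
  using D_class_rep rep_self by metis

lemma D_class_empty: "D_class S Map.empty = cls {}"
proof -
  have "t = Map.empty" if "dom x = {}" "ran x = ran t" for x t :: "'a list \<rightharpoonup> 'a list"
  proof (rule ext)
    fix w
    have "ran t = {}" using that by (auto simp: ran_def)
    then show "t w = None" by (cases "t w") (auto simp: ran_def)
  qed
  then show ?thesis
    using hull_carrier.zero[of A M] by (fastforce simp: D_class_def green_D_S cls_def)
qed

lemma zero_class_S: "zero_class S = cls {}"
  by (simp add: zero_class_def zero_el_S D_class_empty)

lemma cls_inject:
  assumes "X \<in> insert {} \<X>" "Y \<in> insert {} \<X>" shows "cls X = cls Y \<longleftrightarrow> X = Y"
proof
  assume eq: "cls X = cls Y"
  have main: "X = Y" if eq: "cls X = cls Y" and X: "X \<in> \<X>" for X Y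
  proof -
    have v: "valid [] X" using X by (simp add: valid_Nil)
    have "rep [] X [] \<in> cls Y" using eq rep_in_cls[OF v v] by simp
    then show ?thesis using rep_nonempty[OF v] rep_inject[OF v v] by (auto simp: cls_def split: if_splits)
  qed
  show "X = Y" using main[OF eq] main[OF eq[symmetric]] assms by blast
qed simp

lemma D_classes_S: "D_classes S = cls ` insert {} \<X>"
proof -
  have "D_class S s \<in> cls ` insert {} \<X>" if "s \<in> hull_carrier A M" for s
    using that by (cases rule: hull_cases) (auto simp: D_class_empty D_class_rep validD)
  moreover have "cls X \<in> D_class S ` hull_carrier A M" if X: "X \<in> insert {} \<X>" for X
  proof (cases "X = {}")
    case True then show ?thesis using D_class_empty hull_carrier.zero by (metis image_eqI)
  next
    case False
    then have "valid [] X" using X by (simp add: valid_Nil)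
    then show ?thesis using D_class_rep rep_in_hull by (metis image_eqI)
  qed
  ultimately show ?thesis unfolding D_classes_def carrier_S by blast
qed

lemma cls_nonzero: "X \<in> \<X> \<Longrightarrow> cls X \<noteq> zero_class S"
  using cls_inject[of X "{}"] nonempty_member by (auto simp: zero_class_S)

lemma gen_idems_eq: "gen_idems A M = {pid (cyl [a] (F a)) |a. a \<in> A}"
proof -
  have "theta A M a \<circ>\<^sub>m pinverse (theta A M a) = pid (cyl [a] (F a))" if "a \<in> A" for a
    using theta_rep[OF that] by (simp add: comp_pinverse pinj_rep)
  then show ?thesis unfolding gen_idems_def by (auto; metis)
qed

lemma valid_single: "a \<in> A \<Longrightarrow> valid [a] (F a)"
  by (simp add: valid_def wd_single F_in_\<X>)

text \<open>An idempotent above \<open>\<theta>\<^sub>a \<theta>\<^sub>a\<^sup>-\<^sup>1\<close> has prefix \<open>[]\<close> or \<open>[a]\<close>, and with prefix \<open>[a]\<close> it is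
  \<open>\<theta>\<^sub>a \<theta>\<^sub>a\<^sup>-\<^sup>1\<close> itself.\<close>

lemma gen_idems_up_diff: "gen_idems_up A M - gen_idems A M = {pid (starts X) |X. X \<in> \<X>}"
proof (intro Set.set_eqI iffI)
  fix e assume e: "e \<in> gen_idems_up A M - gen_idems A M"
  then obtain C a where C: "e = pid C" "C \<in> cyls" and a: "a \<in> A" and le: "nat_le S (pid (cyl [a] (F a))) (pid C)"
    by (auto simp: gen_idems_up_def idems_S gen_idems_eq)
  have va: "valid [a] (F a)" using a by (rule valid_single)
  have sub: "cyl [a] (F a) \<subseteq> C" using le C va by (simp add: nat_le_pid)
  have "C \<noteq> {}" using sub valid_cyl_nonempty[OF va, of "[a]"] by blast
  then obtain \<alpha> X where X: "C = cyl \<alpha> X" "valid \<alpha> X" using C(2) cyls_nonempty by blast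
  then obtain u where u: "[a] = \<alpha> @ u" "lam X u (F a)"
    using cyl_subsetD[OF validD(1) va] sub by blast
  have "\<alpha> = []"
  proof (rule ccontr)
    assume "\<alpha> \<noteq> []"
    then have "\<alpha> = [a]" "u = []" using u(1) by (auto simp: Cons_eq_append_conv)
    then have "X = F a" using u(2) X(2) by (auto simp: lam_Nil valid_def)
    then show False using e C X \<open>\<alpha> = [a]\<close> a by (auto simp: gen_idems_eq)
  qed
  then show "e \<in> {pid (starts X) |X. X \<in> \<X>}" using C X validD(1) by (auto simp: cyl_Nil)
next
  fix e assume "e \<in> {pid (starts X) |X. X \<in> \<X>}"
  then obtain X where X: "e = pid (starts X)" "X \<in> \<X>" by blast
  obtain a where a: "a \<in> X" using nonempty_member[OF X(2)] by blast
  then have aA: "a \<in> A" using \<X>_subset X by blast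
  have "lam X [a] (F a)" using a X valid_single[OF aA] by (simp add: lam_def)
  then have "cyl [a] (F a) \<subseteq> starts X" by (rule lam_starts)
  then have "nat_le S (pid (cyl [a] (F a))) e" using X aA by (simp add: nat_le_pid valid_single)
  then have up: "e \<in> gen_idems_up A M" unfolding gen_idems_up_def gen_idems_eq using X aA by auto
  have "e \<notin> gen_idems A M"
  proof
    assume "e \<in> gen_idems A M"
    then obtain b where "b \<in> A" "cyl [] X = cyl [b] (F b)" using X by (auto simp: gen_idems_eq cyl_Nil)
    then show False using cyl_inject[of "[]" X "[b]" "F b"] X valid_single by (simp add: valid_Nil)
  qed
  then show "e \<in> gen_idems_up A M - gen_idems A M" using up by blast
qed

lemma class_rep_cls:
  assumes "X \<in> insert {} \<X>" shows "class_rep A M (cls X) = pid (starts X)"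
proof (cases "X = {}")
  case True then show ?thesis by (simp add: class_rep_def zero_class_S zero_el_S pid_empty)
next
  case False
  then have X: "X \<in> \<X>" using assms by simp
  then have v: "valid [] X" by (simp add: valid_Nil)
  have "(THE e. e \<in> cls X \<and> e \<in> gen_idems_up A M - gen_idems A M) = pid (starts X)"
  proof (rule the_equality)
    show "pid (starts X) \<in> cls X \<and> pid (starts X) \<in> gen_idems_up A M - gen_idems A M"
      using rep_in_cls[OF v v] X by (auto simp: gen_idems_up_diff rep_self cyl_Nil)
    fix e assume e: "e \<in> cls X \<and> e \<in> gen_idems_up A M - gen_idems A M"
    then obtain Y where Y: "e = pid (starts Y)" "Y \<in> \<X>" by (auto simp: gen_idems_up_diff)
    then have eY: "e = rep [] Y []" by (simp add: rep_self cyl_Nil)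
    obtain \<alpha> \<beta> where "e = rep \<alpha> X \<beta>" "valid \<alpha> X" "valid \<beta> X" using e False by (auto simp: cls_def)
    then have "Y = X" using eY rep_inject Y(2) by (metis valid_Nil)
    then show "e = pid (starts X)" using Y by simp
  qed
  then show ?thesis using cls_nonzero[OF X] by (simp add: class_rep_def)
qed

lemma cyl_same_Int: "cyl \<alpha> X \<inter> cyl \<alpha> Y = cyl \<alpha> (X \<inter> Y)"
  unfolding starts_Int[symmetric] cyl_def by auto

lemma cyl_same_subset: "X \<subseteq> A \<Longrightarrow> cyl \<alpha> X \<subseteq> cyl \<alpha> Y \<longleftrightarrow> X \<subseteq> Y"
  using inj_image_subset_iff[of "(@) \<alpha>" "starts X" "starts Y"] starts_subset_iff[of X Y]
  by (simp add: cyl_def inj_on_def)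

lemma valid_subset: "valid \<alpha> X \<Longrightarrow> Y \<in> \<X> \<Longrightarrow> Y \<subseteq> X \<Longrightarrow> valid \<alpha> Y"
  by (auto simp: valid_def)

lemma cyl_between:
  assumes "valid \<alpha> Y" "valid \<alpha> X" "G \<in> cyls" "cyl \<alpha> Y \<subseteq> G" "G \<subseteq> cyl \<alpha> X"
  obtains Z where "G = cyl \<alpha> Z" "Z \<in> \<X>" "Y \<subseteq> Z" "Z \<subseteq> X"
proof -
  have "G \<noteq> {}" using assms(4) valid_cyl_nonempty[OF assms(1), of \<alpha>] by blast
  then obtain \<beta> Z where Z: "G = cyl \<beta> Z" "valid \<beta> Z" using assms(3) cyls_nonempty by blast
  obtain u where u: "\<beta> = \<alpha> @ u" "lam X u Z" using cyl_subsetD[of X \<beta> Z \<alpha>] assms Z validD(1) by blast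
  obtain v where v: "\<alpha> = \<beta> @ v" "lam Z v Y" using cyl_subsetD[of Z \<alpha> Y \<beta>] assms Z validD(1) by blast
  have "u = []" "v = []" using u v by auto
  then have "G = cyl \<alpha> Z" "Z \<in> \<X>" "Y \<subseteq> Z" "Z \<subseteq> X" using u Z(1) v(2) by (simp_all add: lam_Nil)
  then show ?thesis by (rule that)
qed

text \<open>Below a cylinder there are two kinds of covers: those with the same prefix, given by a
  cover in \<open>\<X>\<close>, and those that prolong the prefix by a letter \<open>x\<close>, which are covers exactly when
  no member of \<open>\<X>\<close> properly inside \<open>X\<close> contains \<open>x\<close>.\<close>

definition subcov :: "'a set \<Rightarrow> 'a list \<Rightarrow> 'a set \<Rightarrow> bool" where
  "subcov X u W \<longleftrightarrow> X \<in> \<X> \<and> (u = [] \<and> cov W X \<or>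
     (\<exists>x\<in>X. u = [x] \<and> W = F x \<and> (\<forall>Y\<in>\<X>. x \<in> Y \<and> Y \<subseteq> X \<longrightarrow> Y = X)))"

lemma subcov_lam: "subcov X u W \<Longrightarrow> lam X u W"
  unfolding subcov_def lam_def using \<X>_subset valid_single
  by (auto simp: valid_Nil dest: covD)

lemma subcov_ccov:
  assumes v: "valid \<alpha> X" and s: "subcov X u W"
  shows "ccov (cyl (\<alpha> @ u) W) (cyl \<alpha> X)"
proof -
  have l: "lam X u W" using s by (rule subcov_lam)
  then have vu: "valid (\<alpha> @ u) W" using valid_append v by blast
  have sub: "cyl (\<alpha> @ u) W \<subseteq> cyl \<alpha> X" using cyl_mono[OF l] .
  have "\<not> (\<alpha> @ u = \<alpha> \<and> W = X)" using s by (auto simp: subcov_def cov_def)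
  then have "cyl (\<alpha> @ u) W \<noteq> cyl \<alpha> X" using cyl_inject[OF vu v] by blast
  moreover have "G = cyl (\<alpha> @ u) W \<or> G = cyl \<alpha> X"
    if G: "G \<in> cyls" "cyl (\<alpha> @ u) W \<subseteq> G" "G \<subseteq> cyl \<alpha> X" for G
  proof -
    have "G \<noteq> {}" using G(2) valid_cyl_nonempty[OF vu, of "\<alpha> @ u"] by blast
    then obtain \<beta> Z where Z: "G = cyl \<beta> Z" "valid \<beta> Z" using G(1) cyls_nonempty by blast
    obtain p where p: "\<beta> = \<alpha> @ p" "lam X p Z" using cyl_subsetD[of X \<beta> Z \<alpha>] G Z v validD(1) by blast
    obtain q where q: "\<alpha> @ u = \<beta> @ q" "lam Z q W" using cyl_subsetD[of Z "\<alpha> @ u" W \<beta>] G Z vu validD(1) by blast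
    have u: "u = p @ q" using p q by simp
    have Zin: "Z \<in> \<X>" using Z validD by blast
    from s consider (a) "u = []" "cov W X"
      | (b) x where "x \<in> X" "u = [x]" "W = F x" "\<forall>Y\<in>\<X>. x \<in> Y \<and> Y \<subseteq> X \<longrightarrow> Y = X"
      unfolding subcov_def by blast
    then show ?thesis
    proof cases
      case a
      then have "p = []" "q = []" using u by auto
      then have "W \<subseteq> Z" "Z \<subseteq> X" using p q by (auto simp: lam_Nil)
      then have "Z = W \<or> Z = X" using cov_between[OF a(2) Zin] by blast
      then show ?thesis using Z p \<open>p = []\<close> a by auto
    next
      case b
      show ?thesis
      proof (cases "p = []")
        case True
        then have "x \<in> Z" "Z \<subseteq> X" using p q u b by (auto simp: lam_def)
        then have "Z = X" using b(4) Zin by blast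
        then show ?thesis using Z p True by simp
      next
        case False
        then have "p = [x]" "q = []" using u b by (auto simp: Cons_eq_append_conv)
        then have "F x \<subseteq> Z" "Z \<subseteq> F x" using p q b by (auto simp: lam_def valid_def)
        then show ?thesis using Z p \<open>p = [x]\<close> b by auto
      qed
    qed
  qed
  ultimately show ?thesis unfolding ccov_def using v vu sub by auto
qed

lemma ccovD:
  assumes v: "valid \<alpha> X" and c: "ccov C (cyl \<alpha> X)" and "C \<noteq> {}"
  shows "\<exists>u W. C = cyl (\<alpha> @ u) W \<and> subcov X u W"
proof -
  have X: "X \<in> \<X>" using v validD by blast
  have sub: "C \<subset> cyl \<alpha> X" "C \<in> cyls" using c by (auto simp: ccov_def)
  then obtain \<beta> Z where Z: "C = cyl \<beta> Z" "valid \<beta> Z" using cyls_nonempty[OF sub(2) assms(3)] by blast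
  obtain u where u: "\<beta> = \<alpha> @ u" "lam X u Z" using cyl_subsetD[of X \<beta> Z \<alpha>] sub Z X by blast
  have Zin: "Z \<in> \<X>" using Z validD by blast
  have btw: "G = C \<or> G = cyl \<alpha> X" if "G \<in> cyls" "C \<subseteq> G" "G \<subseteq> cyl \<alpha> X" for G
    using c that unfolding ccov_def by blast
  show ?thesis
  proof (cases u)
    case Nil
    then have ZX: "Z \<subseteq> X" "\<beta> = \<alpha>" using u by (auto simp: lam_Nil)
    have "Y = Z \<or> Y = X" if Y: "Y \<in> \<X>" "Z \<subseteq> Y" "Y \<subseteq> X" for Y
    proof -
      have vY: "valid \<alpha> Y" using valid_subset v Y by blast
      have "cyl \<alpha> Z \<subseteq> cyl \<alpha> Y" "cyl \<alpha> Y \<subseteq> cyl \<alpha> X" using Y \<X>_subset Zin by (simp_all add: cyl_same_subset)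
      then have "cyl \<alpha> Y = cyl \<alpha> Z \<or> cyl \<alpha> Y = cyl \<alpha> X" using btw[of "cyl \<alpha> Y"] vY Z ZX by simp
      then show ?thesis using cyl_inject vY v Z ZX by blast
    qed
    moreover have "Z \<noteq> X" using sub Z ZX by blast
    ultimately have "cov Z X" unfolding cov_def using Zin X ZX by blast
    then show ?thesis using Z u Nil X unfolding subcov_def by blast
  next
    case (Cons x r)
    have x: "x \<in> X" using u(2) Cons by (simp add: lam_def)
    then have xA: "x \<in> A" using \<X>_subset X by blast
    have lx: "lam X [x] (F x)" using x X valid_single[OF xA] by (simp add: lam_def)
    have vx: "valid (\<alpha> @ [x]) (F x)" using valid_append v lx by blast
    have "valid (x # r) Z" using u(2) Cons by (simp add: lam_def)
    then have "lam (F x) r Z"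
      using F_in_\<X>[OF xA] by (auto simp: lam_def valid_def wd_Cons split: if_splits)
    then have "C \<subseteq> cyl (\<alpha> @ [x]) (F x)" using cyl_mono[of "F x" r Z "\<alpha> @ [x]"] Z u Cons by simp
    moreover have lex: "cyl (\<alpha> @ [x]) (F x) \<subseteq> cyl \<alpha> X" using cyl_mono[OF lx] .
    moreover have "cyl (\<alpha> @ [x]) (F x) \<noteq> cyl \<alpha> X" using cyl_inject[OF vx v] by auto
    ultimately have C: "C = cyl (\<alpha> @ [x]) (F x)" using btw[of "cyl (\<alpha> @ [x]) (F x)"] vx by auto
    have "Y = X" if Y: "Y \<in> \<X>" "x \<in> Y" "Y \<subseteq> X" for Y
    proof -
      have vY: "valid \<alpha> Y" using valid_subset v Y by blast
      have "lam Y [x] (F x)" using Y valid_single[OF xA] by (simp add: lam_def)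
      then have "C \<subseteq> cyl \<alpha> Y" unfolding C by (rule cyl_mono)
      moreover have "cyl \<alpha> Y \<subseteq> cyl \<alpha> X" using Y \<X>_subset by (simp add: cyl_same_subset)
      ultimately have "cyl \<alpha> Y = C \<or> cyl \<alpha> Y = cyl \<alpha> X" using btw[of "cyl \<alpha> Y"] vY by simp
      moreover have "cyl \<alpha> Y \<noteq> C" unfolding C using cyl_inject[OF vY vx] by auto
      ultimately show ?thesis using cyl_inject[OF vY v] by blast
    qed
    then have "subcov X [x] (F x)" unfolding subcov_def using X x by blast
    then show ?thesis using C by blast
  qed
qed

text \<open>If one of two overlapping covers prolongs the prefix by \<open>x\<close>, then either the other keeps the
  prefix and its set contains \<open>x\<close>, or both prolong it by \<open>x\<close>; so they are comparable.\<close>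

lemma subcov_incomparable:
  assumes u: "subcov H u W" and t: "subcov L t V"
    and nle: "\<not> cyl (\<alpha> @ u) W \<subseteq> cyl (\<alpha> @ t) V" "\<not> cyl (\<alpha> @ t) V \<subseteq> cyl (\<alpha> @ u) W"
    and ne: "cyl (\<alpha> @ u) W \<inter> cyl (\<alpha> @ t) V \<noteq> {}"
  shows "u = [] \<and> t = []"
proof (rule ccontr)
  obtain q r where qr: "u @ q = t @ r" "q \<in> starts W" "r \<in> starts V"
    using ne by (auto simp: cyl_iff)
  assume n: "\<not> (u = [] \<and> t = [])"
  have single: "u = [] \<or> (\<exists>x. u = [x] \<and> W = F x)" "t = [] \<or> (\<exists>x. t = [x] \<and> V = F x)"
    using u t unfolding subcov_def by blast+
  show False
  proof (cases "u = []")
    case True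
    then obtain x where x: "t = [x]" "V = F x" using n single by blast
    then have "x \<in> W" using qr True by (auto simp: starts_def)
    then have "lam W [x] V"
      using x lamD(3)[OF subcov_lam[OF t]] lamD(2)[OF subcov_lam[OF u]] by (simp add: lam_def)
    then show False using nle(2) cyl_mono[of W "[x]" V \<alpha>] x True by simp
  next
    case False
    then obtain x where x: "u = [x]" "W = F x" using single by blast
    show False
    proof (cases "t = []")
      case True
      then have "x \<in> V" using x qr True by (auto simp: starts_def)
      then have "lam V [x] W"
        using x lamD(3)[OF subcov_lam[OF u]] lamD(2)[OF subcov_lam[OF t]] by (simp add: lam_def)
      then show False using nle(1) cyl_mono[of V "[x]" W \<alpha>] x True by simp
    next
      case False
      then have "t = u \<and> V = W" using single x qr by auto
      then show False using nle by simp
    qed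
  qed
qed

text \<open>The closure condition on incomparable overlapping covers hence never leads out of the
  idempotents with prefix \<open>\<alpha>\<close>, and the core is computed inside \<open>\<X>\<close>.\<close>

lemma core_cyl:
  assumes v: "valid \<alpha> X"
  shows "core S (pid (cyl \<alpha> X)) = (\<lambda>Y. pid (cyl \<alpha> Y)) ` set_core X"
proof -
  let ?e = "pid (cyl \<alpha> X)" and ?K = "(\<lambda>Y. pid (cyl \<alpha> Y)) ` set_core X"
  have X: "X \<in> \<X>" using v validD by blast
  have vY: "valid \<alpha> Y" "Y \<subseteq> A" "Y \<in> \<X>" "Y \<subseteq> X" if "Y \<in> set_core X" for Y
    using set_coreD[OF X that] valid_subset[OF v] \<X>_subset by blast+
  have le: "nat_le S (pid (cyl \<alpha> Y)) (pid (cyl \<alpha> Z)) \<longleftrightarrow> Y \<subseteq> Z" if "valid \<alpha> Y" "valid \<alpha> Z" for Y Z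
    using that validD(3) by (simp add: nat_le_pid cyl_same_subset)
  have K: "core_closed S ?e ?K"
    unfolding core_closed_def zero_el_S mult_S
  proof (intro conjI ballI allI impI)
    show "?K \<subseteq> down S ?e" using vY v le unfolding down_def by auto
    show "?e \<in> ?K" using set_core_self by blast
  next
    fix f g assume "f \<in> ?K" "g \<in> ?K" "f \<circ>\<^sub>m g \<noteq> Map.empty"
    then obtain Y Z where YZ: "Y \<in> set_core X" "Z \<in> set_core X" "f \<circ>\<^sub>m g = pid (cyl \<alpha> (Y \<inter> Z))"
      by (auto simp: pid_comp cyl_same_Int)
    then have "Y \<inter> Z \<noteq> {}" using \<open>f \<circ>\<^sub>m g \<noteq> Map.empty\<close> by (auto simp: cyl_def)
    then show "f \<circ>\<^sub>m g \<in> ?K" using set_core_Int YZ by blast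
  next
    fix h\<^sub>1 h\<^sub>2 f g assume h: "h\<^sub>1 \<in> ?K" "h\<^sub>2 \<in> ?K"
      and c: "covered_by S f h\<^sub>1 \<and> covered_by S g h\<^sub>2 \<and> \<not> nat_le S f g \<and> \<not> nat_le S g f \<and> f \<circ>\<^sub>m g \<noteq> Map.empty"
    have main: "f \<in> ?K" if h: "H \<in> set_core X" "L \<in> set_core X"
      and c: "covered_by S f (pid (cyl \<alpha> H))" "covered_by S g (pid (cyl \<alpha> L))"
        "\<not> nat_le S f g" "\<not> nat_le S g f" "f \<circ>\<^sub>m g \<noteq> Map.empty" for f g H L
    proof -
      obtain C D where CD: "f = pid C" "g = pid D" using c(1,2) by (auto simp: covered_by_def idems_S)
      have ne: "C \<inter> D \<noteq> {}" using c(5) by (auto simp: CD pid_comp)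
      obtain u W where u: "C = cyl (\<alpha> @ u) W" "subcov H u W"
        using ccovD[OF vY(1)[OF h(1)], of C] c(1) ne unfolding CD covered_by_pid by blast
      obtain t V where t: "D = cyl (\<alpha> @ t) V" "subcov L t V"
        using ccovD[OF vY(1)[OF h(2)], of D] c(2) ne unfolding CD covered_by_pid by blast
      have vs: "valid (\<alpha> @ u) W" "valid (\<alpha> @ t) V"
        using valid_append[OF vY(1)[OF h(1)] subcov_lam[OF u(2)]] valid_append[OF vY(1)[OF h(2)] subcov_lam[OF t(2)]] .
      have nle: "\<not> C \<subseteq> D" "\<not> D \<subseteq> C" using c(3,4) vs u t by (simp_all add: CD nat_le_pid)
      obtain q r where qr: "u @ q = t @ r" "q \<in> starts W" "r \<in> starts V"
        using ne unfolding u t by (auto simp: cyl_iff)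
      have pre: "u = [] \<and> t = []"
        using subcov_incomparable[OF u(2) t(2)] nle ne unfolding u t by blast
      have cc: "cov W H" "cov V L" using u t pre unfolding subcov_def by auto
      have "\<not> W \<subseteq> V" "\<not> V \<subseteq> W" using nle u t pre cc \<X>_subset covD by (simp_all add: cyl_same_subset)
      moreover have "W \<inter> V \<noteq> {}" using qr pre by (auto simp: starts_def)
      ultimately have "W \<in> set_core X" using set_core_incomparable[OF h cc] by blast
      then show ?thesis using CD u pre by simp
    qed
    obtain H L where HL: "H \<in> set_core X" "L \<in> set_core X" "h\<^sub>1 = pid (cyl \<alpha> H)" "h\<^sub>2 = pid (cyl \<alpha> L)"
      using h by blast
    have "f \<in> ?K" using main[OF HL(1,2)] c HL by blast
    moreover have "g \<circ>\<^sub>m f \<noteq> Map.empty" using c by (auto simp: covered_by_def idems_S pid_comp Int_commute)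
    then have "g \<in> ?K" using main[OF HL(2,1)] c HL by blast
    ultimately show "f \<in> ?K" "g \<in> ?K" by simp_all
  next
    fix e\<^sub>1 e\<^sub>2 g assume "e\<^sub>1 \<in> ?K" "e\<^sub>2 \<in> ?K" "g \<in> idems S" and gl: "nat_less S e\<^sub>1 g \<and> nat_less S g e\<^sub>2"
    then obtain Y Z G where YZ: "Y \<in> set_core X" "Z \<in> set_core X" "e\<^sub>1 = pid (cyl \<alpha> Y)" "e\<^sub>2 = pid (cyl \<alpha> Z)"
      "g = pid G" "G \<in> cyls" by (auto simp: idems_S)
    then have "cyl \<alpha> Y \<subset> G" "G \<subset> cyl \<alpha> Z" using gl vY(1) by (simp_all add: nat_less_pid)
    moreover from this obtain V where V: "G = cyl \<alpha> V" "V \<in> \<X>" "Y \<subseteq> V" "V \<subseteq> Z"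
      using cyl_between[OF vY(1) vY(1)] YZ by (metis psubset_imp_subset)
    ultimately have "Y \<subset> V" "V \<subset> Z" by auto
    then show "g \<in> ?K" using set_core_between[OF YZ(1,2) V(2)] V YZ by blast
  qed
  have "pid (cyl \<alpha> Y) \<in> C" if C: "core_closed S ?e C" and "Y \<in> set_core X" for C Y
    using that(2)
  proof (induction rule: set_core.induct)
    case set_core_self
    show ?case using C by (simp add: core_closed_def)
  next
    case (set_core_Int Y Z)
    have "pid (cyl \<alpha> Y) \<circ>\<^sub>m pid (cyl \<alpha> Z) = pid (cyl \<alpha> (Y \<inter> Z))" by (simp add: pid_comp cyl_same_Int)
    moreover have "pid (cyl \<alpha> (Y \<inter> Z)) \<noteq> Map.empty"
    proof -
      have "Y \<inter> Z \<subseteq> A" using vY(2)[OF set_core_Int(1)] by blast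
      then show ?thesis using cyl_nonempty[of "Y \<inter> Z" \<alpha>] set_core_Int(3) by simp
    qed
    ultimately show ?case using C set_core_Int.IH unfolding core_closed_def zero_el_S mult_S by metis
  next
    case (set_core_incomparable H L Y Z)
    have hl: "valid \<alpha> H" "valid \<alpha> L" using vY set_core_incomparable by blast+
    have yz: "valid \<alpha> Y" "valid \<alpha> Z"
      using valid_subset[OF hl(1), of Y] valid_subset[OF hl(2), of Z]
        covD[OF set_core_incomparable(3)] covD[OF set_core_incomparable(4)] by simp_all
    have "subcov H [] Y" "subcov L [] Z"
      using set_core_incomparable(3,4) covD[OF set_core_incomparable(3)] covD[OF set_core_incomparable(4)]
      unfolding subcov_def by simp_all
    then have "covered_by S (pid (cyl \<alpha> Y)) (pid (cyl \<alpha> H))" "covered_by S (pid (cyl \<alpha> Z)) (pid (cyl \<alpha> L))"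
      unfolding covered_by_pid using subcov_ccov[OF hl(1), of "[]"] subcov_ccov[OF hl(2), of "[]"] by simp_all
    moreover have "pid (cyl \<alpha> Y) \<circ>\<^sub>m pid (cyl \<alpha> Z) \<noteq> Map.empty"
      unfolding pid_comp cyl_same_Int pid_eq_empty
      using cyl_nonempty[OF _ set_core_incomparable(7), of \<alpha>] validD(3)[OF yz(1)] by blast
    moreover have "\<not> nat_le S (pid (cyl \<alpha> Y)) (pid (cyl \<alpha> Z))" "\<not> nat_le S (pid (cyl \<alpha> Z)) (pid (cyl \<alpha> Y))"
      using set_core_incomparable(5,6) le[OF yz] le[OF yz(2,1)] by simp_all
    moreover have "\<forall>h\<^sub>1\<in>C. \<forall>h\<^sub>2\<in>C. \<forall>f g. covered_by S f h\<^sub>1 \<and> covered_by S g h\<^sub>2 \<and>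
        \<not> nat_le S f g \<and> \<not> nat_le S g f \<and> f \<circ>\<^sub>m g \<noteq> Map.empty \<longrightarrow> f \<in> C \<and> g \<in> C"
      using C unfolding core_closed_def zero_el_S mult_S by (elim conjE)
    ultimately show ?case using set_core_incomparable.IH by blast
  next
    case (set_core_between Y Z G)
    have g: "valid \<alpha> G" using valid_subset[OF vY(1)[OF set_core_between(2)] set_core_between(3)] set_core_between(5) by simp
    have yz: "valid \<alpha> Y" "valid \<alpha> Z" using vY(1) set_core_between(1,2) by blast+
    have "cyl \<alpha> Y \<noteq> cyl \<alpha> G" "cyl \<alpha> G \<noteq> cyl \<alpha> Z"
      using cyl_inject[OF yz(1) g] cyl_inject[OF g yz(2)] set_core_between(4,5) by blast+
    then have "nat_less S (pid (cyl \<alpha> Y)) (pid (cyl \<alpha> G))" "nat_less S (pid (cyl \<alpha> G)) (pid (cyl \<alpha> Z))"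
      using set_core_between(4,5) le[OF yz(1) g] le[OF g yz(2)] by (simp_all add: nat_less_def less_imp_le)
    moreover have between: "\<forall>e\<^sub>1\<in>C. \<forall>e\<^sub>2\<in>C. \<forall>g\<in>idems S. nat_less S e\<^sub>1 g \<and> nat_less S g e\<^sub>2 \<longrightarrow> g \<in> C"
      using C unfolding core_closed_def by (elim conjE)
    moreover have "pid (cyl \<alpha> G) \<in> idems S" using g by simp
    ultimately show ?case using set_core_between.IH by blast
  qed
  then show ?thesis using K unfolding core_def by blast
qed


lemma not_covered_zero: "\<not> covered_by S f Map.empty"
proof
  assume c: "covered_by S f Map.empty"
  then obtain C where "f = pid C" by (auto simp: covered_by_def idems_S)
  then show False using c covered_by_pid[of C "{}"] by (simp add: pid_empty ccov_def)
qed

lemma core_zero: "core S Map.empty = {Map.empty}"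
proof -
  have d: "down S Map.empty = {Map.empty}"
    using nat_le_pid[of _ "{}"] by (auto simp: down_def idems_S pid_empty[symmetric])
  have "core_closed S Map.empty {Map.empty}"
    unfolding core_closed_def d zero_el_S mult_S by (auto simp: nat_less_def nat_le_def not_covered_zero)
  moreover have "Map.empty \<in> C" if "core_closed S Map.empty C" for C
    using that by (simp add: core_closed_def)
  ultimately show ?thesis unfolding core_def by blast
qed

lemma preceq1_S: "preceq1 S a b \<longleftrightarrow> a = cls {} \<and> b = cls {} \<or> (\<exists>X Y. a = cls X \<and> b = cls Y \<and> ple1 X Y)"
proof
  assume "preceq1 S a b"
  then obtain E f g where E: "E \<in> cyls" "f \<in> core S (pid E)" "g \<in> core S (pid E)"
    and ab: "D_class S f = a" "D_class S g = b" "nat_le S f g"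
    by (auto simp: preceq1_def idems_S)
  show "a = cls {} \<and> b = cls {} \<or> (\<exists>X Y. a = cls X \<and> b = cls Y \<and> ple1 X Y)"
  proof (cases "E = {}")
    case True
    then have "f = Map.empty" "g = Map.empty" using E(2,3) by (auto simp: pid_empty core_zero)
    then show ?thesis using ab D_class_empty by simp
  next
    case False
    then obtain \<alpha> W where W: "E = cyl \<alpha> W" "valid \<alpha> W" using cyls_nonempty E(1) by blast
    obtain X Y where XY: "X \<in> set_core W" "Y \<in> set_core W" "f = pid (cyl \<alpha> X)" "g = pid (cyl \<alpha> Y)"
      using E W core_cyl by auto
    have v: "valid \<alpha> X" "valid \<alpha> Y"
      using valid_subset[OF W(2)] set_coreD[OF validD(1)[OF W(2)]] XY by blast+
    then have "X \<subseteq> Y" using ab(3) XY validD(3)[OF v(1)] by (simp add: nat_le_pid cyl_same_subset)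
    then have "ple1 X Y" unfolding ple1_def using XY validD(1)[OF W(2)] by blast
    then show ?thesis using ab XY v by (auto simp: D_class_cyl)
  qed
next
  assume "a = cls {} \<and> b = cls {} \<or> (\<exists>X Y. a = cls X \<and> b = cls Y \<and> ple1 X Y)"
  then show "preceq1 S a b"
  proof (elim disjE exE conjE)
    assume ab: "a = cls {}" "b = cls {}"
    have "nat_le S Map.empty Map.empty" using nat_le_pid[of "{}" "{}"] by (simp add: pid_empty)
    moreover have "Map.empty \<in> idems S" using pid_in_idems[of "{}"] by (simp add: pid_empty)
    ultimately show ?thesis unfolding preceq1_def using core_zero D_class_empty ab by blast
  next
    fix X Y assume ab: "a = cls X" "b = cls Y" "ple1 X Y"
    then obtain W where W: "W \<in> \<X>" "X \<in> set_core W" "Y \<in> set_core W" "X \<subseteq> Y" by (auto simp: ple1_def)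
    then have v: "valid [] W" "valid [] X" "valid [] Y" using set_coreD by (auto simp: valid_Nil)
    have "nat_le S (pid (cyl [] X)) (pid (cyl [] Y))"
      using W v validD(3)[OF v(2)] by (simp add: nat_le_pid cyl_same_subset)
    then show ?thesis unfolding preceq1_def
      using core_cyl[OF v(1)] W v D_class_cyl[OF v(2)] D_class_cyl[OF v(3)] ab
      by (intro bexI[of _ "pid (cyl [] W)"] bexI[of _ "pid (cyl [] X)"] bexI[of _ "pid (cyl [] Y)"]) auto
  qed
qed

lemma preceq_S: "preceq S a b \<longleftrightarrow> (\<exists>X Y. a = cls X \<and> b = cls Y \<and> ple0 X Y)"
proof
  let ?R = "\<lambda>a b. preceq1 S a b \<or> a = zero_class S \<and> b \<in> D_classes S"
  have step: "\<exists>X Y. a = cls X \<and> b = cls Y \<and> ple0 X Y" if R: "?R a b" for a b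
  proof (cases "preceq1 S a b")
    case True
    then consider "a = cls {}" "b = cls {}" | X Y where "a = cls X" "b = cls Y" "ple1 X Y"
      unfolding preceq1_S by blast
    then show ?thesis
    proof cases
      case 1 then show ?thesis unfolding ple0_def by blast
    next
      case (2 X Y)
      then have "ple0 X Y" unfolding ple0_def ple_def by blast
      then show ?thesis using 2 by blast
    qed
  next
    case False
    then obtain Y where "a = cls {}" "Y \<in> insert {} \<X>" "b = cls Y"
      using R unfolding zero_class_S D_classes_S by blast
    then show ?thesis unfolding ple0_def by blast
  qed
  assume "preceq S a b"
  then show "\<exists>X Y. a = cls X \<and> b = cls Y \<and> ple0 X Y"
    unfolding preceq_def
  proof (induction rule: tranclp_induct)
    case (base b) then show ?case by (rule step)
  next
    case (step b c)
    from \<open>?R b c\<close> obtain Y' Z where Z: "b = cls Y'" "c = cls Z" "ple0 Y' Z"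
      using \<open>\<And>b a. ?R a b \<Longrightarrow> \<exists>X Y. a = cls X \<and> b = cls Y \<and> ple0 X Y\<close> by blast
    from step.IH obtain X Y where X: "a = cls X" "b = cls Y" "ple0 X Y" by blast
    have "Y' = Y" using cls_inject[of Y' Y] ple0_member[OF X(3)] ple0_member[OF Z(3)] X(2) Z(1) by simp
    then show ?case using X Z ple0_trans by blast
  qed
next
  assume "\<exists>X Y. a = cls X \<and> b = cls Y \<and> ple0 X Y"
  then obtain X Y where XY: "a = cls X" "b = cls Y" "ple0 X Y" by blast
  show "preceq S a b"
  proof (cases "X = {}")
    case True
    have "b \<in> D_classes S" using ple0_member[OF XY(3)] XY(2) unfolding D_classes_S by blast
    then show ?thesis unfolding preceq_def using XY(1) True zero_class_S by blast
  next
    case False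
    then have "ple1\<^sup>+\<^sup>+ X Y" using XY(3) unfolding ple0_def ple_def by blast
    then have "preceq S (cls X) (cls Y)"
    proof (induction rule: tranclp_induct)
      case (base Y) then show ?case unfolding preceq_def preceq1_S by blast
    next
      case (step Y Z)
      then have "preceq1 S (cls Y) (cls Z)" unfolding preceq1_S by blast
      then show ?case using step.IH unfolding preceq_def by (blast intro: tranclp.trancl_into_trancl)
    qed
    then show ?thesis using XY by simp
  qed
qed

lemma preceq_cls:
  assumes "X \<in> insert {} \<X>" "Y \<in> insert {} \<X>" shows "preceq S (cls X) (cls Y) \<longleftrightarrow> ple0 X Y"
proof
  assume "preceq S (cls X) (cls Y)"
  then obtain X' Y' where X': "cls X = cls X'" "cls Y = cls Y'" "ple0 X' Y'" unfolding preceq_S by blast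
  then have "X = X'" "Y = Y'" using cls_inject assms ple0_member[OF X'(3)] by blast+
  then show "ple0 X Y" using X' by simp
qed (use preceq_S in blast)

lemma meet_cls:
  assumes "X \<in> insert {} \<X>" "Y \<in> insert {} \<X>" shows "meet S (cls X) (cls Y) = cls (mt X Y)"
  unfolding meet_def
proof (rule the_equality)
  let ?P = "\<lambda>m. m \<in> D_classes S \<and> preceq S m (cls X) \<and> preceq S m (cls Y) \<and>
    (\<forall>x\<in>D_classes S. preceq S x (cls X) \<and> preceq S x (cls Y) \<longrightarrow> preceq S x m)"
  have m: "mt X Y \<in> insert {} \<X>" by (rule mt_member)
  show *: "?P (cls (mt X Y))"
  proof (intro conjI ballI impI)
    show "cls (mt X Y) \<in> D_classes S" using m unfolding D_classes_S by blast
    show "preceq S (cls (mt X Y)) (cls X)" "preceq S (cls (mt X Y)) (cls Y)"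
      using mt_lower[OF assms] preceq_S by blast+
    fix z assume "z \<in> D_classes S" and le: "preceq S z (cls X) \<and> preceq S z (cls Y)"
    then obtain Z where Z: "z = cls Z" "Z \<in> insert {} \<X>" unfolding D_classes_S by blast
    then have "ple0 Z X" "ple0 Z Y" using le preceq_cls[OF Z(2)] assms by blast+
    then show "preceq S z (cls (mt X Y))" using mt_ple0_greatest Z preceq_S by blast
  qed
  fix m' assume m': "?P m'"
  then obtain Z where Z: "m' = cls Z" "Z \<in> insert {} \<X>" unfolding D_classes_S by blast
  have "preceq S m' (cls (mt X Y))" "preceq S (cls (mt X Y)) m'" using * m' by blast+
  then have "ple0 Z (mt X Y)" "ple0 (mt X Y) Z"
    using preceq_cls[OF Z(2) m] preceq_cls[OF m Z(2)] unfolding Z(1) by blast+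
  then have "Z = mt X Y" using ple0_subset by (metis subset_antisym)
  then show "m' = cls (mt X Y)" using Z by simp
qed

lemma p_idem_cls:
  "X \<in> insert {} \<X> \<Longrightarrow> Y \<in> insert {} \<X> \<Longrightarrow> p_idem A M (cls X) (cls Y) = pid (starts (mt X Y))"
  unfolding p_idem_def using meet_cls class_rep_cls mt_member by metis

section \<open>Exits and labelled paths\<close>

text \<open>The nonzero idempotents \<open>f \<lless> e\<^sub>X\<close> that label the graph: all covers except the good ones.\<close>

definition exitp :: "'a set \<Rightarrow> 'a list \<Rightarrow> 'a set \<Rightarrow> bool" where
  "exitp X u W \<longleftrightarrow> subcov X u W \<and> \<not> (u = [] \<and> ple W X)"

lemma exitp_lam: "exitp X u W \<Longrightarrow> lam X u W"
  unfolding exitp_def using subcov_lam by blast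

lemma exitp_member: "exitp X u W \<Longrightarrow> X \<in> \<X> \<and> W \<in> \<X>"
  using exitp_lam lamD by blast

lemma exitp_cases:
  assumes "exitp X u W"
  obtains "u = []" "cov W X" "\<not> ple W X"
    | x where "x \<in> X" "u = [x]" "W = F x" "\<And>Y. Y \<in> \<X> \<Longrightarrow> x \<in> Y \<Longrightarrow> Y \<subseteq> X \<Longrightarrow> Y = X"
  using assms unfolding exitp_def subcov_def by blast

lemma exit_idem_iff:
  assumes "X \<in> insert {} \<X>"
  shows "exit_idem A M (cls X) f \<longleftrightarrow> (\<exists>u W. f = pid (cyl u W) \<and> exitp X u W)"
proof (cases "X = {}")
  case True
  have "\<not> exit_idem A M (cls X) f"
  proof
    assume "exit_idem A M (cls X) f"
    then have "f \<noteq> Map.empty" "f \<in> idems S" "covered_by S f (pid {})"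
      using class_rep_cls[OF assms] True by (auto simp: exit_idem_def Let_def zero_el_S)
    then show False by (auto simp: idems_S covered_by_pid ccov_def)
  qed
  then show ?thesis using True exitp_member nonempty_member by blast
next
  case False
  then have X: "X \<in> \<X>" "valid [] X" using assms by (auto simp: valid_Nil)
  have r: "class_rep A M (cls X) = pid (cyl [] X)" using class_rep_cls[OF assms] by (simp add: cyl_Nil)
  have key: "(pid (cyl u W) \<noteq> class_rep A M (D_class S (pid (cyl u W))) \<or>
      \<not> preceq S (D_class S (pid (cyl u W))) (cls X)) \<longleftrightarrow> \<not> (u = [] \<and> ple W X)" if s: "subcov X u W" for u W
  proof -
    have v: "valid u W" "W \<in> \<X>" using lamD subcov_lam[OF s] by blast+
    have "class_rep A M (cls W) = pid (cyl [] W)" using class_rep_cls v by (simp add: cyl_Nil)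
    moreover have "cyl u W = cyl [] W \<longleftrightarrow> u = []" using cyl_inject[OF v(1), of "[]" W] v(2) by (auto simp: valid_Nil)
    moreover have "preceq S (cls W) (cls X) \<longleftrightarrow> ple W X" using preceq_cls[of W X] X v ple0_iff_ple by simp
    ultimately show ?thesis using D_class_cyl[OF v(1)] by simp
  qed
  show ?thesis
  proof
    assume e: "exit_idem A M (cls X) f"
    then obtain C where C: "f = pid C" "C \<in> cyls" "C \<noteq> {}" "ccov C (cyl [] X)"
      by (auto simp: exit_idem_def Let_def zero_el_S idems_S r covered_by_pid)
    obtain u W where u: "C = cyl u W" "subcov X u W" using ccovD[OF X(2) C(4,3)] by auto
    then show "\<exists>u W. f = pid (cyl u W) \<and> exitp X u W"
      using e key[OF u(2)] C(1) unfolding exit_idem_def Let_def exitp_def by blast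
  next
    assume "\<exists>u W. f = pid (cyl u W) \<and> exitp X u W"
    then obtain u W where u: "f = pid (cyl u W)" "subcov X u W" "\<not> (u = [] \<and> ple W X)"
      unfolding exitp_def by blast
    have v: "valid u W" using lamD subcov_lam[OF u(2)] by blast
    have "ccov (cyl u W) (cyl [] X)" using subcov_ccov[OF X(2) u(2)] by simp
    then show "exit_idem A M (cls X) f"
      unfolding exit_idem_def Let_def r zero_el_S using u key[OF u(2)] v valid_cyl_nonempty[OF v, of u]
      by (simp add: covered_by_pid)
  qed
qed

text \<open>Exits are the covers that the order cannot see.  Two of them never overlap, and an exit of
  \<open>X\<close> never meets a class properly below \<open>X\<close>; this rigidity makes the decomposition of an
  idempotent along exits unique.\<close>

lemma exitp_disjoint:
  assumes e: "exitp X u W" "exitp X t V" and ne: "cyl u W \<inter> cyl t V \<noteq> {}"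
  shows "u = t \<and> W = V"
proof -
  obtain q r where qr: "u @ q = t @ r" "q \<in> starts W" "r \<in> starts V"
    using ne by (auto simp: cyl_iff)
  have no: False if "cov W X" "x \<in> W" "\<And>Y. Y \<in> \<X> \<Longrightarrow> x \<in> Y \<Longrightarrow> Y \<subseteq> X \<Longrightarrow> Y = X" for x W
    using that covD by blast
  show ?thesis
  proof (cases rule: exitp_cases[OF e(1)])
    case 1
    note uW = 1
    show ?thesis
    proof (cases rule: exitp_cases[OF e(2)])
      case 1
      then have "W \<inter> V \<noteq> {}" using uW qr by (auto simp: starts_def)
      then show ?thesis using cov_eq_or_disjoint[OF uW(2) 1(2) uW(3)] uW(1) 1(1) by simp
    next
      case (2 x)
      then have "x \<in> W" using uW qr by (auto simp: starts_def)
      then show ?thesis using no[OF uW(2)] 2(4) by blast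
    qed
  next
    case (2 x)
    note uW = 2
    show ?thesis
    proof (cases rule: exitp_cases[OF e(2)])
      case 1
      then have "x \<in> V" using uW qr by (auto simp: starts_def)
      then show ?thesis using no[OF 1(2)] uW(4) by blast
    next
      case (2 y)
      then show ?thesis using uW(2,3) qr by simp
    qed
  qed
qed

lemma exitp_disjoint_ple:
  assumes e: "exitp X u W" and V: "ple V X" "V \<noteq> X"
  shows "cyl u W \<inter> starts V = {}"
proof (rule ccontr)
  assume "cyl u W \<inter> starts V \<noteq> {}"
  then obtain q where q: "q \<in> starts W" "u @ q \<in> starts V" by (auto simp: cyl_iff)
  show False
  proof (cases rule: exitp_cases[OF e])
    case 1
    then have "V \<inter> W \<noteq> {}" using q by (auto simp: starts_def)
    then show False using gcov_spread[OF V 1(2)] gcov_ple 1(3) by blast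
  next
    case (2 x)
    then have "x \<in> V" using q by (auto simp: starts_def)
    then show False using 2(4)[of V] V ple_subset[OF V(1)] by blast
  qed
qed

text \<open>A letter of \<open>X\<close> gives an exit if no member of \<open>\<X>\<close> properly inside \<open>X\<close> contains it, and otherwise there is
  some cover of \<open>X\<close> in \<open>\<X>\<close>, which is good or an exit.\<close>

lemma exitp_or_below:
  assumes X: "X \<in> \<X>" shows "(\<exists>u W. exitp X u W) \<or> (\<exists>Y. ple Y X \<and> Y \<noteq> X)"
proof -
  obtain x where x: "x \<in> X" using nonempty_member[OF X] by blast
  show ?thesis
  proof (cases "\<forall>Y\<in>\<X>. x \<in> Y \<and> Y \<subseteq> X \<longrightarrow> Y = X")
    case True
    then have "exitp X [x] (F x)" unfolding exitp_def subcov_def using x X by blast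
    then show ?thesis by blast
  next
    case False
    then obtain Z where Z: "cov Z X" using cov_above X by (metis psubsetI)
    then have "subcov X [] Z" unfolding subcov_def using X by blast
    then show ?thesis using Z covD(3)[OF Z] unfolding exitp_def by blast
  qed
qed

text \<open>Labelled paths from \<open>Z\<close> to \<open>X\<close>: exits \<open>(V, u, W)\<close>, joined by relations \<open>\<preceq>\<close>.\<close>

fun lp :: "'a set \<Rightarrow> ('a set \<times> 'a list \<times> 'a set) list \<Rightarrow> 'a set \<Rightarrow> bool" where
  "lp X [] Z \<longleftrightarrow> ple Z X"
| "lp X ((V, u, W) # ws) Z \<longleftrightarrow> ple V X \<and> exitp V u W \<and> lp W ws Z"

definition word :: "('a set \<times> 'a list \<times> 'a set) list \<Rightarrow> 'a list" where
  "word ws = concat (map (\<lambda>(V, u, W). u) ws)"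

lemma word_simps [simp]: "word [] = []" "word ((V, u, W) # ws) = u @ word ws" "word (ws @ vs) = word ws @ word vs"
  by (simp_all add: word_def)

lemma ple_lam: "ple Z X \<Longrightarrow> lam X [] Z"
  using ple_subset by (simp add: lam_Nil)

lemma lp_lam: "lp X ws Z \<Longrightarrow> lam X (word ws) Z"
proof (induction X ws Z rule: lp.induct)
  case (1 X Z) then show ?case using ple_lam by simp
next
  case (2 X V u W ws Z)
  then have "lam X [] V" "lam V u W" "lam W (word ws) Z" using ple_lam exitp_lam by simp_all
  then show ?case using lam_trans[of X "[]" V] lam_trans[of X u W] by simp
qed

lemma lp_mono: "ple X Y \<Longrightarrow> lp X ws Z \<Longrightarrow> lp Y ws Z"
  by (cases ws) (auto intro: ple_trans)

lemma lp_append: "lp X ws Z \<Longrightarrow> lp Z vs W \<Longrightarrow> lp X (ws @ vs) W"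
  by (induction X ws Z rule: lp.induct) (auto intro: lp_mono)

lemma lam_ConsD:
  assumes "lam X (x # \<alpha>) Z" shows "x \<in> X" "x \<in> A" "lam (F x) \<alpha> Z"
proof -
  show "x \<in> X" using assms by (simp add: lam_def)
  show "x \<in> A" using assms by (auto simp: lam_def valid_def wd_Cons)
  then show "lam (F x) \<alpha> Z"
    using assms F_in_\<X> by (auto simp: lam_def valid_def wd_Cons split: if_splits)
qed

text \<open>The measure decreases along every cover: one of the form \<open>(x, F x)\<close> shortens the word, the
  others keep it and shrink \<open>X\<close>.\<close>

lemma lp_exists: "lam X \<alpha> Z \<Longrightarrow> \<exists>ws. lp X ws Z \<and> word ws = \<alpha>"
proof (induction "length \<alpha> * Suc (card A) + card X" arbitrary: X \<alpha> rule: less_induct)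
  case less
  have X: "X \<in> \<X>" "Z \<in> \<X>" using less.prems lamD by blast+
  \<comment> \<open>One step down through a cover: a good cover changes nothing in the path, an exit is
     recorded.\<close>
  have step: ?case if s: "subcov X u W" and l: "lam W \<beta> Z" "\<alpha> = u @ \<beta>"
    and lt: "length \<beta> * Suc (card A) + card W < length \<alpha> * Suc (card A) + card X" for u W \<beta>
  proof -
    obtain ws where ws: "lp W ws Z" "word ws = \<beta>" using less.hyps[OF lt l(1)] by blast
    show ?thesis
    proof (cases "exitp X u W")
      case True
      then have "lp X ((X, u, W) # ws) Z" using ws ple_refl X by simp
      then show ?thesis using ws l(2) by (intro exI[of _ "(X, u, W) # ws"]) simp
    next
      case False
      then have "u = []" "ple W X" using s unfolding exitp_def by blast+
      then show ?thesis using ws lp_mono[of W X ws Z] l(2) by auto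
    qed
  qed
  have down: ?case if Y: "Y \<in> \<X>" "Y \<subset> X" "lam Y \<alpha> Z" for Y
  proof -
    obtain W where W: "cov W X" "Y \<subseteq> W" using cov_above[OF Y(1) X(1) Y(2)] by blast
    then have "lam W [] Y" using Y covD by (simp add: lam_Nil)
    then have l: "lam W \<alpha> Z" using lam_trans[of W "[]" Y \<alpha> Z] Y by simp
    have "card W < card X" using covD[OF W(1)] finite_member by (simp add: psubset_card_mono)
    then show ?thesis using step[of "[]" W \<alpha>] W l X unfolding subcov_def by auto
  qed
  show ?case
  proof (cases \<alpha>)
    case Nil
    then have ZX: "Z \<subseteq> X" using less.prems by (simp add: lam_Nil)
    show ?thesis
    proof (cases "Z = X")
      case True then show ?thesis using Nil ple_refl X by (intro exI[of _ "[]"]) simp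
    next
      case False
      then show ?thesis using down[of Z] ZX X Nil by (auto simp: lam_Nil)
    qed
  next
    case (Cons x \<beta>)
    have x: "x \<in> X" "x \<in> A" "lam (F x) \<beta> Z" using lam_ConsD less.prems Cons by blast+
    show ?thesis
    proof (cases "\<forall>Y\<in>\<X>. x \<in> Y \<and> Y \<subseteq> X \<longrightarrow> Y = X")
      case True
      then have "subcov X [x] (F x)" using x X unfolding subcov_def by blast
      moreover have "card (F x) \<le> card A" using F_subset finite_A by (rule card_mono[rotated])
      ultimately show ?thesis using step[of "[x]" "F x" \<beta>] x Cons by simp
    next
      case False
      then obtain Y where Y: "Y \<in> \<X>" "x \<in> Y" "Y \<subset> X" by blast
      then have "lam Y \<alpha> Z" using less.prems Cons by (simp add: lam_def)
      then show ?thesis using down Y by blast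
    qed
  qed
qed

text \<open>Two paths of the same arrow start with exits of \<open>V\<close> and of \<open>V'\<close> that overlap.  Both exits
  meet \<open>V \<inter> V'\<close>, which lies below \<open>V\<close> and \<open>V'\<close>, so \<open>V = V \<inter> V' = V'\<close>, and then the exits agree
  because distinct exits are disjoint.\<close>

lemma lp_unique:
  assumes "lp X ws Z" "lp X vs Z" "word ws = word vs" shows "ws = vs"
proof -
  \<comment> \<open>If \<open>Z \<preceq> X\<close> then convexity makes every cover between \<open>Z\<close> and \<open>X\<close> good.\<close>
  have no: False if Z: "ple Z X" and p: "lp X ((V, u, W) # vs) Z" "word ((V, u, W) # vs) = []" for X V u W vs
  proof -
    have e: "exitp V u W" "u = []" "ple V X" and l: "lam W [] Z" using p lp_lam[of W vs Z] by auto
    have sub: "cov W V" "\<not> ple W V" using e by (auto elim: exitp_cases)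
    have "Z \<subseteq> W" using l by (simp add: lam_Nil)
    then have "ple Z V" using ple_convex[OF Z] ple_subset[OF e(3)] covD[OF sub(1)] by blast
    then show False using ple_convex[of Z V W] sub covD[OF sub(1)] \<open>Z \<subseteq> W\<close> by blast
  qed
  show ?thesis using assms
  proof (induction ws arbitrary: X vs)
  case Nil
  then show ?case
  proof (cases vs)
    case c: (Cons q vs')
    obtain V u W where "q = (V, u, W)" by (cases q)
    then show ?thesis using no[of X V u W vs'] Nil c by simp
  qed simp
next
  case (Cons p ws)
  obtain V u W where p: "p = (V, u, W)" by (cases p)
  show ?case
  proof (cases vs)
    case Nil
    then show ?thesis using no[of X V u W ws] Cons.prems p by simp
  next
    case c: (Cons q vs')
    obtain V' u' W' where q: "q = (V', u', W')" by (cases q)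
    have e: "ple V X" "exitp V u W" "lp W ws Z" "ple V' X" "exitp V' u' W'" "lp W' vs' Z"
      and w: "u @ word ws = u' @ word vs'"
      using Cons.prems p q c by simp_all
    let ?C = "cyl (u @ word ws) Z"
    have C1: "?C \<subseteq> cyl u W" using cyl_mono[OF lp_lam[OF e(3)]] .
    have C2: "?C \<subseteq> cyl u' W'" unfolding w using cyl_mono[OF lp_lam[OF e(6)]] .
    have s: "cyl u W \<subseteq> starts V" "cyl u' W' \<subseteq> starts V'" using lam_starts exitp_lam e by blast+
    have "lam W (word ws) Z" using lp_lam e by blast
    then have Cne: "?C \<noteq> {}" using valid_cyl_nonempty lamD(3) by blast
    have "?C \<subseteq> starts (V \<inter> V')" using C1 C2 s starts_Int by blast
    then have ne: "V \<inter> V' \<noteq> {}" using Cne by auto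
    note I = ple_Int[OF e(1,4) ne]
    have "V \<inter> V' = V" using exitp_disjoint_ple[OF e(2)] I C1 \<open>?C \<subseteq> starts (V \<inter> V')\<close> Cne by blast
    moreover have "V \<inter> V' = V'" using exitp_disjoint_ple[OF e(5)] I C2 \<open>?C \<subseteq> starts (V \<inter> V')\<close> Cne by blast
    ultimately have "V = V'" by simp
    then have "u = u' \<and> W = W'" using exitp_disjoint[OF e(2)] e(5) C1 C2 Cne by blast
    then show ?thesis using Cons.IH[of W vs'] e w p q c \<open>V = V'\<close> by simp
  qed
qed
qed

text \<open>Arrows and labelled paths thus correspond, compatibly with concatenation: the category of
  arrows is generated freely by \<open>\<preceq>\<close> and the exits.\<close>

definition path :: "'a set \<Rightarrow> 'a list \<Rightarrow> 'a set \<Rightarrow> ('a set \<times> 'a list \<times> 'a set) list" where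
  "path X \<alpha> Z = (THE ws. lp X ws Z \<and> word ws = \<alpha>)"

lemma path_eqI: "lp X ws Z \<Longrightarrow> word ws = \<alpha> \<Longrightarrow> path X \<alpha> Z = ws"
  unfolding path_def using lp_unique by (intro the_equality) auto

lemma lp_path: "lam X \<alpha> Z \<Longrightarrow> lp X (path X \<alpha> Z) Z" "lam X \<alpha> Z \<Longrightarrow> word (path X \<alpha> Z) = \<alpha>"
  using lp_exists path_eqI by metis+

lemma path_append: "lam X \<alpha> Z \<Longrightarrow> lam Z \<beta> W \<Longrightarrow> path X (\<alpha> @ \<beta>) W = path X \<alpha> Z @ path Z \<beta> W"
  using lp_append[OF lp_path(1) lp_path(1)] by (intro path_eqI) (simp_all add: lp_path(2))

end

section \<open>The combinatorial data of the inverse hull\<close>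

datatype 'p cd = Zero | Vert "'p set" | Exit "'p set" "'p list" "'p set"

lemma restrict_both_iff:
  "s = pid P \<circ>\<^sub>m t \<circ>\<^sub>m pid Q \<and> t = pid P' \<circ>\<^sub>m s \<circ>\<^sub>m pid Q' \<longleftrightarrow>
    s = t \<and> ran s \<subseteq> P \<inter> P' \<and> dom s \<subseteq> Q \<inter> Q'"
proof
  assume st: "s = pid P \<circ>\<^sub>m t \<circ>\<^sub>m pid Q \<and> t = pid P' \<circ>\<^sub>m s \<circ>\<^sub>m pid Q'"
  have 1: "t w = Some v \<and> v \<in> P \<and> w \<in> Q" if "s w = Some v" for w v
  proof -
    have "(pid P \<circ>\<^sub>m t \<circ>\<^sub>m pid Q) w = Some v" by (subst conjunct1[OF st, symmetric]) (rule that)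
    then show ?thesis by (auto simp: map_comp_Some_iff)
  qed
  have 2: "s w = Some v \<and> v \<in> P' \<and> w \<in> Q'" if "t w = Some v" for w v
  proof -
    have "(pid P' \<circ>\<^sub>m s \<circ>\<^sub>m pid Q') w = Some v" by (subst conjunct2[OF st, symmetric]) (rule that)
    then show ?thesis by (auto simp: map_comp_Some_iff)
  qed
  have "s = t"
  proof (rule map_eqI)
    show "s w = Some v \<longleftrightarrow> t w = Some v" for w v using 1[of w v] 2[of w v] by blast
  qed
  moreover have "v \<in> P \<inter> P' \<and> w \<in> Q \<inter> Q'" if "s w = Some v" for w v
    using 1[OF that] 2[of w v] by blast
  then have "ran s \<subseteq> P \<inter> P'" "dom s \<subseteq> Q \<inter> Q'" unfolding ran_def dom_def by blast+
  ultimately show "s = t \<and> ran s \<subseteq> P \<inter> P' \<and> dom s \<subseteq> Q \<inter> Q'" by simp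
next
  assume "s = t \<and> ran s \<subseteq> P \<inter> P' \<and> dom s \<subseteq> Q \<inter> Q'"
  then have "s = t" "pid P \<circ>\<^sub>m t = t" "t \<circ>\<^sub>m pid Q = t" "pid P' \<circ>\<^sub>m t = t" "t \<circ>\<^sub>m pid Q' = t"
    using pid_comp_eq[of t P] pid_comp_eq[of t P'] comp_pid_eq[of t Q] comp_pid_eq[of t Q'] by auto
  then show "s = pid P \<circ>\<^sub>m t \<circ>\<^sub>m pid Q \<and> t = pid P' \<circ>\<^sub>m s \<circ>\<^sub>m pid Q'" by simp
qed

context markov_shift
begin

abbreviation SP :: "'a hull_triple set sgrp" where
  "SP \<equiv> S_preceq A M"

definition triple_ok :: "'a set \<Rightarrow> ('a list \<rightharpoonup> 'a list) \<Rightarrow> 'a set \<Rightarrow> bool" where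
  "triple_ok X s Y \<longleftrightarrow> X \<in> insert {} \<X> \<and> Y \<in> insert {} \<X> \<and> s \<in> hull_carrier A M \<and>
    ran s \<subseteq> starts X \<and> dom s \<subseteq> starts Y"

definition tri :: "'a set \<Rightarrow> ('a list \<rightharpoonup> 'a list) \<Rightarrow> 'a set \<Rightarrow> 'a hull_triple set" where
  "tri X s Y = triple_class A M (cls X, s, cls Y)"

lemma triples_S: "triples A M = {(cls X, s, cls Y) |X s Y. triple_ok X s Y}"
proof -
  have le: "nat_le S (s \<circ>\<^sub>m star S s) (p_idem A M (cls X) (cls X)) \<longleftrightarrow> ran s \<subseteq> starts X"
       "nat_le S (star S s \<circ>\<^sub>m s) (p_idem A M (cls X) (cls X)) \<longleftrightarrow> dom s \<subseteq> starts X"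
    if "X \<in> insert {} \<X>" "s \<in> hull_carrier A M" for X s
    using that ran_in_cyls dom_in_cyls nat_le_pid[OF _ starts_in_cyls[OF that(1)]]
    by (simp_all del: insert_iff add: p_idem_cls mt_self star_S comp_pinverse pinverse_comp hull_pinj)
  have "(u, s, v) \<in> triples A M \<longleftrightarrow> (\<exists>X Y. u = cls X \<and> v = cls Y \<and> triple_ok X s Y)" for u s v
  proof
    assume t: "(u, s, v) \<in> triples A M"
    then have uv: "u \<in> cls ` insert {} \<X>" "v \<in> cls ` insert {} \<X>"
      unfolding triples_def Let_def D_classes_S by simp_all
    then obtain X Y where X: "u = cls X" "X \<in> insert {} \<X>" "v = cls Y" "Y \<in> insert {} \<X>"
      by (elim imageE)
    have "s \<in> hull_carrier A M" "nat_le S (s \<circ>\<^sub>m star S s) (p_idem A M u u)" "nat_le S (star S s \<circ>\<^sub>m s) (p_idem A M v v)"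
      using t unfolding triples_def Let_def by (simp_all add: carrier_S)
    then have "triple_ok X s Y" unfolding triple_ok_def using le[OF X(2)] le[OF X(4)] X by blast
    then show "\<exists>X Y. u = cls X \<and> v = cls Y \<and> triple_ok X s Y" using X by blast
  next
    assume "\<exists>X Y. u = cls X \<and> v = cls Y \<and> triple_ok X s Y"
    then obtain X Y where X: "u = cls X" "v = cls Y" "X \<in> insert {} \<X>" "Y \<in> insert {} \<X>" "s \<in> hull_carrier A M"
      "ran s \<subseteq> starts X" "dom s \<subseteq> starts Y" unfolding triple_ok_def by blast
    then have "u \<in> D_classes S" "v \<in> D_classes S" unfolding D_classes_S by blast+
    then show "(u, s, v) \<in> triples A M"
      unfolding triples_def Let_def using X le[OF X(3,5)] le[OF X(4,5)] by (simp add: carrier_S)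
  qed
  then show ?thesis by (auto, blast)
qed

lemma triple_okD: "triple_ok X s Y \<Longrightarrow> (cls X, s, cls Y) \<in> triples A M"
  unfolding triples_S by blast

lemma starts_triangle:
  "w \<in> starts (mt X Y) \<Longrightarrow> w \<in> starts (mt Y Z) \<Longrightarrow> w \<in> starts (mt X Z)"
  using mt_triangle by (auto simp: starts_def)

text \<open>Related triples have the same middle element: each is a restriction of the other.\<close>

lemma triple_rel_iff:
  assumes "X \<in> insert {} \<X>" "Y \<in> insert {} \<X>" "X' \<in> insert {} \<X>" "Y' \<in> insert {} \<X>"
  shows "((cls X, s, cls Y), (cls X', t, cls Y')) \<in> triple_rel A M \<longleftrightarrow>
    s = t \<and> s \<in> hull_carrier A M \<and> ran s \<subseteq> starts (mt X X') \<and> dom s \<subseteq> starts (mt Y Y')"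
proof -
  have ok: "(cls X, s, cls Y) \<in> triples A M \<longleftrightarrow> triple_ok X s Y" if "X \<in> insert {} \<X>" "Y \<in> insert {} \<X>" for X s Y
  proof
    assume "(cls X, s, cls Y) \<in> triples A M"
    then obtain X' Y' where X': "cls X = cls X'" "cls Y = cls Y'" "triple_ok X' s Y'" unfolding triples_S by blast
    have m: "X' \<in> insert {} \<X>" "Y' \<in> insert {} \<X>" using X'(3) unfolding triple_ok_def by blast+
    have "X = X'" "Y = Y'"
      using cls_inject[OF that(1) m(1)] cls_inject[OF that(2) m(2)] X'(1,2) by simp_all
    then show "triple_ok X s Y" using X' by simp
  qed (rule triple_okD)
  have "triple_ok X s Y \<and> triple_ok X' s Y'"
    if "s \<in> hull_carrier A M" "ran s \<subseteq> starts (mt X X')" "dom s \<subseteq> starts (mt Y Y')"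
    unfolding triple_ok_def
    using that assms order_trans[OF that(2) starts_mono[OF mt_subset(1)]] order_trans[OF that(2) starts_mono[OF mt_subset(2)]]
      order_trans[OF that(3) starts_mono[OF mt_subset(1)]] order_trans[OF that(3) starts_mono[OF mt_subset(2)]]
    by simp
  moreover have "s \<in> hull_carrier A M" if "triple_ok X s Y" using that by (simp add: triple_ok_def)
  ultimately show ?thesis
    unfolding triple_rel_def Let_def mem_Collect_eq prod.case mult_S ok[OF assms(1,2)] ok[OF assms(3,4)]
      p_idem_cls[OF assms(1,3)] p_idem_cls[OF assms(4,2)] p_idem_cls[OF assms(3,1)] p_idem_cls[OF assms(2,4)]
      mt_commute[of X' X] mt_commute[of Y' Y] restrict_both_iff by blast
qed

lemma tri_iff:
  assumes "triple_ok X s Y"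
  shows "x \<in> tri X s Y \<longleftrightarrow> (\<exists>X'\<in>insert {} \<X>. \<exists>Y'\<in>insert {} \<X>. x = (cls X', s, cls Y') \<and>
    ran s \<subseteq> starts (mt X X') \<and> dom s \<subseteq> starts (mt Y Y'))"
proof
  assume "x \<in> tri X s Y"
  then have r: "((cls X, s, cls Y), x) \<in> triple_rel A M" by (simp add: tri_def triple_class_def)
  then have "x \<in> triples A M" unfolding triple_rel_def Let_def by auto
  then obtain X' t Y' where x: "x = (cls X', t, cls Y')" "X' \<in> insert {} \<X>" "Y' \<in> insert {} \<X>"
    unfolding triples_S triple_ok_def by blast
  then show "\<exists>X'\<in>insert {} \<X>. \<exists>Y'\<in>insert {} \<X>. x = (cls X', s, cls Y') \<and>
    ran s \<subseteq> starts (mt X X') \<and> dom s \<subseteq> starts (mt Y Y')"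
    using r triple_rel_iff[of X Y X' Y' s t] assms unfolding triple_ok_def by blast
next
  assume "\<exists>X'\<in>insert {} \<X>. \<exists>Y'\<in>insert {} \<X>. x = (cls X', s, cls Y') \<and>
    ran s \<subseteq> starts (mt X X') \<and> dom s \<subseteq> starts (mt Y Y')"
  then obtain X' Y' where x: "x = (cls X', s, cls Y')" "X' \<in> insert {} \<X>" "Y' \<in> insert {} \<X>"
    "ran s \<subseteq> starts (mt X X')" "dom s \<subseteq> starts (mt Y Y')" by blast
  then show "x \<in> tri X s Y"
    using triple_rel_iff[of X Y X' Y' s s] assms unfolding triple_ok_def by (simp add: tri_def triple_class_def)
qed

lemma self_in_tri:
  assumes "triple_ok X s Y" shows "(cls X, s, cls Y) \<in> tri X s Y"
proof -
  have m: "X \<in> insert {} \<X>" "Y \<in> insert {} \<X>" using assms unfolding triple_ok_def by blast+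
  show ?thesis
    unfolding tri_iff[OF assms] using assms mt_self[OF m(1)] mt_self[OF m(2)]
    by (intro bexI[OF _ m(1)] bexI[OF _ m(2)]) (simp add: triple_ok_def)
qed

lemma tri_eqI:
  assumes "triple_ok X s Y" "triple_ok X' s Y'" "ran s \<subseteq> starts (mt X X')" "dom s \<subseteq> starts (mt Y Y')"
  shows "tri X s Y = tri X' s Y'"
proof -
  have sub: "tri X s Y \<subseteq> tri X' s Y'"
    if ok: "triple_ok X s Y" "triple_ok X' s Y'" and rd: "ran s \<subseteq> starts (mt X' X)" "dom s \<subseteq> starts (mt Y' Y)"
    for X Y X' Y'
  proof
    fix x assume "x \<in> tri X s Y"
    then obtain Z W where Z: "Z \<in> insert {} \<X>" "W \<in> insert {} \<X>" "x = (cls Z, s, cls W)"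
      "ran s \<subseteq> starts (mt X Z)" "dom s \<subseteq> starts (mt Y W)" unfolding tri_iff[OF ok(1)] by blast
    have "ran s \<subseteq> starts (mt X' Z)" using starts_triangle[of _ X' X Z] rd(1) Z(4) by (meson subset_eq)
    moreover have "dom s \<subseteq> starts (mt Y' W)" using starts_triangle[of _ Y' Y W] rd(2) Z(5) by (meson subset_eq)
    ultimately show "x \<in> tri X' s Y'" unfolding tri_iff[OF ok(2)] using Z by blast
  qed
  show ?thesis
    using sub[OF assms(1,2)] sub[OF assms(2,1)] assms(3,4) by (simp add: mt_commute)
qed

lemma tri_eq_iff:
  assumes "triple_ok X s Y" "triple_ok X' t Y'"
  shows "tri X s Y = tri X' t Y' \<longleftrightarrow> s = t \<and> ran s \<subseteq> starts (mt X X') \<and> dom s \<subseteq> starts (mt Y Y')"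
proof
  assume eq: "tri X s Y = tri X' t Y'"
  have m: "X' \<in> insert {} \<X>" "Y' \<in> insert {} \<X>" using assms unfolding triple_ok_def by blast+
  have "(cls X', t, cls Y') \<in> tri X s Y" using eq self_in_tri[OF assms(2)] by simp
  then obtain Z W where Z: "Z \<in> insert {} \<X>" "W \<in> insert {} \<X>" "cls X' = cls Z" "t = s" "cls Y' = cls W"
    "ran s \<subseteq> starts (mt X Z)" "dom s \<subseteq> starts (mt Y W)" unfolding tri_iff[OF assms(1)] by blast
  have "X' = Z" "Y' = W" using cls_inject[OF m(1) Z(1)] cls_inject[OF m(2) Z(2)] Z(3,5) by simp_all
  then show "s = t \<and> ran s \<subseteq> starts (mt X X') \<and> dom s \<subseteq> starts (mt Y Y')" using Z by simp
qed (use assms tri_eqI in blast)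

lemma carrier_SP: "carrier SP = {tri X s Y |X s Y. triple_ok X s Y}"
  unfolding S_preceq_def triple_class_def tri_def triples_S quotient_def by auto

lemma triple_ok_mult:
  assumes "triple_ok X s Y" "triple_ok X' t Y'"
  shows "triple_ok X (s \<circ>\<^sub>m pid (starts (mt Y X')) \<circ>\<^sub>m t) Y'"
proof -
  have "pid (starts (mt Y X')) \<in> hull_carrier A M" using mt_member starts_in_cyls pid_in_hull by blast
  then show ?thesis
    using assms unfolding triple_ok_def
    by (auto simp: hull_carrier.comp map_comp_Some_iff ran_def dom_def subset_iff)
qed

text \<open>The product does not depend on representatives because
  \<open>p\<^sub>u\<^sub>,\<^sub>v p\<^sub>v\<^sub>,\<^sub>w \<le> p\<^sub>u\<^sub>,\<^sub>w\<close>.\<close>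

lemma mult_SP:
  assumes "triple_ok X s Y" "triple_ok X' t Y'"
  shows "tri X s Y \<odot>\<^bsub>SP\<^esub> tri X' t Y' = tri X (s \<circ>\<^sub>m pid (starts (mt Y X')) \<circ>\<^sub>m t) Y'"
proof -
  let ?r = "tri X (s \<circ>\<^sub>m pid (starts (mt Y X')) \<circ>\<^sub>m t) Y'"
  have each: "triple_class A M (triple_mult A M x y) = ?r" if x: "x \<in> tri X s Y" and y: "y \<in> tri X' t Y'" for x y
  proof -
    obtain Z W where Z: "Z \<in> insert {} \<X>" "W \<in> insert {} \<X>" "x = (cls Z, s, cls W)"
      "ran s \<subseteq> starts (mt X Z)" "dom s \<subseteq> starts (mt Y W)" using x unfolding tri_iff[OF assms(1)] by blast
    obtain Z' W' where Z': "Z' \<in> insert {} \<X>" "W' \<in> insert {} \<X>" "y = (cls Z', t, cls W')"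
      "ran t \<subseteq> starts (mt X' Z')" "dom t \<subseteq> starts (mt Y' W')" using y unfolding tri_iff[OF assms(2)] by blast
    have ok: "triple_ok Z s W" "triple_ok Z' t W'"
      unfolding triple_ok_def
      using Z Z' assms order_trans[OF Z(4) starts_mono[OF mt_subset(2)]] order_trans[OF Z(5) starts_mono[OF mt_subset(2)]]
        order_trans[OF Z'(4) starts_mono[OF mt_subset(2)]] order_trans[OF Z'(5) starts_mono[OF mt_subset(2)]]
      by (simp_all add: triple_ok_def)
    have "u \<in> starts (mt W Z') \<longleftrightarrow> u \<in> starts (mt Y X')" if u: "u \<in> dom s" "u \<in> ran t" for u
    proof -
      have a: "u \<in> starts (mt Y W)" "u \<in> starts (mt X' Z')" using Z Z' u by blast+
      show ?thesis using a starts_triangle mt_commute by metis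
    qed
    then have eq: "s \<circ>\<^sub>m pid (starts (mt W Z')) \<circ>\<^sub>m t = s \<circ>\<^sub>m pid (starts (mt Y X')) \<circ>\<^sub>m t"
      by (intro map_eqI) (auto simp: map_comp_Some_iff ran_def dom_def)
    have "triple_class A M (triple_mult A M x y) = tri Z (s \<circ>\<^sub>m pid (starts (mt W Z')) \<circ>\<^sub>m t) W'"
      unfolding triple_mult_def Let_def tri_def Z(3) Z'(3) using p_idem_cls[OF Z(2) Z'(1)] by simp
    also have "\<dots> = ?r"
      unfolding eq
    proof (rule tri_eqI)
      show "triple_ok Z (s \<circ>\<^sub>m pid (starts (mt Y X')) \<circ>\<^sub>m t) W'" using triple_ok_mult[OF ok] eq by simp
      show "triple_ok X (s \<circ>\<^sub>m pid (starts (mt Y X')) \<circ>\<^sub>m t) Y'" by (rule triple_ok_mult[OF assms])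
      have "ran (s \<circ>\<^sub>m pid (starts (mt Y X')) \<circ>\<^sub>m t) \<subseteq> ran s" "dom (s \<circ>\<^sub>m pid (starts (mt Y X')) \<circ>\<^sub>m t) \<subseteq> dom t"
        by (auto simp: map_comp_Some_iff ran_def)
      then show "ran (s \<circ>\<^sub>m pid (starts (mt Y X')) \<circ>\<^sub>m t) \<subseteq> starts (mt Z X)"
        "dom (s \<circ>\<^sub>m pid (starts (mt Y X')) \<circ>\<^sub>m t) \<subseteq> starts (mt W' Y')"
        using Z(4) Z'(5) mt_commute[of X Z] mt_commute[of W' Y'] by auto
    qed
    finally show ?thesis .
  qed
  have "(cls X, s, cls Y) \<in> tri X s Y" "(cls X', t, cls Y') \<in> tri X' t Y'"
    using self_in_tri assms by blast+
  then have "(\<Union>x\<in>tri X s Y. \<Union>y\<in>tri X' t Y'. triple_class A M (triple_mult A M x y)) = ?r"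
    using each by blast
  then show ?thesis by (simp add: S_preceq_def)
qed

lemma SP_closed: "x \<in> carrier SP \<Longrightarrow> y \<in> carrier SP \<Longrightarrow> x \<odot>\<^bsub>SP\<^esub> y \<in> carrier SP"
  unfolding carrier_SP using mult_SP triple_ok_mult by blast

lemma SP_assoc:
  assumes "x \<in> carrier SP" "y \<in> carrier SP" "z \<in> carrier SP"
  shows "(x \<odot>\<^bsub>SP\<^esub> y) \<odot>\<^bsub>SP\<^esub> z = x \<odot>\<^bsub>SP\<^esub> (y \<odot>\<^bsub>SP\<^esub> z)"
proof -
  obtain X s Y X' t Y' X'' r Y'' where
    "x = tri X s Y" "triple_ok X s Y" "y = tri X' t Y'" "triple_ok X' t Y'" "z = tri X'' r Y''" "triple_ok X'' r Y''"
    using assms unfolding carrier_SP by blast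
  then show ?thesis using mult_SP triple_ok_mult by (simp add: comp_assoc)
qed

lemma zero_el_SP: "zero_el SP = tri {} Map.empty {}"
proof -
  let ?z = "tri {} Map.empty {}"
  have zok: "triple_ok {} Map.empty {}" by (simp add: triple_ok_def hull_carrier.zero)
  have zc: "?z \<in> carrier SP" unfolding carrier_SP using zok by blast
  have z: "is_zero SP ?z"
    unfolding is_zero_def
  proof (intro conjI ballI)
    fix x assume "x \<in> carrier SP"
    then obtain X s Y where x: "x = tri X s Y" "triple_ok X s Y" unfolding carrier_SP by blast
    have ok: "triple_ok {} Map.empty Y" "triple_ok X Map.empty {}"
      using x by (simp_all add: triple_ok_def hull_carrier.zero)
    show "?z \<odot>\<^bsub>SP\<^esub> x = ?z"
      using mult_SP[OF zok x(2)] tri_eqI[OF ok(1) zok] x by simp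
    show "x \<odot>\<^bsub>SP\<^esub> ?z = ?z"
      using mult_SP[OF x(2) zok] tri_eqI[OF ok(2) zok] x by simp
  qed (fact zc)
  show ?thesis unfolding zero_el_def
  proof (rule the_equality, fact z)
    fix y assume y: "is_zero SP y"
    then have "y \<odot>\<^bsub>SP\<^esub> ?z = y" using zc by (simp add: is_zero_def)
    moreover have "y \<odot>\<^bsub>SP\<^esub> ?z = ?z" using z y by (simp add: is_zero_def)
    ultimately show "y = ?z" by simp
  qed
qed

lemma left_ideal_SP_dom:
  assumes ok: "triple_ok X s Y" "triple_ok X' t Y'" and "tri X s Y \<in> left_ideal SP (tri X' t Y')"
  shows "dom s \<subseteq> dom t"
proof -
  from assms(3) consider "tri X s Y = tri X' t Y'" | y where "y \<in> carrier SP" "tri X s Y = y \<odot>\<^bsub>SP\<^esub> tri X' t Y'"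
    unfolding left_ideal_def by blast
  then show ?thesis
  proof cases
    case 1 then show ?thesis using tri_eq_iff[OF ok] by simp
  next
    case (2 y)
    then obtain Z r W where y: "y = tri Z r W" "triple_ok Z r W" unfolding carrier_SP by blast
    have "tri X s Y = tri Z (r \<circ>\<^sub>m pid (starts (mt W X')) \<circ>\<^sub>m t) Y'" using mult_SP y ok 2 by simp
    then have "s = r \<circ>\<^sub>m pid (starts (mt W X')) \<circ>\<^sub>m t" using tri_eq_iff[OF ok(1) triple_ok_mult[OF y(2) ok(2)]] by simp
    then show ?thesis by (auto simp: map_comp_Some_iff)
  qed
qed

lemma right_ideal_SP_ran:
  assumes ok: "triple_ok X s Y" "triple_ok X' t Y'" and "tri X s Y \<in> right_ideal SP (tri X' t Y')"
  shows "ran s \<subseteq> ran t"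
proof -
  from assms(3) consider "tri X s Y = tri X' t Y'" | y where "y \<in> carrier SP" "tri X s Y = tri X' t Y' \<odot>\<^bsub>SP\<^esub> y"
    unfolding right_ideal_def by blast
  then show ?thesis
  proof cases
    case 1 then show ?thesis using tri_eq_iff[OF ok] by simp
  next
    case (2 y)
    then obtain Z r W where y: "y = tri Z r W" "triple_ok Z r W" unfolding carrier_SP by blast
    have "tri X s Y = tri X' (t \<circ>\<^sub>m pid (starts (mt Y' Z)) \<circ>\<^sub>m r) W" using mult_SP y ok 2 by simp
    then have "s = t \<circ>\<^sub>m pid (starts (mt Y' Z)) \<circ>\<^sub>m r" using tri_eq_iff[OF ok(1) triple_ok_mult[OF ok(2) y(2)]] by simp
    then show ?thesis by (auto simp: map_comp_Some_iff ran_def)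
  qed
qed

lemma left_ideal_SP_mono:
  assumes "a \<in> carrier SP" "b \<in> carrier SP" shows "left_ideal SP (a \<odot>\<^bsub>SP\<^esub> b) \<subseteq> left_ideal SP b"
proof
  fix x assume "x \<in> left_ideal SP (a \<odot>\<^bsub>SP\<^esub> b)"
  then have "x = a \<odot>\<^bsub>SP\<^esub> b \<or> (\<exists>c\<in>carrier SP. x = (c \<odot>\<^bsub>SP\<^esub> a) \<odot>\<^bsub>SP\<^esub> b)"
    using SP_assoc assms unfolding left_ideal_def by auto
  then show "x \<in> left_ideal SP b" using SP_closed assms unfolding left_ideal_def by blast
qed

lemma right_ideal_SP_mono:
  assumes "a \<in> carrier SP" "b \<in> carrier SP" shows "right_ideal SP (a \<odot>\<^bsub>SP\<^esub> b) \<subseteq> right_ideal SP a"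
proof
  fix x assume "x \<in> right_ideal SP (a \<odot>\<^bsub>SP\<^esub> b)"
  then have "x = a \<odot>\<^bsub>SP\<^esub> b \<or> (\<exists>c\<in>carrier SP. x = a \<odot>\<^bsub>SP\<^esub> (b \<odot>\<^bsub>SP\<^esub> c))"
    using SP_assoc assms unfolding right_ideal_def by auto
  then show "x \<in> right_ideal SP a" using SP_closed assms unfolding right_ideal_def by blast
qed

text \<open>The idempotents \<open>[X, f, X]\<close>, with \<open>f\<close> given by its domain.\<close>

definition it :: "'a set \<Rightarrow> 'a list set \<Rightarrow> 'a hull_triple set" where
  "it X C = tri X (pid C) X"

definition it_ok :: "'a set \<Rightarrow> 'a list set \<Rightarrow> bool" where
  "it_ok X C \<longleftrightarrow> X \<in> insert {} \<X> \<and> C \<in> cyls \<and> C \<subseteq> starts X"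

lemma it_ok: "it_ok X C \<longleftrightarrow> triple_ok X (pid C) X"
  unfolding it_ok_def triple_ok_def by (auto simp: pid_in_hull)

lemma it_carrier: "it_ok X C \<Longrightarrow> it X C \<in> carrier SP"
  unfolding it_ok carrier_SP it_def by blast

lemma it_eq_iff: "it_ok X C \<Longrightarrow> it_ok Y D \<Longrightarrow> it X C = it Y D \<longleftrightarrow> C = D \<and> C \<subseteq> starts (mt X Y)"
  unfolding it_ok it_def by (simp add: tri_eq_iff)

lemma it_ok_mult: "it_ok X C \<Longrightarrow> it_ok Y D \<Longrightarrow> it_ok X (C \<inter> starts (mt X Y) \<inter> D)"
  unfolding it_ok_def using Int_cyls starts_in_cyls mt_member by auto

lemma it_mult:
  assumes "it_ok X C" "it_ok Y D" shows "it X C \<odot>\<^bsub>SP\<^esub> it Y D = it X (C \<inter> starts (mt X Y) \<inter> D)"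
proof -
  have ok: "triple_ok X (pid (C \<inter> starts (mt X Y) \<inter> D)) X" using it_ok_mult[OF assms] it_ok by blast
  have m: "triple_ok X (pid (C \<inter> starts (mt X Y) \<inter> D)) Y"
    using triple_ok_mult[of X "pid C" X Y "pid D" Y] assms by (simp add: it_ok pid_comp)
  have "it X C \<odot>\<^bsub>SP\<^esub> it Y D = tri X (pid (C \<inter> starts (mt X Y) \<inter> D)) Y"
    using mult_SP[of X "pid C" X Y "pid D" Y] assms by (simp add: it_ok it_def pid_comp)
  also have "\<dots> = it X (C \<inter> starts (mt X Y) \<inter> D)"
    unfolding it_def
  proof (rule tri_eqI[OF m ok])
    have "X \<in> insert {} \<X>" using assms by (simp add: it_ok_def)
    then show "ran (pid (C \<inter> starts (mt X Y) \<inter> D)) \<subseteq> starts (mt X X)"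
      using assms by (auto simp: it_ok_def mt_self simp del: insert_iff)
    show "dom (pid (C \<inter> starts (mt X Y) \<inter> D)) \<subseteq> starts (mt Y X)" by (auto simp: mt_commute)
  qed
  finally show ?thesis .
qed

lemma it_mult_commute:
  assumes "it_ok X C" "it_ok Y D" shows "it X C \<odot>\<^bsub>SP\<^esub> it Y D = it Y D \<odot>\<^bsub>SP\<^esub> it X C"
  unfolding it_mult[OF assms] it_mult[OF assms(2,1)]
  using it_eq_iff[OF it_ok_mult[OF assms] it_ok_mult[OF assms(2,1)]] by (auto simp: mt_commute)

text \<open>Since related triples share their middle element, domains and ranges still separate ideals;
  conversely a middle element \<open>s\<close> from \<open>C\<close> to \<open>D\<close> gives a triple connecting \<open>[X, C, X]\<close> and
  \<open>[Y, D, Y]\<close>.\<close>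

lemma green_D_it:
  assumes "it_ok X C" "it_ok Y D"
  shows "green_D SP (it X C) (it Y D) \<longleftrightarrow> (\<exists>s\<in>hull_carrier A M. dom s = C \<and> ran s = D)"
proof
  assume "green_D SP (it X C) (it Y D)"
  then obtain x where x: "x \<in> carrier SP" "left_ideal SP (it X C) = left_ideal SP x"
    "right_ideal SP x = right_ideal SP (it Y D)" unfolding green_D_def by blast
  then obtain Z s W where s: "x = tri Z s W" "triple_ok Z s W" unfolding carrier_SP by blast
  have self: "a \<in> left_ideal SP a" "a \<in> right_ideal SP a" for a by (simp_all add: left_ideal_def right_ideal_def)
  have "it X C \<in> left_ideal SP x" "x \<in> left_ideal SP (it X C)" "x \<in> right_ideal SP (it Y D)" "it Y D \<in> right_ideal SP x"
    using self[of x] self(1)[of "it X C"] self(2)[of "it Y D"] by (simp_all only: x(2,3))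
  then have "dom s = C" "ran s = D"
    using left_ideal_SP_dom[of X "pid C" X Z s W] left_ideal_SP_dom[of Z s W X "pid C" X]
      right_ideal_SP_ran[of Y "pid D" Y Z s W] right_ideal_SP_ran[of Z s W Y "pid D" Y] s assms
    unfolding it_ok it_def by auto
  then show "\<exists>s\<in>hull_carrier A M. dom s = C \<and> ran s = D" using s unfolding triple_ok_def by blast
next
  assume "\<exists>s\<in>hull_carrier A M. dom s = C \<and> ran s = D"
  then obtain s where s: "s \<in> hull_carrier A M" "dom s = C" "ran s = D" by blast
  note j = hull_pinj[OF s(1)]
  have X: "X \<in> insert {} \<X>" "Y \<in> insert {} \<X>" "C \<subseteq> starts X" "D \<subseteq> starts Y"
    using assms by (simp_all add: it_ok_def)
  have dr: "dom (pinverse s) = D" "ran (pinverse s) = C"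
    using s by (auto simp: dom_def ran_def pinverse_Some[OF j])
  have ok: "triple_ok Y s X" "triple_ok X (pinverse s) Y"
    using s X dr by (simp_all add: triple_ok_def hull_carrier.inv)
  let ?x = "tri Y s X" and ?y = "tri X (pinverse s) Y"
  have mm: "mt X X = X" "mt Y Y = Y" using X mt_self by blast+
  have a: "?x \<odot>\<^bsub>SP\<^esub> it X C = ?x"
    using mult_SP[OF ok(1)] assms(1) X s by (simp add: it_def it_ok mm comp_assoc pid_comp comp_pid_eq)
  have b: "?y \<odot>\<^bsub>SP\<^esub> ?x = it X C"
    using mult_SP[OF ok(2,1)] X s by (simp add: it_def mm comp_assoc pid_comp_eq pinverse_comp[OF j])
  have c: "it Y D \<odot>\<^bsub>SP\<^esub> ?x = ?x"
    using mult_SP[OF _ ok(1), of Y "pid D" Y] assms(2) X s by (simp add: it_def it_ok mm comp_assoc pid_comp_eq)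
  have d: "?x \<odot>\<^bsub>SP\<^esub> ?y = it Y D"
    using mult_SP[OF ok(1,2)] X s dr by (simp add: it_def mm comp_assoc pid_comp_eq comp_pinverse[OF j])
  have car: "?x \<in> carrier SP" "?y \<in> carrier SP" unfolding carrier_SP using ok by blast+
  note ic = it_carrier[OF assms(1)] it_carrier[OF assms(2)]
  have "left_ideal SP (it X C) = left_ideal SP ?x"
    using left_ideal_SP_mono[OF car(2,1)] left_ideal_SP_mono[OF car(1) ic(1)] a b by simp
  moreover have "right_ideal SP ?x = right_ideal SP (it Y D)"
    using right_ideal_SP_mono[OF car] right_ideal_SP_mono[OF ic(2) car(1)] c d by simp
  ultimately show "green_D SP (it X C) (it Y D)" unfolding green_D_def using car ic by blast
qed

text \<open>Coordinates for \<open>CD\<close>: the zero, the elements \<open>[a, e\<^sub>a, a]\<close> and the elements \<open>[b, f, b]\<close>,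
  with their multiplication table and their classes.\<close>

definition cd_set :: "'a cd set" where
  "cd_set = {Zero} \<union> Vert ` \<X> \<union> {Exit X u W |X u W. exitp X u W}"

fun cd_top :: "'a cd \<Rightarrow> 'a set" where
  "cd_top Zero = {}" | "cd_top (Vert X) = X" | "cd_top (Exit X u W) = X"

fun cd_cyl :: "'a cd \<Rightarrow> 'a list set" where
  "cd_cyl Zero = {}" | "cd_cyl (Vert X) = starts X" | "cd_cyl (Exit X u W) = cyl u W"

fun cd_class :: "'a cd \<Rightarrow> 'a set" where
  "cd_class Zero = {}" | "cd_class (Vert X) = X" | "cd_class (Exit X u W) = W"

definition cd_val :: "'a cd \<Rightarrow> 'a hull_triple set" where
  "cd_val i = it (cd_top i) (cd_cyl i)"

fun cd_mult :: "'a cd \<Rightarrow> 'a cd \<Rightarrow> 'a cd" where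
  "cd_mult (Vert X) (Vert Y) = (if mt X Y = {} then Zero else Vert (mt X Y))"
| "cd_mult (Exit X u W) (Vert Y) = (if ple X Y then Exit X u W else Zero)"
| "cd_mult (Vert Y) (Exit X u W) = (if ple X Y then Exit X u W else Zero)"
| "cd_mult (Exit X u W) (Exit Y t V) = (if X = Y \<and> u = t \<and> W = V then Exit X u W else Zero)"
| "cd_mult _ _ = Zero"

lemma cd_set_cases:
  assumes "i \<in> cd_set"
  obtains "i = Zero" | X where "i = Vert X" "X \<in> \<X>" | X u W where "i = Exit X u W" "exitp X u W"
  using assms unfolding cd_set_def by blast

lemma cd_it_ok: "i \<in> cd_set \<Longrightarrow> it_ok (cd_top i) (cd_cyl i)"
  by (erule cd_set_cases)
    (auto simp: it_ok_def exitp_member lam_starts[OF exitp_lam] lamD(3)[OF exitp_lam])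

lemma cd_cyl_class:
  assumes "i \<in> cd_set"
  shows "(i = Zero \<and> cd_class i = {} \<and> cd_cyl i = {}) \<or>
    (\<exists>u. valid u (cd_class i) \<and> cd_cyl i = cyl u (cd_class i))"
  using assms
proof (cases rule: cd_set_cases)
  case (2 X) then show ?thesis by (auto simp: cyl_Nil valid_Nil intro!: exI[of _ "[]"])
next
  case (3 X u W) then show ?thesis using lamD(3)[OF exitp_lam] by auto
qed simp

lemma green_D_cd:
  assumes "i \<in> cd_set" "j \<in> cd_set"
  shows "green_D SP (cd_val i) (cd_val j) \<longleftrightarrow> cd_class i = cd_class j"
proof -
  have "(\<exists>s\<in>hull_carrier A M. dom s = cd_cyl i \<and> ran s = cd_cyl j) \<longleftrightarrow> cd_class i = cd_class j"
  proof
    assume "\<exists>s\<in>hull_carrier A M. dom s = cd_cyl i \<and> ran s = cd_cyl j"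
    then obtain s where s: "s \<in> hull_carrier A M" "dom s = cd_cyl i" "ran s = cd_cyl j" by blast
    show "cd_class i = cd_class j"
    proof (cases rule: hull_cases[OF s(1)])
      case 1
      then have "cd_cyl i = {}" "cd_cyl j = {}" using s by auto
      then show ?thesis using cd_cyl_class[OF assms(1)] cd_cyl_class[OF assms(2)] valid_cyl_nonempty by metis
    next
      case (2 \<alpha> X \<beta>)
      then have eq: "cd_cyl i = cyl \<beta> X" "cd_cyl j = cyl \<alpha> X" using s by simp_all
      then have "cd_cyl i \<noteq> {}" "cd_cyl j \<noteq> {}" using valid_cyl_nonempty 2 by blast+
      then obtain u v where "valid u (cd_class i)" "cyl u (cd_class i) = cyl \<beta> X"
        "valid v (cd_class j)" "cyl v (cd_class j) = cyl \<alpha> X"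
        using eq cd_cyl_class[OF assms(1)] cd_cyl_class[OF assms(2)] by metis
      then show ?thesis using cyl_inject 2 by metis
    qed
  next
    assume eq: "cd_class i = cd_class j"
    from cd_cyl_class[OF assms(1)] show "\<exists>s\<in>hull_carrier A M. dom s = cd_cyl i \<and> ran s = cd_cyl j"
    proof
      assume i: "i = Zero \<and> cd_class i = {} \<and> cd_cyl i = {}"
      then have "cd_cyl j = {}" using eq cd_cyl_class[OF assms(2)] validD(4) by metis
      then show ?thesis using i hull_carrier.zero by (metis dom_empty ran_empty)
    next
      assume "\<exists>u. valid u (cd_class i) \<and> cd_cyl i = cyl u (cd_class i)"
      then obtain u where u: "valid u (cd_class i)" "cd_cyl i = cyl u (cd_class i)" by blast
      then obtain v where v: "valid v (cd_class i)" "cd_cyl j = cyl v (cd_class i)"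
        using cd_cyl_class[OF assms(2)] eq validD(4) by metis
      then show ?thesis using rep_in_hull[OF v(1) u(1)] u by (intro bexI) simp_all
    qed
  qed
  then show ?thesis unfolding cd_val_def using green_D_it[OF cd_it_ok cd_it_ok] assms by simp
qed

lemma CD_carrier_eq: "CD_carrier A M = cd_val ` cd_set"
proof -
  have v: "{triple_class A M (a, class_rep A M a, a) |a. a \<in> D_classes S \<and>
      class_rep A M a \<in> gen_idems_up A M - gen_idems A M} = cd_val ` Vert ` \<X>" (is "?L = ?R")
  proof
    have ne: "starts X \<noteq> {}" if "X \<in> \<X>" for X
      using valid_cyl_nonempty[of "[]" X "[]"] that by (simp add: valid_Nil cyl_Nil)
    show "?L \<subseteq> ?R"
    proof
      fix x assume "x \<in> ?L"
      then obtain X where X: "X \<in> insert {} \<X>" "x = tri X (class_rep A M (cls X)) X"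
        "class_rep A M (cls X) \<in> {pid (starts X) |X. X \<in> \<X>}"
        unfolding D_classes_S gen_idems_up_diff tri_def by blast
      then obtain Y where "starts X = starts Y" "Y \<in> \<X>" using class_rep_cls by auto
      then have "X \<in> \<X>" using X(1) ne[of Y] by auto
      moreover have "x = cd_val (Vert X)" using X(2) class_rep_cls[OF X(1)] by (simp add: cd_val_def it_def)
      ultimately show "x \<in> ?R" by blast
    qed
    show "?R \<subseteq> ?L"
    proof
      fix x assume "x \<in> ?R"
      then obtain X where X: "X \<in> \<X>" "x = tri X (pid (starts X)) X" by (auto simp: cd_val_def it_def)
      then show "x \<in> ?L"
        unfolding D_classes_S gen_idems_up_diff using class_rep_cls[of X]
        by (auto simp: tri_def intro!: exI[of _ "cls X"])
    qed
  qed
  have e: "{triple_class A M (b, f, b) |b f. b \<in> D_classes S \<and> exit_idem A M b f} =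
      cd_val ` {Exit X u W |X u W. exitp X u W}" (is "?L = ?R")
  proof
    show "?L \<subseteq> ?R"
    proof
      fix x assume "x \<in> ?L"
      then obtain X f where X: "X \<in> insert {} \<X>" "exit_idem A M (cls X) f" "x = tri X f X"
        unfolding D_classes_S tri_def by blast
      then obtain u W where "f = pid (cyl u W)" "exitp X u W" using exit_idem_iff by blast
      then show "x \<in> ?R" using X by (auto simp: cd_val_def it_def intro!: image_eqI[of _ _ "Exit X u W"])
    qed
    show "?R \<subseteq> ?L"
    proof
      fix x assume "x \<in> ?R"
      then obtain X u W where X: "exitp X u W" "x = tri X (pid (cyl u W)) X" by (auto simp: cd_val_def it_def)
      then have "X \<in> insert {} \<X>" using exitp_member by blast
      then have "exit_idem A M (cls X) (pid (cyl u W))" "cls X \<in> D_classes S"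
        using exit_idem_iff X unfolding D_classes_S by blast+
      then show "x \<in> ?L" using X unfolding tri_def by blast
    qed
  qed
  have z: "zero_el SP = cd_val Zero" unfolding zero_el_SP by (simp add: cd_val_def it_def pid_empty)
  show ?thesis unfolding CD_carrier_def Let_def v e z cd_set_def by blast
qed

text \<open>The meet of \<open>X\<close> and \<open>Y\<close> is below \<open>X\<close>, and exits of \<open>X\<close> are disjoint from everything properly
  below \<open>X\<close>.  In a product, an exit of \<open>X\<close> is therefore either kept, when \<open>X \<preceq> Y\<close>, or
  annihilated.\<close>

lemma exitp_starts_mt:
  assumes "exitp X u W"
  shows "mt X Y \<noteq> X \<Longrightarrow> cyl u W \<inter> starts (mt X Y) = {}" "mt X Y = X \<longleftrightarrow> ple X Y"
proof -
  have "ple (mt X Y) X" if "mt X Y \<noteq> {}" using that unfolding mt_def by (auto split: if_splits)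
  then show "cyl u W \<inter> starts (mt X Y) = {}" if "mt X Y \<noteq> X"
    using exitp_disjoint_ple[OF assms _ that] by (cases "mt X Y = {}") auto
  show "mt X Y = X \<longleftrightarrow> ple X Y" using mt_eq_iff exitp_member[OF assms] by blast
qed

text \<open>An exit \<open>(X, [], W)\<close> and the vertex \<open>W\<close> have the same middle element, but the triples are
  related only if \<open>W \<preceq> X\<close>, which is excluded for an exit.\<close>

lemma inj_cd_val: "inj_on cd_val cd_set"
proof (rule inj_onI)
  have main: "i = j \<or> (\<exists>X u W Y. i = Exit X u W \<and> j = Vert Y)"
    if ij: "i \<in> cd_set" "j \<in> cd_set" "cd_val i = cd_val j" for i j
  proof -
    have eq: "cd_cyl i = cd_cyl j" "cd_cyl i \<subseteq> starts (mt (cd_top i) (cd_top j))"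
      using it_eq_iff[OF cd_it_ok cd_it_ok] ij unfolding cd_val_def by blast+
    have c: "cd_class i = cd_class j"
    proof (cases "cd_cyl i = {}")
      case True
      then show ?thesis using eq cd_cyl_class[OF ij(1)] cd_cyl_class[OF ij(2)] valid_cyl_nonempty by metis
    next
      case False
      then show ?thesis using eq cd_cyl_class[OF ij(1)] cd_cyl_class[OF ij(2)] cyl_inject by metis
    qed
    have ne: "k = Zero \<longleftrightarrow> cd_class k = {}" if "k \<in> cd_set" for k
      using cd_cyl_class[OF that] validD(4) by auto
    show ?thesis
      using ij(1)
    proof (cases rule: cd_set_cases)
      case 1 then show ?thesis using c ne[OF ij(2)] by simp
    next
      case (2 X)
      show ?thesis
        using ij(2)
      proof (cases rule: cd_set_cases)
        case 1 then show ?thesis using c ne[OF ij(1)] by simp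
      next
        case (2 Y) then show ?thesis using c \<open>i = Vert X\<close> by simp
      next
        case (3 Y u W)
        have W: "W = X" using c 2 3 by simp
        have "cyl [] X = cyl u W" using eq 2 3 by (simp add: cyl_Nil)
        then have "u = []" using cyl_inject[of "[]" X u W] 2 lamD(3)[OF exitp_lam[OF 3(2)]] by (simp add: valid_Nil)
        moreover have "starts X \<subseteq> starts (mt X Y)" using eq 2 3 by simp
        then have "X \<subseteq> mt X Y" using starts_subset_iff \<X>_subset 2 by blast
        then have "ple X Y" using mt_eq_iff[OF 2(2)] mt_subset by blast
        ultimately show ?thesis using 3 W unfolding exitp_def by blast
      qed
    next
      case (3 X u W)
      show ?thesis
        using ij(2)
      proof (cases rule: cd_set_cases)
        case 1 then show ?thesis using c ne[OF ij(1)] by simp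
      next
        case (2 Y) then show ?thesis using 3 by blast
      next
        case e: (3 Y t V)
        have V: "V = W" using c 3 e by simp
        have v: "valid u W" "valid t V" using lamD(3) exitp_lam 3 e by blast+
        then have u: "u = t" using cyl_inject[of u W t V] eq 3 e by simp
        have ne: "cyl u W \<noteq> {}" using valid_cyl_nonempty v by blast
        have s: "cyl u W \<subseteq> starts (mt X Y)" using eq 3 e by simp
        have "ple X Y" using exitp_starts_mt[OF 3(2), of Y] s ne by blast
        moreover have "ple Y X" using exitp_starts_mt[OF e(2), of X] s ne u V mt_commute[of X Y] by auto
        ultimately show ?thesis using ple_antisym u V 3 e by simp
      qed
    qed
  qed
  fix i j assume ij: "i \<in> cd_set" "j \<in> cd_set" "cd_val i = cd_val j"
  then show "i = j" using main[OF ij] main[OF ij(2,1) ij(3)[symmetric]] by auto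
qed

lemma cd_mult_val:
  assumes "i \<in> cd_set" "j \<in> cd_set"
  shows "cd_mult i j \<in> cd_set \<and> cd_val i \<odot>\<^bsub>SP\<^esub> cd_val j = cd_val (cd_mult i j)"
proof -
  note ok = cd_it_ok[OF assms(1)] cd_it_ok[OF assms(2)]
  have m: "cd_val i \<odot>\<^bsub>SP\<^esub> cd_val j = it (cd_top i) (cd_cyl i \<inter> starts (mt (cd_top i) (cd_top j)) \<inter> cd_cyl j)"
    unfolding cd_val_def by (rule it_mult[OF ok])
  have zero: "it X {} = cd_val Zero" if "X \<in> insert {} \<X>" for X
    unfolding cd_val_def using that by (subst it_eq_iff) (auto simp: it_ok_def)
  have top: "cd_top i \<in> insert {} \<X>" using ok by (simp add: it_ok_def)
  have ev: ?thesis if i: "i = Exit X u W" "exitp X u W" and j: "j = Vert Y" "Y \<in> \<X>" for X u W Y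
  proof (cases "ple X Y")
    case True
    then have "mt X Y = X" by (rule mt_ple)
    moreover have "starts X \<subseteq> starts Y" using ple_subset[OF True] by (simp add: starts_mono)
    ultimately have "cyl u W \<inter> starts (mt X Y) \<inter> starts Y = cyl u W" using lam_starts[OF exitp_lam[OF i(2)]] by auto
    then show ?thesis using m i j True by (simp add: cd_val_def cd_set_def)
  next
    case False
    then have "cyl u W \<inter> starts (mt X Y) \<inter> starts Y = {}" using exitp_starts_mt[OF i(2), of Y] by blast
    then show ?thesis using m i j False zero[OF top] by (simp add: cd_set_def)
  qed
  show ?thesis
    using assms(1)
  proof (cases rule: cd_set_cases)
    case 1
    then show ?thesis using m zero[OF top] by (simp add: cd_set_def)
  next
    case (2 X)
    show ?thesis
      using assms(2)
    proof (cases rule: cd_set_cases)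
      case 1
      then show ?thesis using m zero[OF top] 2 by (simp add: cd_set_def)
    next
      case v: (2 Y)
      let ?Z = "mt X Y"
      have "starts X \<inter> starts ?Z \<inter> starts Y = starts ?Z"
        using starts_mono[OF mt_subset(1)[of X Y]] starts_mono[OF mt_subset(2)[of X Y]] by blast
      then have p: "cd_val i \<odot>\<^bsub>SP\<^esub> cd_val j = it X (starts ?Z)" using m 2 v by simp
      show ?thesis
      proof (cases "?Z = {}")
        case True then show ?thesis using p zero[of X] 2 v by (simp add: cd_set_def)
      next
        case False
        then have Z: "?Z \<in> \<X>" "ple ?Z X" using mt_member[of X Y] unfolding mt_def by (auto split: if_splits)
        have "mt X ?Z = ?Z" using mt_ple[OF Z(2)] mt_commute by metis
        then have "it X (starts ?Z) = it ?Z (starts ?Z)"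
          using Z 2 starts_mono[OF mt_subset(1)] by (subst it_eq_iff) (auto simp: it_ok_def)
        then show ?thesis using p Z False 2 v by (simp add: cd_val_def cd_set_def)
      qed
    next
      case (3 Y u W)
      have "cd_val i \<odot>\<^bsub>SP\<^esub> cd_val j = cd_val j \<odot>\<^bsub>SP\<^esub> cd_val i"
        unfolding cd_val_def by (rule it_mult_commute[OF ok])
      moreover have "it (cd_top j) (cd_cyl j \<inter> starts (mt (cd_top j) (cd_top i)) \<inter> cd_cyl i) = cd_val j \<odot>\<^bsub>SP\<^esub> cd_val i"
        unfolding cd_val_def by (rule it_mult[OF ok(2,1), symmetric])
      ultimately have m': "cd_val i \<odot>\<^bsub>SP\<^esub> cd_val j = it Y (cyl u W \<inter> starts (mt Y X) \<inter> starts X)"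
        using 2 3 by simp
      have Y: "Y \<in> insert {} \<X>" using exitp_member 3 by blast
      show ?thesis
      proof (cases "ple Y X")
        case True
        then have "mt Y X = Y" by (rule mt_ple)
        moreover have "starts Y \<subseteq> starts X" using ple_subset[OF True] by (simp add: starts_mono)
        ultimately have "cyl u W \<inter> starts (mt Y X) \<inter> starts X = cyl u W" using lam_starts[OF exitp_lam[OF 3(2)]] by auto
        then show ?thesis using m' 2 3 True by (simp add: cd_val_def cd_set_def)
      next
        case False
        then have "cyl u W \<inter> starts (mt Y X) \<inter> starts X = {}" using exitp_starts_mt[OF 3(2), of X] by blast
        then show ?thesis using m' 2 3 False zero[OF Y] by (simp add: cd_set_def)
      qed
    qed
  next
    case (3 X u W)
    show ?thesis
      using assms(2)
    proof (cases rule: cd_set_cases)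
      case 1
      then show ?thesis using m zero[OF top] 3 by (simp add: cd_set_def)
    next
      case (2 Y) then show ?thesis using ev 3 by blast
    next
      case e: (3 Y t V)
      show ?thesis
      proof (cases "X = Y \<and> u = t \<and> W = V")
        case True
        have "mt X X = X" using mt_self exitp_member[OF 3(2)] by blast
        then have "cyl u W \<inter> starts (mt X X) \<inter> cyl u W = cyl u W" using lam_starts[OF exitp_lam[OF 3(2)]] by auto
        then show ?thesis using m 3 e True by (simp add: cd_val_def cd_set_def)
      next
        case False
        have "cyl u W \<inter> starts (mt X Y) \<inter> cyl t V = {}"
        proof (rule ccontr)
          assume ne: "cyl u W \<inter> starts (mt X Y) \<inter> cyl t V \<noteq> {}"
          have "ple X Y" using exitp_starts_mt[OF 3(2), of Y] ne by blast
          moreover have "ple Y X" using exitp_starts_mt[OF e(2), of X] ne mt_commute[of X Y] by auto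
          ultimately have "X = Y" by (rule ple_antisym)
          then show False using exitp_disjoint[OF 3(2)] e(2) ne False by blast
        qed
        moreover have "cd_mult i j = Zero" using 3 e False by auto
        ultimately show ?thesis using m 3(1) e(1) zero[OF top] by (simp add: cd_set_def)
      qed
    qed
  qed
qed


lemma nonzero_classes: "D_classes S - {zero_class S} = cls ` \<X>"
proof -
  have "cls {} \<notin> cls ` \<X>" using cls_nonzero zero_class_S by auto
  then show ?thesis unfolding D_classes_S zero_class_S by auto
qed

lemma verts_hull_graph: "verts (hull_graph A M) = cls ` \<X>"
  unfolding hull_graph_def Let_def by (simp add: nonzero_classes)

lemma inj_cls: "inj_on cls \<X>"
  using cls_inject by (auto simp: inj_on_def)

definition edge :: "'a set \<Rightarrow> 'a list \<Rightarrow> 'a set \<Rightarrow> 'a set \<Rightarrow>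
    ('a list \<rightharpoonup> 'a list) set \<times> ('a list \<rightharpoonup> 'a list) \<times> ('a list \<rightharpoonup> 'a list) set" where
  "edge X u W Y = (cls X, pid (cyl u W), cls Y)"

lemma edges_hull_graph:
  "edges (hull_graph A M) = {edge X u W Y |X u W Y. exitp X u W \<and> ple Y W}"
proof -
  have "x \<in> edges (hull_graph A M) \<longleftrightarrow> (\<exists>X u W Y. x = edge X u W Y \<and> exitp X u W \<and> ple Y W)" for x
  proof
    assume "x \<in> edges (hull_graph A M)"
    moreover obtain a f b where x0: "x = (a, f, b)" by (cases x)
    ultimately have x: "x = (a, f, b)" "a \<in> cls ` \<X>" "b \<in> cls ` \<X>" "exit_idem A M a f" "preceq S b (D_class S f)"
      unfolding hull_graph_def Let_def nonzero_classes by simp_all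
    then obtain X Y where XY: "a = cls X" "X \<in> \<X>" "b = cls Y" "Y \<in> \<X>" by blast
    then obtain u W where u: "f = pid (cyl u W)" "exitp X u W" using exit_idem_iff[of X f] x by auto
    have W: "W \<in> \<X>" "valid u W" using exitp_member[OF u(2)] lamD(3)[OF exitp_lam[OF u(2)]] by blast+
    have "ple Y W"
      using x(5) preceq_cls[of Y W] ple0_iff_ple[OF XY(4)] XY W(1) D_class_cyl[OF W(2)] u(1) by simp
    then show "\<exists>X u W Y. x = edge X u W Y \<and> exitp X u W \<and> ple Y W"
      using x XY u unfolding edge_def by blast
  next
    assume "\<exists>X u W Y. x = edge X u W Y \<and> exitp X u W \<and> ple Y W"
    then obtain X u W Y where x: "x = edge X u W Y" "exitp X u W" "ple Y W" by blast
    have m: "X \<in> \<X>" "W \<in> \<X>" "valid u W" "Y \<in> \<X>"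
      using exitp_member[OF x(2)] lamD(3)[OF exitp_lam[OF x(2)]] ple_subset[OF x(3)] by blast+
    have "exit_idem A M (cls X) (pid (cyl u W))" using exit_idem_iff[of X] m(1) x(2) by auto
    moreover have "preceq S (cls Y) (D_class S (pid (cyl u W)))"
      using preceq_cls[of Y W] ple0_iff_ple[OF m(4)] m x(3) D_class_cyl[OF m(3)] by simp
    ultimately show "x \<in> edges (hull_graph A M)"
      unfolding x edge_def hull_graph_def Let_def nonzero_classes using m by simp
  qed
  then show ?thesis by blast
qed

lemma edge_fields [simp]:
  "src (hull_graph A M) (edge X u W Y) = cls Y" "rng (hull_graph A M) (edge X u W Y) = cls X"
  "lab (hull_graph A M) (edge X u W Y) = (cls X, pid (cyl u W))"
  by (simp_all add: edge_def hull_graph_def Let_def)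

lemma alphabet_hull_graph:
  "alphabet (hull_graph A M) = {(cls X, pid (cyl u W)) |X u W. exitp X u W}"
proof -
  have "(cls X, pid (cyl u W)) \<in> alphabet (hull_graph A M)" if e: "exitp X u W" for X u W
  proof -
    have "edge X u W W \<in> edges (hull_graph A M)"
      unfolding edges_hull_graph using e ple_refl[of W] exitp_member[OF e] by blast
    then show ?thesis unfolding alphabet_def by (rule rev_image_eqI) simp
  qed
  moreover have "\<exists>X u W. l = (cls X, pid (cyl u W)) \<and> exitp X u W" if "l \<in> alphabet (hull_graph A M)" for l
    using that unfolding alphabet_def edges_hull_graph by (elim imageE CollectE exE conjE) auto
  ultimately show ?thesis by blast
qed

lemma label_inject:
  assumes "exitp X u W" "exitp Y t V" "(cls X, pid (cyl u W)) = (cls Y, pid (cyl t V))"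
  shows "X = Y \<and> u = t \<and> W = V"
proof -
  have "X = Y" using assms exitp_member cls_inject[of X Y] by simp
  moreover have "u = t \<and> W = V"
    using cyl_inject[OF lamD(3)[OF exitp_lam[OF assms(1)]] lamD(3)[OF exitp_lam[OF assms(2)]]] assms(3) by simp
  ultimately show ?thesis by simp
qed

lemma exitp_word: "exitp X u W \<Longrightarrow> u \<in> insert [] ((\<lambda>x. [x]) ` A)"
  using \<X>_subset exitp_member by (blast elim: exitp_cases)

lemma finite_exits: "finite {u. exitp X u W}"
  by (rule finite_subset[of _ "insert [] ((\<lambda>x. [x]) ` A)"]) (use exitp_word finite_A in auto)

lemma cd_mult_left_fixed:
  assumes "i \<in> cd_set"
  shows "cd_mult i (Vert Y) = i \<longleftrightarrow> i = Zero \<or> ple (cd_top i) Y"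
  using assms
proof (cases rule: cd_set_cases)
  case (2 X)
  then show ?thesis using mt_eq_iff[of X Y] nonempty_member[of X] by auto
qed auto

text \<open>The order of \<open>CD\<close> separates \<open>\<C>\<close> from \<open>\<C>\<^sup>\<lless>\<close>: the exits are the atoms, whereas below a vertex
  there is always an exit or a smaller vertex.\<close>

lemma vert_iff_not_atom:
  assumes "i \<in> cd_set" "i \<noteq> Zero"
  shows "(\<exists>j\<in>cd_set. j \<noteq> Zero \<and> j \<noteq> i \<and> cd_mult j i = j) \<longleftrightarrow> (\<exists>X. i = Vert X)"
  using assms(1)
proof (cases rule: cd_set_cases)
  case 1 then show ?thesis using assms(2) by simp
next
  case (2 X)
  have "\<exists>j\<in>cd_set. j \<noteq> Zero \<and> j \<noteq> i \<and> cd_mult j i = j"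
  proof (cases "\<exists>u W. exitp X u W")
    case True
    then obtain u W where e: "exitp X u W" by blast
    then show ?thesis using 2 ple_refl by (intro bexI[of _ "Exit X u W"]) (auto simp: cd_set_def)
  next
    case False
    then obtain Y where Y: "ple Y X" "Y \<noteq> X" using exitp_or_below 2 by blast
    then have "mt Y X = Y" "Y \<in> \<X>" "Y \<noteq> {}"
      using mt_ple[OF Y(1)] ple_subset[OF Y(1)] nonempty_member[of Y] by simp_all
    then show ?thesis using 2 Y by (intro bexI[of _ "Vert Y"]) (auto simp: cd_set_def)
  qed
  then show ?thesis using 2 by blast
next
  case (3 X u W)
  have "\<not> (\<exists>j\<in>cd_set. j \<noteq> Zero \<and> j \<noteq> i \<and> cd_mult j i = j)"
  proof
    assume "\<exists>j\<in>cd_set. j \<noteq> Zero \<and> j \<noteq> i \<and> cd_mult j i = j"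
    then obtain j where j: "j \<in> cd_set" "j \<noteq> Zero" "j \<noteq> i" "cd_mult j i = j" by blast
    then show False using 3 by (cases j) (auto split: if_splits)
  qed
  then show ?thesis using 3 by blast
qed

end

section \<open>Combinatorial isomorphisms\<close>

locale two_shifts = S: markov_shift A M + T: markov_shift B N
  for A :: "'a set" and M :: "'a \<Rightarrow> 'a \<Rightarrow> nat" and B :: "'b set" and N :: "'b \<Rightarrow> 'b \<Rightarrow> nat"
begin

text \<open>To this each of the three conditions of the theorem is reduced: an order isomorphism of the
  nonzero classes that preserves the number of exits from each class to each class.\<close>

definition comb_iso :: "('a set \<Rightarrow> 'b set) \<Rightarrow> ('a set \<Rightarrow> 'a set \<Rightarrow> 'a list \<Rightarrow> 'b list) \<Rightarrow> bool" where
  "comb_iso \<phi> g \<longleftrightarrow> bij_betw \<phi> S.\<X> T.\<X> \<and>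
     (\<forall>X\<in>S.\<X>. \<forall>Y\<in>S.\<X>. S.ple X Y \<longleftrightarrow> T.ple (\<phi> X) (\<phi> Y)) \<and>
     (\<forall>X\<in>S.\<X>. \<forall>W\<in>S.\<X>. bij_betw (g X W) {u. S.exitp X u W} {u. T.exitp (\<phi> X) u (\<phi> W)})"

lemma comb_isoD:
  assumes "comb_iso \<phi> g"
  shows "bij_betw \<phi> S.\<X> T.\<X>"
    and "X \<in> S.\<X> \<Longrightarrow> Y \<in> S.\<X> \<Longrightarrow> S.ple X Y \<longleftrightarrow> T.ple (\<phi> X) (\<phi> Y)"
    and "X \<in> S.\<X> \<Longrightarrow> W \<in> S.\<X> \<Longrightarrow> bij_betw (g X W) {u. S.exitp X u W} {u. T.exitp (\<phi> X) u (\<phi> W)}"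
  using assms unfolding comb_iso_def by blast+

lemma comb_iso_obj:
  assumes ci: "comb_iso \<phi> g" and X: "X \<in> S.\<X>"
  shows "\<phi> X \<in> T.\<X>" and "Y \<in> S.\<X> \<Longrightarrow> \<phi> X = \<phi> Y \<longleftrightarrow> X = Y"
  using comb_isoD(1)[OF ci] X by (auto simp: bij_betw_def inj_on_def)

lemma comb_iso_surj: "comb_iso \<phi> g \<Longrightarrow> X' \<in> T.\<X> \<Longrightarrow> \<exists>X\<in>S.\<X>. X' = \<phi> X"
  using comb_isoD(1)[of \<phi> g] by (auto simp: bij_betw_def)

lemma comb_iso_exit:
  assumes ci: "comb_iso \<phi> g" and e: "S.exitp X u W" shows "T.exitp (\<phi> X) (g X W u) (\<phi> W)"
  using bij_betwE[OF comb_isoD(3)[OF ci]] S.exitp_member[OF e] e by blast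

lemma comb_iso_exit_surj:
  assumes ci: "comb_iso \<phi> g" and e: "T.exitp X' u' W'"
  shows "\<exists>X u W. S.exitp X u W \<and> X' = \<phi> X \<and> u' = g X W u \<and> W' = \<phi> W"
proof -
  obtain X W where X: "X \<in> S.\<X>" "X' = \<phi> X" "W \<in> S.\<X>" "W' = \<phi> W"
    using T.exitp_member[OF e] comb_iso_surj[OF ci, of X'] comb_iso_surj[OF ci, of W'] by blast
  then have "u' \<in> g X W ` {u. S.exitp X u W}"
    using bij_betw_imp_surj_on[OF comb_isoD(3)[OF ci, of X W]] e by simp
  then show ?thesis using X by blast
qed

lemma comb_iso_exit_inject:
  assumes ci: "comb_iso \<phi> g" and e: "S.exitp X u W" "S.exitp Y t V"
    and eq: "\<phi> X = \<phi> Y" "g X W u = g Y V t" "\<phi> W = \<phi> V"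
  shows "X = Y \<and> u = t \<and> W = V"
proof -
  have m: "X \<in> S.\<X>" "W \<in> S.\<X>" using S.exitp_member[OF e(1)] by blast+
  have "X = Y" "W = V" using comb_iso_obj(2)[OF ci] m S.exitp_member[OF e(2)] eq by blast+
  then show ?thesis using e eq comb_isoD(3)[OF ci m] by (auto simp: bij_betw_def inj_on_def)
qed

definition cd_iso :: "('a cd \<Rightarrow> 'b cd) \<Rightarrow> bool" where
  "cd_iso \<rho> \<longleftrightarrow> bij_betw \<rho> S.cd_set T.cd_set \<and>
     (\<forall>i\<in>S.cd_set. \<forall>j\<in>S.cd_set. \<rho> (S.cd_mult i j) = T.cd_mult (\<rho> i) (\<rho> j)) \<and>
     (\<forall>i\<in>S.cd_set. \<forall>j\<in>S.cd_set. S.cd_class i = S.cd_class j \<longleftrightarrow> T.cd_class (\<rho> i) = T.cd_class (\<rho> j))"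

lemma bij_S: "bij_betw S.cd_val S.cd_set (CD_carrier A M)"
  unfolding bij_betw_def S.CD_carrier_eq using S.inj_cd_val by simp

lemma bij_T: "bij_betw T.cd_val T.cd_set (CD_carrier B N)"
  unfolding bij_betw_def T.CD_carrier_eq using T.inj_cd_val by simp

lemma CD_iso_cd_iso: "(\<exists>\<pi>. D_preserving_CD_iso A M B N \<pi>) \<longleftrightarrow> (\<exists>\<rho>. cd_iso \<rho>)"
proof
  let ?iS = "inv_into S.cd_set S.cd_val" and ?iT = "inv_into T.cd_set T.cd_val"
  have CD: "carrier (CD A M) = CD_carrier A M" "mult (CD A M) = mult S.SP"
    "carrier (CD B N) = CD_carrier B N" "mult (CD B N) = mult T.SP"
    by (simp_all add: CD_def)
  {
    assume "\<exists>\<pi>. D_preserving_CD_iso A M B N \<pi>"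
    then obtain \<pi> where b: "bij_betw \<pi> (CD_carrier A M) (CD_carrier B N)"
      and m: "\<And>x y. x \<in> CD_carrier A M \<Longrightarrow> y \<in> CD_carrier A M \<Longrightarrow> \<pi> (x \<odot>\<^bsub>S.SP\<^esub> y) = \<pi> x \<odot>\<^bsub>T.SP\<^esub> \<pi> y"
      and d: "\<And>x y. x \<in> CD_carrier A M \<Longrightarrow> y \<in> CD_carrier A M \<Longrightarrow> green_D S.SP x y \<longleftrightarrow> green_D T.SP (\<pi> x) (\<pi> y)"
      unfolding D_preserving_CD_iso_def sgrp_iso_def CD by blast
    define \<rho> where "\<rho> = ?iT \<circ> (\<pi> \<circ> S.cd_val)"
    have bb: "bij_betw (\<pi> \<circ> S.cd_val) S.cd_set (CD_carrier B N)" by (rule bij_betw_trans[OF bij_S b])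
    have b\<rho>: "bij_betw \<rho> S.cd_set T.cd_set" unfolding \<rho>_def by (rule bij_betw_trans[OF bb bij_betw_inv_into[OF bij_T]])
    have v: "T.cd_val (\<rho> i) = \<pi> (S.cd_val i)" if "i \<in> S.cd_set" for i
    proof -
      have "\<pi> (S.cd_val i) \<in> T.cd_val ` T.cd_set"
        using bij_betwE[OF bb] that T.CD_carrier_eq by auto
      then show ?thesis unfolding \<rho>_def by (simp add: f_inv_into_f)
    qed
    have inT: "\<rho> i \<in> T.cd_set" if "i \<in> S.cd_set" for i using bij_betwE[OF b\<rho>] that by blast
    have inC: "S.cd_val i \<in> CD_carrier A M" if "i \<in> S.cd_set" for i using S.CD_carrier_eq that by simp
    have "\<rho> (S.cd_mult i j) = T.cd_mult (\<rho> i) (\<rho> j)" if ij: "i \<in> S.cd_set" "j \<in> S.cd_set" for i j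
    proof -
      note M = S.cd_mult_val[OF ij] T.cd_mult_val[OF inT[OF ij(1)] inT[OF ij(2)]]
      have "T.cd_val (\<rho> (S.cd_mult i j)) = \<pi> (S.cd_val i \<odot>\<^bsub>S.SP\<^esub> S.cd_val j)" using v M by simp
      also have "\<dots> = T.cd_val (T.cd_mult (\<rho> i) (\<rho> j))" using m[OF inC[OF ij(1)] inC[OF ij(2)]] v[OF ij(1)] v[OF ij(2)] M(2) by simp
      finally show ?thesis using inj_onD[OF T.inj_cd_val] inT M by blast
    qed
    moreover have "S.cd_class i = S.cd_class j \<longleftrightarrow> T.cd_class (\<rho> i) = T.cd_class (\<rho> j)"
      if ij: "i \<in> S.cd_set" "j \<in> S.cd_set" for i j
      using d[OF inC inC, OF ij] S.green_D_cd[OF ij] T.green_D_cd[OF inT inT, OF ij] v ij by simp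
    ultimately show "\<exists>\<rho>. cd_iso \<rho>" unfolding cd_iso_def using b\<rho> by blast
  next
    assume "\<exists>\<rho>. cd_iso \<rho>"
    then obtain \<rho> where b: "bij_betw \<rho> S.cd_set T.cd_set"
      and m: "\<And>i j. i \<in> S.cd_set \<Longrightarrow> j \<in> S.cd_set \<Longrightarrow> \<rho> (S.cd_mult i j) = T.cd_mult (\<rho> i) (\<rho> j)"
      and d: "\<And>i j. i \<in> S.cd_set \<Longrightarrow> j \<in> S.cd_set \<Longrightarrow> S.cd_class i = S.cd_class j \<longleftrightarrow> T.cd_class (\<rho> i) = T.cd_class (\<rho> j)"
      unfolding cd_iso_def by blast
    define \<pi> where "\<pi> = T.cd_val \<circ> (\<rho> \<circ> ?iS)"
    have b\<pi>: "bij_betw \<pi> (CD_carrier A M) (CD_carrier B N)"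
      unfolding \<pi>_def by (rule bij_betw_trans[OF bij_betw_trans[OF bij_betw_inv_into[OF bij_S] b] bij_T])
    have v: "\<pi> (S.cd_val i) = T.cd_val (\<rho> i)" if "i \<in> S.cd_set" for i
      unfolding \<pi>_def using that S.inj_cd_val by simp
    have inT: "\<rho> i \<in> T.cd_set" if "i \<in> S.cd_set" for i using bij_betwE[OF b] that by blast
    have "\<pi> (x \<odot>\<^bsub>S.SP\<^esub> y) = \<pi> x \<odot>\<^bsub>T.SP\<^esub> \<pi> y \<and> (green_D S.SP x y \<longleftrightarrow> green_D T.SP (\<pi> x) (\<pi> y))"
      if xy: "x \<in> CD_carrier A M" "y \<in> CD_carrier A M" for x y
    proof -
      obtain i j where ij: "i \<in> S.cd_set" "j \<in> S.cd_set" "x = S.cd_val i" "y = S.cd_val j"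
        using xy unfolding S.CD_carrier_eq by blast
      show ?thesis
        using S.cd_mult_val[OF ij(1,2)] T.cd_mult_val[OF inT inT, OF ij(1,2)] v ij m d
          S.green_D_cd[OF ij(1,2)] T.green_D_cd[OF inT inT, OF ij(1,2)] by simp
    qed
    then show "\<exists>\<pi>. D_preserving_CD_iso A M B N \<pi>"
      unfolding D_preserving_CD_iso_def sgrp_iso_def CD using b\<pi> by blast
  }
qed

text \<open>The multiplication table of \<open>CD\<close> mentions only the order and equality of exits.\<close>

lemma comb_iso_cd_iso:
  assumes ci: "comb_iso \<phi> g" shows "\<exists>\<rho>. cd_iso \<rho>"
proof -
  note b\<phi> = comb_isoD(1)[OF ci] and le = comb_isoD(2)[OF ci] and bg = comb_isoD(3)[OF ci]
  note inj\<phi> = comb_iso_obj(2)[OF ci] and in\<phi> = comb_iso_obj(1)[OF ci] and ex = comb_iso_exit[OF ci]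
    and ex' = comb_iso_exit_surj[OF ci] and einj = comb_iso_exit_inject[OF ci]
  define \<rho> where "\<rho> = (\<lambda>i. case i of Zero \<Rightarrow> Zero | Vert X \<Rightarrow> Vert (\<phi> X) | Exit X u W \<Rightarrow> Exit (\<phi> X) (g X W u) (\<phi> W))"
  have \<rho>: "\<rho> Zero = Zero" "\<rho> (Vert X) = Vert (\<phi> X)" "\<rho> (Exit X u W) = Exit (\<phi> X) (g X W u) (\<phi> W)" for X u W
    by (simp_all add: \<rho>_def)
  have inj: "inj_on \<rho> S.cd_set"
    by (rule inj_onI, elim S.cd_set_cases) (auto simp: \<rho> inj\<phi> dest: einj)
  have img: "\<rho> ` S.cd_set = T.cd_set"
  proof
    show "\<rho> ` S.cd_set \<subseteq> T.cd_set"
      using in\<phi> ex unfolding S.cd_set_def T.cd_set_def by (auto simp: \<rho>)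
    show "T.cd_set \<subseteq> \<rho> ` S.cd_set"
    proof
      fix j assume "j \<in> T.cd_set"
      then show "j \<in> \<rho> ` S.cd_set"
      proof (cases rule: T.cd_set_cases)
        case 1 then show ?thesis by (intro image_eqI[of _ _ Zero]) (auto simp: \<rho> S.cd_set_def)
      next
        case (2 X')
        then obtain X where "X \<in> S.\<X>" "X' = \<phi> X" using b\<phi> by (auto simp: bij_betw_def)
        then show ?thesis using 2 by (intro image_eqI[of _ _ "Vert X"]) (auto simp: \<rho> S.cd_set_def)
      next
        case (3 X' u' W')
        obtain X u W where X: "S.exitp X u W" "X' = \<phi> X" "u' = g X W u" "W' = \<phi> W" using ex'[OF 3(2)] by blast
        then show ?thesis using 3 X by (intro image_eqI[of _ _ "Exit X u W"]) (auto simp: \<rho> S.cd_set_def)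
      qed
    qed
  qed
  have mt: "if S.mt X Y = {} then T.mt (\<phi> X) (\<phi> Y) = {} else T.mt (\<phi> X) (\<phi> Y) = \<phi> (S.mt X Y)"
    if XY: "X \<in> S.\<X>" "Y \<in> S.\<X>" for X Y
  proof (cases "S.mt X Y = {}")
    case True
    have "T.mt (\<phi> X) (\<phi> Y) = {}"
    proof (rule ccontr)
      assume ne: "T.mt (\<phi> X) (\<phi> Y) \<noteq> {}"
      then have Z: "T.ple (T.mt (\<phi> X) (\<phi> Y)) (\<phi> X)" "T.ple (T.mt (\<phi> X) (\<phi> Y)) (\<phi> Y)"
        unfolding T.mt_def by (auto split: if_splits)
      then have "T.mt (\<phi> X) (\<phi> Y) \<in> \<phi> ` S.\<X>" using T.ple_subset b\<phi> unfolding bij_betw_def by blast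
      then obtain Z where "Z \<in> S.\<X>" "T.mt (\<phi> X) (\<phi> Y) = \<phi> Z" by blast
      then have "S.ple Z X" "S.ple Z Y" "Z \<noteq> {}" using le XY Z S.nonempty_member by auto
      then have "Z \<subseteq> S.mt X Y" using S.mt_greatest[of Z X Y] S.ple_subset by auto
      then show False using True \<open>Z \<noteq> {}\<close> by blast
    qed
    then show ?thesis using True by simp
  next
    case False
    then have Z: "S.ple (S.mt X Y) X" "S.ple (S.mt X Y) Y" unfolding S.mt_def by (auto split: if_splits)
    then have m: "S.mt X Y \<in> S.\<X>" using S.ple_subset by blast
    then have l: "T.ple (\<phi> (S.mt X Y)) (\<phi> X)" "T.ple (\<phi> (S.mt X Y)) (\<phi> Y)" using Z le XY by blast+
    note G = T.mt_greatest[OF l]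
    let ?m = "T.mt (\<phi> X) (\<phi> Y)"
    have t: "T.ple (\<phi> (S.mt X Y)) ?m" using G by simp
    then have "?m \<in> T.\<X>" "?m \<noteq> {}" using T.ple_subset T.nonempty_member by blast+
    then have tt: "T.ple ?m (\<phi> X)" "T.ple ?m (\<phi> Y)" unfolding T.mt_def by (auto split: if_splits)
    obtain Z where Zm: "Z \<in> S.\<X>" "?m = \<phi> Z" using \<open>?m \<in> T.\<X>\<close> b\<phi> unfolding bij_betw_def by blast
    then have "S.ple Z X" "S.ple Z Y" using le XY tt by simp_all
    then have "S.ple Z (S.mt X Y)" using S.mt_greatest[of Z X Y] by simp
    then have "T.ple ?m (\<phi> (S.mt X Y))" using le Zm m by simp
    then show ?thesis using T.ple_antisym t False by simp
  qed
  have mult: "\<rho> (S.cd_mult i j) = T.cd_mult (\<rho> i) (\<rho> j)" if "i \<in> S.cd_set" "j \<in> S.cd_set" for i j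
    using that
  proof (elim S.cd_set_cases)
    fix X Y assume a: "i = Vert X" "X \<in> S.\<X>" "j = Vert Y" "Y \<in> S.\<X>"
    show ?thesis using mt[OF a(2,4)] T.nonempty_member[OF in\<phi>] S.mt_member[of X Y] a
      by (auto simp: \<rho> split: if_splits)
  next
    fix X u W Y t V assume a: "i = Exit X u W" "S.exitp X u W" "j = Exit Y t V" "S.exitp Y t V"
    show ?thesis
      using einj[OF a(2,4)] a(1,3) by (auto simp: \<rho>)
  qed (auto simp: \<rho> le dest: S.exitp_member)
  have cl: "S.cd_class i = S.cd_class j \<longleftrightarrow> T.cd_class (\<rho> i) = T.cd_class (\<rho> j)"
    if "i \<in> S.cd_set" "j \<in> S.cd_set" for i j
  proof -
    have c: "S.cd_class i \<in> insert {} S.\<X> \<and> T.cd_class (\<rho> i) = (if S.cd_class i = {} then {} else \<phi> (S.cd_class i))"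
      if "i \<in> S.cd_set" for i
      using that
    proof (cases rule: S.cd_set_cases)
      case (2 X) then show ?thesis using S.nonempty_member by (auto simp: \<rho>)
    next
      case (3 X u W) then show ?thesis using S.nonempty_member S.exitp_member by (auto simp: \<rho>)
    qed (simp add: \<rho>)
    have ne: "\<phi> X \<noteq> {}" if "X \<in> S.\<X>" for X using T.nonempty_member[OF in\<phi>[OF that]] .
    show ?thesis
      using c[OF that(1)] c[OF that(2)] inj\<phi> ne[of "S.cd_class i"] ne[of "S.cd_class j"]
      by (cases "S.cd_class i = {}"; cases "S.cd_class j = {}") auto
  qed
  show ?thesis unfolding cd_iso_def bij_betw_def using inj img mult cl by blast
qed

text \<open>Vertices go to vertices since exits are atoms.  An exit of \<open>X\<close> lies below the vertex \<open>Y\<close> iff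
  \<open>X \<preceq> Y\<close>, which recovers \<open>X\<close>; and the class of an exit is found as the vertex in the same
  \<open>\<D>\<close>-class.\<close>

lemma cd_iso_comb_iso:
  assumes "cd_iso \<rho>" shows "\<exists>\<phi> g. comb_iso \<phi> g"
proof -
  from assms have b: "bij_betw \<rho> S.cd_set T.cd_set"
    and m: "\<And>i j. i \<in> S.cd_set \<Longrightarrow> j \<in> S.cd_set \<Longrightarrow> \<rho> (S.cd_mult i j) = T.cd_mult (\<rho> i) (\<rho> j)"
    and d: "\<And>i j. i \<in> S.cd_set \<Longrightarrow> j \<in> S.cd_set \<Longrightarrow> S.cd_class i = S.cd_class j \<longleftrightarrow> T.cd_class (\<rho> i) = T.cd_class (\<rho> j)"
    unfolding cd_iso_def by blast+
  have inT: "\<rho> i \<in> T.cd_set" if "i \<in> S.cd_set" for i using bij_betwE[OF b] that by blast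
  have inj: "\<rho> i = \<rho> j \<longleftrightarrow> i = j" if "i \<in> S.cd_set" "j \<in> S.cd_set" for i j
    using b that by (meson bij_betw_imp_inj_on inj_on_eq_iff)
  have surj: "\<exists>i\<in>S.cd_set. \<rho> i = j" if "j \<in> T.cd_set" for j
    using that unfolding bij_betw_imp_surj_on[OF b, symmetric] by blast
  have Z: "Zero \<in> S.cd_set" "Zero \<in> T.cd_set" by (simp_all add: S.cd_set_def T.cd_set_def)
  have zero: "\<rho> Zero = Zero"
  proof -
    obtain i where i: "i \<in> S.cd_set" "\<rho> i = Zero" using surj[OF Z(2)] by blast
    have "T.cd_mult x Zero = Zero" for x by (cases x) auto
    then show ?thesis using m[OF Z(1) i(1)] i(2) by simp
  qed
  have vert: "(\<exists>X. i = Vert X) \<longleftrightarrow> (\<exists>X. \<rho> i = Vert X)" if i: "i \<in> S.cd_set" for i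
  proof (cases "i = Zero")
    case True then show ?thesis using zero by simp
  next
    case False
    have z: "\<rho> j = Zero \<longleftrightarrow> j = Zero" if "j \<in> S.cd_set" for j using inj[OF that Z(1)] zero by simp
    have f: "T.cd_mult (\<rho> j) (\<rho> i) = \<rho> j \<longleftrightarrow> S.cd_mult j i = j" if "j \<in> S.cd_set" for j
      using m[OF that i] inj[of "S.cd_mult j i" j] S.cd_mult_val[OF that i] that by simp
    have "(\<exists>j\<in>S.cd_set. j \<noteq> Zero \<and> j \<noteq> i \<and> S.cd_mult j i = j) \<longleftrightarrow>
      (\<exists>j\<in>S.cd_set. \<rho> j \<noteq> Zero \<and> \<rho> j \<noteq> \<rho> i \<and> T.cd_mult (\<rho> j) (\<rho> i) = \<rho> j)"
      using z f inj[OF _ i] by blast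
    also have "\<dots> \<longleftrightarrow> (\<exists>j\<in>T.cd_set. j \<noteq> Zero \<and> j \<noteq> \<rho> i \<and> T.cd_mult j (\<rho> i) = j)"
      using surj inT by metis
    finally show ?thesis
      using S.vert_iff_not_atom[OF i False] T.vert_iff_not_atom[OF inT[OF i]] z[OF i] False by simp
  qed
  define \<phi> where "\<phi> X = T.cd_class (\<rho> (Vert X))" for X
  have VS: "Vert X \<in> S.cd_set \<longleftrightarrow> X \<in> S.\<X>" for X by (auto simp: S.cd_set_def)
  have VT: "Vert X \<in> T.cd_set \<longleftrightarrow> X \<in> T.\<X>" for X by (auto simp: T.cd_set_def)
  have ES: "Exit X u W \<in> S.cd_set \<longleftrightarrow> S.exitp X u W" for X u W by (auto simp: S.cd_set_def)
  have ET: "Exit X u W \<in> T.cd_set \<longleftrightarrow> T.exitp X u W" for X u W by (auto simp: T.cd_set_def)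
  have \<rho>V: "\<rho> (Vert X) = Vert (\<phi> X) \<and> \<phi> X \<in> T.\<X>" if "X \<in> S.\<X>" for X
    using vert[of "Vert X"] inT[of "Vert X"] that VS VT unfolding \<phi>_def by auto
  have inj\<phi>: "\<phi> X = \<phi> Y \<longleftrightarrow> X = Y" if "X \<in> S.\<X>" "Y \<in> S.\<X>" for X Y
    using inj[of "Vert X" "Vert Y"] \<rho>V that VS by simp
  have b\<phi>: "bij_betw \<phi> S.\<X> T.\<X>"
    unfolding bij_betw_def
  proof
    show "inj_on \<phi> S.\<X>" using inj\<phi> by (simp add: inj_on_def)
    show "\<phi> ` S.\<X> = T.\<X>"
    proof
      show "T.\<X> \<subseteq> \<phi> ` S.\<X>"
      proof
        fix X' assume "X' \<in> T.\<X>"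
        then obtain i where i: "i \<in> S.cd_set" "\<rho> i = Vert X'" using surj[of "Vert X'"] VT by blast
        then obtain X where "i = Vert X" using vert[OF i(1)] by blast
        then show "X' \<in> \<phi> ` S.\<X>" using i VS unfolding \<phi>_def by (auto intro!: image_eqI[of _ _ X])
      qed
    qed (use \<rho>V in blast)
  qed
  have fixed: "S.cd_mult i (Vert Y) = i \<longleftrightarrow> T.cd_mult (\<rho> i) (Vert (\<phi> Y)) = \<rho> i"
    if "i \<in> S.cd_set" "Y \<in> S.\<X>" for i Y
    using m[of i "Vert Y"] inj[of "S.cd_mult i (Vert Y)" i] S.cd_mult_val[of i "Vert Y"] that VS \<rho>V by simp
  have below: "S.ple (S.cd_top i) Y \<longleftrightarrow> T.ple (T.cd_top (\<rho> i)) (\<phi> Y)"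
    if i: "i \<in> S.cd_set" "i \<noteq> Zero" and Y: "Y \<in> S.\<X>" for i Y
    using fixed[OF i(1) Y] S.cd_mult_left_fixed[OF i(1)] T.cd_mult_left_fixed[OF inT[OF i(1)]] i(2)
      inj[OF i(1) Z(1)] zero by simp
  have le: "S.ple X Y \<longleftrightarrow> T.ple (\<phi> X) (\<phi> Y)" if "X \<in> S.\<X>" "Y \<in> S.\<X>" for X Y
    using below[of "Vert X" Y] that VS \<rho>V by simp
  define g where "g X W u = (case \<rho> (Exit X u W) of Exit X' u' W' \<Rightarrow> u' | _ \<Rightarrow> [])" for X W u
  have \<rho>E: "\<rho> (Exit X u W) = Exit (\<phi> X) (g X W u) (\<phi> W)" if e: "S.exitp X u W" for X u W
  proof -
    have i: "Exit X u W \<in> S.cd_set" using e ES by blast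
    have XW: "X \<in> S.\<X>" "W \<in> S.\<X>" using S.exitp_member[OF e] by blast+
    have "\<rho> (Exit X u W) \<noteq> Zero" using inj[OF i Z(1)] zero by simp
    moreover have "\<nexists>X'. \<rho> (Exit X u W) = Vert X'" using vert[OF i] by simp
    ultimately obtain X' u' W' where eq: "\<rho> (Exit X u W) = Exit X' u' W'" by (cases "\<rho> (Exit X u W)") auto
    have X': "X' \<in> T.\<X>" using T.exitp_member ET inT[OF i] eq by metis
    have bel: "S.ple X Y \<longleftrightarrow> T.ple X' (\<phi> Y)" if "Y \<in> S.\<X>" for Y using below[OF i _ that] eq by simp
    obtain Y where Y: "Y \<in> S.\<X>" "X' = \<phi> Y" using X' b\<phi> unfolding bij_betw_def by blast
    have "T.ple X' (\<phi> X)" using bel[OF XW(1)] S.ple_refl XW by blast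
    moreover have "T.ple (\<phi> X) X'" using bel[OF Y(1)] T.ple_refl[OF X'] le[OF XW(1) Y(1)] Y(2) by simp
    ultimately have "X' = \<phi> X" by (rule T.ple_antisym)
    moreover have "W' = \<phi> W" using d[OF i, of "Vert W"] VS XW eq \<rho>V[OF XW(2)] by simp
    ultimately show ?thesis unfolding g_def eq by simp
  qed
  have bg: "bij_betw (g X W) {u. S.exitp X u W} {u. T.exitp (\<phi> X) u (\<phi> W)}" if XW: "X \<in> S.\<X>" "W \<in> S.\<X>" for X W
    unfolding bij_betw_def
  proof
    show "inj_on (g X W) {u. S.exitp X u W}"
    proof (rule inj_onI)
      fix u t assume "u \<in> {u. S.exitp X u W}" "t \<in> {u. S.exitp X u W}" "g X W u = g X W t"
      then show "u = t" using \<rho>E[of X u W] \<rho>E[of X t W] inj[of "Exit X u W" "Exit X t W"] ES by simp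
    qed
    show "g X W ` {u. S.exitp X u W} = {u. T.exitp (\<phi> X) u (\<phi> W)}"
    proof
      show "g X W ` {u. S.exitp X u W} \<subseteq> {u. T.exitp (\<phi> X) u (\<phi> W)}"
      proof
        fix u' assume "u' \<in> g X W ` {u. S.exitp X u W}"
        then obtain u where "S.exitp X u W" "u' = g X W u" by blast
        then show "u' \<in> {u. T.exitp (\<phi> X) u (\<phi> W)}" using \<rho>E[of X u W] inT[of "Exit X u W"] ES ET by simp
      qed
      show "{u. T.exitp (\<phi> X) u (\<phi> W)} \<subseteq> g X W ` {u. S.exitp X u W}"
      proof
        fix u' assume "u' \<in> {u. T.exitp (\<phi> X) u (\<phi> W)}"
        then obtain i where i: "i \<in> S.cd_set" "\<rho> i = Exit (\<phi> X) u' (\<phi> W)"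
          using surj[of "Exit (\<phi> X) u' (\<phi> W)"] ET by blast
        show "u' \<in> g X W ` {u. S.exitp X u W}"
          using i(1)
        proof (cases rule: S.cd_set_cases)
          case 1 then show ?thesis using i zero by simp
        next
          case (2 Y) then show ?thesis using i \<rho>V by simp
        next
          case (3 Y t V)
          then have "\<phi> Y = \<phi> X" "g Y V t = u'" "\<phi> V = \<phi> W" using \<rho>E[OF 3(2)] i by simp_all
          moreover have "Y \<in> S.\<X>" "V \<in> S.\<X>" using S.exitp_member[OF 3(2)] by blast+
          ultimately have "Y = X" "V = W" using inj\<phi> XW by blast+
          then show ?thesis using 3(2) \<open>g Y V t = u'\<close> by blast
        qed
      qed
    qed
  qed
  show ?thesis unfolding comb_iso_def using b\<phi> le bg by blast
qed

definition graph_iso_cond :: bool where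
  "graph_iso_cond \<longleftrightarrow> (\<exists>\<pi>\<^sub>0 \<pi>\<^sub>1 \<pi>\<^sub>2. lgraph_iso (hull_graph A M) (hull_graph B N) \<pi>\<^sub>0 \<pi>\<^sub>1 \<pi>\<^sub>2 \<and>
        order_iso_on (verts (hull_graph A M)) (preceq S.S) (verts (hull_graph B N)) (preceq T.S) \<pi>\<^sub>0)"

text \<open>Edges with label \<open>(X, u, W)\<close> correspond to the classes \<open>Y \<preceq> W\<close>, so an edge map is obtained
  from the maps of exits and of classes.\<close>

lemma comb_iso_graph:
  assumes ci: "comb_iso \<phi> g" shows graph_iso_cond
proof -
  note b\<phi> = comb_isoD(1)[OF ci] and le = comb_isoD(2)[OF ci] and bg = comb_isoD(3)[OF ci]
  note inj\<phi> = comb_iso_obj(2)[OF ci] and in\<phi> = comb_iso_obj(1)[OF ci] and ex = comb_iso_exit[OF ci]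
    and ex' = comb_iso_exit_surj[OF ci] and einj = comb_iso_exit_inject[OF ci]
  define dec where "dec l = (SOME p. case p of (X, u, W) \<Rightarrow> S.exitp X u W \<and> l = (S.cls X, pid (S.cyl u W)))" for l
  have dec: "dec (S.cls X, pid (S.cyl u W)) = (X, u, W)" if e: "S.exitp X u W" for X u W
  proof -
    let ?l = "(S.cls X, pid (S.cyl u W))"
    obtain Y t V where p: "dec ?l = (Y, t, V)" by (cases "dec ?l")
    have "case dec ?l of (Y, t, V) \<Rightarrow> S.exitp Y t V \<and> ?l = (S.cls Y, pid (S.cyl t V))"
      unfolding dec_def by (rule someI[of _ "(X, u, W)"]) (simp add: e)
    then have "S.exitp Y t V" "?l = (S.cls Y, pid (S.cyl t V))" unfolding p by simp_all
    then show ?thesis using S.label_inject[OF e] p by blast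
  qed
  define \<pi>\<^sub>0 where "\<pi>\<^sub>0 = T.cls \<circ> (\<phi> \<circ> inv_into S.\<X> S.cls)"
  define \<pi>\<^sub>2 where "\<pi>\<^sub>2 l = (case dec l of (X, u, W) \<Rightarrow> (T.cls (\<phi> X), pid (T.cyl (g X W u) (\<phi> W))))" for l
  define \<pi>\<^sub>1 where "\<pi>\<^sub>1 e = (case e of (a, f, b) \<Rightarrow> (fst (\<pi>\<^sub>2 (a, f)), snd (\<pi>\<^sub>2 (a, f)), \<pi>\<^sub>0 b))" for e
  have p0: "\<pi>\<^sub>0 (S.cls X) = T.cls (\<phi> X)" if "X \<in> S.\<X>" for X
    unfolding \<pi>\<^sub>0_def using that S.inj_cls by simp
  have p2: "\<pi>\<^sub>2 (S.cls X, pid (S.cyl u W)) = (T.cls (\<phi> X), pid (T.cyl (g X W u) (\<phi> W)))" if "S.exitp X u W" for X u W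
    unfolding \<pi>\<^sub>2_def dec[OF that] by simp
  have p1: "\<pi>\<^sub>1 (S.edge X u W Y) = T.edge (\<phi> X) (g X W u) (\<phi> W) (\<phi> Y)" if "S.exitp X u W" "Y \<in> S.\<X>" for X u W Y
    unfolding \<pi>\<^sub>1_def S.edge_def T.edge_def using p2[OF that(1)] p0[OF that(2)] by simp
  have bS: "bij_betw S.cls S.\<X> (S.cls ` S.\<X>)" "bij_betw T.cls T.\<X> (T.cls ` T.\<X>)"
    using S.inj_cls T.inj_cls by (simp_all add: bij_betw_def)
  have b0: "bij_betw \<pi>\<^sub>0 (S.cls ` S.\<X>) (T.cls ` T.\<X>)"
    unfolding \<pi>\<^sub>0_def by (rule bij_betw_trans[OF bij_betw_trans[OF bij_betw_inv_into[OF bS(1)] b\<phi>] bS(2)])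
  have b2: "bij_betw \<pi>\<^sub>2 (alphabet (hull_graph A M)) (alphabet (hull_graph B N))"
    unfolding bij_betw_def S.alphabet_hull_graph T.alphabet_hull_graph
  proof
    show "inj_on \<pi>\<^sub>2 {(S.cls X, pid (S.cyl u W)) |X u W. S.exitp X u W}"
    proof (rule inj_onI, elim CollectE exE conjE)
      fix x y X u W Y t V assume l: "x = (S.cls X, pid (S.cyl u W))" "S.exitp X u W"
        "y = (S.cls Y, pid (S.cyl t V))" "S.exitp Y t V" and eq: "\<pi>\<^sub>2 x = \<pi>\<^sub>2 y"
      then have "(T.cls (\<phi> X), pid (T.cyl (g X W u) (\<phi> W))) = (T.cls (\<phi> Y), pid (T.cyl (g Y V t) (\<phi> V)))"
        using p2 by simp
      from T.label_inject[OF ex[OF l(2)] ex[OF l(4)] this] show "x = y" using einj l by blast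
    qed
    show "\<pi>\<^sub>2 ` {(S.cls X, pid (S.cyl u W)) |X u W. S.exitp X u W} = {(T.cls X, pid (T.cyl u W)) |X u W. T.exitp X u W}"
    proof
      show "\<pi>\<^sub>2 ` {(S.cls X, pid (S.cyl u W)) |X u W. S.exitp X u W} \<subseteq> {(T.cls X, pid (T.cyl u W)) |X u W. T.exitp X u W}"
      proof (rule subsetI, elim imageE CollectE exE conjE)
        fix y x X u W assume "y = \<pi>\<^sub>2 x" "x = (S.cls X, pid (S.cyl u W))" "S.exitp X u W"
        then show "y \<in> {(T.cls X, pid (T.cyl u W)) |X u W. T.exitp X u W}" using p2[of X u W] ex[of X u W] by auto
      qed
      show "{(T.cls X, pid (T.cyl u W)) |X u W. T.exitp X u W} \<subseteq> \<pi>\<^sub>2 ` {(S.cls X, pid (S.cyl u W)) |X u W. S.exitp X u W}"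
      proof (rule subsetI, elim CollectE exE conjE)
        fix x X' u' W' assume x: "x = (T.cls X', pid (T.cyl u' W'))" "T.exitp X' u' W'"
        obtain X u W where e: "S.exitp X u W" "X' = \<phi> X" "u' = g X W u" "W' = \<phi> W" using ex'[OF x(2)] by blast
        then have "x = \<pi>\<^sub>2 (S.cls X, pid (S.cyl u W))" using p2 x by simp
        then show "x \<in> \<pi>\<^sub>2 ` {(S.cls X, pid (S.cyl u W)) |X u W. S.exitp X u W}" using e by blast
      qed
    qed
  qed
  have b1: "bij_betw \<pi>\<^sub>1 (edges (hull_graph A M)) (edges (hull_graph B N))"
    unfolding bij_betw_def S.edges_hull_graph T.edges_hull_graph
  proof
    show "inj_on \<pi>\<^sub>1 {S.edge X u W Y |X u W Y. S.exitp X u W \<and> S.ple Y W}"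
    proof (rule inj_onI, elim CollectE exE conjE)
      fix x y X u W Z Y t V Z' assume l: "x = S.edge X u W Z" "S.exitp X u W" "S.ple Z W"
        "y = S.edge Y t V Z'" "S.exitp Y t V" "S.ple Z' V" and eq: "\<pi>\<^sub>1 x = \<pi>\<^sub>1 y"
      have Z: "Z \<in> S.\<X>" "Z' \<in> S.\<X>" using S.ple_subset l by blast+
      have E: "T.edge (\<phi> X) (g X W u) (\<phi> W) (\<phi> Z) = T.edge (\<phi> Y) (g Y V t) (\<phi> V) (\<phi> Z')"
        using p1 l eq Z by simp
      then have "(T.cls (\<phi> X), pid (T.cyl (g X W u) (\<phi> W))) = (T.cls (\<phi> Y), pid (T.cyl (g Y V t) (\<phi> V)))"
        and "T.cls (\<phi> Z) = T.cls (\<phi> Z')" unfolding T.edge_def by simp_all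
      then have "X = Y \<and> u = t \<and> W = V" "Z = Z'"
        using T.label_inject[OF ex[OF l(2)] ex[OF l(5)]] einj[OF l(2,5)]
          T.cls_inject[of "\<phi> Z" "\<phi> Z'"] in\<phi>[OF Z(1)] in\<phi>[OF Z(2)] inj\<phi>[OF Z] by simp_all
      then show "x = y" using l by simp
    qed
    show "\<pi>\<^sub>1 ` {S.edge X u W Y |X u W Y. S.exitp X u W \<and> S.ple Y W} = {T.edge X u W Y |X u W Y. T.exitp X u W \<and> T.ple Y W}"
    proof
      show "\<pi>\<^sub>1 ` {S.edge X u W Y |X u W Y. S.exitp X u W \<and> S.ple Y W} \<subseteq> {T.edge X u W Y |X u W Y. T.exitp X u W \<and> T.ple Y W}"
      proof (rule subsetI, elim imageE CollectE exE conjE)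
        fix x e X u W Y assume a: "x = \<pi>\<^sub>1 e" "e = S.edge X u W Y" "S.exitp X u W" "S.ple Y W"
        then have "T.ple (\<phi> Y) (\<phi> W)" "Y \<in> S.\<X>" using le S.ple_subset by blast+
        then show "x \<in> {T.edge X u W Y |X u W Y. T.exitp X u W \<and> T.ple Y W}"
          using a p1[OF a(3)] ex[OF a(3)] by auto
      qed
      show "{T.edge X u W Y |X u W Y. T.exitp X u W \<and> T.ple Y W} \<subseteq> \<pi>\<^sub>1 ` {S.edge X u W Y |X u W Y. S.exitp X u W \<and> S.ple Y W}"
      proof (rule subsetI, elim CollectE exE conjE)
        fix x X' u' W' Y' assume x: "x = T.edge X' u' W' Y'" "T.exitp X' u' W'" "T.ple Y' W'"
        obtain X u W where e: "S.exitp X u W" "X' = \<phi> X" "u' = g X W u" "W' = \<phi> W" using ex'[OF x(2)] by blast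
        obtain Y where Y: "Y \<in> S.\<X>" "Y' = \<phi> Y" using T.ple_subset[OF x(3)] b\<phi> unfolding bij_betw_def by blast
        have "S.ple Y W" using le[OF Y(1)] S.exitp_member[OF e(1)] x(3) Y e by simp
        moreover have "x = \<pi>\<^sub>1 (S.edge X u W Y)" using p1[OF e(1) Y(1)] x e Y by simp
        ultimately show "x \<in> \<pi>\<^sub>1 ` {S.edge X u W Y |X u W Y. S.exitp X u W \<and> S.ple Y W}" using e by blast
      qed
    qed
  qed
  have fields: "src (hull_graph B N) (\<pi>\<^sub>1 x) = \<pi>\<^sub>0 (src (hull_graph A M) x) \<and>
      rng (hull_graph B N) (\<pi>\<^sub>1 x) = \<pi>\<^sub>0 (rng (hull_graph A M) x) \<and>
      lab (hull_graph B N) (\<pi>\<^sub>1 x) = \<pi>\<^sub>2 (lab (hull_graph A M) x)" if "x \<in> edges (hull_graph A M)" for x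
  proof -
    obtain X u W Y where x: "x = S.edge X u W Y" "S.exitp X u W" "S.ple Y W"
      using \<open>x \<in> edges (hull_graph A M)\<close> unfolding S.edges_hull_graph by blast
    have "Y \<in> S.\<X>" "X \<in> S.\<X>" using S.ple_subset x S.exitp_member by blast+
    then show ?thesis using x p0 p1 p2 by simp
  qed
  have ord: "preceq S.S a b \<longleftrightarrow> preceq T.S (\<pi>\<^sub>0 a) (\<pi>\<^sub>0 b)" if ab: "a \<in> S.cls ` S.\<X>" "b \<in> S.cls ` S.\<X>" for a b
  proof -
    obtain X Y where X: "a = S.cls X" "b = S.cls Y" "X \<in> S.\<X>" "Y \<in> S.\<X>" using ab by blast
    then show ?thesis
      using p0 le[OF X(3,4)] S.preceq_cls[of X Y] T.preceq_cls[of "\<phi> X" "\<phi> Y"] in\<phi>[OF X(3)] in\<phi>[OF X(4)]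
        S.ple0_iff_ple T.ple0_iff_ple by simp
  qed
  show ?thesis
    unfolding graph_iso_cond_def lgraph_iso_def order_iso_on_def S.verts_hull_graph T.verts_hull_graph
    using b0 b1 b2 fields ord by blast
qed

lemma graph_comb_iso:
  assumes graph_iso_cond shows "\<exists>\<phi> g. comb_iso \<phi> g"
proof -
  obtain \<pi>\<^sub>0 \<pi>\<^sub>1 \<pi>\<^sub>2 where iso: "lgraph_iso (hull_graph A M) (hull_graph B N) \<pi>\<^sub>0 \<pi>\<^sub>1 \<pi>\<^sub>2"
    and ord: "order_iso_on (verts (hull_graph A M)) (preceq S.S) (verts (hull_graph B N)) (preceq T.S) \<pi>\<^sub>0"
    using assms unfolding graph_iso_cond_def by blast
  have b: "bij_betw \<pi>\<^sub>0 (S.cls ` S.\<X>) (T.cls ` T.\<X>)" "bij_betw \<pi>\<^sub>1 (edges (hull_graph A M)) (edges (hull_graph B N))"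
    "bij_betw \<pi>\<^sub>2 (alphabet (hull_graph A M)) (alphabet (hull_graph B N))"
    using iso unfolding lgraph_iso_def S.verts_hull_graph T.verts_hull_graph by blast+
  have fields: "src (hull_graph B N) (\<pi>\<^sub>1 x) = \<pi>\<^sub>0 (src (hull_graph A M) x)"
    "rng (hull_graph B N) (\<pi>\<^sub>1 x) = \<pi>\<^sub>0 (rng (hull_graph A M) x)"
    "lab (hull_graph B N) (\<pi>\<^sub>1 x) = \<pi>\<^sub>2 (lab (hull_graph A M) x)" if "x \<in> edges (hull_graph A M)" for x
    using iso that unfolding lgraph_iso_def by blast+
  have bS: "bij_betw S.cls S.\<X> (S.cls ` S.\<X>)" "bij_betw T.cls T.\<X> (T.cls ` T.\<X>)"
    using S.inj_cls T.inj_cls by (simp_all add: bij_betw_def)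
  define \<phi> where "\<phi> = inv_into T.\<X> T.cls \<circ> (\<pi>\<^sub>0 \<circ> S.cls)"
  have b\<phi>: "bij_betw \<phi> S.\<X> T.\<X>"
    unfolding \<phi>_def by (rule bij_betw_trans[OF bij_betw_trans[OF bS(1) b(1)] bij_betw_inv_into[OF bS(2)]])
  have p0: "\<pi>\<^sub>0 (S.cls X) = T.cls (\<phi> X)" if "X \<in> S.\<X>" for X
  proof -
    have "\<pi>\<^sub>0 (S.cls X) \<in> T.cls ` T.\<X>" using bij_betwE[OF b(1)] that by blast
    then show ?thesis unfolding \<phi>_def by (simp add: f_inv_into_f)
  qed
  have inj\<phi>: "\<phi> X = \<phi> Y \<longleftrightarrow> X = Y" if "X \<in> S.\<X>" "Y \<in> S.\<X>" for X Y
    using that b\<phi> by (meson bij_betw_imp_inj_on inj_on_eq_iff)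
  have in\<phi>: "\<phi> X \<in> T.\<X>" if "X \<in> S.\<X>" for X using that b\<phi> bij_betwE by blast
  have le: "S.ple X Y \<longleftrightarrow> T.ple (\<phi> X) (\<phi> Y)" if XY: "X \<in> S.\<X>" "Y \<in> S.\<X>" for X Y
  proof -
    have "preceq S.S (S.cls X) (S.cls Y) \<longleftrightarrow> preceq T.S (\<pi>\<^sub>0 (S.cls X)) (\<pi>\<^sub>0 (S.cls Y))"
      using ord XY unfolding order_iso_on_def S.verts_hull_graph by blast
    then show ?thesis
      using p0 XY S.preceq_cls[of X Y] T.preceq_cls[of "\<phi> X" "\<phi> Y"] in\<phi>[OF XY(1)] in\<phi>[OF XY(2)]
        S.ple0_iff_ple T.ple0_iff_ple by simp
  qed
  let ?lS = "\<lambda>X u W. (S.cls X, pid (S.cyl u W))" and ?lT = "\<lambda>X u W. (T.cls X, pid (T.cyl u W))"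
  have inj2: "X = Y \<and> u = t \<and> W = V" if e: "S.exitp X u W" "S.exitp Y t V" and "\<pi>\<^sub>2 (?lS X u W) = \<pi>\<^sub>2 (?lS Y t V)"
    for X u W Y t V
  proof -
    have "?lS X u W = ?lS Y t V"
      using inj_onD[OF bij_betw_imp_inj_on[OF b(3)] that(3)] e unfolding S.alphabet_hull_graph by blast
    then show ?thesis using S.label_inject[OF e] by blast
  qed
  \<comment> \<open>The edges with a given label have as sources exactly the classes below the class of the
     label, so the class of a label is determined by the graph.\<close>
  have key: "\<exists>u'. T.exitp (\<phi> X) u' (\<phi> W) \<and> \<pi>\<^sub>2 (?lS X u W) = ?lT (\<phi> X) u' (\<phi> W)" if e: "S.exitp X u W" for X u W
  proof -
    have m: "X \<in> S.\<X>" "W \<in> S.\<X>" using S.exitp_member[OF e] by blast+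
    let ?e = "S.edge X u W W"
    have eE: "?e \<in> edges (hull_graph A M)" unfolding S.edges_hull_graph using e S.ple_refl[OF m(2)] by blast
    then have "\<pi>\<^sub>1 ?e \<in> edges (hull_graph B N)" using bij_betwE[OF b(2)] by blast
    then obtain X' u' W' Y' where e': "\<pi>\<^sub>1 ?e = T.edge X' u' W' Y'" "T.exitp X' u' W'" "T.ple Y' W'"
      unfolding T.edges_hull_graph by blast
    have m': "X' \<in> T.\<X>" "W' \<in> T.\<X>" "Y' \<in> T.\<X>" using T.exitp_member[OF e'(2)] T.ple_subset[OF e'(3)] by blast+
    have "T.cls X' = T.cls (\<phi> X)" "T.cls Y' = T.cls (\<phi> W)" and lab: "?lT X' u' W' = \<pi>\<^sub>2 (?lS X u W)"
      using fields[OF eE] e'(1) p0[OF m(1)] p0[OF m(2)] by simp_all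
    then have X': "X' = \<phi> X" "Y' = \<phi> W" using T.cls_inject m' in\<phi>[OF m(1)] in\<phi>[OF m(2)] by simp_all
    have "T.edge X' u' W' W' \<in> edges (hull_graph B N)"
      unfolding T.edges_hull_graph using e'(2) T.ple_refl[OF m'(2)] by blast
    then have "T.edge X' u' W' W' \<in> \<pi>\<^sub>1 ` edges (hull_graph A M)" using bij_betw_imp_surj_on[OF b(2)] by simp
    then obtain x where x: "x \<in> edges (hull_graph A M)" "\<pi>\<^sub>1 x = T.edge X' u' W' W'" by (elim imageE) simp
    obtain Y t V Z where s: "x = S.edge Y t V Z" "S.exitp Y t V" "S.ple Z V"
      using x(1) unfolding S.edges_hull_graph by blast
    have Z: "Z \<in> S.\<X>" using S.ple_subset s by blast
    have "\<pi>\<^sub>2 (?lS Y t V) = \<pi>\<^sub>2 (?lS X u W)" and src: "T.cls W' = T.cls (\<phi> Z)"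
      using fields[OF x(1)] x(2) s lab p0[OF Z] by simp_all
    then have V: "V = W" using inj2[OF s(2) e] by blast
    have "W' = \<phi> Z" using src T.cls_inject m' in\<phi>[OF Z] by simp
    then have "T.ple W' (\<phi> W)" using le[OF Z m(2)] s(3) V by simp
    then have "W' = \<phi> W" using e'(3) X' T.ple_antisym by blast
    then show ?thesis using e'(2) lab X' by auto
  qed
  define g where "g X W u = (SOME u'. T.exitp (\<phi> X) u' (\<phi> W) \<and> \<pi>\<^sub>2 (?lS X u W) = ?lT (\<phi> X) u' (\<phi> W))" for X W u
  have g: "T.exitp (\<phi> X) (g X W u) (\<phi> W)" "\<pi>\<^sub>2 (?lS X u W) = ?lT (\<phi> X) (g X W u) (\<phi> W)" if "S.exitp X u W" for X u W
    using someI_ex[OF key[OF that]] unfolding g_def by blast+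
  have bg: "bij_betw (g X W) {u. S.exitp X u W} {u. T.exitp (\<phi> X) u (\<phi> W)}" if XW: "X \<in> S.\<X>" "W \<in> S.\<X>" for X W
    unfolding bij_betw_def
  proof
    show "inj_on (g X W) {u. S.exitp X u W}"
    proof (rule inj_onI)
      fix u t assume "u \<in> {u. S.exitp X u W}" "t \<in> {u. S.exitp X u W}" "g X W u = g X W t"
      then show "u = t" using g(2)[of X u W] g(2)[of X t W] inj2[of X u W X t W] by simp
    qed
    show "g X W ` {u. S.exitp X u W} = {u. T.exitp (\<phi> X) u (\<phi> W)}"
    proof
      show "g X W ` {u. S.exitp X u W} \<subseteq> {u. T.exitp (\<phi> X) u (\<phi> W)}" using g(1) by blast
      show "{u. T.exitp (\<phi> X) u (\<phi> W)} \<subseteq> g X W ` {u. S.exitp X u W}"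
      proof
        fix u' assume "u' \<in> {u. T.exitp (\<phi> X) u (\<phi> W)}"
        then have e': "T.exitp (\<phi> X) u' (\<phi> W)" by simp
        then have "?lT (\<phi> X) u' (\<phi> W) \<in> alphabet (hull_graph B N)" unfolding T.alphabet_hull_graph by blast
        then have "?lT (\<phi> X) u' (\<phi> W) \<in> \<pi>\<^sub>2 ` alphabet (hull_graph A M)" using b(3) unfolding bij_betw_def by blast
        then obtain Y t V where Y: "S.exitp Y t V" "?lT (\<phi> X) u' (\<phi> W) = \<pi>\<^sub>2 (?lS Y t V)"
          unfolding S.alphabet_hull_graph by blast
        then have "?lT (\<phi> X) u' (\<phi> W) = ?lT (\<phi> Y) (g Y V t) (\<phi> V)" using g(2) by simp
        then have eq: "\<phi> X = \<phi> Y" "u' = g Y V t" "\<phi> W = \<phi> V" using T.label_inject[OF e' g(1)[OF Y(1)]] by blast+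
        then have "X = Y" "W = V" using inj\<phi> XW S.exitp_member[OF Y(1)] by blast+
        then show "u' \<in> g X W ` {u. S.exitp X u W}" using eq(2) Y(1) by blast
      qed
    qed
  qed
  show ?thesis unfolding comb_iso_def using b\<phi> le bg by blast
qed

end

section \<open>Equivalences of categories\<close>

locale cat =
  fixes C :: "('o, 'm) category"
  assumes dom_cod: "f \<in> Arr C \<Longrightarrow> Dom C f \<in> Obj C \<and> Cod C f \<in> Obj C"
    and ident: "x \<in> Obj C \<Longrightarrow> Ident C x \<in> Arr C \<and> Dom C (Ident C x) = x \<and> Cod C (Ident C x) = x"
    and comp: "f \<in> Arr C \<Longrightarrow> g \<in> Arr C \<Longrightarrow> Cod C f = Dom C g \<Longrightarrow>
      Comp C g f \<in> Arr C \<and> Dom C (Comp C g f) = Dom C f \<and> Cod C (Comp C g f) = Cod C g"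
    and assoc: "f \<in> Arr C \<Longrightarrow> g \<in> Arr C \<Longrightarrow> h \<in> Arr C \<Longrightarrow> Cod C f = Dom C g \<Longrightarrow> Cod C g = Dom C h \<Longrightarrow>
      Comp C h (Comp C g f) = Comp C (Comp C h g) f"
    and ident_left: "f \<in> Arr C \<Longrightarrow> Comp C (Ident C (Cod C f)) f = f"
    and ident_right: "f \<in> Arr C \<Longrightarrow> Comp C f (Ident C (Dom C f)) = f"
begin

lemma iso_cancel_left:
  assumes h: "is_isomorphism C h" and fg: "f \<in> Arr C" "g \<in> Arr C" "Cod C f = Dom C h" "Cod C g = Dom C h"
    and eq: "Comp C h f = Comp C h g"
  shows "f = g"
proof -
  obtain k where k: "k \<in> Arr C" "Dom C k = Cod C h" "Comp C k h = Ident C (Dom C h)" and hA: "h \<in> Arr C"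
    using h unfolding is_isomorphism_def by blast
  have "f = Comp C k (Comp C h f)" using assoc[OF fg(1) hA k(1)] fg k ident_left[OF fg(1)] by simp
  also have "\<dots> = Comp C k (Comp C h g)" using eq by simp
  also have "\<dots> = g" using assoc[OF fg(2) hA k(1)] fg k ident_left[OF fg(2)] by simp
  finally show ?thesis .
qed

lemma iso_cancel_right:
  assumes h: "is_isomorphism C h" and fg: "f \<in> Arr C" "g \<in> Arr C" "Dom C f = Cod C h" "Dom C g = Cod C h"
    and eq: "Comp C f h = Comp C g h"
  shows "f = g"
proof -
  obtain k where k: "k \<in> Arr C" "Cod C k = Dom C h" "Comp C h k = Ident C (Cod C h)" and hA: "h \<in> Arr C"
    using h unfolding is_isomorphism_def by blast
  have "f = Comp C (Comp C f h) k" using assoc[OF k(1) hA fg(1)] fg k ident_right[OF fg(1)] by simp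
  also have "\<dots> = Comp C (Comp C g h) k" using eq by simp
  also have "\<dots> = g" using assoc[OF k(1) hA fg(2)] fg k ident_right[OF fg(2)] by simp
  finally show ?thesis .
qed

end

lemma is_natural_isoD:
  assumes "is_natural_iso C D F\<^sub>0 F\<^sub>1 G\<^sub>0 G\<^sub>1 \<eta>"
  shows "x \<in> Obj C \<Longrightarrow> is_isomorphism D (\<eta> x) \<and> Dom D (\<eta> x) = F\<^sub>0 x \<and> Cod D (\<eta> x) = G\<^sub>0 x"
    and "f \<in> Arr C \<Longrightarrow> Comp D (\<eta> (Cod C f)) (F\<^sub>1 f) = Comp D (G\<^sub>1 f) (\<eta> (Dom C f))"
  using assms unfolding is_natural_iso_def by blast+

lemma is_functorD:
  assumes "is_functor C D F\<^sub>0 F\<^sub>1" "f \<in> Arr C"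
  shows "F\<^sub>1 f \<in> Arr D" "Dom D (F\<^sub>1 f) = F\<^sub>0 (Dom C f)" "Cod D (F\<^sub>1 f) = F\<^sub>0 (Cod C f)"
    and "g \<in> Arr C \<Longrightarrow> Cod C f = Dom C g \<Longrightarrow> F\<^sub>1 (Comp C g f) = Comp D (F\<^sub>1 g) (F\<^sub>1 f)"
  using assms unfolding is_functor_def by blast+

lemma equivalence_faithful:
  assumes "cat C" and nat: "is_natural_iso C C id id (G\<^sub>0 \<circ> F\<^sub>0) (G\<^sub>1 \<circ> F\<^sub>1) \<eta>"
    and fg: "f \<in> Arr C" "g \<in> Arr C" "Dom C f = Dom C g" "Cod C f = Cod C g" "F\<^sub>1 f = F\<^sub>1 g"
  shows "f = g"
proof -
  interpret cat C by fact
  have "Cod C f \<in> Obj C" using dom_cod fg by blast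
  then have iso: "is_isomorphism C (\<eta> (Cod C f))" "Dom C (\<eta> (Cod C f)) = Cod C f"
    using is_natural_isoD(1)[OF nat] by simp_all
  have "Comp C (\<eta> (Cod C f)) f = Comp C (G\<^sub>1 (F\<^sub>1 f)) (\<eta> (Dom C f))"
    "Comp C (\<eta> (Cod C g)) g = Comp C (G\<^sub>1 (F\<^sub>1 g)) (\<eta> (Dom C g))"
    using is_natural_isoD(2)[OF nat fg(1)] is_natural_isoD(2)[OF nat fg(2)] by simp_all
  then have eq: "Comp C (\<eta> (Cod C f)) f = Comp C (\<eta> (Cod C f)) g" using fg(3-5) by simp
  show ?thesis
    by (rule iso_cancel_left[OF iso(1) fg(1,2) iso(2)[symmetric] trans[OF fg(4)[symmetric] iso(2)[symmetric]] eq])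
qed

lemma equivalence_faithful_inverse:
  assumes "cat D" and nat: "is_natural_iso D D (F\<^sub>0 \<circ> G\<^sub>0) (F\<^sub>1 \<circ> G\<^sub>1) id id \<epsilon>"
    and fg: "f \<in> Arr D" "g \<in> Arr D" "Dom D f = Dom D g" "Cod D f = Cod D g" "G\<^sub>1 f = G\<^sub>1 g"
  shows "f = g"
proof -
  interpret cat D by fact
  have "Dom D f \<in> Obj D" using dom_cod fg by blast
  then have iso: "is_isomorphism D (\<epsilon> (Dom D f))" "Cod D (\<epsilon> (Dom D f)) = Dom D f"
    using is_natural_isoD(1)[OF nat] by simp_all
  have "Comp D (\<epsilon> (Cod D f)) (F\<^sub>1 (G\<^sub>1 f)) = Comp D f (\<epsilon> (Dom D f))"
    "Comp D (\<epsilon> (Cod D g)) (F\<^sub>1 (G\<^sub>1 g)) = Comp D g (\<epsilon> (Dom D g))"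
    using is_natural_isoD(2)[OF nat fg(1)] is_natural_isoD(2)[OF nat fg(2)] by simp_all
  then have eq: "Comp D f (\<epsilon> (Dom D f)) = Comp D g (\<epsilon> (Dom D f))" using fg(3-5) by simp
  show ?thesis
    by (rule iso_cancel_right[OF iso(1) fg(1,2) iso(2)[symmetric] trans[OF fg(3)[symmetric] iso(2)[symmetric]] eq])
qed

text \<open>Fullness of \<open>F\<close>: the arrow \<open>\<eta>\<^sub>y\<^sup>-\<^sup>1 \<circ> G h \<circ> \<eta>\<^sub>x\<close> is mapped by \<open>G F\<close> to \<open>G h\<close>, and \<open>G\<close> is
  faithful.\<close>

lemma equivalence_full:
  assumes "cat C" "cat D" and F: "is_functor C D F\<^sub>0 F\<^sub>1" and G: "is_functor D C G\<^sub>0 G\<^sub>1"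
    and \<eta>: "is_natural_iso C C id id (G\<^sub>0 \<circ> F\<^sub>0) (G\<^sub>1 \<circ> F\<^sub>1) \<eta>"
    and \<epsilon>: "is_natural_iso D D (F\<^sub>0 \<circ> G\<^sub>0) (F\<^sub>1 \<circ> G\<^sub>1) id id \<epsilon>"
    and x: "x \<in> Obj C" "y \<in> Obj C" and h: "h \<in> Arr D" "Dom D h = F\<^sub>0 x" "Cod D h = F\<^sub>0 y"
  shows "\<exists>f\<in>Arr C. Dom C f = x \<and> Cod C f = y \<and> F\<^sub>1 f = h"
proof -
  interpret C: cat C by fact
  interpret D: cat D by fact
  have ix: "is_isomorphism C (\<eta> x)" "Dom C (\<eta> x) = x" "Cod C (\<eta> x) = G\<^sub>0 (F\<^sub>0 x)"
    and iy: "is_isomorphism C (\<eta> y)" "Dom C (\<eta> y) = y" "Cod C (\<eta> y) = G\<^sub>0 (F\<^sub>0 y)"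
    using is_natural_isoD(1)[OF \<eta> x(1)] is_natural_isoD(1)[OF \<eta> x(2)] by simp_all
  have ax: "\<eta> x \<in> Arr C" and ay: "\<eta> y \<in> Arr C" using ix iy unfolding is_isomorphism_def by blast+
  obtain k where k: "k \<in> Arr C" "Dom C k = Cod C (\<eta> y)" "Cod C k = y" "Comp C (\<eta> y) k = Ident C (Cod C (\<eta> y))"
    using iy(1,2) unfolding is_isomorphism_def by auto
  have Gh: "G\<^sub>1 h \<in> Arr C" "Dom C (G\<^sub>1 h) = G\<^sub>0 (F\<^sub>0 x)" "Cod C (G\<^sub>1 h) = G\<^sub>0 (F\<^sub>0 y)"
    using is_functorD[OF G h(1)] h by simp_all
  define m where "m = Comp C (G\<^sub>1 h) (\<eta> x)"
  have m: "m \<in> Arr C" "Dom C m = x" "Cod C m = G\<^sub>0 (F\<^sub>0 y)" unfolding m_def using C.comp[OF ax Gh(1)] ix Gh by auto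
  define f where "f = Comp C k m"
  have f: "f \<in> Arr C" "Dom C f = x" "Cod C f = y" unfolding f_def using C.comp[OF m(1) k(1)] m k iy by auto
  have "Comp C (\<eta> y) f = m"
    unfolding f_def using C.assoc[OF m(1) k(1) ay] m k iy C.ident_left[OF m(1)] by simp
  moreover have "Comp C (\<eta> y) f = Comp C (G\<^sub>1 (F\<^sub>1 f)) (\<eta> x)" using is_natural_isoD(2)[OF \<eta> f(1)] f by simp
  ultimately have eq: "Comp C (G\<^sub>1 (F\<^sub>1 f)) (\<eta> x) = Comp C (G\<^sub>1 h) (\<eta> x)" unfolding m_def by simp
  have Ff: "F\<^sub>1 f \<in> Arr D" "Dom D (F\<^sub>1 f) = F\<^sub>0 x" "Cod D (F\<^sub>1 f) = F\<^sub>0 y" using is_functorD[OF F f(1)] f by simp_all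
  then have GF: "G\<^sub>1 (F\<^sub>1 f) \<in> Arr C" "Dom C (G\<^sub>1 (F\<^sub>1 f)) = G\<^sub>0 (F\<^sub>0 x)" using is_functorD[OF G Ff(1)] by simp_all
  have "G\<^sub>1 (F\<^sub>1 f) = G\<^sub>1 h" using C.iso_cancel_right[OF ix(1) GF(1) Gh(1)] GF Gh ix eq by simp
  then have "F\<^sub>1 f = h" using equivalence_faithful_inverse[OF assms(2) \<epsilon> Ff(1) h(1)] Ff h by simp
  then show ?thesis using f by blast
qed

text \<open>Dually, \<open>G\<close> is full by way of \<open>\<epsilon>\<^sub>y \<circ> F h \<circ> \<epsilon>\<^sub>x\<^sup>-\<^sup>1\<close>.\<close>

lemma equivalence_full_inverse:
  assumes "cat C" "cat D" and F: "is_functor C D F\<^sub>0 F\<^sub>1" and G: "is_functor D C G\<^sub>0 G\<^sub>1"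
    and \<eta>: "is_natural_iso C C id id (G\<^sub>0 \<circ> F\<^sub>0) (G\<^sub>1 \<circ> F\<^sub>1) \<eta>"
    and \<epsilon>: "is_natural_iso D D (F\<^sub>0 \<circ> G\<^sub>0) (F\<^sub>1 \<circ> G\<^sub>1) id id \<epsilon>"
    and x: "x \<in> Obj D" "y \<in> Obj D" and h: "h \<in> Arr C" "Dom C h = G\<^sub>0 x" "Cod C h = G\<^sub>0 y"
  shows "\<exists>f\<in>Arr D. Dom D f = x \<and> Cod D f = y \<and> G\<^sub>1 f = h"
proof -
  interpret D: cat D by fact
  have ix: "is_isomorphism D (\<epsilon> x)" "Cod D (\<epsilon> x) = x" "Dom D (\<epsilon> x) = F\<^sub>0 (G\<^sub>0 x)"
    and iy: "is_isomorphism D (\<epsilon> y)" "Cod D (\<epsilon> y) = y" "Dom D (\<epsilon> y) = F\<^sub>0 (G\<^sub>0 y)"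
    using is_natural_isoD(1)[OF \<epsilon> x(1)] is_natural_isoD(1)[OF \<epsilon> x(2)] by simp_all
  have ax: "\<epsilon> x \<in> Arr D" and ay: "\<epsilon> y \<in> Arr D" using ix iy unfolding is_isomorphism_def by blast+
  obtain k where k: "k \<in> Arr D" "Dom D k = x" "Cod D k = Dom D (\<epsilon> x)" "Comp D k (\<epsilon> x) = Ident D (Dom D (\<epsilon> x))"
    using ix(1,2) unfolding is_isomorphism_def by auto
  note Fh = is_functorD[OF F h(1)]
  define m where "m = Comp D (\<epsilon> y) (F\<^sub>1 h)"
  have m: "m \<in> Arr D" "Dom D m = F\<^sub>0 (G\<^sub>0 x)" "Cod D m = y"
    unfolding m_def using D.comp[OF Fh(1) ay] iy Fh h by auto
  define f where "f = Comp D m k"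
  have f: "f \<in> Arr D" "Dom D f = x" "Cod D f = y" unfolding f_def using D.comp[OF k(1) m(1)] m k ix by auto
  have "Comp D f (\<epsilon> x) = m"
    unfolding f_def using D.assoc[OF ax k(1) m(1)] m k ix D.ident_right[OF m(1)] by simp
  moreover have "Comp D (\<epsilon> y) (F\<^sub>1 (G\<^sub>1 f)) = Comp D f (\<epsilon> x)" using is_natural_isoD(2)[OF \<epsilon> f(1)] f by simp
  ultimately have eq: "Comp D (\<epsilon> y) (F\<^sub>1 (G\<^sub>1 f)) = Comp D (\<epsilon> y) (F\<^sub>1 h)" unfolding m_def by simp
  have Gf: "G\<^sub>1 f \<in> Arr C" "Dom C (G\<^sub>1 f) = G\<^sub>0 x" "Cod C (G\<^sub>1 f) = G\<^sub>0 y" using is_functorD[OF G f(1)] f by simp_all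
  note FG = is_functorD[OF F Gf(1)]
  have "F\<^sub>1 (G\<^sub>1 f) = F\<^sub>1 h" using D.iso_cancel_left[OF iy(1) FG(1) Fh(1)] FG Fh Gf h iy eq by simp
  then have "G\<^sub>1 f = h" using equivalence_faithful[OF assms(1) \<eta> Gf(1) h(1)] Gf h by simp
  then show ?thesis using f by blast
qed

context markov_shift
begin

abbreviation CS :: "('a list \<rightharpoonup> 'a list, ('a list \<rightharpoonup> 'a list) \<times> ('a list \<rightharpoonup> 'a list) \<times> ('a list \<rightharpoonup> 'a list)) category" where
  "CS \<equiv> morita_category S"

definition arrow :: "'a list set \<Rightarrow> ('a list \<rightharpoonup> 'a list) \<Rightarrow> 'a list set \<Rightarrow> bool" where
  "arrow C s D \<longleftrightarrow> C \<in> cyls \<and> D \<in> cyls \<and> s \<in> hull_carrier A M \<and> ran s \<subseteq> C \<and> dom s \<subseteq> D"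

lemma Obj_CS: "Obj CS = pid ` cyls"
  by (simp add: morita_category_def idems_S)

lemma CS_simps [simp]:
  "Dom CS (e, s, f) = f" "Cod CS (e, s, f) = e" "Ident CS e = (e, e, e)"
  "Comp CS (e, s, f) (f', t, g) = (e, s \<circ>\<^sub>m t, g)"
  by (simp_all add: morita_category_def)

lemma pid_arrow: "arrow C s D \<Longrightarrow> pid C \<circ>\<^sub>m s = s" "arrow C s D \<Longrightarrow> s \<circ>\<^sub>m pid D = s"
  by (simp_all add: arrow_def pid_comp_eq comp_pid_eq)

lemma Arr_CS: "Arr CS = {(pid C, s, pid D) |C s D. arrow C s D}"
proof -
  have key: "(\<exists>t\<in>carrier S. s = pid C \<circ>\<^sub>m t \<circ>\<^sub>m pid D) \<longleftrightarrow> s \<in> hull_carrier A M \<and> ran s \<subseteq> C \<and> dom s \<subseteq> D"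
    if "C \<in> cyls" "D \<in> cyls" for C D s
  proof
    assume "\<exists>t\<in>carrier S. s = pid C \<circ>\<^sub>m t \<circ>\<^sub>m pid D"
    then obtain t where t: "t \<in> hull_carrier A M" "s = pid C \<circ>\<^sub>m t \<circ>\<^sub>m pid D" by (auto simp: carrier_S)
    then have "s \<in> hull_carrier A M" using that by (simp add: hull_carrier.comp pid_in_hull)
    then show "s \<in> hull_carrier A M \<and> ran s \<subseteq> C \<and> dom s \<subseteq> D"
      using t(2) by (auto simp: map_comp_Some_iff ran_def)
  next
    assume s: "s \<in> hull_carrier A M \<and> ran s \<subseteq> C \<and> dom s \<subseteq> D"
    then have "s = pid C \<circ>\<^sub>m s \<circ>\<^sub>m pid D" by (simp add: pid_comp_eq comp_pid_eq)
    then show "\<exists>t\<in>carrier S. s = pid C \<circ>\<^sub>m t \<circ>\<^sub>m pid D" using s by (auto simp: carrier_S)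
  qed
  show ?thesis
  proof (intro Set.set_eqI iffI)
    fix x assume "x \<in> Arr CS"
    then obtain C s D where x: "x = (pid C, s, pid D)" "C \<in> cyls" "D \<in> cyls" "\<exists>t\<in>carrier S. s = pid C \<circ>\<^sub>m t \<circ>\<^sub>m pid D"
      unfolding morita_category_def idems_S by auto
    then show "x \<in> {(pid C, s, pid D) |C s D. arrow C s D}" using key[OF x(2,3)] unfolding arrow_def by blast
  next
    fix x assume "x \<in> {(pid C, s, pid D) |C s D. arrow C s D}"
    then obtain C s D where x: "x = (pid C, s, pid D)" "C \<in> cyls" "D \<in> cyls"
      "s \<in> hull_carrier A M \<and> ran s \<subseteq> C \<and> dom s \<subseteq> D" unfolding arrow_def by blast
    then show "x \<in> Arr CS" using key[OF x(2,3), of s] by (simp add: morita_category_def)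
  qed
qed

lemma arrow_in_Arr: "(pid C, s, pid D) \<in> Arr CS \<longleftrightarrow> arrow C s D"
  unfolding Arr_CS by auto

lemma arrow_comp: "arrow C s D \<Longrightarrow> arrow D t E \<Longrightarrow> arrow C (s \<circ>\<^sub>m t) E"
  unfolding arrow_def by (auto simp: hull_carrier.comp map_comp_Some_iff ran_def dom_def)

lemma arrow_pid: "D \<in> cyls \<Longrightarrow> C \<in> cyls \<Longrightarrow> E \<in> cyls \<Longrightarrow> D \<subseteq> C \<Longrightarrow> D \<subseteq> E \<Longrightarrow> arrow C (pid D) E"
  unfolding arrow_def by (simp add: pid_in_hull)

lemma cat_CS: "cat CS"
proof
  fix f assume "f \<in> Arr CS"
  then obtain C s D where f: "f = (pid C, s, pid D)" "arrow C s D" unfolding Arr_CS by blast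
  then show "Dom CS f \<in> Obj CS \<and> Cod CS f \<in> Obj CS" by (simp add: Obj_CS arrow_def)
  show "Comp CS (Ident CS (Cod CS f)) f = f" "Comp CS f (Ident CS (Dom CS f)) = f"
    using f pid_arrow by simp_all
next
  fix x assume "x \<in> Obj CS"
  then obtain C where "x = pid C" "C \<in> cyls" unfolding Obj_CS by blast
  then show "Ident CS x \<in> Arr CS \<and> Dom CS (Ident CS x) = x \<and> Cod CS (Ident CS x) = x"
    by (simp add: arrow_in_Arr arrow_pid)
next
  fix f g assume fg: "f \<in> Arr CS" "g \<in> Arr CS" "Cod CS f = Dom CS g"
  then obtain C s D t E where "f = (pid D, t, pid E)" "arrow D t E" "g = (pid C, s, pid D)" "arrow C s D"
    unfolding Arr_CS by auto
  then show "Comp CS g f \<in> Arr CS \<and> Dom CS (Comp CS g f) = Dom CS f \<and> Cod CS (Comp CS g f) = Cod CS g"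
    using arrow_comp by (simp add: arrow_in_Arr)
next
  fix f g h assume "f \<in> Arr CS" "g \<in> Arr CS" "h \<in> Arr CS"
  then show "Comp CS h (Comp CS g f) = Comp CS (Comp CS h g) f"
    unfolding Arr_CS by (auto simp: comp_assoc)
qed

text \<open>The relation \<open>\<D>\<close> between the idempotents with domains \<open>C\<close> and \<open>D\<close>, that is, isomorphism of
  these objects of \<open>C(S)\<close>.\<close>

definition eqv :: "'a list set \<Rightarrow> 'a list set \<Rightarrow> bool" where
  "eqv C D \<longleftrightarrow> (\<exists>s\<in>hull_carrier A M. dom s = C \<and> ran s = D)"

lemma eqv_cyl:
  assumes "valid \<alpha> X" "valid \<beta> Y" shows "eqv (cyl \<alpha> X) (cyl \<beta> Y) \<longleftrightarrow> X = Y"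
proof
  assume "eqv (cyl \<alpha> X) (cyl \<beta> Y)"
  then obtain s where s: "s \<in> hull_carrier A M" "dom s = cyl \<alpha> X" "ran s = cyl \<beta> Y" unfolding eqv_def by blast
  show "X = Y"
  proof (cases rule: hull_cases[OF s(1)])
    case 1 then show ?thesis using s valid_cyl_nonempty[OF assms(1), of \<alpha>] by auto
  next
    case (2 \<gamma> Z \<delta>)
    then have "cyl \<delta> Z = cyl \<alpha> X" "cyl \<gamma> Z = cyl \<beta> Y" using s by simp_all
    then have "Z = X" "Z = Y" using cyl_inject[OF 2(3) assms(1)] cyl_inject[OF 2(2) assms(2)] by simp_all
    then show ?thesis by simp
  qed
next
  assume "X = Y"
  then show "eqv (cyl \<alpha> X) (cyl \<beta> Y)" unfolding eqv_def
    using rep_in_hull[OF assms(2)] assms by (intro bexI[of _ "rep \<beta> X \<alpha>"]) simp_all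
qed

lemma eqv_sym: "eqv C D \<Longrightarrow> eqv D C"
proof -
  assume "eqv C D"
  then obtain s where s: "s \<in> hull_carrier A M" "dom s = C" "ran s = D" unfolding eqv_def by blast
  have "dom (pinverse s) = D" "ran (pinverse s) = C"
    using s by (auto simp: dom_def ran_def pinverse_Some[OF hull_pinj[OF s(1)]])
  then show ?thesis unfolding eqv_def using s hull_carrier.inv by blast
qed

lemma eqv_nonempty:
  assumes "eqv C (cyl \<beta> Y)" "valid \<beta> Y" obtains \<alpha> where "C = cyl \<alpha> Y" "valid \<alpha> Y"
proof -
  obtain s where s: "s \<in> hull_carrier A M" "dom s = C" "ran s = cyl \<beta> Y" using assms unfolding eqv_def by blast
  show ?thesis
  proof (cases rule: hull_cases[OF s(1)])
    case 1 then show ?thesis using s valid_cyl_nonempty[OF assms(2), of \<beta>] by auto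
  next
    case (2 \<gamma> Z \<delta>)
    then have "Z = Y" using s cyl_inject[OF 2(2) assms(2)] by simp
    then show ?thesis using that[of \<delta>] 2 s by simp
  qed
qed

lemma split_range:
  assumes s: "arrow C s D" and t: "arrow D t C" and ts: "t \<circ>\<^sub>m s = pid D" and st: "s \<circ>\<^sub>m t = pid E"
  shows "dom s = D \<and> ran s = E"
proof -
  have 1: "t v = Some w" if "s w = Some v" for w v
  proof -
    have "w \<in> D" using s that unfolding arrow_def by blast
    then have "(t \<circ>\<^sub>m s) w = Some w" using ts by simp
    then show ?thesis using that by (auto simp: map_comp_Some_iff)
  qed
  have "\<exists>v. s w = Some v" if "w \<in> D" for w
  proof -
    have "(t \<circ>\<^sub>m s) w = Some w" using ts that by simp
    then show ?thesis by (auto simp: map_comp_Some_iff)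
  qed
  then have "dom s = D" using s unfolding arrow_def by blast
  moreover have "v \<in> ran s \<longleftrightarrow> v \<in> E" for v
  proof
    assume "v \<in> ran s"
    then obtain w where w: "s w = Some v" unfolding ran_def by blast
    then have "(s \<circ>\<^sub>m t) v = Some v" using 1 by (auto simp: map_comp_Some_iff)
    then show "v \<in> E" using st by simp
  next
    assume "v \<in> E"
    then have "(s \<circ>\<^sub>m t) v = Some v" using st by simp
    then show "v \<in> ran s" by (auto simp: map_comp_Some_iff ran_def)
  qed
  ultimately show ?thesis by blast
qed

end

section \<open>Morita equivalence preserves the combinatorial data\<close>

locale shift_functor = two_shifts A M B N
  for A :: "'a set" and M :: "'a \<Rightarrow> 'a \<Rightarrow> nat" and B :: "'b set" and N :: "'b \<Rightarrow> 'b \<Rightarrow> nat" +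
  fixes F\<^sub>0 :: "('a list \<rightharpoonup> 'a list) \<Rightarrow> ('b list \<rightharpoonup> 'b list)"
    and F\<^sub>1 :: "('a list \<rightharpoonup> 'a list) \<times> ('a list \<rightharpoonup> 'a list) \<times> ('a list \<rightharpoonup> 'a list) \<Rightarrow>
      ('b list \<rightharpoonup> 'b list) \<times> ('b list \<rightharpoonup> 'b list) \<times> ('b list \<rightharpoonup> 'b list)"
  assumes fctr: "is_functor S.CS T.CS F\<^sub>0 F\<^sub>1"
    and faithful: "f \<in> Arr S.CS \<Longrightarrow> g \<in> Arr S.CS \<Longrightarrow> Dom S.CS f = Dom S.CS g \<Longrightarrow> Cod S.CS f = Cod S.CS g \<Longrightarrow>
      F\<^sub>1 f = F\<^sub>1 g \<Longrightarrow> f = g"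
    and full: "x \<in> Obj S.CS \<Longrightarrow> y \<in> Obj S.CS \<Longrightarrow> h \<in> Arr T.CS \<Longrightarrow> Dom T.CS h = F\<^sub>0 x \<Longrightarrow> Cod T.CS h = F\<^sub>0 y \<Longrightarrow>
      \<exists>f\<in>Arr S.CS. Dom S.CS f = x \<and> Cod S.CS f = y \<and> F\<^sub>1 f = h"
begin

definition F0c :: "'a list set \<Rightarrow> 'b list set" where
  "F0c C = dom (F\<^sub>0 (pid C))"

definition F1c :: "'a list set \<Rightarrow> ('a list \<rightharpoonup> 'a list) \<Rightarrow> 'a list set \<Rightarrow> ('b list \<rightharpoonup> 'b list)" where
  "F1c C s D = fst (snd (F\<^sub>1 (pid C, s, pid D)))"

lemma F0_pid: assumes "C \<in> S.cyls" shows "F\<^sub>0 (pid C) = pid (F0c C) \<and> F0c C \<in> T.cyls"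
proof -
  have "F\<^sub>0 (pid C) \<in> pid ` T.cyls"
    using fctr assms unfolding is_functor_def S.Obj_CS T.Obj_CS by blast
  then show ?thesis unfolding F0c_def by auto
qed

lemma F1_arrow:
  assumes "S.arrow C s D"
  shows "F\<^sub>1 (pid C, s, pid D) = (pid (F0c C), F1c C s D, pid (F0c D))" "T.arrow (F0c C) (F1c C s D) (F0c D)"
proof -
  have C: "C \<in> S.cyls" "D \<in> S.cyls" using assms by (simp_all add: S.arrow_def)
  have "(pid C, s, pid D) \<in> Arr S.CS" using assms S.arrow_in_Arr by blast
  then have f: "F\<^sub>1 (pid C, s, pid D) \<in> Arr T.CS" "Dom T.CS (F\<^sub>1 (pid C, s, pid D)) = F\<^sub>0 (pid D)"
    "Cod T.CS (F\<^sub>1 (pid C, s, pid D)) = F\<^sub>0 (pid C)"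
    using is_functorD[OF fctr] by simp_all
  then obtain C' s' D' where e: "F\<^sub>1 (pid C, s, pid D) = (pid C', s', pid D')" "T.arrow C' s' D'" unfolding T.Arr_CS by blast
  then have "C' = F0c C" "D' = F0c D" using f F0_pid[OF C(1)] F0_pid[OF C(2)] by simp_all
  then show "F\<^sub>1 (pid C, s, pid D) = (pid (F0c C), F1c C s D, pid (F0c D))" "T.arrow (F0c C) (F1c C s D) (F0c D)"
    using e unfolding F1c_def by simp_all
qed

lemma F1c_comp:
  assumes "S.arrow C s D" "S.arrow D t E" shows "F1c C (s \<circ>\<^sub>m t) E = F1c C s D \<circ>\<^sub>m F1c D t E"
proof -
  have "F\<^sub>1 (Comp S.CS (pid C, s, pid D) (pid D, t, pid E)) = Comp T.CS (F\<^sub>1 (pid C, s, pid D)) (F\<^sub>1 (pid D, t, pid E))"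
    using assms by (intro is_functorD(4)[OF fctr]) (simp_all add: S.arrow_in_Arr)
  then show ?thesis using F1_arrow[OF assms(1)] F1_arrow[OF assms(2)] F1_arrow[OF S.arrow_comp[OF assms]] by simp
qed

lemma F1c_ident: assumes "C \<in> S.cyls" shows "F1c C (pid C) C = pid (F0c C)"
proof -
  have "F\<^sub>1 (Ident S.CS (pid C)) = Ident T.CS (F\<^sub>0 (pid C))"
    using fctr assms unfolding is_functor_def S.Obj_CS by blast
  then show ?thesis using F1_arrow[of C "pid C" C] F0_pid[OF assms] assms by (simp add: S.arrow_pid)
qed

lemma F1c_inject:
  assumes "S.arrow C s D" "S.arrow C t D" "F1c C s D = F1c C t D" shows "s = t"
  using faithful[of "(pid C, s, pid D)" "(pid C, t, pid D)"] assms F1_arrow S.arrow_in_Arr by simp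

lemma F1c_surj:
  assumes "C \<in> S.cyls" "D \<in> S.cyls" "T.arrow (F0c C) h (F0c D)"
  shows "\<exists>s. S.arrow C s D \<and> F1c C s D = h"
proof -
  have "\<exists>f\<in>Arr S.CS. Dom S.CS f = pid D \<and> Cod S.CS f = pid C \<and> F\<^sub>1 f = (pid (F0c C), h, pid (F0c D))"
    using assms F0_pid by (intro full) (simp_all add: S.Obj_CS T.arrow_in_Arr)
  then obtain f where f: "f \<in> Arr S.CS" "Dom S.CS f = pid D" "Cod S.CS f = pid C" "F\<^sub>1 f = (pid (F0c C), h, pid (F0c D))"
    by blast
  then obtain s where "f = (pid C, s, pid D)" "S.arrow C s D" unfolding S.Arr_CS by auto
  then show ?thesis using f unfolding F1c_def by auto
qed

lemma eqv_F0c: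
  assumes "S.eqv C D" shows "T.eqv (F0c C) (F0c D)"
proof -
  obtain s where s: "s \<in> hull_carrier A M" "dom s = C" "ran s = D" using assms unfolding S.eqv_def by blast
  note j = S.hull_pinj[OF s(1)]
  have C: "C \<in> S.cyls" "D \<in> S.cyls" using S.dom_in_cyls[OF s(1)] S.ran_in_cyls[OF s(1)] s by simp_all
  have "dom (pinverse s) = D" "ran (pinverse s) = C"
    using s by (auto simp: dom_def ran_def pinverse_Some[OF j])
  then have a: "S.arrow D s C" "S.arrow C (pinverse s) D"
    using s C unfolding S.arrow_def by (simp_all add: hull_carrier.inv)
  have "F1c C (pinverse s) D \<circ>\<^sub>m F1c D s C = pid (F0c C)"
    using F1c_comp[OF a(2,1)] F1c_ident[OF C(1)] s by (simp add: pinverse_comp[OF j])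
  moreover have "F1c D s C \<circ>\<^sub>m F1c C (pinverse s) D = pid (F0c D)"
    using F1c_comp[OF a] F1c_ident[OF C(2)] s by (simp add: comp_pinverse[OF j])
  ultimately have "dom (F1c D s C) = F0c C \<and> ran (F1c D s C) = F0c D"
    using T.split_range[OF F1_arrow(2)[OF a(1)] F1_arrow(2)[OF a(2)]] by blast
  then show ?thesis unfolding T.eqv_def using F1_arrow(2)[OF a(1)] unfolding T.arrow_def by blast
qed

text \<open>The endomorphism monoid of the object \<open>e\<close> is \<open>e S e\<close>, whose idempotents are those below \<open>e\<close>.\<close>

definition below :: "'a list set \<Rightarrow> 'a list set \<Rightarrow> 'b list set" where
  "below C D = dom (F1c C (pid D) C)"

lemma below_pid:
  assumes "C \<in> S.cyls" "D \<in> S.cyls" "D \<subseteq> C"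
  shows "F1c C (pid D) C = pid (below C D)" "below C D \<in> T.cyls" "below C D \<subseteq> F0c C"
proof -
  have a: "S.arrow C (pid D) C" using assms S.arrow_pid by blast
  note t = F1_arrow(2)[OF a]
  have "F1c C (pid D) C \<circ>\<^sub>m F1c C (pid D) C = F1c C (pid D) C" using F1c_comp[OF a a] by (simp add: pid_comp)
  then have "F1c C (pid D) C \<in> idems T.S" using t by (simp add: idems_def T.carrier_S T.arrow_def)
  then show "F1c C (pid D) C = pid (below C D)" "below C D \<in> T.cyls" unfolding below_def T.idems_S by auto
  show "below C D \<subseteq> F0c C" using t unfolding below_def T.arrow_def by simp
qed

lemma below_Int:
  assumes "C \<in> S.cyls" "D \<in> S.cyls" "D \<subseteq> C" "E \<in> S.cyls" "E \<subseteq> C"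
  shows "below C (D \<inter> E) = below C D \<inter> below C E"
proof -
  have a: "S.arrow C (pid D) C" "S.arrow C (pid E) C" using assms S.arrow_pid by blast+
  have "F1c C (pid (D \<inter> E)) C = pid (below C D) \<circ>\<^sub>m pid (below C E)"
    using F1c_comp[OF a] below_pid(1)[OF assms(1-3)] below_pid(1)[OF assms(1,4,5)] by (simp add: pid_comp)
  then show ?thesis
    using below_pid(1)[OF assms(1) S.Int_cyls[OF assms(2,4)]] assms(3) by (simp add: pid_comp le_infI1)
qed

lemma bij_below:
  assumes C: "C \<in> S.cyls"
  shows "bij_betw (below C) {D \<in> S.cyls. D \<subseteq> C} {D \<in> T.cyls. D \<subseteq> F0c C}"
  unfolding bij_betw_def
proof
  show "inj_on (below C) {D \<in> S.cyls. D \<subseteq> C}"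
  proof (rule inj_onI)
    fix D E assume D: "D \<in> {D \<in> S.cyls. D \<subseteq> C}" "E \<in> {D \<in> S.cyls. D \<subseteq> C}" and eq: "below C D = below C E"
    then have "F1c C (pid D) C = F1c C (pid E) C" using below_pid(1)[OF C] by simp
    then have "(pid D :: 'a list \<rightharpoonup> 'a list) = pid E" using F1c_inject[of C "pid D" C "pid E"] S.arrow_pid C D by simp
    then show "D = E" by simp
  qed
  show "below C ` {D \<in> S.cyls. D \<subseteq> C} = {D \<in> T.cyls. D \<subseteq> F0c C}"
  proof
    show "below C ` {D \<in> S.cyls. D \<subseteq> C} \<subseteq> {D \<in> T.cyls. D \<subseteq> F0c C}" using below_pid(2,3)[OF C] by auto
    show "{D \<in> T.cyls. D \<subseteq> F0c C} \<subseteq> below C ` {D \<in> S.cyls. D \<subseteq> C}"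
    proof
      fix D' assume D': "D' \<in> {D \<in> T.cyls. D \<subseteq> F0c C}"
      then have "T.arrow (F0c C) (pid D') (F0c C)" using T.arrow_pid F0_pid[OF C] by simp
      then obtain s where s: "S.arrow C s C" "F1c C s C = pid D'" using F1c_surj[OF C C] by blast
      have "F1c C (s \<circ>\<^sub>m s) C = F1c C s C" using F1c_comp[OF s(1,1)] s(2) by (simp add: pid_comp)
      then have "s \<circ>\<^sub>m s = s" using F1c_inject[OF S.arrow_comp[OF s(1,1)] s(1)] by simp
      then have "s \<in> idems S.S" using s(1) by (simp add: idems_def S.carrier_S S.arrow_def)
      then obtain D where D: "D \<in> S.cyls" "s = pid D" unfolding S.idems_S by blast
      then have "D \<subseteq> C" using s(1) by (simp add: S.arrow_def)
      then show "D' \<in> below C ` {D \<in> S.cyls. D \<subseteq> C}" using D s(2) unfolding below_def by (auto intro!: image_eqI[of _ _ D])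
    qed
  qed
qed

text \<open>The idempotent \<open>f \<le> e\<close> of the endomorphism monoid of \<open>e\<close> splits through the object \<open>f\<close>.
  Functors preserve splittings, so its image splits through the image of \<open>f\<close>.\<close>

lemma eqv_below:
  assumes "C \<in> S.cyls" "D \<in> S.cyls" "D \<subseteq> C" shows "T.eqv (F0c D) (below C D)"
proof -
  have a: "S.arrow C (pid D) D" "S.arrow D (pid D) C" using assms S.arrow_pid by blast+
  have "F1c D (pid D) C \<circ>\<^sub>m F1c C (pid D) D = pid (F0c D)"
    using F1c_comp[OF a(2,1)] F1c_ident[OF assms(2)] by (simp add: pid_comp)
  moreover have "F1c C (pid D) D \<circ>\<^sub>m F1c D (pid D) C = pid (below C D)"
    using F1c_comp[OF a] below_pid(1)[OF assms] by (simp add: pid_comp)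
  ultimately have "dom (F1c C (pid D) D) = F0c D \<and> ran (F1c C (pid D) D) = below C D"
    using T.split_range[OF F1_arrow(2)[OF a(1)] F1_arrow(2)[OF a(2)]] by blast
  then show ?thesis unfolding T.eqv_def using F1_arrow(2)[OF a(1)] unfolding T.arrow_def by blast
qed

lemma F0c_nonempty:
  assumes C: "C \<in> S.cyls" "C \<noteq> {}" shows "F0c C \<noteq> {}"
proof
  assume "F0c C = {}"
  then have "below C {} = below C C" using below_pid(3)[OF C(1)] C S.empty_in_cyls by blast
  then show False using bij_betw_imp_inj_on[OF bij_below[OF C(1)]] C by (auto simp: inj_on_def)
qed

definition class_map :: "'a set \<Rightarrow> 'b set" where
  "class_map X = (SOME Y. \<exists>\<gamma>. T.valid \<gamma> Y \<and> F0c (S.starts X) = T.cyl \<gamma> Y)"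

lemma class_map:
  assumes "X \<in> S.\<X>" shows "\<exists>\<gamma>. T.valid \<gamma> (class_map X) \<and> F0c (S.starts X) = T.cyl \<gamma> (class_map X)"
proof -
  have C: "S.starts X \<in> S.cyls" "S.starts X \<noteq> {}"
    using assms S.valid_cyl_nonempty[of "[]" X "[]"] by (simp_all add: S.valid_Nil S.cyl_Nil)
  have "\<exists>Y \<gamma>. T.valid \<gamma> Y \<and> F0c (S.starts X) = T.cyl \<gamma> Y"
    using T.cyls_nonempty F0_pid[OF C(1)] F0c_nonempty[OF C] by blast
  then show ?thesis unfolding class_map_def by (rule someI_ex)
qed

lemma F0c_cyl:
  assumes v: "S.valid \<alpha> X" shows "\<exists>\<beta>. T.valid \<beta> (class_map X) \<and> F0c (S.cyl \<alpha> X) = T.cyl \<beta> (class_map X)"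
proof -
  have X: "X \<in> S.\<X>" "S.valid [] X" using v S.validD by (simp_all add: S.valid_Nil)
  obtain \<gamma> where \<gamma>: "T.valid \<gamma> (class_map X)" "F0c (S.starts X) = T.cyl \<gamma> (class_map X)" using class_map[OF X(1)] by blast
  have "S.eqv (S.cyl \<alpha> X) (S.cyl [] X)" using S.eqv_cyl[OF v X(2)] by simp
  then have "T.eqv (F0c (S.cyl \<alpha> X)) (T.cyl \<gamma> (class_map X))" using eqv_F0c \<gamma> by (metis S.cyl_Nil)
  then show ?thesis using T.eqv_nonempty[OF _ \<gamma>(1)] by metis
qed

end

context two_shifts
begin

text \<open>What a Morita equivalence is used for: isomorphisms of the semilattices below the \<open>e\<^sub>X\<close> that
  respect the classes.\<close>

definition down_iso :: "('a set \<Rightarrow> 'b set) \<Rightarrow> ('a set \<Rightarrow> 'a list set \<Rightarrow> 'b list set) \<Rightarrow> bool" where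
  "down_iso \<phi> \<psi> \<longleftrightarrow> (\<forall>X\<in>S.\<X>. \<phi> X \<in> T.\<X> \<and>
     bij_betw (\<psi> X) {D \<in> S.cyls. D \<subseteq> S.starts X} {D \<in> T.cyls. D \<subseteq> T.starts (\<phi> X)} \<and>
     (\<forall>D E. D \<in> S.cyls \<and> D \<subseteq> S.starts X \<and> E \<in> S.cyls \<and> E \<subseteq> S.starts X \<longrightarrow> \<psi> X (D \<inter> E) = \<psi> X D \<inter> \<psi> X E) \<and>
     (\<forall>u W. S.lam X u W \<longrightarrow> (\<exists>u'. T.lam (\<phi> X) u' (\<phi> W) \<and> \<psi> X (S.cyl u W) = T.cyl u' (\<phi> W))))"

end

text \<open>The object \<open>e\<^sub>X\<close> is sent to some idempotent in the class of \<open>\<phi> X\<close> with a prefix \<open>\<gamma>\<close>; deleting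
  this prefix moves its semilattice to that below \<open>e\<close> of the class \<open>\<phi> X\<close>.\<close>

lemma (in shift_functor) down_iso_class_map: "\<exists>\<psi>. down_iso class_map \<psi>"
proof -
  define \<gamma> where "\<gamma> X = (SOME \<gamma>. T.valid \<gamma> (class_map X) \<and> F0c (S.starts X) = T.cyl \<gamma> (class_map X))" for X
  have \<gamma>: "T.valid (\<gamma> X) (class_map X)" "F0c (S.starts X) = T.cyl (\<gamma> X) (class_map X)" if "X \<in> S.\<X>" for X
    using someI_ex[OF class_map[OF that]] unfolding \<gamma>_def by blast+
  define \<psi> where "\<psi> X D = (@) (\<gamma> X) -` below (S.starts X) D" for X D
  have "class_map X \<in> T.\<X> \<and>
     bij_betw (\<psi> X) {D \<in> S.cyls. D \<subseteq> S.starts X} {D \<in> T.cyls. D \<subseteq> T.starts (class_map X)} \<and>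
     (\<forall>D E. D \<in> S.cyls \<and> D \<subseteq> S.starts X \<and> E \<in> S.cyls \<and> E \<subseteq> S.starts X \<longrightarrow> \<psi> X (D \<inter> E) = \<psi> X D \<inter> \<psi> X E) \<and>
     (\<forall>u W. S.lam X u W \<longrightarrow> (\<exists>u'. T.lam (class_map X) u' (class_map W) \<and> \<psi> X (S.cyl u W) = T.cyl u' (class_map W)))"
    if X: "X \<in> S.\<X>" for X
  proof (intro conjI allI impI)
    let ?C = "S.starts X" and ?Y = "class_map X"
    have C: "?C \<in> S.cyls" using X by simp
    note g = \<gamma>[OF X]
    show Y: "?Y \<in> T.\<X>" using g T.validD by blast
    have pre: "(@) (\<gamma> X) -` T.cyl (\<gamma> X @ u) W = T.cyl u W" for u W by (auto simp: T.cyl_append)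
    have cylD: "\<exists>u W. D = T.cyl (\<gamma> X @ u) W \<and> T.lam ?Y u W" if D: "D \<in> T.cyls" "D \<noteq> {}" "D \<subseteq> F0c ?C" for D
    proof -
      obtain \<beta> W where W: "D = T.cyl \<beta> W" "T.valid \<beta> W" using T.cyls_nonempty D by blast
      then show ?thesis using T.cyl_subsetD[OF Y W(2)] D(3) g(2) by blast
    qed
    have bv: "bij_betw ((-`) ((@) (\<gamma> X))) {D \<in> T.cyls. D \<subseteq> F0c ?C} {D \<in> T.cyls. D \<subseteq> T.starts ?Y}"
      unfolding bij_betw_def
    proof
      have im: "D = (@) (\<gamma> X) ` ((@) (\<gamma> X) -` D)" if "D \<subseteq> F0c ?C" for D
        using that unfolding g(2) T.cyl_def by blast
      show "inj_on ((-`) ((@) (\<gamma> X))) {D \<in> T.cyls. D \<subseteq> F0c ?C}"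
      proof (rule inj_onI)
        fix D E assume "D \<in> {D \<in> T.cyls. D \<subseteq> F0c ?C}" "E \<in> {D \<in> T.cyls. D \<subseteq> F0c ?C}"
          and eq: "(@) (\<gamma> X) -` D = (@) (\<gamma> X) -` E"
        then have "D \<subseteq> F0c ?C" "E \<subseteq> F0c ?C" by simp_all
        from trans[OF im[OF this(1)] trans[OF arg_cong[OF eq, of "(`) ((@) (\<gamma> X))"] im[OF this(2), symmetric]]] show "D = E" .
      qed
      show "(-`) ((@) (\<gamma> X)) ` {D \<in> T.cyls. D \<subseteq> F0c ?C} = {D \<in> T.cyls. D \<subseteq> T.starts ?Y}"
      proof (intro equalityI subsetI)
        fix E assume "E \<in> (-`) ((@) (\<gamma> X)) ` {D \<in> T.cyls. D \<subseteq> F0c ?C}"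
        then obtain D where D: "D \<in> T.cyls" "D \<subseteq> F0c ?C" "E = (@) (\<gamma> X) -` D" by blast
        show "E \<in> {D \<in> T.cyls. D \<subseteq> T.starts ?Y}"
        proof (cases "D = {}")
          case True then show ?thesis using D by simp
        next
          case False
          then obtain u W where "D = T.cyl (\<gamma> X @ u) W" "T.lam ?Y u W" using cylD D by blast
          then show ?thesis using D(3) pre T.lam_starts T.lamD(3) by simp
        qed
      next
        fix E assume E: "E \<in> {D \<in> T.cyls. D \<subseteq> T.starts ?Y}"
        show "E \<in> (-`) ((@) (\<gamma> X)) ` {D \<in> T.cyls. D \<subseteq> F0c ?C}"
        proof (cases "E = {}")
          case True then show ?thesis by (intro image_eqI[of _ _ "{}"]) simp_all
        next
          case False
          then obtain u W where W: "E = T.cyl u W" "T.valid u W" using T.cyls_nonempty E by blast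
          then have l: "T.lam ?Y u W" using T.cyl_subset_starts[OF Y W(2)] E by blast
          then have "T.cyl (\<gamma> X @ u) W \<in> T.cyls" "T.cyl (\<gamma> X @ u) W \<subseteq> F0c ?C"
            using T.cyl_mono[OF l] T.valid_append[OF g(1) l] g(2) by simp_all
          then show ?thesis using pre W by (intro image_eqI[of _ _ "T.cyl (\<gamma> X @ u) W"]) simp_all
        qed
      qed
    qed
    have eq: "\<psi> X = (-`) ((@) (\<gamma> X)) \<circ> below ?C" by (auto simp: \<psi>_def)
    show "bij_betw (\<psi> X) {D \<in> S.cyls. D \<subseteq> ?C} {D \<in> T.cyls. D \<subseteq> T.starts ?Y}"
      unfolding eq by (rule bij_betw_trans[OF bij_below[OF C] bv])
    show "\<psi> X (D \<inter> E) = \<psi> X D \<inter> \<psi> X E"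
      if "D \<in> S.cyls \<and> D \<subseteq> ?C \<and> E \<in> S.cyls \<and> E \<subseteq> ?C" for D E
      using that below_Int[OF C] by (simp add: \<psi>_def)
    show "\<exists>u'. T.lam ?Y u' (class_map W) \<and> \<psi> X (S.cyl u W) = T.cyl u' (class_map W)" if l: "S.lam X u W" for u W
    proof -
      have D: "S.cyl u W \<in> S.cyls" "S.cyl u W \<subseteq> ?C" using S.lamD(3)[OF l] S.lam_starts[OF l] by simp_all
      obtain \<beta> where \<beta>: "T.valid \<beta> (class_map W)" "F0c (S.cyl u W) = T.cyl \<beta> (class_map W)"
        using F0c_cyl[OF S.lamD(3)[OF l]] by blast
      have "T.eqv (below ?C (S.cyl u W)) (T.cyl \<beta> (class_map W))"
        using T.eqv_sym[OF eqv_below[OF C D]] \<beta> by simp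
      then obtain \<delta> where \<delta>: "below ?C (S.cyl u W) = T.cyl \<delta> (class_map W)" "T.valid \<delta> (class_map W)"
        using T.eqv_nonempty[OF _ \<beta>(1)] by metis
      obtain u' where "\<delta> = \<gamma> X @ u'" "T.lam ?Y u' (class_map W)"
        using T.cyl_subsetD[OF Y \<delta>(2)] below_pid(3)[OF C D] \<delta>(1) g(2) by metis
      then show ?thesis using \<delta> pre unfolding \<psi>_def by auto
    qed
  qed
  then show ?thesis unfolding down_iso_def by blast
qed

context markov_shift
begin

lemma subcov_iff_ccov:
  assumes X: "X \<in> \<X>" and v: "valid u W" shows "subcov X u W \<longleftrightarrow> ccov (cyl u W) (starts X)"
proof
  have vX: "valid [] X" using X by (simp add: valid_Nil)
  show "ccov (cyl u W) (starts X)" if "subcov X u W" using subcov_ccov[OF vX that] by (simp add: cyl_Nil)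
  show "subcov X u W" if c: "ccov (cyl u W) (starts X)"
  proof -
    have "ccov (cyl u W) (cyl [] X)" using c by (simp add: cyl_Nil)
    then obtain t V where t: "cyl u W = cyl t V" "subcov X t V"
      using ccovD[OF vX _ valid_cyl_nonempty[OF v, of u]] by auto
    then have "u = t \<and> W = V" using cyl_inject[OF v lamD(3)[OF subcov_lam]] by blast
    then show ?thesis using t by simp
  qed
qed

lemma subcov_word: "subcov X u W \<Longrightarrow> u \<in> insert [] ((\<lambda>x. [x]) ` A)"
  using \<X>_subset unfolding subcov_def by blast

lemma finite_subcov: "finite {u. subcov X u W}"
  by (rule finite_subset[of _ "insert [] ((\<lambda>x. [x]) ` A)"]) (use subcov_word finite_A in auto)

text \<open>Between two given classes at most one cover is not an exit, namely \<open>e\<^sub>W \<lless> e\<^sub>X\<close> when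
  \<open>W \<preceq> X\<close>.\<close>

lemma card_exitp:
  "card {u. exitp X u W} = card {u. subcov X u W} - (if cov W X \<and> ple W X then 1 else 0)"
proof (cases "cov W X \<and> ple W X")
  case True
  then have "[] \<in> {u. subcov X u W}" using covD by (auto simp: subcov_def)
  moreover have "{u. exitp X u W} = {u. subcov X u W} - {[]}" using True by (auto simp: exitp_def)
  ultimately show ?thesis using True finite_subcov by (simp add: card_Diff_singleton)
next
  case False
  then have "{u. exitp X u W} = {u. subcov X u W}" by (auto simp: exitp_def subcov_def)
  then show ?thesis using False by auto
qed

end

context two_shifts
begin

context
  fixes \<phi> :: "'a set \<Rightarrow> 'b set" and \<psi> :: "'a set \<Rightarrow> 'a list set \<Rightarrow> 'b list set"
  assumes down: "down_iso \<phi> \<psi>"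
begin

lemma down_class: "X \<in> S.\<X> \<Longrightarrow> \<phi> X \<in> T.\<X>"
  and down_bij: "X \<in> S.\<X> \<Longrightarrow>
    bij_betw (\<psi> X) {D \<in> S.cyls. D \<subseteq> S.starts X} {D \<in> T.cyls. D \<subseteq> T.starts (\<phi> X)}"
  and down_Int: "X \<in> S.\<X> \<Longrightarrow> D \<in> S.cyls \<Longrightarrow> D \<subseteq> S.starts X \<Longrightarrow> E \<in> S.cyls \<Longrightarrow> E \<subseteq> S.starts X \<Longrightarrow>
    \<psi> X (D \<inter> E) = \<psi> X D \<inter> \<psi> X E"
  and down_cyl: "X \<in> S.\<X> \<Longrightarrow> S.lam X u W \<Longrightarrow> \<exists>u'. T.lam (\<phi> X) u' (\<phi> W) \<and> \<psi> X (S.cyl u W) = T.cyl u' (\<phi> W)"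
  using down unfolding down_iso_def by simp_all

lemma down_in: "X \<in> S.\<X> \<Longrightarrow> D \<in> S.cyls \<Longrightarrow> D \<subseteq> S.starts X \<Longrightarrow> \<psi> X D \<in> T.cyls \<and> \<psi> X D \<subseteq> T.starts (\<phi> X)"
  using bij_betwE[OF down_bij] by blast

lemma down_surj:
  assumes "X \<in> S.\<X>" "D' \<in> T.cyls" "D' \<subseteq> T.starts (\<phi> X)"
  obtains D where "D \<in> S.cyls" "D \<subseteq> S.starts X" "\<psi> X D = D'"
proof -
  have "D' \<in> \<psi> X ` {D \<in> S.cyls. D \<subseteq> S.starts X}"
    unfolding bij_betw_imp_surj_on[OF down_bij[OF assms(1)]] using assms by simp
  then show ?thesis using that by blast
qed

lemma down_inject:
  assumes "X \<in> S.\<X>" "D \<in> S.cyls" "D \<subseteq> S.starts X" "E \<in> S.cyls" "E \<subseteq> S.starts X" "\<psi> X D = \<psi> X E"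
  shows "D = E"
  using inj_onD[OF bij_betw_imp_inj_on[OF down_bij[OF assms(1)]] assms(6)] assms by blast

lemma down_mono:
  assumes "X \<in> S.\<X>" "D \<in> S.cyls" "D \<subseteq> S.starts X" "E \<in> S.cyls" "E \<subseteq> S.starts X"
  shows "\<psi> X D \<subseteq> \<psi> X E \<longleftrightarrow> D \<subseteq> E"
proof
  assume "D \<subseteq> E"
  then have "D \<inter> E = D" by blast
  then show "\<psi> X D \<subseteq> \<psi> X E" using down_Int[OF assms] by auto
next
  assume "\<psi> X D \<subseteq> \<psi> X E"
  then have "\<psi> X (D \<inter> E) = \<psi> X D" using down_Int[OF assms] by blast
  moreover have "D \<inter> E \<in> S.cyls" "D \<inter> E \<subseteq> S.starts X" using S.Int_cyls assms by blast+
  ultimately have "D \<inter> E = D" using down_inject assms by blast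
  then show "D \<subseteq> E" by blast
qed

lemma down_top:
  assumes X: "X \<in> S.\<X>" shows "\<psi> X (S.starts X) = T.starts (\<phi> X)"
proof -
  have "T.starts (\<phi> X) \<in> T.cyls" using down_class[OF X] by simp
  then obtain D where D: "D \<in> S.cyls" "D \<subseteq> S.starts X" "\<psi> X D = T.starts (\<phi> X)"
    using down_surj[OF X] by blast
  have C: "S.starts X \<in> S.cyls" using X by simp
  have "\<psi> X D \<subseteq> \<psi> X (S.starts X)" using down_mono[OF X D(1,2) C] D(2) by simp
  then show ?thesis using D(3) down_in[OF X C] by blast
qed

lemma down_ccov:
  assumes X: "X \<in> S.\<X>" and D: "D \<in> S.cyls" "D \<subseteq> S.starts X" and E: "E \<in> S.cyls" "E \<subseteq> S.starts X"
  shows "T.ccov (\<psi> X D) (\<psi> X E) \<longleftrightarrow> S.ccov D E"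
proof -
  have sub: "\<psi> X G \<subset> \<psi> X H \<longleftrightarrow> G \<subset> H"
    if "G \<in> S.cyls" "G \<subseteq> S.starts X" "H \<in> S.cyls" "H \<subseteq> S.starts X" for G H
    using down_mono[OF X that] down_mono[OF X that(3,4,1,2)] by (simp add: less_le_not_le)
  have "(\<exists>G\<in>T.cyls. \<psi> X D \<subset> G \<and> G \<subset> \<psi> X E) \<longleftrightarrow> (\<exists>G\<in>S.cyls. D \<subset> G \<and> G \<subset> E)"
  proof
    assume "\<exists>G\<in>T.cyls. \<psi> X D \<subset> G \<and> G \<subset> \<psi> X E"
    then obtain G' where G': "G' \<in> T.cyls" "\<psi> X D \<subset> G'" "G' \<subset> \<psi> X E" by blast
    then have "G' \<subseteq> T.starts (\<phi> X)" using down_in[OF X E] by blast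
    then obtain G where G: "G \<in> S.cyls" "G \<subseteq> S.starts X" "\<psi> X G = G'" using down_surj[OF X G'(1)] by blast
    then show "\<exists>G\<in>S.cyls. D \<subset> G \<and> G \<subset> E" using G' sub[OF D G(1,2)] sub[OF G(1,2) E] by blast
  next
    assume "\<exists>G\<in>S.cyls. D \<subset> G \<and> G \<subset> E"
    then obtain G where G: "G \<in> S.cyls" "D \<subset> G" "G \<subset> E" by blast
    then have Gs: "G \<subseteq> S.starts X" using E by blast
    then show "\<exists>G\<in>T.cyls. \<psi> X D \<subset> G \<and> G \<subset> \<psi> X E"
      using G sub[OF D G(1) Gs] sub[OF G(1) Gs E] down_in[OF X G(1) Gs] by blast
  qed
  then show ?thesis unfolding S.ccov_def T.ccov_def using sub[OF D E] down_in[OF X D] down_in[OF X E] D E by simp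
qed

text \<open>An isomorphism may move some \<open>e\<^sub>Y \<le> e\<^sub>X\<close> to an idempotent with a nonempty prefix, but not if
  \<open>Y\<close> lies in the core of \<open>X\<close>: the core is defined by the order alone, and prefixes are empty in the
  core of the image.\<close>

lemma down_core:
  assumes X: "X \<in> S.\<X>" and Y: "Y \<in> S.set_core X"
  shows "\<psi> X (S.starts Y) = T.starts (\<phi> Y) \<and> \<phi> Y \<in> T.set_core (\<phi> X)"
  using Y
proof (induction rule: S.set_core.induct)
  have st: "S.starts V \<in> S.cyls" "S.starts V \<subseteq> S.starts X" "S.lam X [] V" "V \<in> S.\<X>" if "V \<in> S.set_core X" for V
    using S.set_coreD[OF X that] S.starts_mono by (simp_all add: S.lam_Nil X)
  have fin: "\<psi> X (S.starts V) = T.starts (\<phi> V) \<and> \<phi> V = V'" if V: "V \<in> S.set_core X" "\<psi> X (S.starts V) = T.starts V'" "V' \<in> T.\<X>" for V V'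
  proof -
    obtain u' where u': "T.lam (\<phi> X) u' (\<phi> V)" "\<psi> X (S.starts V) = T.cyl u' (\<phi> V)"
      using down_cyl[OF X st(3)[OF V(1)]] by (auto simp: S.cyl_Nil)
    then have "T.cyl u' (\<phi> V) = T.cyl [] V'" using V(2) by (simp add: T.cyl_Nil)
    then have "u' = [] \<and> \<phi> V = V'"
      using T.cyl_inject[OF T.lamD(3)[OF u'(1)], of "[]" V'] V(3) by (simp add: T.valid_Nil)
    then show ?thesis using V(2) by simp
  qed
  have mono: "V \<subseteq> W \<longleftrightarrow> \<phi> V \<subseteq> \<phi> W"
    if "V \<in> S.set_core X" "W \<in> S.set_core X" "\<psi> X (S.starts V) = T.starts (\<phi> V)" "\<psi> X (S.starts W) = T.starts (\<phi> W)" for V W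
    using down_mono[OF X st(1,2)[OF that(1)] st(1,2)[OF that(2)]] that(3,4)
      S.starts_subset_iff[OF S.\<X>_subset[OF st(4)[OF that(1)]]]
      T.starts_subset_iff[OF T.\<X>_subset[OF down_class[OF st(4)[OF that(1)]]]] by simp
  {
    case set_core_self
    show ?case using down_top[OF X] T.set_core_self by simp
  next
    case (set_core_Int Y Z)
    have c: "Y \<inter> Z \<in> S.set_core X" using S.set_core_Int set_core_Int by blast
    have eq: "\<psi> X (S.starts (Y \<inter> Z)) = T.starts (\<phi> Y \<inter> \<phi> Z)"
      using down_Int[OF X st(1,2)[OF set_core_Int(1)] st(1,2)[OF set_core_Int(2)]] set_core_Int.IH
      by (simp add: S.starts_Int T.starts_Int)
    obtain u' where u': "T.lam (\<phi> X) u' (\<phi> (Y \<inter> Z))" "\<psi> X (S.starts (Y \<inter> Z)) = T.cyl u' (\<phi> (Y \<inter> Z))"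
      using down_cyl[OF X st(3)[OF c]] by (auto simp: S.cyl_Nil)
    have "T.starts (\<phi> Y \<inter> \<phi> Z) \<noteq> {}" using T.valid_cyl_nonempty[OF T.lamD(3)[OF u'(1)], of u'] u'(2) eq by simp
    then have ne: "\<phi> Y \<inter> \<phi> Z \<noteq> {}" by auto
    then have "\<phi> Y \<inter> \<phi> Z \<in> T.\<X>"
      using T.Int_member down_class st(4)[OF set_core_Int(1)] st(4)[OF set_core_Int(2)] by blast
    from fin[OF c eq this] show ?case using T.set_core_Int[of "\<phi> Y" "\<phi> X" "\<phi> Z"] set_core_Int.IH ne by simp
  next
    case (set_core_incomparable H K Y Z)
    have c: "Y \<in> S.set_core X" using S.set_core_incomparable[OF set_core_incomparable(1-7)] .
    have c': "Z \<in> S.set_core X"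
      using S.set_core_incomparable[OF set_core_incomparable(2,1,4,3,6,5)] set_core_incomparable(7) by blast
    have cc: "S.ccov (S.starts V) (S.starts G)" if "S.cov V G" for V G
      using S.subcov_iff_ccov[of G "[]" V] S.covD[OF that] that by (simp add: S.subcov_def S.valid_Nil S.cyl_Nil)
    have cov: "T.ccov (\<psi> X (S.starts Y)) (T.starts (\<phi> H))" "T.ccov (\<psi> X (S.starts Z)) (T.starts (\<phi> K))"
      using down_ccov[OF X st(1,2)[OF c] st(1,2)[OF set_core_incomparable(1)]] cc[OF set_core_incomparable(3)]
        down_ccov[OF X st(1,2)[OF c'] st(1,2)[OF set_core_incomparable(2)]] cc[OF set_core_incomparable(4)]
        set_core_incomparable.IH by simp_all
    obtain u where u: "T.lam (\<phi> X) u (\<phi> Y)" "\<psi> X (S.starts Y) = T.cyl u (\<phi> Y)"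
      using down_cyl[OF X st(3)[OF c]] by (auto simp: S.cyl_Nil)
    obtain t where t: "T.lam (\<phi> X) t (\<phi> Z)" "\<psi> X (S.starts Z) = T.cyl t (\<phi> Z)"
      using down_cyl[OF X st(3)[OF c']] by (auto simp: S.cyl_Nil)
    have HK: "\<phi> H \<in> T.\<X>" "\<phi> K \<in> T.\<X>"
      using down_class st(4)[OF set_core_incomparable(1)] st(4)[OF set_core_incomparable(2)] by blast+
    have s: "T.subcov (\<phi> H) u (\<phi> Y)" "T.subcov (\<phi> K) t (\<phi> Z)"
      using cov T.subcov_iff_ccov[OF HK(1) T.lamD(3)[OF u(1)]] T.subcov_iff_ccov[OF HK(2) T.lamD(3)[OF t(1)]] u t by simp_all
    have inc: "\<not> S.starts Y \<subseteq> S.starts Z" "\<not> S.starts Z \<subseteq> S.starts Y"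
      using set_core_incomparable(5,6) S.starts_subset_iff S.\<X>_subset st(4)[OF c] st(4)[OF c'] by simp_all
    then have nle: "\<not> T.cyl u (\<phi> Y) \<subseteq> T.cyl t (\<phi> Z)" "\<not> T.cyl t (\<phi> Z) \<subseteq> T.cyl u (\<phi> Y)"
      using down_mono[OF X st(1,2)[OF c] st(1,2)[OF c']] down_mono[OF X st(1,2)[OF c'] st(1,2)[OF c]] u t by simp_all
    have YZ: "Y \<inter> Z \<in> S.\<X>" using S.Int_member st(4)[OF c] st(4)[OF c'] set_core_incomparable(7) by blast
    then have "S.lam X [] (Y \<inter> Z)" using st(3)[OF c] by (auto simp: S.lam_Nil)
    then obtain v' where v': "T.lam (\<phi> X) v' (\<phi> (Y \<inter> Z))" "\<psi> X (S.starts (Y \<inter> Z)) = T.cyl v' (\<phi> (Y \<inter> Z))"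
      using down_cyl[OF X] by (metis S.cyl_Nil)
    have "\<psi> X (S.starts (Y \<inter> Z)) = T.cyl u (\<phi> Y) \<inter> T.cyl t (\<phi> Z)"
      using down_Int[OF X st(1,2)[OF c] st(1,2)[OF c']] u t by (simp add: S.starts_Int)
    then have ne: "T.cyl u (\<phi> Y) \<inter> T.cyl t (\<phi> Z) \<noteq> {}"
      using v' T.valid_cyl_nonempty[OF T.lamD(3)[OF v'(1)], of v'] by simp
    have nil: "u = []" "t = []" using T.subcov_incomparable[OF s, of "[]"] nle ne by simp_all
    have "T.cov (\<phi> Y) (\<phi> H)" "T.cov (\<phi> Z) (\<phi> K)" using s nil by (auto simp: T.subcov_def)
    moreover have "\<not> \<phi> Y \<subseteq> \<phi> Z" "\<not> \<phi> Z \<subseteq> \<phi> Y" "\<phi> Y \<inter> \<phi> Z \<noteq> {}"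
      using nle ne nil T.starts_mono by (auto simp: T.cyl_Nil T.starts_Int)
    ultimately have "\<phi> Y \<in> T.set_core (\<phi> X)"
      using T.set_core_incomparable[of "\<phi> H" "\<phi> X" "\<phi> K" "\<phi> Y" "\<phi> Z"] set_core_incomparable.IH by blast
    then show ?case using u nil by (simp add: T.cyl_Nil)
  next
    case (set_core_between Y Z G)
    have c: "G \<in> S.set_core X" using S.set_core_between[OF set_core_between(1-5)] .
    note sY = st[OF set_core_between(1)] and sZ = st[OF set_core_between(2)] and sG = st[OF c]
    have "\<psi> X (S.starts Y) \<subseteq> \<psi> X (S.starts G)" "\<psi> X (S.starts G) \<subseteq> \<psi> X (S.starts Z)"
      using down_mono[OF X sY(1,2) sG(1,2)] down_mono[OF X sG(1,2) sZ(1,2)] set_core_between(4,5) S.starts_mono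
      by (simp_all add: less_imp_le)
    then have "T.cyl [] (\<phi> Y) \<subseteq> \<psi> X (S.starts G)" "\<psi> X (S.starts G) \<subseteq> T.cyl [] (\<phi> Z)"
      using set_core_between.IH by (simp_all add: T.cyl_Nil)
    then obtain V where V: "\<psi> X (S.starts G) = T.cyl [] V" "V \<in> T.\<X>" "\<phi> Y \<subseteq> V" "V \<subseteq> \<phi> Z"
      using T.cyl_between[of "[]" "\<phi> Y" "\<phi> Z" "\<psi> X (S.starts G)"] down_class[OF sY(4)] down_class[OF sZ(4)]
        down_in[OF X sG(1,2)] by (metis T.valid_Nil)
    have f: "\<psi> X (S.starts G) = T.starts (\<phi> G)" "\<phi> G = V" using fin[OF c] V by (simp_all add: T.cyl_Nil)
    have "\<phi> Y \<subset> \<phi> G" "\<phi> G \<subset> \<phi> Z"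
      using mono[OF set_core_between(1) c] mono[OF c set_core_between(1)] mono[OF c set_core_between(2)]
        mono[OF set_core_between(2) c] set_core_between.IH f set_core_between(4,5) by (simp_all add: less_le_not_le)
    then show ?case
      using T.set_core_between[of "\<phi> Y" "\<phi> X" "\<phi> Z" "\<phi> G"] set_core_between.IH f V by simp
  }
qed

lemma down_ple: assumes "S.ple Y X" shows "T.ple (\<phi> Y) (\<phi> X)"
proof -
  have step: "T.ple1 (\<phi> Y) (\<phi> X)" if p: "S.ple1 Y X" for Y X
  proof -
    obtain W where W: "W \<in> S.\<X>" "Y \<in> S.set_core W" "X \<in> S.set_core W" "Y \<subseteq> X" using p unfolding S.ple1_def by blast
    note Y = S.set_coreD[OF W(1,2)] and X = S.set_coreD[OF W(1,3)]
    have "\<psi> W (S.starts Y) \<subseteq> \<psi> W (S.starts X)"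
      using down_mono[OF W(1), of "S.starts Y" "S.starts X"] Y X S.starts_mono[of Y W] S.starts_mono[of X W]
        S.starts_mono[OF W(4)] by simp
    then have "T.starts (\<phi> Y) \<subseteq> T.starts (\<phi> X)" using down_core[OF W(1,2)] down_core[OF W(1,3)] by simp
    then have "\<phi> Y \<subseteq> \<phi> X" using T.starts_subset_iff T.\<X>_subset down_class Y by blast
    then show ?thesis unfolding T.ple1_def using down_core[OF W(1,2)] down_core[OF W(1,3)] down_class[OF W(1)] by blast
  qed
  show ?thesis using assms[unfolded S.ple_def] unfolding T.ple_def
    by (induction rule: tranclp_induct) (use step in \<open>auto intro: tranclp.intros\<close>)
qed

lemma down_card_subcov:
  assumes inj: "inj_on \<phi> S.\<X>" and surj: "T.\<X> \<subseteq> \<phi> ` S.\<X>" and XW: "X \<in> S.\<X>" "W \<in> S.\<X>"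
  shows "card {u. S.subcov X u W} = card {u. T.subcov (\<phi> X) u (\<phi> W)}"
proof -
  define h where "h u = (SOME u'. T.lam (\<phi> X) u' (\<phi> W) \<and> \<psi> X (S.cyl u W) = T.cyl u' (\<phi> W))" for u
  have h: "T.lam (\<phi> X) (h u) (\<phi> W)" "\<psi> X (S.cyl u W) = T.cyl (h u) (\<phi> W)" if "S.lam X u W" for u
    using someI_ex[OF down_cyl[OF XW(1) that]] unfolding h_def by blast+
  have C: "S.cyl u V \<in> S.cyls" "S.cyl u V \<subseteq> S.starts X" if "S.lam X u V" for u V
    using S.lamD(3)[OF that] S.lam_starts[OF that] by simp_all
  have t: "S.starts X \<in> S.cyls" "S.starts X \<subseteq> S.starts X" using XW by simp_all
  have iff: "T.subcov (\<phi> X) (h u) (\<phi> W) \<longleftrightarrow> S.subcov X u W" if l: "S.lam X u W" for u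
    using down_ccov[OF XW(1) C[OF l] t] h[OF l] down_top[OF XW(1)]
      S.subcov_iff_ccov[OF XW(1) S.lamD(3)[OF l]] T.subcov_iff_ccov[OF down_class[OF XW(1)] T.lamD(3)[OF h(1)[OF l]]] by simp
  have "bij_betw h {u. S.subcov X u W} {u. T.subcov (\<phi> X) u (\<phi> W)}"
    unfolding bij_betw_def
  proof
    show "inj_on h {u. S.subcov X u W}"
    proof (rule inj_onI)
      fix u v assume "u \<in> {u. S.subcov X u W}" "v \<in> {u. S.subcov X u W}" and eq: "h u = h v"
      then have l: "S.lam X u W" "S.lam X v W" using S.subcov_lam by blast+
      then have "\<psi> X (S.cyl u W) = \<psi> X (S.cyl v W)" using h eq by simp
      then have "S.cyl u W = S.cyl v W" using down_inject[OF XW(1) C[OF l(1)] C[OF l(2)]] by simp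
      then show "u = v" using S.cyl_inject[OF S.lamD(3)[OF l(1)] S.lamD(3)[OF l(2)]] by simp
    qed
    show "h ` {u. S.subcov X u W} = {u. T.subcov (\<phi> X) u (\<phi> W)}"
    proof
      show "h ` {u. S.subcov X u W} \<subseteq> {u. T.subcov (\<phi> X) u (\<phi> W)}" using iff S.subcov_lam by blast
      show "{u. T.subcov (\<phi> X) u (\<phi> W)} \<subseteq> h ` {u. S.subcov X u W}"
      proof
        fix u' assume "u' \<in> {u. T.subcov (\<phi> X) u (\<phi> W)}"
        then have s: "T.subcov (\<phi> X) u' (\<phi> W)" by simp
        note l' = T.subcov_lam[OF s]
        obtain D where D: "D \<in> S.cyls" "D \<subseteq> S.starts X" "\<psi> X D = T.cyl u' (\<phi> W)"
          using down_surj[OF XW(1), of "T.cyl u' (\<phi> W)"] T.lamD(3)[OF l'] T.lam_starts[OF l'] T.cyl_in_cyls by blast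
        have "D \<noteq> {}"
        proof
          assume "D = {}"
          then have "\<psi> X D \<subseteq> \<psi> X E" if "E \<in> S.cyls" "E \<subseteq> S.starts X" for E
            using down_mono[OF XW(1) D(1,2) that] by simp
          moreover obtain E where "E \<in> S.cyls" "E \<subseteq> S.starts X" "\<psi> X E = {}"
            using down_surj[OF XW(1), of "{}"] by auto
          ultimately show False using D(3) T.valid_cyl_nonempty[OF T.lamD(3)[OF l'], of u'] by blast
        qed
        then obtain u V where u: "D = S.cyl u V" "S.valid u V" using S.cyls_nonempty D(1) by blast
        then have l: "S.lam X u V" using S.cyl_subset_starts[OF XW(1) u(2)] D(2) by simp
        obtain u'' where "T.lam (\<phi> X) u'' (\<phi> V)" "\<psi> X D = T.cyl u'' (\<phi> V)" using down_cyl[OF XW(1) l] u by blast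
        then have "u'' = u'" "\<phi> V = \<phi> W" using T.cyl_inject[OF T.lamD(3) T.lamD(3)[OF l']] D(3) by metis+
        then have V: "V = W" using inj S.lamD(2)[OF l] XW by (auto simp: inj_on_def)
        then have lW: "S.lam X u W" using l by simp
        have "T.cyl (h u) (\<phi> W) = T.cyl u' (\<phi> W)" using h(2)[OF lW] D(3) u V by simp
        then have "h u = u'" using T.cyl_inject[OF T.lamD(3)[OF h(1)[OF lW]] T.lamD(3)[OF l']] by blast
        then show "u' \<in> h ` {u. S.subcov X u W}" using iff[OF lW] s by blast
      qed
    qed
  qed
  then show ?thesis by (rule bij_betw_same_card)
qed

end

text \<open>Covers are counted by the isomorphisms below the \<open>e\<^sub>X\<close>, and the covers that are not exits are
  covers for \<open>\<preceq>\<close>; so the numbers of exits agree.\<close>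

lemma down_iso_comb_iso:
  assumes d: "down_iso \<phi> \<psi>" and b: "bij_betw \<phi> S.\<X> T.\<X>"
    and le: "\<And>X Y. X \<in> S.\<X> \<Longrightarrow> Y \<in> S.\<X> \<Longrightarrow> S.ple X Y \<longleftrightarrow> T.ple (\<phi> X) (\<phi> Y)"
  shows "\<exists>g. comb_iso \<phi> g"
proof -
  have inj: "inj_on \<phi> S.\<X>" and img: "\<phi> ` S.\<X> = T.\<X>" using b by (simp_all add: bij_betw_def)
  have in\<phi>: "\<phi> X \<in> T.\<X>" if "X \<in> S.\<X>" for X using img that by blast
  have inj\<phi>: "\<phi> X = \<phi> Y \<longleftrightarrow> X = Y" if "X \<in> S.\<X>" "Y \<in> S.\<X>" for X Y
    using inj that by (auto simp: inj_on_def)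
  have cov: "S.cov W X \<and> S.ple W X \<longleftrightarrow> T.cov (\<phi> W) (\<phi> X) \<and> T.ple (\<phi> W) (\<phi> X)" if XW: "X \<in> S.\<X>" "W \<in> S.\<X>" for X W
  proof -
    have "(\<forall>Z. S.ple W Z \<and> S.ple Z X \<longrightarrow> Z = W \<or> Z = X) \<longleftrightarrow> (\<forall>Z\<in>S.\<X>. S.ple W Z \<and> S.ple Z X \<longrightarrow> Z = W \<or> Z = X)"
      using S.ple_subset by blast
    also have "\<dots> \<longleftrightarrow> (\<forall>Z\<in>S.\<X>. T.ple (\<phi> W) (\<phi> Z) \<and> T.ple (\<phi> Z) (\<phi> X) \<longrightarrow> \<phi> Z = \<phi> W \<or> \<phi> Z = \<phi> X)"
      using le XW inj\<phi> by simp
    also have "\<dots> \<longleftrightarrow> (\<forall>Z\<in>T.\<X>. T.ple (\<phi> W) Z \<and> T.ple Z (\<phi> X) \<longrightarrow> Z = \<phi> W \<or> Z = \<phi> X)"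
      unfolding img[symmetric] by simp
    also have "\<dots> \<longleftrightarrow> (\<forall>Z. T.ple (\<phi> W) Z \<and> T.ple Z (\<phi> X) \<longrightarrow> Z = \<phi> W \<or> Z = \<phi> X)"
      using T.ple_subset by blast
    finally show ?thesis unfolding S.cov_ple_iff T.cov_ple_iff using le[OF XW(2,1)] inj\<phi>[OF XW(2,1)] by simp
  qed
  have "\<exists>g. bij_betw g {u. S.exitp X u W} {u. T.exitp (\<phi> X) u (\<phi> W)}" if XW: "X \<in> S.\<X>" "W \<in> S.\<X>" for X W
  proof (rule finite_same_card_bij[OF S.finite_exits T.finite_exits])
    show "card {u. S.exitp X u W} = card {u. T.exitp (\<phi> X) u (\<phi> W)}"
      unfolding S.card_exitp T.card_exitp
      using cov[OF XW] down_card_subcov[OF d inj _ XW] img by simp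
  qed
  then have "\<exists>g. \<forall>X\<in>S.\<X>. \<forall>W\<in>S.\<X>. bij_betw (g X W) {u. S.exitp X u W} {u. T.exitp (\<phi> X) u (\<phi> W)}"
    by metis
  then show ?thesis unfolding comb_iso_def using b le by blast
qed

end

lemma (in markov_shift) iso_eqv:
  assumes h: "is_isomorphism CS h" and "Dom CS h = pid C" "Cod CS h = pid D" shows "eqv C D"
proof -
  obtain k where k: "k \<in> Arr CS" "Dom CS k = Cod CS h" "Cod CS k = Dom CS h"
    "Comp CS k h = Ident CS (Dom CS h)" "Comp CS h k = Ident CS (Cod CS h)" and hA: "h \<in> Arr CS"
    using h unfolding is_isomorphism_def by blast
  obtain s where s: "h = (pid D, s, pid C)" "arrow D s C" using hA assms unfolding Arr_CS by auto
  obtain t where t: "k = (pid C, t, pid D)" "arrow C t D" using k(1-3) s unfolding Arr_CS by auto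
  have "t \<circ>\<^sub>m s = pid C" "s \<circ>\<^sub>m t = pid D" using k(4,5) s t by simp_all
  then have "dom s = C \<and> ran s = D" using split_range[OF s(2) t(2)] by blast
  then show ?thesis unfolding eqv_def using s(2) unfolding arrow_def by blast
qed

context two_shifts
begin

text \<open>The unit and the counit of the equivalence make the two maps of classes mutually inverse, so
  that \<open>\<preceq>\<close> is preserved in both directions.\<close>

lemma morita_comb_iso:
  assumes "morita_equivalent S.S T.S" shows "\<exists>\<phi> g. comb_iso \<phi> g"
proof -
  obtain F\<^sub>0 F\<^sub>1 G\<^sub>0 G\<^sub>1 \<eta> \<epsilon> where F: "is_functor S.CS T.CS F\<^sub>0 F\<^sub>1" and G: "is_functor T.CS S.CS G\<^sub>0 G\<^sub>1"
    and \<eta>: "is_natural_iso S.CS S.CS id id (G\<^sub>0 \<circ> F\<^sub>0) (G\<^sub>1 \<circ> F\<^sub>1) \<eta>"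
    and \<epsilon>: "is_natural_iso T.CS T.CS (F\<^sub>0 \<circ> G\<^sub>0) (F\<^sub>1 \<circ> G\<^sub>1) id id \<epsilon>"
    using assms unfolding morita_equivalent_def equivalent_categories_def by blast
  note full = equivalence_full[OF S.cat_CS T.cat_CS F G \<eta> \<epsilon>]
  note full' = equivalence_full_inverse[OF S.cat_CS T.cat_CS F G \<eta> \<epsilon>]
  interpret R: two_shifts B N A M by unfold_locales
  interpret FF: shift_functor A M B N F\<^sub>0 F\<^sub>1
    by unfold_locales (fact F, rule equivalence_faithful[OF S.cat_CS \<eta>], assumption+, rule full, assumption+)
  interpret GG: shift_functor B N A M G\<^sub>0 G\<^sub>1
    by unfold_locales (fact G, rule equivalence_faithful_inverse[OF T.cat_CS \<epsilon>], assumption+, rule full', assumption+)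
  let ?\<phi> = FF.class_map and ?\<phi>' = GG.class_map
  obtain \<psi> \<psi>' where d: "down_iso ?\<phi> \<psi>" "R.down_iso ?\<phi>' \<psi>'" using FF.down_iso_class_map GG.down_iso_class_map by blast
  have in\<phi>: "?\<phi> X \<in> T.\<X>" if "X \<in> S.\<X>" for X using down_class[OF d(1) that] .
  have in\<phi>': "?\<phi>' X \<in> S.\<X>" if "X \<in> T.\<X>" for X using R.down_class[OF d(2) that] .
  have inv1: "?\<phi>' (?\<phi> X) = X" if X: "X \<in> S.\<X>" for X
  proof -
    obtain \<gamma> where \<gamma>: "T.valid \<gamma> (?\<phi> X)" "FF.F0c (S.starts X) = T.cyl \<gamma> (?\<phi> X)" using FF.class_map[OF X] by blast
    obtain \<beta> where \<beta>: "S.valid \<beta> (?\<phi>' (?\<phi> X))" "GG.F0c (T.cyl \<gamma> (?\<phi> X)) = S.cyl \<beta> (?\<phi>' (?\<phi> X))"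
      using GG.F0c_cyl[OF \<gamma>(1)] by blast
    have C: "S.starts X \<in> S.cyls" using X by simp
    then have "pid (S.starts X) \<in> Obj S.CS" by (simp add: S.Obj_CS)
    note n = is_natural_isoD(1)[OF \<eta> this]
    have "G\<^sub>0 (F\<^sub>0 (pid (S.starts X))) = pid (S.cyl \<beta> (?\<phi>' (?\<phi> X)))"
      using FF.F0_pid[OF C] GG.F0_pid[OF T.cyl_in_cyls[OF \<gamma>(1)]] \<gamma> \<beta> by simp
    then have "S.eqv (S.cyl [] X) (S.cyl \<beta> (?\<phi>' (?\<phi> X)))" using n by (intro S.iso_eqv[of "\<eta> (pid (S.starts X))"]) (simp_all add: S.cyl_Nil)
    then show ?thesis using S.eqv_cyl[OF _ \<beta>(1), of "[]" X] X by (simp add: S.valid_Nil)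
  qed
  have inv2: "?\<phi> (?\<phi>' X) = X" if X: "X \<in> T.\<X>" for X
  proof -
    obtain \<gamma> where \<gamma>: "S.valid \<gamma> (?\<phi>' X)" "GG.F0c (T.starts X) = S.cyl \<gamma> (?\<phi>' X)" using GG.class_map[OF X] by blast
    obtain \<beta> where \<beta>: "T.valid \<beta> (?\<phi> (?\<phi>' X))" "FF.F0c (S.cyl \<gamma> (?\<phi>' X)) = T.cyl \<beta> (?\<phi> (?\<phi>' X))"
      using FF.F0c_cyl[OF \<gamma>(1)] by blast
    have C: "T.starts X \<in> T.cyls" using X by simp
    then have "pid (T.starts X) \<in> Obj T.CS" by (simp add: T.Obj_CS)
    note n = is_natural_isoD(1)[OF \<epsilon> this]
    have "F\<^sub>0 (G\<^sub>0 (pid (T.starts X))) = pid (T.cyl \<beta> (?\<phi> (?\<phi>' X)))"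
      using GG.F0_pid[OF C] FF.F0_pid[OF S.cyl_in_cyls[OF \<gamma>(1)]] \<gamma> \<beta> by simp
    then have "T.eqv (T.cyl \<beta> (?\<phi> (?\<phi>' X))) (T.cyl [] X)" using n by (intro T.iso_eqv[of "\<epsilon> (pid (T.starts X))"]) (simp_all add: T.cyl_Nil)
    then show ?thesis using T.eqv_cyl[OF \<beta>(1), of "[]" X] X by (simp add: T.valid_Nil)
  qed
  have b: "bij_betw ?\<phi> S.\<X> T.\<X>"
    by (rule bij_betw_byWitness[of _ ?\<phi>']) (use inv1 inv2 in\<phi> in\<phi>' in auto)
  have le: "S.ple X Y \<longleftrightarrow> T.ple (?\<phi> X) (?\<phi> Y)" if "X \<in> S.\<X>" "Y \<in> S.\<X>" for X Y
    using down_ple[OF d(1), of X Y] R.down_ple[OF d(2), of "?\<phi> X" "?\<phi> Y"] inv1 that by auto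
  show ?thesis using down_iso_comb_iso[OF d(1) b le] by blast
qed

end

section \<open>The combinatorial data determine the category up to equivalence\<close>

context markov_shift
begin

text \<open>Normal forms of the arrows of \<open>C(S)\<close>: after transport to the objects \<open>e\<^sub>X\<close> and \<open>e\<^sub>Y\<close>, a nonzero
  arrow is a pair of arrows \<open>\<gamma>\<close>, \<open>\<delta>\<close> from a common source \<open>Z\<close>.\<close>

lemma arrow_cases:
  assumes "x \<in> Arr CS"
  obtains e f where "x = (e, Map.empty, f)" "e \<in> idems S" "f \<in> idems S"
    | \<alpha> X \<gamma> Z \<beta> Y \<delta> where "x = (rep \<alpha> X \<alpha>, rep (\<alpha> @ \<gamma>) Z (\<beta> @ \<delta>), rep \<beta> Y \<beta>)"
      "valid \<alpha> X" "valid \<beta> Y" "lam X \<gamma> Z" "lam Y \<delta> Z"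
proof -
  obtain C s D where x: "x = (pid C, s, pid D)" "arrow C s D" using assms unfolding Arr_CS by blast
  then have CD: "C \<in> cyls" "D \<in> cyls" "s \<in> hull_carrier A M" "ran s \<subseteq> C" "dom s \<subseteq> D" by (simp_all add: arrow_def)
  show ?thesis
  proof (cases rule: hull_cases[OF CD(3)])
    case 1 then show ?thesis using that(1)[of "pid C" "pid D"] x CD by simp
  next
    case (2 \<sigma> Z \<tau>)
    then have sub: "cyl \<sigma> Z \<subseteq> C" "cyl \<tau> Z \<subseteq> D" using CD by simp_all
    then have "C \<noteq> {}" "D \<noteq> {}" using valid_cyl_nonempty 2 by blast+
    then obtain \<alpha> X \<beta> Y where C: "C = cyl \<alpha> X" "valid \<alpha> X" and D: "D = cyl \<beta> Y" "valid \<beta> Y"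
      using cyls_nonempty[OF CD(1)] cyls_nonempty[OF CD(2)] by blast
    obtain \<gamma> where \<gamma>: "\<sigma> = \<alpha> @ \<gamma>" "lam X \<gamma> Z" using cyl_subsetD[OF validD(1)[OF C(2)] 2(2)] sub C by blast
    obtain \<delta> where \<delta>: "\<tau> = \<beta> @ \<delta>" "lam Y \<delta> Z" using cyl_subsetD[OF validD(1)[OF D(2)] 2(3)] sub D by blast
    show ?thesis using that(2)[of \<alpha> X \<gamma> Z \<beta> \<delta> Y] x C D \<gamma> \<delta> 2 by (simp add: rep_self)
  qed
qed

lemma arr_rep:
  assumes "valid \<alpha> X" "valid \<beta> Y" "lam X \<gamma> Z" "lam Y \<delta> Z"
  shows "(rep \<alpha> X \<alpha>, rep (\<alpha> @ \<gamma>) Z (\<beta> @ \<delta>), rep \<beta> Y \<beta>) \<in> Arr CS"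
  using assms valid_append[OF assms(1,3)] valid_append[OF assms(2,4)] cyl_mono[OF assms(3)] cyl_mono[OF assms(4)]
  by (simp add: rep_self arrow_in_Arr arrow_def rep_in_hull)

lemma arr_zero: "e \<in> idems S \<Longrightarrow> f \<in> idems S \<Longrightarrow> (e, Map.empty, f) \<in> Arr CS"
  unfolding idems_S by (auto simp: arrow_in_Arr arrow_def hull_carrier.zero)

lemma empty_idem: "Map.empty \<in> idems S"
  using pid_in_idems[of "{}"] by (simp add: pid_empty)

lemma rep_idem: "valid \<alpha> X \<Longrightarrow> rep \<alpha> X \<alpha> \<in> idems S"
  by (simp add: rep_self)

lemma idem_cases:
  assumes "e \<in> idems S" obtains "e = Map.empty" | \<alpha> X where "e = rep \<alpha> X \<alpha>" "valid \<alpha> X"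
  using assms unfolding idems_S by (auto elim!: cylsE simp: rep_self pid_empty)

definition parse :: "('a list \<rightharpoonup> 'a list) \<Rightarrow> 'a list \<times> 'a set \<times> 'a list" where
  "parse s = (SOME p. case p of (\<alpha>, X, \<beta>) \<Rightarrow> valid \<alpha> X \<and> valid \<beta> X \<and> s = rep \<alpha> X \<beta>)"

lemma parse_rep:
  assumes "valid \<alpha> X" "valid \<beta> X" shows "parse (rep \<alpha> X \<beta>) = (\<alpha>, X, \<beta>)"
proof -
  obtain \<gamma> Y \<delta> where p: "parse (rep \<alpha> X \<beta>) = (\<gamma>, Y, \<delta>)" by (cases "parse (rep \<alpha> X \<beta>)")
  have "case parse (rep \<alpha> X \<beta>) of (\<gamma>, Y, \<delta>) \<Rightarrow> valid \<gamma> Y \<and> valid \<delta> Y \<and> rep \<alpha> X \<beta> = rep \<gamma> Y \<delta>"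
    unfolding parse_def by (rule someI[of _ "(\<alpha>, X, \<beta>)"]) (simp add: assms)
  then have "valid \<gamma> Y" "valid \<delta> Y" "rep \<alpha> X \<beta> = rep \<gamma> Y \<delta>" unfolding p by simp_all
  then show ?thesis using rep_inject[OF assms] p by simp
qed

lemma cyl_append_Int: "cyl (\<beta> @ \<delta>) Z \<inter> cyl (\<beta> @ \<gamma>) W = (@) \<beta> ` (cyl \<delta> Z \<inter> cyl \<gamma> W)"
  by (auto simp: cyl_append)

lemma cyl_append_image: "cyl (\<beta> @ \<delta>) Z = (@) \<beta> ` cyl \<delta> Z"
  by (auto simp: cyl_append)

end

context two_shifts
begin

text \<open>The functor replaces every object by the isomorphic object \<open>e\<^sub>X\<close> and forgets the prefixes
  \<open>\<alpha>\<close>, \<open>\<beta>\<close> of an arrow, before it applies \<open>\<psi>\<close> to the remaining words \<open>\<gamma>\<close>, \<open>\<delta>\<close>.\<close>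

definition obj_map :: "('a set \<Rightarrow> 'b set) \<Rightarrow> ('a list \<rightharpoonup> 'a list) \<Rightarrow> ('b list \<rightharpoonup> 'b list)" where
  "obj_map \<phi> e = (if e = Map.empty then Map.empty else case S.parse e of (\<alpha>, X, _) \<Rightarrow> T.rep [] (\<phi> X) [])"

definition arr_map :: "('a set \<Rightarrow> 'b set) \<Rightarrow> ('a set \<Rightarrow> 'a list \<Rightarrow> 'a set \<Rightarrow> 'b list) \<Rightarrow>
    ('a list \<rightharpoonup> 'a list) \<times> ('a list \<rightharpoonup> 'a list) \<times> ('a list \<rightharpoonup> 'a list) \<Rightarrow>
    ('b list \<rightharpoonup> 'b list) \<times> ('b list \<rightharpoonup> 'b list) \<times> ('b list \<rightharpoonup> 'b list)" where
  "arr_map \<phi> \<psi> x = (case x of (e, s, f) \<Rightarrow> (obj_map \<phi> e,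
     if s = Map.empty then Map.empty
     else (case (S.parse e, S.parse s, S.parse f) of ((\<alpha>, X, _), (\<sigma>, Z, \<tau>), (\<beta>, Y, _)) \<Rightarrow>
       T.rep (\<psi> X (drop (length \<alpha>) \<sigma>) Z) (\<phi> Z) (\<psi> Y (drop (length \<beta>) \<tau>) Z)),
     obj_map \<phi> f))"

lemma obj_map_empty: "obj_map \<phi> Map.empty = Map.empty"
  by (simp add: obj_map_def)

lemma obj_map_rep: "S.valid \<alpha> X \<Longrightarrow> obj_map \<phi> (S.rep \<alpha> X \<alpha>) = T.rep [] (\<phi> X) []"
  using S.parse_rep[of \<alpha> X \<alpha>] S.rep_nonempty[of \<alpha> X \<alpha>] by (simp add: obj_map_def)

lemma arr_map_empty: "arr_map \<phi> \<psi> (e, Map.empty, f) = (obj_map \<phi> e, Map.empty, obj_map \<phi> f)"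
  by (simp add: arr_map_def)

lemma arr_map_rep:
  assumes "S.valid \<alpha> X" "S.valid \<beta> Y" "S.lam X \<gamma> Z" "S.lam Y \<delta> Z"
  shows "arr_map \<phi> \<psi> (S.rep \<alpha> X \<alpha>, S.rep (\<alpha> @ \<gamma>) Z (\<beta> @ \<delta>), S.rep \<beta> Y \<beta>) =
    (T.rep [] (\<phi> X) [], T.rep (\<psi> X \<gamma> Z) (\<phi> Z) (\<psi> Y \<delta> Z), T.rep [] (\<phi> Y) [])"
  using S.parse_rep[OF assms(1,1)] S.parse_rep[OF assms(2,2)] S.rep_nonempty[OF S.valid_append[OF assms(1,3)], of "\<beta> @ \<delta>"]
    S.parse_rep[OF S.valid_append[OF assms(1,3)] S.valid_append[OF assms(2,4)]] obj_map_rep assms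
  by (simp add: arr_map_def)

end

text \<open>An isomorphism between the categories of arrows \<open>lam\<close> of the two shifts, given by maps in both
  directions that respect concatenation.\<close>

locale lam_iso = two_shifts A M B N
  for A :: "'a set" and M :: "'a \<Rightarrow> 'a \<Rightarrow> nat" and B :: "'b set" and N :: "'b \<Rightarrow> 'b \<Rightarrow> nat" +
  fixes \<phi> :: "'a set \<Rightarrow> 'b set" and \<psi> :: "'a set \<Rightarrow> 'a list \<Rightarrow> 'a set \<Rightarrow> 'b list"
    and \<phi>' :: "'b set \<Rightarrow> 'a set" and \<psi>' :: "'b set \<Rightarrow> 'b list \<Rightarrow> 'b set \<Rightarrow> 'a list"
  assumes inverse_obj: "X \<in> S.\<X> \<Longrightarrow> \<phi>' (\<phi> X) = X" "Y \<in> T.\<X> \<Longrightarrow> \<phi> (\<phi>' Y) = Y"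
    and lam_map: "S.lam X \<alpha> Z \<Longrightarrow> T.lam (\<phi> X) (\<psi> X \<alpha> Z) (\<phi> Z)"
      "T.lam Y \<beta> W \<Longrightarrow> S.lam (\<phi>' Y) (\<psi>' Y \<beta> W) (\<phi>' W)"
    and map_append: "S.lam X \<alpha> Z \<Longrightarrow> S.lam Z \<gamma> V \<Longrightarrow> \<psi> X (\<alpha> @ \<gamma>) V = \<psi> X \<alpha> Z @ \<psi> Z \<gamma> V"
      "T.lam Y \<beta> W \<Longrightarrow> T.lam W \<delta> U \<Longrightarrow> \<psi>' Y (\<beta> @ \<delta>) U = \<psi>' Y \<beta> W @ \<psi>' W \<delta> U"
    and inverse_map: "S.lam X \<alpha> Z \<Longrightarrow> \<psi>' (\<phi> X) (\<psi> X \<alpha> Z) (\<phi> Z) = \<alpha>"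
      "T.lam Y \<beta> W \<Longrightarrow> \<psi> (\<phi>' Y) (\<psi>' Y \<beta> W) (\<phi>' W) = \<beta>"
begin

lemma swap: "lam_iso B N A M \<phi>' \<psi>' \<phi> \<psi>"
  by unfold_locales (fact inverse_obj lam_map map_append inverse_map)+

lemma map_Nil: "X \<in> S.\<X> \<Longrightarrow> \<psi> X [] X = []"
  using map_append(1)[of X "[]" X "[]" X] by (simp add: S.lam_Nil)

lemma obj_in: "X \<in> S.\<X> \<Longrightarrow> \<phi> X \<in> T.\<X>"
  using T.lamD(1)[OF lam_map(1)[of X "[]" X]] by (simp add: S.lam_Nil)

lemma map_order:
  assumes "S.lam Y \<alpha> Z" "S.lam Y \<beta> W" "S.cyl \<beta> W \<subseteq> S.cyl \<alpha> Z"
  shows "T.cyl (\<psi> Y \<beta> W) (\<phi> W) \<subseteq> T.cyl (\<psi> Y \<alpha> Z) (\<phi> Z)"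
proof -
  obtain u where u: "\<beta> = \<alpha> @ u" "S.lam Z u W"
    using S.cyl_subsetD[OF S.lamD(2)[OF assms(1)] S.lamD(3)[OF assms(2)] assms(3)] by blast
  then show ?thesis using map_append(1)[OF assms(1) u(2)] T.cyl_mono[OF lam_map(1)[OF u(2)]] by simp
qed

end

context lam_iso
begin

interpretation R: lam_iso B N A M \<phi>' \<psi>' \<phi> \<psi>
  by (rule swap)

text \<open>A meet on the side of the second shift comes, through \<open>\<psi>'\<close>, from a lower bound on the side of
  the first.\<close>

lemma map_lower_bound:
  assumes l: "S.lam Y \<delta> Z" "S.lam Y \<gamma> W" and ne: "T.cyl (\<psi> Y \<delta> Z) (\<phi> Z) \<inter> T.cyl (\<psi> Y \<gamma> W) (\<phi> W) \<noteq> {}"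
  shows "\<exists>\<kappa> V. S.lam Y \<kappa> V \<and> S.cyl \<kappa> V \<subseteq> S.cyl \<delta> Z \<inter> S.cyl \<gamma> W \<and>
    T.cyl (\<psi> Y \<delta> Z) (\<phi> Z) \<inter> T.cyl (\<psi> Y \<gamma> W) (\<phi> W) = T.cyl (\<psi> Y \<kappa> V) (\<phi> V)"
proof -
  have Y: "Y \<in> S.\<X>" using S.lamD l by blast
  note l' = lam_map(1)[OF l(1)] lam_map(1)[OF l(2)]
  obtain u v V' where V': "T.lam (\<phi> Z) u V'"
    "T.cyl (\<psi> Y \<delta> Z) (\<phi> Z) \<inter> T.cyl (\<psi> Y \<gamma> W) (\<phi> W) = T.cyl (\<psi> Y \<delta> Z @ u) V'"
    using T.cyl_Int[OF T.lamD(3)[OF l'(1)] T.lamD(3)[OF l'(2)] ne] by blast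
  let ?k = "\<psi> Y \<delta> Z @ u"
  have lk: "T.lam (\<phi> Y) ?k V'" using T.lam_trans[OF l'(1) V'(1)] .
  have backward: "S.cyl (\<psi>' (\<phi> Y) ?k V') (\<phi>' V') \<subseteq> S.cyl \<epsilon> U"
    if e: "S.lam Y \<epsilon> U" "T.cyl ?k V' \<subseteq> T.cyl (\<psi> Y \<epsilon> U) (\<phi> U)" for \<epsilon> U
    using R.map_order[OF lam_map(1)[OF e(1)] lk e(2)] inverse_map(1)[OF e(1)] inverse_obj(1) S.lamD(2)[OF e(1)] by simp
  have "S.lam Y (\<psi>' (\<phi> Y) ?k V') (\<phi>' V')" using lam_map(2)[OF lk] inverse_obj(1)[OF Y] by simp
  moreover have "S.cyl (\<psi>' (\<phi> Y) ?k V') (\<phi>' V') \<subseteq> S.cyl \<delta> Z \<inter> S.cyl \<gamma> W"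
    using backward[OF l(1)] backward[OF l(2)] V'(2) by blast
  moreover have "\<psi> Y (\<psi>' (\<phi> Y) ?k V') (\<phi>' V') = ?k" "\<phi> (\<phi>' V') = V'"
    using inverse_map(2)[OF lk] inverse_obj(1)[OF Y] inverse_obj(2)[OF T.lamD(2)[OF lk]] by simp_all
  ultimately show ?thesis using V'(2) by metis
qed

lemma map_meet:
  assumes l: "S.lam Y \<delta> Z" "S.lam Y \<gamma> W" "S.lam Y \<kappa> V" and eq: "S.cyl \<delta> Z \<inter> S.cyl \<gamma> W = S.cyl \<kappa> V"
  shows "T.cyl (\<psi> Y \<delta> Z) (\<phi> Z) \<inter> T.cyl (\<psi> Y \<gamma> W) (\<phi> W) = T.cyl (\<psi> Y \<kappa> V) (\<phi> V)"
proof
  show up: "T.cyl (\<psi> Y \<kappa> V) (\<phi> V) \<subseteq> T.cyl (\<psi> Y \<delta> Z) (\<phi> Z) \<inter> T.cyl (\<psi> Y \<gamma> W) (\<phi> W)"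
    using map_order[OF l(1,3)] map_order[OF l(2,3)] eq by blast
  have "T.cyl (\<psi> Y \<kappa> V) (\<phi> V) \<noteq> {}" using T.valid_cyl_nonempty[OF T.lamD(3)[OF lam_map(1)[OF l(3)]]] .
  then have "T.cyl (\<psi> Y \<delta> Z) (\<phi> Z) \<inter> T.cyl (\<psi> Y \<gamma> W) (\<phi> W) \<noteq> {}" using up by blast
  then obtain \<kappa>' V' where k: "S.lam Y \<kappa>' V'" "S.cyl \<kappa>' V' \<subseteq> S.cyl \<delta> Z \<inter> S.cyl \<gamma> W"
    "T.cyl (\<psi> Y \<delta> Z) (\<phi> Z) \<inter> T.cyl (\<psi> Y \<gamma> W) (\<phi> W) = T.cyl (\<psi> Y \<kappa>' V') (\<phi> V')"
    using map_lower_bound[OF l(1,2)] by blast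
  then show "T.cyl (\<psi> Y \<delta> Z) (\<phi> Z) \<inter> T.cyl (\<psi> Y \<gamma> W) (\<phi> W) \<subseteq> T.cyl (\<psi> Y \<kappa> V) (\<phi> V)"
    using map_order[OF l(3) k(1)] eq by simp
qed

lemma map_disjoint:
  assumes l: "S.lam Y \<delta> Z" "S.lam Y \<gamma> W" and eq: "S.cyl \<delta> Z \<inter> S.cyl \<gamma> W = {}"
  shows "T.cyl (\<psi> Y \<delta> Z) (\<phi> Z) \<inter> T.cyl (\<psi> Y \<gamma> W) (\<phi> W) = {}"
proof (rule ccontr)
  assume "T.cyl (\<psi> Y \<delta> Z) (\<phi> Z) \<inter> T.cyl (\<psi> Y \<gamma> W) (\<phi> W) \<noteq> {}"
  then obtain \<kappa> V where k: "S.lam Y \<kappa> V" "S.cyl \<kappa> V \<subseteq> S.cyl \<delta> Z \<inter> S.cyl \<gamma> W"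
    using map_lower_bound[OF l] by blast
  then show False using eq S.valid_cyl_nonempty[OF S.lamD(3)[OF k(1)], of \<kappa>] by simp
qed

text \<open>A product of two arrows is formed over the meet of the inner arrows, which is preserved even
  though the two inner arrows may change their lengths relative to each other.\<close>

lemma functor_map: "is_functor S.CS T.CS (obj_map \<phi>) (arr_map \<phi> \<psi>)"
  unfolding is_functor_def
proof (intro conjI ballI impI)
  have obj: "obj_map \<phi> e \<in> idems T.S" if "e \<in> idems S.S" for e
    using that
  proof (cases rule: S.idem_cases)
    case 1 then show ?thesis using T.empty_idem by (simp add: obj_map_empty)
  next
    case (2 \<alpha> X)
    then show ?thesis using T.rep_idem[of "[]" "\<phi> X"] obj_in[of X] S.validD(1) by (simp add: obj_map_rep T.valid_Nil)
  qed
  have O: "Obj S.CS = idems S.S" "Obj T.CS = idems T.S" by (simp_all add: morita_category_def)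
  show "obj_map \<phi> x \<in> Obj T.CS" if "x \<in> Obj S.CS" for x using obj that O by simp
  have vN: "T.valid [] (\<phi> X)" if "S.valid \<alpha> X" for \<alpha> X using obj_in S.validD(1)[OF that] by (simp add: T.valid_Nil)
  show "arr_map \<phi> \<psi> x \<in> Arr T.CS" "Dom T.CS (arr_map \<phi> \<psi> x) = obj_map \<phi> (Dom S.CS x)"
    "Cod T.CS (arr_map \<phi> \<psi> x) = obj_map \<phi> (Cod S.CS x)" if x: "x \<in> Arr S.CS" for x
  proof -
    have "arr_map \<phi> \<psi> x \<in> Arr T.CS \<and> Dom T.CS (arr_map \<phi> \<psi> x) = obj_map \<phi> (Dom S.CS x) \<and>
      Cod T.CS (arr_map \<phi> \<psi> x) = obj_map \<phi> (Cod S.CS x)"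
      using x
    proof (cases rule: S.arrow_cases)
      case (1 e f) then show ?thesis using obj T.arr_zero by (simp add: arr_map_empty)
    next
      case (2 \<alpha> X \<gamma> Z \<beta> Y \<delta>)
      then show ?thesis
        using arr_map_rep[OF 2(2-5)] T.arr_rep[OF vN[OF 2(2)] vN[OF 2(3)] lam_map(1)[OF 2(4)] lam_map(1)[OF 2(5)]]
        by (simp add: obj_map_rep)
    qed
    then show "arr_map \<phi> \<psi> x \<in> Arr T.CS" "Dom T.CS (arr_map \<phi> \<psi> x) = obj_map \<phi> (Dom S.CS x)"
      "Cod T.CS (arr_map \<phi> \<psi> x) = obj_map \<phi> (Cod S.CS x)" by blast+
  qed
  show "arr_map \<phi> \<psi> (Ident S.CS x) = Ident T.CS (obj_map \<phi> x)" if x: "x \<in> Obj S.CS" for x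
  proof -
    have "x \<in> idems S.S" using x O by simp
    then show ?thesis
    proof (cases rule: S.idem_cases)
      case 1 then show ?thesis by (simp add: arr_map_empty obj_map_empty)
    next
      case (2 \<alpha> X)
      have X: "X \<in> S.\<X>" using 2 S.validD by blast
      then have "S.lam X [] X" by (simp add: S.lam_Nil)
      then show ?thesis using arr_map_rep[OF 2(2,2), of "[]" X "[]"] 2 map_Nil[OF X] by (simp add: obj_map_rep)
    qed
  qed
  show "arr_map \<phi> \<psi> (Comp S.CS y x) = Comp T.CS (arr_map \<phi> \<psi> y) (arr_map \<phi> \<psi> x)"
    if xy: "x \<in> Arr S.CS" "y \<in> Arr S.CS" "Cod S.CS x = Dom S.CS y" for x y
    using xy(1)
  proof (cases rule: S.arrow_cases)
    case (1 e f)
    obtain e' s f' where y: "y = (e', s, f')" by (cases y)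
    have "\<exists>s. arr_map \<phi> \<psi> y = (obj_map \<phi> e', s, obj_map \<phi> f')" unfolding y arr_map_def by simp
    then show ?thesis using 1 y by (auto simp: arr_map_empty)
  next
    case x: (2 \<beta> Y \<gamma>' Z' \<omega> W \<delta>')
    show ?thesis
      using xy(2)
    proof (cases rule: S.arrow_cases)
      case (1 e f)
      then show ?thesis using x arr_map_rep[OF x(2-5)] by (simp add: arr_map_empty obj_map_rep)
    next
      case y: (2 \<alpha> X \<gamma> Z \<beta>\<^sub>1 Y\<^sub>1 \<delta>)
      have "S.rep \<beta>\<^sub>1 Y\<^sub>1 \<beta>\<^sub>1 = S.rep \<beta> Y \<beta>" using xy(3) x(1) y(1) by simp
      then have "\<beta>\<^sub>1 = \<beta> \<and> Y\<^sub>1 = Y" using S.rep_inject[OF y(3,3) x(2,2)] by blast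
      then have Y1: "\<beta>\<^sub>1 = \<beta>" "Y\<^sub>1 = Y" by simp_all
      have l: "S.lam Y \<delta> Z" "S.lam Y \<gamma>' Z'" using y x Y1 by simp_all
      have Fy: "arr_map \<phi> \<psi> y = (T.rep [] (\<phi> X) [], T.rep (\<psi> X \<gamma> Z) (\<phi> Z) (\<psi> Y \<delta> Z), T.rep [] (\<phi> Y) [])"
        using arr_map_rep[OF y(2-5)] y(1) Y1 by simp
      have Fx: "arr_map \<phi> \<psi> x = (T.rep [] (\<phi> Y) [], T.rep (\<psi> Y \<gamma>' Z') (\<phi> Z') (\<psi> W \<delta>' Z'), T.rep [] (\<phi> W) [])"
        using arr_map_rep[OF x(2-5)] x(1) by simp
      show ?thesis
      proof (cases "S.cyl \<delta> Z \<inter> S.cyl \<gamma>' Z' = {}")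
        case True
        then have "S.rep (\<alpha> @ \<gamma>) Z (\<beta> @ \<delta>) \<circ>\<^sub>m S.rep (\<beta> @ \<gamma>') Z' (\<omega> @ \<delta>') = Map.empty"
          by (intro S.rep_comp_disjoint) (simp add: S.cyl_append_Int)
        then have "Comp S.CS y x = (S.rep \<alpha> X \<alpha>, Map.empty, S.rep \<omega> W \<omega>)" using x(1) y(1) Y1 by simp
        moreover have "T.rep (\<psi> X \<gamma> Z) (\<phi> Z) (\<psi> Y \<delta> Z) \<circ>\<^sub>m T.rep (\<psi> Y \<gamma>' Z') (\<phi> Z') (\<psi> W \<delta>' Z') = Map.empty"
          using T.rep_comp_disjoint map_disjoint[OF l True] by blast
        ultimately show ?thesis using Fx Fy y(2) x(3) by (simp add: arr_map_empty obj_map_rep)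
      next
        case False
        obtain u v V where V: "\<delta> @ u = \<gamma>' @ v" "S.lam Z u V" "S.lam Z' v V" "S.cyl \<delta> Z \<inter> S.cyl \<gamma>' Z' = S.cyl (\<delta> @ u) V"
          using S.cyl_Int[OF S.lamD(3)[OF l(1)] S.lamD(3)[OF l(2)] False] by blast
        have "S.rep (\<alpha> @ \<gamma>) Z (\<beta> @ \<delta>) \<circ>\<^sub>m S.rep (\<beta> @ \<gamma>') Z' (\<omega> @ \<delta>') = S.rep ((\<alpha> @ \<gamma>) @ u) V ((\<omega> @ \<delta>') @ v)"
          using V(1,4) S.cyl_append_image[of \<beta> "\<delta> @ u" V] by (intro S.rep_comp) (simp_all add: S.cyl_append_Int)
        then have "Comp S.CS y x = (S.rep \<alpha> X \<alpha>, S.rep (\<alpha> @ (\<gamma> @ u)) V (\<omega> @ (\<delta>' @ v)), S.rep \<omega> W \<omega>)"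
          using x(1) y(1) Y1 by simp
        then have L: "arr_map \<phi> \<psi> (Comp S.CS y x) =
            (T.rep [] (\<phi> X) [], T.rep (\<psi> X (\<gamma> @ u) V) (\<phi> V) (\<psi> W (\<delta>' @ v) V), T.rep [] (\<phi> W) [])"
          using arr_map_rep[OF y(2) x(3) S.lam_trans[OF y(4) V(2)] S.lam_trans[OF x(5) V(3)]] by simp
        have m: "T.cyl (\<psi> Y \<delta> Z) (\<phi> Z) \<inter> T.cyl (\<psi> Y \<gamma>' Z') (\<phi> Z') = T.cyl (\<psi> Y \<delta> Z @ \<psi> Z u V) (\<phi> V)"
          using map_meet[OF l S.lam_trans[OF l(1) V(2)] V(4)] map_append(1)[OF l(1) V(2)] by simp
        have e: "\<psi> Y \<delta> Z @ \<psi> Z u V = \<psi> Y \<gamma>' Z' @ \<psi> Z' v V"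
          using map_append(1)[OF l(1) V(2)] map_append(1)[OF l(2) V(3)] V(1) by simp
        have "T.rep (\<psi> X \<gamma> Z) (\<phi> Z) (\<psi> Y \<delta> Z) \<circ>\<^sub>m T.rep (\<psi> Y \<gamma>' Z') (\<phi> Z') (\<psi> W \<delta>' Z') =
            T.rep (\<psi> X \<gamma> Z @ \<psi> Z u V) (\<phi> V) (\<psi> W \<delta>' Z' @ \<psi> Z' v V)"
          by (rule T.rep_comp[OF e m])
        then show ?thesis unfolding L Fx Fy using map_append(1)[OF y(4) V(2)] map_append(1)[OF x(5) V(3)] by simp
      qed
    qed
  qed
qed

lemma back_obj:
  "R.obj_map \<phi>' (obj_map \<phi> Map.empty) = Map.empty"
  "S.valid \<alpha> X \<Longrightarrow> R.obj_map \<phi>' (obj_map \<phi> (S.rep \<alpha> X \<alpha>)) = S.rep [] X []"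
  using obj_in[of X] S.validD(1)[of \<alpha> X] inverse_obj(1)[of X] R.obj_map_rep[of "[]" "\<phi> X"]
  by (simp_all add: obj_map_empty R.obj_map_empty obj_map_rep T.valid_Nil)

lemma back_arr:
  "R.arr_map \<phi>' \<psi>' (arr_map \<phi> \<psi> (e, Map.empty, f)) =
     (R.obj_map \<phi>' (obj_map \<phi> e), Map.empty, R.obj_map \<phi>' (obj_map \<phi> f))"
  "S.valid \<alpha> X \<Longrightarrow> S.valid \<beta> Y \<Longrightarrow> S.lam X \<gamma> Z \<Longrightarrow> S.lam Y \<delta> Z \<Longrightarrow>
    R.arr_map \<phi>' \<psi>' (arr_map \<phi> \<psi> (S.rep \<alpha> X \<alpha>, S.rep (\<alpha> @ \<gamma>) Z (\<beta> @ \<delta>), S.rep \<beta> Y \<beta>)) =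
     (S.rep [] X [], S.rep \<gamma> Z \<delta>, S.rep [] Y [])"
proof -
  show "R.arr_map \<phi>' \<psi>' (arr_map \<phi> \<psi> (e, Map.empty, f)) =
     (R.obj_map \<phi>' (obj_map \<phi> e), Map.empty, R.obj_map \<phi>' (obj_map \<phi> f))"
    by (simp add: arr_map_empty R.arr_map_empty)
  assume a: "S.valid \<alpha> X" "S.valid \<beta> Y" "S.lam X \<gamma> Z" "S.lam Y \<delta> Z"
  have m: "X \<in> S.\<X>" "Y \<in> S.\<X>" "Z \<in> S.\<X>" using S.lamD a by blast+
  then have v: "T.valid [] (\<phi> X)" "T.valid [] (\<phi> Y)" using obj_in by (simp_all add: T.valid_Nil)
  show "R.arr_map \<phi>' \<psi>' (arr_map \<phi> \<psi> (S.rep \<alpha> X \<alpha>, S.rep (\<alpha> @ \<gamma>) Z (\<beta> @ \<delta>), S.rep \<beta> Y \<beta>)) =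
     (S.rep [] X [], S.rep \<gamma> Z \<delta>, S.rep [] Y [])"
    using arr_map_rep[OF a] R.arr_map_rep[OF v lam_map(1)[OF a(3)] lam_map(1)[OF a(4)]]
      inverse_obj(1)[OF m(1)] inverse_obj(1)[OF m(2)] inverse_obj(1)[OF m(3)] inverse_map(1)[OF a(3)] inverse_map(1)[OF a(4)]
    by simp
qed

text \<open>Both composites of the two functors forget prefixes, and \<open>\<theta>\<^sub>\<alpha>\<close> restricted to the domain of
  \<open>e\<^sub>X\<close> is an isomorphism between \<open>e\<^sub>X\<close> and the original object.\<close>

definition unit :: "('a list \<rightharpoonup> 'a list) \<Rightarrow> ('a list \<rightharpoonup> 'a list) \<times> ('a list \<rightharpoonup> 'a list) \<times> ('a list \<rightharpoonup> 'a list)" where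
  "unit e = (if e = Map.empty then (Map.empty, Map.empty, Map.empty)
     else case S.parse e of (\<alpha>, X, _) \<Rightarrow> (S.rep [] X [], S.rep [] X \<alpha>, S.rep \<alpha> X \<alpha>))"

definition counit :: "('a list \<rightharpoonup> 'a list) \<Rightarrow> ('a list \<rightharpoonup> 'a list) \<times> ('a list \<rightharpoonup> 'a list) \<times> ('a list \<rightharpoonup> 'a list)" where
  "counit e = (if e = Map.empty then (Map.empty, Map.empty, Map.empty)
     else case S.parse e of (\<alpha>, X, _) \<Rightarrow> (S.rep \<alpha> X \<alpha>, S.rep \<alpha> X [], S.rep [] X []))"

lemma unit_rep:
  assumes "S.valid \<alpha> X"
  shows "unit (S.rep \<alpha> X \<alpha>) = (S.rep [] X [], S.rep [] X \<alpha>, S.rep \<alpha> X \<alpha>)"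
    "counit (S.rep \<alpha> X \<alpha>) = (S.rep \<alpha> X \<alpha>, S.rep \<alpha> X [], S.rep [] X [])"
  using S.parse_rep[OF assms assms] S.rep_nonempty[OF assms, of \<alpha>] by (simp_all add: unit_def counit_def)

lemma unit_empty:
  "unit Map.empty = (Map.empty, Map.empty, Map.empty)" "counit Map.empty = (Map.empty, Map.empty, Map.empty)"
  by (simp_all add: unit_def counit_def)

lemma unit_properties:
  assumes "e \<in> idems S.S"
  shows "is_isomorphism S.CS (unit e)" "Dom S.CS (unit e) = e" "Cod S.CS (unit e) = R.obj_map \<phi>' (obj_map \<phi> e)"
    and "is_isomorphism S.CS (counit e)" "Cod S.CS (counit e) = e" "Dom S.CS (counit e) = R.obj_map \<phi>' (obj_map \<phi> e)"
proof -
  have inv: "unit e \<in> Arr S.CS \<and> counit e \<in> Arr S.CS \<and> Dom S.CS (unit e) = e \<and> Cod S.CS (counit e) = e \<and>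
    Cod S.CS (unit e) = R.obj_map \<phi>' (obj_map \<phi> e) \<and> Dom S.CS (counit e) = R.obj_map \<phi>' (obj_map \<phi> e) \<and>
    Comp S.CS (counit e) (unit e) = Ident S.CS e \<and>
    Comp S.CS (unit e) (counit e) = Ident S.CS (R.obj_map \<phi>' (obj_map \<phi> e))"
    using assms
  proof (cases rule: S.idem_cases)
    case 1
    then show ?thesis using S.arr_zero[OF S.empty_idem S.empty_idem] back_obj(1) by (simp add: unit_empty)
  next
    case (2 \<alpha> X)
    have X: "X \<in> S.\<X>" "S.valid [] X" "S.lam X [] X" using S.validD(1)[OF 2(2)] by (simp_all add: S.valid_Nil S.lam_Nil)
    have "S.rep \<alpha> X [] \<circ>\<^sub>m S.rep [] X \<alpha> = S.rep \<alpha> X \<alpha>" "S.rep [] X \<alpha> \<circ>\<^sub>m S.rep \<alpha> X [] = S.rep [] X []"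
      using S.rep_comp[of "[]" "[]" "[]" "[]" X X X \<alpha> \<alpha>] S.rep_comp[of \<alpha> "[]" \<alpha> "[]" X X X "[]" "[]"] by simp_all
    then show ?thesis
      using S.arr_rep[OF X(2) 2(2) X(3,3)] S.arr_rep[OF 2(2) X(2) X(3,3)] unit_rep[OF 2(2)] back_obj(2)[OF 2(2)] 2(1) by simp
  qed
  then show "is_isomorphism S.CS (unit e)" "Dom S.CS (unit e) = e" "Cod S.CS (unit e) = R.obj_map \<phi>' (obj_map \<phi> e)"
    "is_isomorphism S.CS (counit e)" "Cod S.CS (counit e) = e" "Dom S.CS (counit e) = R.obj_map \<phi>' (obj_map \<phi> e)"
    unfolding is_isomorphism_def by metis+
qed

lemma unit_natural:
  assumes "x \<in> Arr S.CS"
  shows "Comp S.CS (unit (Cod S.CS x)) x = Comp S.CS (R.arr_map \<phi>' \<psi>' (arr_map \<phi> \<psi> x)) (unit (Dom S.CS x))"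
    and "Comp S.CS (counit (Cod S.CS x)) (R.arr_map \<phi>' \<psi>' (arr_map \<phi> \<psi> x)) = Comp S.CS x (counit (Dom S.CS x))"
proof -
  have "Comp S.CS (unit (Cod S.CS x)) x = Comp S.CS (R.arr_map \<phi>' \<psi>' (arr_map \<phi> \<psi> x)) (unit (Dom S.CS x)) \<and>
    Comp S.CS (counit (Cod S.CS x)) (R.arr_map \<phi>' \<psi>' (arr_map \<phi> \<psi> x)) = Comp S.CS x (counit (Dom S.CS x))"
    using assms
  proof (cases rule: S.arrow_cases)
    case (1 e f)
    have u: "\<exists>s. unit g = (R.obj_map \<phi>' (obj_map \<phi> g), s, g)" "\<exists>s. counit g = (g, s, R.obj_map \<phi>' (obj_map \<phi> g))"
      if "g \<in> idems S.S" for g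
      using unit_properties(2,3,5,6)[OF that] by (cases "unit g"; cases "counit g"; simp)+
    show ?thesis using u[OF 1(2)] u[OF 1(3)] 1(1) by (auto simp: back_arr(1))
  next
    case (2 \<alpha> X \<gamma> Z \<beta> Y \<delta>)
    have i: "S.cyl \<alpha> X \<inter> S.cyl (\<alpha> @ \<gamma>) Z = S.cyl (\<alpha> @ \<gamma>) Z" "S.cyl (\<beta> @ \<delta>) Z \<inter> S.cyl \<beta> Y = S.cyl ((\<beta> @ \<delta>) @ []) Z"
      "S.cyl [] X \<inter> S.cyl \<gamma> Z = S.cyl ([] @ \<gamma>) Z" "S.cyl \<delta> Z \<inter> S.cyl [] Y = S.cyl (\<delta> @ []) Z"
      using S.cyl_mono[OF 2(4), of \<alpha>] S.cyl_mono[OF 2(5), of \<beta>] S.cyl_mono[OF 2(4), of "[]"] S.cyl_mono[OF 2(5), of "[]"] by auto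
    have "S.rep [] X \<alpha> \<circ>\<^sub>m S.rep (\<alpha> @ \<gamma>) Z (\<beta> @ \<delta>) = S.rep \<gamma> Z (\<beta> @ \<delta>)"
      using S.rep_comp[of \<alpha> \<gamma> "\<alpha> @ \<gamma>" "[]", OF _ i(1)] by simp
    moreover have "S.rep \<gamma> Z \<delta> \<circ>\<^sub>m S.rep [] Y \<beta> = S.rep \<gamma> Z (\<beta> @ \<delta>)"
      using S.rep_comp[of \<delta> "[]" "[]" \<delta>, OF _ i(4)] by simp
    moreover have "S.rep \<alpha> X [] \<circ>\<^sub>m S.rep \<gamma> Z \<delta> = S.rep (\<alpha> @ \<gamma>) Z \<delta>"
      using S.rep_comp[of "[]" \<gamma> \<gamma> "[]", OF _ i(3)] by simp
    moreover have "S.rep (\<alpha> @ \<gamma>) Z (\<beta> @ \<delta>) \<circ>\<^sub>m S.rep \<beta> Y [] = S.rep (\<alpha> @ \<gamma>) Z \<delta>"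
      using S.rep_comp[of "\<beta> @ \<delta>" "[]" \<beta> \<delta>, OF _ i(2)] by simp
    ultimately show ?thesis using back_arr(2)[OF 2(2-5)] unit_rep[OF 2(2)] unit_rep[OF 2(3)] 2(1) by simp
  qed
  then show "Comp S.CS (unit (Cod S.CS x)) x = Comp S.CS (R.arr_map \<phi>' \<psi>' (arr_map \<phi> \<psi> x)) (unit (Dom S.CS x))"
    "Comp S.CS (counit (Cod S.CS x)) (R.arr_map \<phi>' \<psi>' (arr_map \<phi> \<psi> x)) = Comp S.CS x (counit (Dom S.CS x))" by blast+
qed

lemma natural_unit:
  "is_natural_iso S.CS S.CS id id (two_shifts.obj_map B N A M \<phi>' \<circ> obj_map \<phi>)
     (two_shifts.arr_map B N A M \<phi>' \<psi>' \<circ> arr_map \<phi> \<psi>) unit"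
  "is_natural_iso S.CS S.CS (two_shifts.obj_map B N A M \<phi>' \<circ> obj_map \<phi>)
     (two_shifts.arr_map B N A M \<phi>' \<psi>' \<circ> arr_map \<phi> \<psi>) id id counit"
proof -
  have O: "Obj S.CS = idems S.S" by (simp add: morita_category_def)
  show "is_natural_iso S.CS S.CS id id (two_shifts.obj_map B N A M \<phi>' \<circ> obj_map \<phi>)
     (two_shifts.arr_map B N A M \<phi>' \<psi>' \<circ> arr_map \<phi> \<psi>) unit"
    unfolding is_natural_iso_def O using unit_properties unit_natural by simp
  show "is_natural_iso S.CS S.CS (two_shifts.obj_map B N A M \<phi>' \<circ> obj_map \<phi>)
     (two_shifts.arr_map B N A M \<phi>' \<psi>' \<circ> arr_map \<phi> \<psi>) id id counit"
    unfolding is_natural_iso_def O using unit_properties unit_natural by simp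
qed

end

lemma (in lam_iso) morita: "morita_equivalent S.S T.S"
proof -
  interpret R: lam_iso B N A M \<phi>' \<psi>' \<phi> \<psi> by (rule swap)
  show ?thesis unfolding morita_equivalent_def equivalent_categories_def
    using functor_map R.functor_map natural_unit(1) R.natural_unit(2) by blast
qed

text \<open>An isomorphism of the combinatorial data acts on labelled paths, and labelled paths are the
  same as arrows.\<close>

lemma (in two_shifts) comb_iso_morita:
  assumes ci: "comb_iso \<phi> g" shows "morita_equivalent S.S T.S"
proof -
  note b\<phi> = comb_isoD(1)[OF ci] and le = comb_isoD(2)[OF ci] and bg = comb_isoD(3)[OF ci]
  define \<phi>' where "\<phi>' = inv_into S.\<X> \<phi>"
  have b\<phi>': "bij_betw \<phi>' T.\<X> S.\<X>" unfolding \<phi>'_def by (rule bij_betw_inv_into[OF b\<phi>])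
  have in\<phi>: "\<phi> X \<in> T.\<X>" if "X \<in> S.\<X>" for X using bij_betwE[OF b\<phi>] that by blast
  have in\<phi>': "\<phi>' X \<in> S.\<X>" if "X \<in> T.\<X>" for X using bij_betwE[OF b\<phi>'] that by blast
  have inv: "\<phi>' (\<phi> X) = X" if "X \<in> S.\<X>" for X
    unfolding \<phi>'_def by (rule bij_betw_inv_into_left[OF b\<phi> that])
  have inv': "\<phi> (\<phi>' X) = X" if "X \<in> T.\<X>" for X
    unfolding \<phi>'_def by (rule bij_betw_inv_into_right[OF b\<phi> that])
  have le': "T.ple X Y \<longleftrightarrow> S.ple (\<phi>' X) (\<phi>' Y)" if "X \<in> T.\<X>" "Y \<in> T.\<X>" for X Y
    using le[OF in\<phi>' in\<phi>', OF that] inv'[OF that(1)] inv'[OF that(2)] by simp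
  define h where "h Y V = inv_into {u. S.exitp (\<phi>' Y) u (\<phi>' V)} (g (\<phi>' Y) (\<phi>' V))" for Y V
  have ex: "T.exitp (\<phi> X) (g X W u) (\<phi> W) \<and> h (\<phi> X) (\<phi> W) (g X W u) = u" if e: "S.exitp X u W" for X u W
  proof -
    have m: "X \<in> S.\<X>" "W \<in> S.\<X>" using S.exitp_member[OF e] by blast+
    show ?thesis
      using bij_betwE[OF bg[OF m]] bij_betw_inv_into_left[OF bg[OF m]] e inv[OF m(1)] inv[OF m(2)] unfolding h_def by simp
  qed
  have ex': "S.exitp (\<phi>' Y) (h Y V u) (\<phi>' V) \<and> g (\<phi>' Y) (\<phi>' V) (h Y V u) = u" if e: "T.exitp Y u V" for Y u V
  proof -
    have m: "Y \<in> T.\<X>" "V \<in> T.\<X>" using T.exitp_member[OF e] by blast+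
    note b = bg[OF in\<phi>'[OF m(1)] in\<phi>'[OF m(2)]]
    have u: "u \<in> {u. T.exitp (\<phi> (\<phi>' Y)) u (\<phi> (\<phi>' V))}" using e inv'[OF m(1)] inv'[OF m(2)] by simp
    show ?thesis
      using bij_betwE[OF bij_betw_inv_into[OF b]] u bij_betw_inv_into_right[OF b u] unfolding h_def by blast
  qed
  define tp where "tp p = (case p of (V, u, W) \<Rightarrow> (\<phi> V, g V W u, \<phi> W))" for p
  define tp' where "tp' p = (case p of (V, u, W) \<Rightarrow> (\<phi>' V, h V W u, \<phi>' W))" for p
  have lp: "T.lp (\<phi> X) (map tp ws) (\<phi> Z) \<and> map tp' (map tp ws) = ws" if "X \<in> S.\<X>" "Z \<in> S.\<X>" "S.lp X ws Z" for X ws Z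
    using that
  proof (induction X ws Z rule: S.lp.induct)
    case (1 X Z) then show ?case using le by simp
  next
    case (2 X V u W ws Z)
    then have m: "V \<in> S.\<X>" "W \<in> S.\<X>" using S.exitp_member[of V u W] by simp_all
    show ?case using 2 m le[OF m(1) 2(2)] ex[of V u W] inv[OF m(1)] inv[OF m(2)] by (simp add: tp_def tp'_def)
  qed
  have lp': "S.lp (\<phi>' X) (map tp' ws) (\<phi>' Z) \<and> map tp (map tp' ws) = ws" if "X \<in> T.\<X>" "Z \<in> T.\<X>" "T.lp X ws Z" for X ws Z
    using that
  proof (induction X ws Z rule: T.lp.induct)
    case (1 X Z) then show ?case using le' by simp
  next
    case (2 X V u W ws Z)
    then have m: "V \<in> T.\<X>" "W \<in> T.\<X>" using T.exitp_member[of V u W] by simp_all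
    show ?case using 2 m le'[OF m(1) 2(2)] ex'[of V u W] inv'[OF m(1)] inv'[OF m(2)] by (simp add: tp_def tp'_def)
  qed
  define \<psi> where "\<psi> X \<alpha> Z = T.word (map tp (S.path X \<alpha> Z))" for X \<alpha> Z
  define \<psi>' where "\<psi>' X \<alpha> Z = S.word (map tp' (T.path X \<alpha> Z))" for X \<alpha> Z
  have lm: "T.lam (\<phi> X) (\<psi> X \<alpha> Z) (\<phi> Z)" "T.path (\<phi> X) (\<psi> X \<alpha> Z) (\<phi> Z) = map tp (S.path X \<alpha> Z)"
    "map tp' (map tp (S.path X \<alpha> Z)) = S.path X \<alpha> Z" if l: "S.lam X \<alpha> Z" for X \<alpha> Z
    using lp[OF S.lamD(1,2)[OF l] S.lp_path(1)[OF l]] T.lp_lam T.path_eqI unfolding \<psi>_def by blast+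
  have lm': "S.lam (\<phi>' X) (\<psi>' X \<alpha> Z) (\<phi>' Z)" "S.path (\<phi>' X) (\<psi>' X \<alpha> Z) (\<phi>' Z) = map tp' (T.path X \<alpha> Z)"
    "map tp (map tp' (T.path X \<alpha> Z)) = T.path X \<alpha> Z" if l: "T.lam X \<alpha> Z" for X \<alpha> Z
    using lp'[OF T.lamD(1,2)[OF l] T.lp_path(1)[OF l]] S.lp_lam S.path_eqI unfolding \<psi>'_def by blast+
  interpret lam_iso A M B N \<phi> \<psi> \<phi>' \<psi>'
  proof unfold_locales
    fix X assume "X \<in> S.\<X>" then show "\<phi>' (\<phi> X) = X" by (rule inv)
  next
    fix Y assume "Y \<in> T.\<X>" then show "\<phi> (\<phi>' Y) = Y" by (rule inv')
  next
    fix X \<alpha> Z assume l: "S.lam X \<alpha> Z"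
    show "T.lam (\<phi> X) (\<psi> X \<alpha> Z) (\<phi> Z)" by (rule lm(1)[OF l])
    show "\<psi>' (\<phi> X) (\<psi> X \<alpha> Z) (\<phi> Z) = \<alpha>"
      unfolding \<psi>'_def lm(2)[OF l] lm(3)[OF l] by (rule S.lp_path(2)[OF l])
  next
    fix Y \<beta> W assume l: "T.lam Y \<beta> W"
    show "S.lam (\<phi>' Y) (\<psi>' Y \<beta> W) (\<phi>' W)" by (rule lm'(1)[OF l])
    show "\<psi> (\<phi>' Y) (\<psi>' Y \<beta> W) (\<phi>' W) = \<beta>"
      unfolding \<psi>_def lm'(2)[OF l] lm'(3)[OF l] by (rule T.lp_path(2)[OF l])
  next
    fix X \<alpha> Z \<gamma> V assume "S.lam X \<alpha> Z" "S.lam Z \<gamma> V"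
    then show "\<psi> X (\<alpha> @ \<gamma>) V = \<psi> X \<alpha> Z @ \<psi> Z \<gamma> V" unfolding \<psi>_def by (simp add: S.path_append)
  next
    fix Y \<beta> W \<delta> U assume "T.lam Y \<beta> W" "T.lam W \<delta> U"
    then show "\<psi>' Y (\<beta> @ \<delta>) U = \<psi>' Y \<beta> W @ \<psi>' W \<delta> U" unfolding \<psi>'_def by (simp add: T.path_append)
  qed
  show ?thesis by (rule morita)
qed

section \<open>The three conditions\<close>

theorem theorem7p9:
  fixes A :: "'a set" and M :: "'a \<Rightarrow> 'a \<Rightarrow> nat"
    and B :: "'b set" and N :: "'b \<Rightarrow> 'b \<Rightarrow> nat"
  assumes "markov_matrix A M" and "markov_matrix B N"
  shows "(morita_equivalent (inverse_hull A M) (inverse_hull B N) \<longleftrightarrow> (\<exists>\<pi>. D_preserving_CD_iso A M B N \<pi>)) \<and>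
    ((\<exists>\<pi>. D_preserving_CD_iso A M B N \<pi>) \<longleftrightarrow>
      (\<exists>\<pi>\<^sub>0 \<pi>\<^sub>1 \<pi>\<^sub>2. lgraph_iso (hull_graph A M) (hull_graph B N) \<pi>\<^sub>0 \<pi>\<^sub>1 \<pi>\<^sub>2 \<and>
        order_iso_on (verts (hull_graph A M)) (preceq (inverse_hull A M))
          (verts (hull_graph B N)) (preceq (inverse_hull B N)) \<pi>\<^sub>0))"
proof -
  interpret two_shifts A M B N by unfold_locales (fact assms)+
  have "morita_equivalent S.S T.S \<longleftrightarrow> (\<exists>\<phi> g. comb_iso \<phi> g)"
    using morita_comb_iso comb_iso_morita by blast
  moreover have "(\<exists>\<pi>. D_preserving_CD_iso A M B N \<pi>) \<longleftrightarrow> (\<exists>\<phi> g. comb_iso \<phi> g)"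
    unfolding CD_iso_cd_iso using cd_iso_comb_iso comb_iso_cd_iso by blast
  moreover have "graph_iso_cond \<longleftrightarrow> (\<exists>\<phi> g. comb_iso \<phi> g)"
    using graph_comb_iso comb_iso_graph by blast
  ultimately show ?thesis unfolding graph_iso_cond_def by blast
qed

end
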